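(* Fix $n\in\mathbb N^\times$ and let $\sigma$ be the dynamics on $\mathcal T(\mathbb N^\times\ltimes(\mathbb Z/n\mathbb Z))$ determined by $\sigma_t(V_a)=a^{it}V_a$ and $\sigma_t(R)=R$. (1) Suppose $\beta\in(1,\infty)$. For each $n^{\mathrm{th}}$ root of unity $z$, there is an extremal $\mathrm{KMS}_\beta$ state $\bar\psi_{\beta,z}$ of $\mathcal T(\mathbb N^\times\ltimes(\mathbb Z/n\mathbb Z))$ determined by $$\bar\psi_{\beta,z}(V_aR^kV_b^* )=\delta_{a,b}\frac{a^{-\beta}}{\zeta(\beta)}\sum_{c\in\mathbb N^\times}c^{-\beta}z^{ck}.$$ The map $z\mapsto\bar\psi_{\beta,z}$ extends to an affine weak*-homeomorphism of the simplex of probability measures on $Z_n$ onto the simplex of $\mathrm{KMS}_\beta$ states of $(\mathcal T(\mathbb N^\times\ltimes(\mathbb Z/n\mathbb Z)),\sigma)$. (2) Suppose $\beta\in(0,1]$. For each divisor $m$ of $n$, there is an extremal $\mathrm{KMS}_\beta$ state $\bar\psi_{\beta,m}$ of $\mathcal T(\mathbb N^\times\ltimes(\mathbb Z/n\mathbb Z))$ determined by $$\bar\psi_{\beta,m}(V_aR^kV_b^* )=\delta_{a,b}\,a^{-\beta}\Big(\frac{m}{\gcd(m,k)}\Big)^{-\beta}\sum_{d\mid\frac{m}{\gcd(m,k)}}\mu(d)\frac{\varphi_\beta(d)}{\varphi(d)}.$$ The map $m\mapsto\bar\psi_{\beta,m}$ extends to an affine weak*-homeomorphism of the simplex of probability measures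 on $\Delta_n:=\{m\in\mathbb N^\times: m\mid n\}$ onto the simplex of $\mathrm{KMS}_\beta$ states of $(\mathcal T(\mathbb N^\times\ltimes(\mathbb Z/n\mathbb Z)),\sigma)$.
   Context: $\mathbb N^\times$ is the multiplicative monoid of positive integers. For $n\in\mathbb N^\times$, $\mathbb N^\times\ltimes(\mathbb Z/n\mathbb Z)$ is the monoid of pairs $(a,[x])$, $a\in\mathbb N^\times$, $[x]\in\mathbb Z/n\mathbb Z$, with $(a,[x])(b,[y])=(ab,[bx+y])$; it is left-cancellative. Its Toeplitz algebra $\mathcal T(\mathbb N^\times\ltimes(\mathbb Z/n\mathbb Z))$ is the C*-algebra generated by the left regular representation $T_s\varepsilon_t=\varepsilon_{st}$ on $\ell^2(\mathbb N^\times\ltimes(\mathbb Z/n\mathbb Z))$; write $R=T_{(1,[1])}$ (a unitary with $R^n=1$) and $V_a=T_{(a,[0])}$ (isometries). The elements $V_aR^kV_b^*$ have dense linear span. A state $\phi$ is a $\mathrm{KMS}_\beta$ state if $\phi(xy)=\phi(y\sigma_{i\beta}(x))$ for all $\sigma$-analytic $x$ and all $y$. $Z_n\subset\mathbb T$ is the set of $n^{\mathrm{th}}$ roots of unity; $\zeta$ is the Riemann zeta function; $\mu$ is the Möbius function; $\varphi$ is Euler's totient; $\varphi_\beta(n)=n^\beta\prod_{p\mid n}(1-p^{-\beta})$. Convention: $\gcd(m,0)=m$. *)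

theory Defs
  imports
    "HOL-Probability.Probability"
    "HOL-Number_Theory.Number_Theory"
    "HOL-Computational_Algebra.Squarefree"
begin

section \<open>Operators on \<open>\<ell>\<^sup>2(S)\<close>\<close>

text \<open>
  The Hilbert space \<open>\<ell>\<^sup>2(S)\<close> consists of the square-summable functions that vanish
  off \<open>S\<close>.  An operator is a function that sends everything outside \<open>\<ell>\<^sup>2(S)\<close> to \<open>0\<close>, so that
  equality of operators is equality of functions and composition is function composition.
\<close>

type_synonym 'a vec = "'a \<Rightarrow> complex"
type_synonym 'a oper = "'a vec \<Rightarrow> 'a vec"

definition ell2 :: "'a set \<Rightarrow> 'a vec set" where
  "ell2 S = {f. (\<forall>t. t \<notin> S \<longrightarrow> f t = 0) \<and> (\<lambda>t. (cmod (f t))\<^sup>2) summable_on S}"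

definition ell2_norm :: "'a vec \<Rightarrow> real" where
  "ell2_norm f = sqrt (\<Sum>\<^sub>\<infinity>t. (cmod (f t))\<^sup>2)"

definition ell2_inner :: "'a vec \<Rightarrow> 'a vec \<Rightarrow> complex" where
  "ell2_inner f g = (\<Sum>\<^sub>\<infinity>t. f t * cnj (g t))"

definition ket :: "'a \<Rightarrow> 'a vec" where
  "ket t = (\<lambda>u. if u = t then 1 else 0)"

definition bounded_ops :: "'a set \<Rightarrow> 'a oper set" where
  "bounded_ops S = {T.
     (\<forall>f\<in>ell2 S. T f \<in> ell2 S) \<and>
     (\<forall>f. f \<notin> ell2 S \<longrightarrow> T f = (\<lambda>_. 0)) \<and>
     (\<forall>f\<in>ell2 S. \<forall>g\<in>ell2 S. \<forall>c. T (\<lambda>t. c * f t + g t) = (\<lambda>t. c * T f t + T g t)) \<and>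
     (\<exists>C. \<forall>f\<in>ell2 S. ell2_norm (T f) \<le> C * ell2_norm f)}"

definition op_one :: "'a set \<Rightarrow> 'a oper" where
  "op_one S = (\<lambda>f. if f \<in> ell2 S then f else (\<lambda>_. 0))"

definition op_add :: "'a oper \<Rightarrow> 'a oper \<Rightarrow> 'a oper" where
  "op_add T U = (\<lambda>f t. T f t + U f t)"

definition op_scale :: "complex \<Rightarrow> 'a oper \<Rightarrow> 'a oper" where
  "op_scale c T = (\<lambda>f t. c * T f t)"

definition op_diff :: "'a oper \<Rightarrow> 'a oper \<Rightarrow> 'a oper" where
  "op_diff T U = (\<lambda>f t. T f t - U f t)"

definition op_adj :: "'a set \<Rightarrow> 'a oper \<Rightarrow> 'a oper" where
  "op_adj S T = (THE U. U \<in> bounded_ops S \<and>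
     (\<forall>f\<in>ell2 S. \<forall>g\<in>ell2 S. ell2_inner (T f) g = ell2_inner f (U g)))"

definition op_norm :: "'a set \<Rightarrow> 'a oper \<Rightarrow> real" where
  "op_norm S T = (SUP f\<in>{f \<in> ell2 S. ell2_norm f \<le> 1}. ell2_norm (T f))"

definition cstar_subalgebra :: "'a set \<Rightarrow> 'a oper set \<Rightarrow> bool" where
  "cstar_subalgebra S A \<longleftrightarrow>
     A \<subseteq> bounded_ops S \<and> A \<noteq> {} \<and>
     (\<forall>T\<in>A. \<forall>U\<in>A. op_add T U \<in> A) \<and>
     (\<forall>c. \<forall>T\<in>A. op_scale c T \<in> A) \<and>
     (\<forall>T\<in>A. \<forall>U\<in>A. T \<circ> U \<in> A) \<and>
     (\<forall>T\<in>A. op_adj S T \<in> A) \<and>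
     (\<forall>X. \<forall>T\<in>bounded_ops S.
        (\<forall>i::nat. X i \<in> A) \<and> (\<lambda>i. op_norm S (op_diff (X i) T)) \<longlonglongrightarrow> 0 \<longrightarrow> T \<in> A)"

section \<open>Toeplitz algebras of left-cancellative monoids\<close>

text \<open>
  By left cancellation the sum below has at most one term, and
  \<open>T\<^sub>s \<epsilon>\<^sub>t = \<epsilon>\<^bsub>st\<^esub>\<close> (lemma \<open>left_shift_ket\<close>).
\<close>

definition left_shift :: "('a, 'b) monoid_scheme \<Rightarrow> 'a \<Rightarrow> 'a oper" where
  "left_shift M s = (\<lambda>f. if f \<in> ell2 (carrier M)
     then (\<lambda>u. \<Sum>\<^sub>\<infinity>t\<in>{t \<in> carrier M. s \<otimes>\<^bsub>M\<^esub> t = u}. f t) else (\<lambda>_. 0))"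

definition toeplitz_algebra :: "('a, 'b) monoid_scheme \<Rightarrow> 'a oper set" where
  "toeplitz_algebra M =
     \<Inter>{A. cstar_subalgebra (carrier M) A \<and> left_shift M ` carrier M \<subseteq> A}"

section \<open>Dynamics, states and the KMS condition\<close>

text \<open>
  Throughout, \<open>A\<close> is a C*-subalgebra of the bounded operators on \<open>\<ell>\<^sup>2(S)\<close> that contains the
  identity operator.  Maps defined on \<open>A\<close> are taken to be extensional.
\<close>

definition star_automorphism ::
    "'a set \<Rightarrow> 'a oper set \<Rightarrow> ('a oper \<Rightarrow> 'a oper) \<Rightarrow> bool" where
  "star_automorphism S A \<alpha> \<longleftrightarrow>
     \<alpha> \<in> extensional A \<and> bij_betw \<alpha> A A \<and>
     (\<forall>T\<in>A. \<forall>U\<in>A. \<alpha> (op_add T U) = op_add (\<alpha> T) (\<alpha> U)) \<and>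
     (\<forall>c. \<forall>T\<in>A. \<alpha> (op_scale c T) = op_scale c (\<alpha> T)) \<and>
     (\<forall>T\<in>A. \<forall>U\<in>A. \<alpha> (T \<circ> U) = \<alpha> T \<circ> \<alpha> U) \<and>
     (\<forall>T\<in>A. \<alpha> (op_adj S T) = op_adj S (\<alpha> T))"

definition dynamics ::
    "'a set \<Rightarrow> 'a oper set \<Rightarrow> (real \<Rightarrow> 'a oper \<Rightarrow> 'a oper) \<Rightarrow> bool" where
  "dynamics S A \<sigma> \<longleftrightarrow>
     (\<forall>t. star_automorphism S A (\<sigma> t)) \<and>
     (\<forall>s t. \<forall>T\<in>A. \<sigma> (s + t) T = \<sigma> s (\<sigma> t T)) \<and>
     (\<forall>T\<in>A. \<forall>t. ((\<lambda>s. op_norm S (op_diff (\<sigma> s T) (\<sigma> t T))) \<longlongrightarrow> 0) (at t))"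

text \<open>
  A state is a positive linear functional of norm one; as the algebra is unital, the norm is
  the value at the identity.
\<close>

definition state :: "'a set \<Rightarrow> 'a oper set \<Rightarrow> ('a oper \<Rightarrow> complex) \<Rightarrow> bool" where
  "state S A \<phi> \<longleftrightarrow>
     \<phi> \<in> extensional A \<and>
     (\<forall>T\<in>A. \<forall>U\<in>A. \<phi> (op_add T U) = \<phi> T + \<phi> U) \<and>
     (\<forall>c. \<forall>T\<in>A. \<phi> (op_scale c T) = c * \<phi> T) \<and>
     (\<forall>T\<in>A. \<phi> (op_adj S T \<circ> T) \<in> \<real>\<^sub>\<ge>\<^sub>0) \<and>
     (\<forall>T\<in>A. cmod (\<phi> T) \<le> op_norm S T) \<and>
     \<phi> (op_one S) = 1"

text \<open>
  \<open>F\<close> is the extension of \<open>t \<mapsto> \<sigma>\<^sub>t(T)\<close> to an entire (norm differentiable) function with values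
  in \<open>A\<close>; an element is analytic if it has such an extension, and then
  \<open>\<sigma>\<^sub>z(T)\<close> means \<open>F z\<close>.
\<close>

definition analytic_extension ::
    "'a set \<Rightarrow> 'a oper set \<Rightarrow> (real \<Rightarrow> 'a oper \<Rightarrow> 'a oper) \<Rightarrow> 'a oper \<Rightarrow> (complex \<Rightarrow> 'a oper) \<Rightarrow> bool"
  where
  "analytic_extension S A \<sigma> T F \<longleftrightarrow>
     (\<forall>z. F z \<in> A) \<and> (\<forall>t. F (complex_of_real t) = \<sigma> t T) \<and>
     (\<forall>z. \<exists>D\<in>A.
        ((\<lambda>w. op_norm S (op_diff (op_scale (1 / (w - z)) (op_diff (F w) (F z))) D)) \<longlongrightarrow> 0) (at z))"

definition kms_states ::
    "'a set \<Rightarrow> 'a oper set \<Rightarrow> (real \<Rightarrow> 'a oper \<Rightarrow> 'a oper) \<Rightarrow> real \<Rightarrow> ('a oper \<Rightarrow> complex) set" where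
  "kms_states S A \<sigma> \<beta> = {\<phi>. state S A \<phi> \<and>
     (\<forall>T\<in>A. \<forall>F. analytic_extension S A \<sigma> T F \<longrightarrow>
        (\<forall>U\<in>A. \<phi> (T \<circ> U) = \<phi> (U \<circ> F (\<i> * complex_of_real \<beta>))))}"

definition extremal :: "'a oper set \<Rightarrow> ('a oper \<Rightarrow> complex) set \<Rightarrow> ('a oper \<Rightarrow> complex) set" where
  "extremal A K = {\<phi> \<in> K. \<forall>\<phi>1\<in>K. \<forall>\<phi>2\<in>K. \<forall>t::real. 0 < t \<and> t < 1 \<and>
     (\<forall>T\<in>A. \<phi> T = of_real t * \<phi>1 T + of_real (1 - t) * \<phi>2 T) \<longrightarrow> \<phi>1 = \<phi> \<and> \<phi>2 = \<phi>}"

section \<open>Weak* topologies and affine homeomorphisms\<close>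

definition weak_star :: "'a oper set \<Rightarrow> ('a oper \<Rightarrow> complex) set \<Rightarrow> ('a oper \<Rightarrow> complex) topology"
  where
  "weak_star A K = subtopology (product_topology (\<lambda>_. euclidean) A) K"

definition prob_measures :: "'x::topological_space set \<Rightarrow> 'x measure set" where
  "prob_measures X = {P. prob_space P \<and> sets P = sets (restrict_space borel X)}"

definition dirac :: "'x::topological_space set \<Rightarrow> 'x \<Rightarrow> 'x measure" where
  "dirac X x = return (restrict_space borel X) x"

text \<open>The coarsest topology that makes \<open>P \<mapsto> \<integral> f dP\<close> continuous for all continuous \<open>f\<close> on \<open>X\<close>.\<close>

definition prob_weak_star :: "'x::topological_space set \<Rightarrow> 'x measure topology" where
  "prob_weak_star X = pullback_topology (prob_measures X)
     (\<lambda>P. \<lambda>f\<in>{f. continuous_on X f}. \<integral>x. f x \<partial>P)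
     (product_topology (\<lambda>_. euclideanreal) {f :: 'x \<Rightarrow> real. continuous_on X f})"

definition affine_on_prob ::
    "'x::topological_space set \<Rightarrow> 'a oper set \<Rightarrow> ('x measure \<Rightarrow> 'a oper \<Rightarrow> complex) \<Rightarrow> bool" where
  "affine_on_prob X A \<Psi> \<longleftrightarrow>
     (\<forall>P\<in>prob_measures X. \<forall>Q\<in>prob_measures X. \<forall>W\<in>prob_measures X. \<forall>t\<in>{0..1}.
        (\<forall>B\<in>sets W. measure W B = t * measure P B + (1 - t) * measure Q B) \<longrightarrow>
        (\<forall>T\<in>A. \<Psi> W T = of_real t * \<Psi> P T + of_real (1 - t) * \<Psi> Q T))"

text \<open>The point map \<open>\<psi>\<close> on \<open>X\<close> is extended along \<open>x \<mapsto> \<delta>\<^sub>x\<close>.\<close>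

definition extends_to_affine_homeo ::
    "'x::topological_space set \<Rightarrow> 'a oper set \<Rightarrow> ('a oper \<Rightarrow> complex) set \<Rightarrow>
     ('x \<Rightarrow> 'a oper \<Rightarrow> complex) \<Rightarrow> bool" where
  "extends_to_affine_homeo X A K \<psi> \<longleftrightarrow>
     (\<exists>\<Psi>. (\<forall>x\<in>X. \<Psi> (dirac X x) = \<psi> x) \<and> affine_on_prob X A \<Psi> \<and>
          homeomorphic_map (prob_weak_star X) (weak_star A K) \<Psi>)"

section \<open>The monoid \<open>\<nat>\<^sup>\<times> \<ltimes> \<int>/n\<int>\<close>\<close>

text \<open>Residue classes are represented by \<open>0, \<dots>, n - 1\<close>.\<close>

definition nz_monoid :: "nat \<Rightarrow> (nat \<times> nat) monoid" where
  "nz_monoid n = \<lparr>carrier = {1..} \<times> {..<n},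
     monoid.mult = (\<lambda>(a, x) (b, y). (a * b, (b * x + y) mod n)), one = (1, 0)\<rparr>"

abbreviation nz_carrier :: "nat \<Rightarrow> (nat \<times> nat) set" where
  "nz_carrier n \<equiv> carrier (nz_monoid n)"

abbreviation nz_toeplitz :: "nat \<Rightarrow> (nat \<times> nat) oper set" where
  "nz_toeplitz n \<equiv> toeplitz_algebra (nz_monoid n)"

definition nz_R :: "nat \<Rightarrow> (nat \<times> nat) oper" where
  "nz_R n = left_shift (nz_monoid n) (1, 1 mod n)"

definition nz_V :: "nat \<Rightarrow> nat \<Rightarrow> (nat \<times> nat) oper" where
  "nz_V n a = left_shift (nz_monoid n) (a, 0)"

text \<open>\<open>V\<^sub>a R\<^sup>k V\<^sub>b\<^sup>*\<close>; as \<open>R\<^sup>n = 1\<close>, exponents \<open>k \<in> \<nat>\<close> cover all integer powers of \<open>R\<close>.\<close>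

definition VRV :: "nat \<Rightarrow> nat \<Rightarrow> nat \<Rightarrow> nat \<Rightarrow> (nat \<times> nat) oper" where
  "VRV n a k b = nz_V n a \<circ> (nz_R n ^^ k) \<circ> op_adj (nz_carrier n) (nz_V n b)"

definition nz_dynamics :: "nat \<Rightarrow> (real \<Rightarrow> (nat \<times> nat) oper \<Rightarrow> (nat \<times> nat) oper) \<Rightarrow> bool" where
  "nz_dynamics n \<sigma> \<longleftrightarrow> dynamics (nz_carrier n) (nz_toeplitz n) \<sigma> \<and>
     (\<forall>t. \<forall>a\<ge>1. \<sigma> t (nz_V n a) = op_scale (of_nat a powr (\<i> * of_real t)) (nz_V n a)) \<and>
     (\<forall>t. \<sigma> t (nz_R n) = nz_R n)"

abbreviation nz_state :: "nat \<Rightarrow> ((nat \<times> nat) oper \<Rightarrow> complex) \<Rightarrow> bool" where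
  "nz_state n \<equiv> state (nz_carrier n) (nz_toeplitz n)"

abbreviation nz_kms ::
    "nat \<Rightarrow> (real \<Rightarrow> (nat \<times> nat) oper \<Rightarrow> (nat \<times> nat) oper) \<Rightarrow> real \<Rightarrow>
     ((nat \<times> nat) oper \<Rightarrow> complex) set" where
  "nz_kms n \<equiv> kms_states (nz_carrier n) (nz_toeplitz n)"

section \<open>Arithmetic functions and the values of the KMS states\<close>

text \<open>The Riemann zeta function, on real arguments greater than \<open>1\<close>.\<close>

definition zeta :: "real \<Rightarrow> real" where
  "zeta \<beta> = (\<Sum>\<^sub>\<infinity>c\<in>{1::nat..}. real c powr (- \<beta>))"

definition moebius :: "nat \<Rightarrow> real" where
  "moebius d = (if squarefree d then (- 1) ^ card (prime_factors d) else 0)"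

definition phi_beta :: "real \<Rightarrow> nat \<Rightarrow> real" where
  "phi_beta \<beta> n = real n powr \<beta> * (\<Prod>p\<in>prime_factors n. 1 - real p powr (- \<beta>))"

definition root_value :: "real \<Rightarrow> complex \<Rightarrow> nat \<Rightarrow> nat \<Rightarrow> nat \<Rightarrow> complex" where
  "root_value \<beta> z a k b = (if a = b
     then of_real ((real a powr (- \<beta>)) / zeta \<beta>) *
          (\<Sum>\<^sub>\<infinity>c\<in>{1::nat..}. of_real (real c powr (- \<beta>)) * z ^ (c * k))
     else 0)"

definition divisor_value :: "real \<Rightarrow> nat \<Rightarrow> nat \<Rightarrow> nat \<Rightarrow> nat \<Rightarrow> complex" where
  "divisor_value \<beta> m a k b = (if a = b
     then of_real (real a powr (- \<beta>) * real (m div gcd m k) powr (- \<beta>) *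
            (\<Sum>d | d dvd m div gcd m k. moebius d * phi_beta \<beta> d / real (totient d)))
     else 0)"

section \<open>Basic facts\<close>

lemma nz_monoid_is_monoid:
  assumes "n \<ge> 1"
  shows "monoid (nz_monoid n)"
proof (rule monoidI)
  show "x \<otimes>\<^bsub>nz_monoid n\<^esub> y \<in> carrier (nz_monoid n)"
    if "x \<in> carrier (nz_monoid n)" "y \<in> carrier (nz_monoid n)" for x y
    using that assms by (auto simp: nz_monoid_def split: prod.splits)
  show "\<one>\<^bsub>nz_monoid n\<^esub> \<in> carrier (nz_monoid n)"
    using assms by (auto simp: nz_monoid_def)
  show "x \<otimes>\<^bsub>nz_monoid n\<^esub> y \<otimes>\<^bsub>nz_monoid n\<^esub> z = x \<otimes>\<^bsub>nz_monoid n\<^esub> (y \<otimes>\<^bsub>nz_monoid n\<^esub> z)"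
    if "x \<in> carrier (nz_monoid n)" "y \<in> carrier (nz_monoid n)" "z \<in> carrier (nz_monoid n)" for x y z
  proof -
    obtain a p b q c r where eqs: "x = (a, p)" "y = (b, q)" "z = (c, r)"
      by (metis prod.exhaust)
    have "(c * ((b * p + q) mod n) + r) mod n = (c * (b * p + q) + r) mod n"
      by (metis mod_add_left_eq mod_mult_right_eq)
    also have "\<dots> = (b * c * p + (c * q + r)) mod n"
      by (simp add: distrib_left ac_simps)
    also have "\<dots> = (b * c * p + (c * q + r) mod n) mod n"
      by (rule mod_add_right_eq[symmetric])
    finally show ?thesis
      by (simp add: eqs nz_monoid_def mult.assoc)
  qed
  show "\<one>\<^bsub>nz_monoid n\<^esub> \<otimes>\<^bsub>nz_monoid n\<^esub> x = x" if "x \<in> carrier (nz_monoid n)" for x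
    using that by (auto simp: nz_monoid_def)
  show "x \<otimes>\<^bsub>nz_monoid n\<^esub> \<one>\<^bsub>nz_monoid n\<^esub> = x" if "x \<in> carrier (nz_monoid n)" for x
    using that by (auto simp: nz_monoid_def)
qed

lemma nz_monoid_left_cancel:
  assumes "s \<in> nz_carrier n" "t \<in> nz_carrier n" "u \<in> nz_carrier n"
    and "s \<otimes>\<^bsub>nz_monoid n\<^esub> t = s \<otimes>\<^bsub>nz_monoid n\<^esub> u"
  shows "t = u"
proof -
  obtain a x b y c z where eqs: "s = (a, x)" "t = (b, y)" "u = (c, z)"
    by (metis prod.exhaust)
  have "b = c" "[b * x + y = b * x + z] (mod n)" "y < n" "z < n"
    using assms by (auto simp: eqs nz_monoid_def cong_def)
  then show ?thesis
    unfolding eqs by (metis cong_add_lcancel_nat cong_less_modulus_unique_nat)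
qed

lemma ket_in_ell2:
  assumes "t \<in> S"
  shows "ket t \<in> ell2 S"
proof -
  have "(\<lambda>u. (cmod (ket t u))\<^sup>2) summable_on {t}"
    by simp
  then have "(\<lambda>u. (cmod (ket t u))\<^sup>2) summable_on S"
    by (rule summable_on_cong_neutral[THEN iffD1, rotated -1]) (use assms in \<open>auto simp: ket_def\<close>)
  then show ?thesis
    using assms by (auto simp: ell2_def ket_def)
qed

lemma left_shift_ket:
  assumes "t \<in> carrier M"
    and "\<And>t'. t' \<in> carrier M \<Longrightarrow> s \<otimes>\<^bsub>M\<^esub> t' = s \<otimes>\<^bsub>M\<^esub> t \<Longrightarrow> t' = t"
  shows "left_shift M s (ket t) = ket (s \<otimes>\<^bsub>M\<^esub> t)"
proof
  fix u
  show "left_shift M s (ket t) u = ket (s \<otimes>\<^bsub>M\<^esub> t) u"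
  proof (cases "u = s \<otimes>\<^bsub>M\<^esub> t")
    case True
    then have "{t' \<in> carrier M. s \<otimes>\<^bsub>M\<^esub> t' = u} = {t}"
      using assms by auto
    then show ?thesis
      using True assms(1) by (simp add: left_shift_def ket_in_ell2) (simp add: ket_def)
  next
    case False
    then have "(\<Sum>\<^sub>\<infinity>t'\<in>{t' \<in> carrier M. s \<otimes>\<^bsub>M\<^esub> t' = u}. ket t t') = 0"
      by (intro infsum_0) (auto simp: ket_def)
    then show ?thesis
      using False assms(1) by (simp add: left_shift_def ket_in_ell2) (simp add: ket_def)
  qed
qed

end

(*
  On the monomials V_a R^k V_b^* a KMS state vanishes unless a = b and is otherwise a^(-beta) times
  its value on R^k.  It is therefore determined by the n-periodic function L(k) = phi(R^k), and any
  state of this form is a KMS state.  Let C be a set of positive integers, closed under products and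
  divisors, over which c^(-beta) is summable.  Moebius inversion over C together with the
  finite Fourier transform writes L uniquely as a combination of the functions
  G_j(k) = (1/Z) * (sum over c in C of c^(-beta) w^(jkc)), with w a primitive n-th root of unity and
  Z the sum of c^(-beta) over C.  The weights are limits of the numbers phi(e_D E_j) >= 0, where e_D
  projects onto the fibres coprime to D and E_j is a spectral projection of R.

  For beta > 1 take C to be all positive integers: each G_j comes from a KMS state, a mixture of
  vector states.  For beta <= 1 take for C the integers all of whose prime factors divide n.  Then
  only those combinations occur that are invariant under the units modulo n: the functions
  k -> phi(e_D R^k) shrink by a definite amount for every prime p with L(pk) different from
  L(k), and the sum of p^(-beta) over the primes p in a set of residue classes outside a proper
  subgroup of the units diverges.  The averages of the G_j over the orbits of the units are the
  Ramanujan-type sums of the theorem; they are values of KMS states, obtained as weak* limits of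
  mixtures over larger and larger sets of primes.
*)

theory Submission
  imports Defs "HOL-Complex_Analysis.Complex_Analysis"
begin

text \<open>Over the integers with prime factors in a finite set they converge, but they scale
  correctly only for those a that lie in the set. The remedy is that an orbit average of the G_j has
  the same value for every C containing m: only gcd classes modulo m enter, their masses are Z times
  a finite Euler product, and Z cancels. Hence the mixtures agree on each monomial from some index
  on, and a limit exists without compactness.

  The divergence over primes is used quantitatively. Adjoining p = r (mod n) to D multiplies
  phi(e_D) by 1 - p^(-\<beta>). The square sum of phi(e_D R^k) over k is at most n phi(e_D)^2, yet
  relative to phi(e_D)^2 each such p adds at least p^(-\<beta>) times a constant, positive if L(rk)
  differs from L(k) for some k. The r that leave L invariant are closed under products, so
  divergence outside a proper subgroup suffices and Dirichlet's theorem is avoided.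

  Uniqueness of the dynamics rests on the contractivity of star-automorphisms, derived from a
  Neumann series.\<close>

lemma ell2_outside: "f \<in> ell2 S \<Longrightarrow> t \<notin> S \<Longrightarrow> f t = 0"
  by (simp add: ell2_def)

lemma ell2_summable:
  assumes "f \<in> ell2 S"
  shows "(\<lambda>t. (cmod (f t))\<^sup>2) summable_on UNIV"
proof -
  have "(\<lambda>t. (cmod (f t))\<^sup>2) summable_on S" using assms by (simp add: ell2_def)
  then show ?thesis
    by (rule summable_on_cong_neutral[THEN iffD1, rotated -1])
       (use assms in \<open>auto simp: ell2_def\<close>)
qed

lemma ell2_norm_nonneg [simp]: "0 \<le> ell2_norm f"
  by (simp add: ell2_norm_def infsum_nonneg)

lemma ell2_norm_sq: "(ell2_norm f)\<^sup>2 = (\<Sum>\<^sub>\<infinity>t. (cmod (f t))\<^sup>2)"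
  by (simp add: ell2_norm_def infsum_nonneg)

lemma L2_set_le_ell2_norm:
  assumes "f \<in> ell2 S" "finite F"
  shows "L2_set (\<lambda>t. cmod (f t)) F \<le> ell2_norm f"
  unfolding L2_set_def ell2_norm_def
  by (intro real_sqrt_le_mono finite_sum_le_infsum ell2_summable[OF assms(1)]) (use assms in auto)

lemma cmod_le_ell2_norm: "f \<in> ell2 S \<Longrightarrow> cmod (f t) \<le> ell2_norm f"
  using L2_set_le_ell2_norm[of f S "{t}"] by simp

text \<open>A bound on all finite sections yields both membership and the norm estimate. Sums,
  adjoints, pointwise limits and partial permutations are all handled through this
  criterion.\<close>

lemma ell2_bound:
  assumes "\<And>t. t \<notin> S \<Longrightarrow> f t = 0" "0 \<le> C"
    and "\<And>F. finite F \<Longrightarrow> L2_set (\<lambda>t. cmod (f t)) F \<le> C"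
  shows "f \<in> ell2 S" "ell2_norm f \<le> C"
proof -
  have b: "(\<Sum>t\<in>F. (cmod (f t))\<^sup>2) \<le> C\<^sup>2" if "finite F" for F
    using assms(3)[OF that] unfolding L2_set_def
    by (metis real_sqrt_le_iff real_sqrt_abs abs_of_nonneg[OF assms(2)])
  have s: "(\<lambda>t. (cmod (f t))\<^sup>2) summable_on A" for A
    by (rule nonneg_bdd_above_summable_on) (auto intro!: bdd_aboveI2 b)
  show "f \<in> ell2 S" using s assms(1) by (auto simp: ell2_def)
  have "(\<Sum>\<^sub>\<infinity>t. (cmod (f t))\<^sup>2) \<le> C\<^sup>2"
    by (rule infsum_le_finite_sums[OF s]) (use b in auto)
  then show "ell2_norm f \<le> C"
    unfolding ell2_norm_def using assms(2) real_le_lsqrt infsum_nonneg by (metis zero_le_power2)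
qed

lemma ell2_zero [simp]: "(\<lambda>_. 0) \<in> ell2 S" and ell2_norm_zero [simp]: "ell2_norm (\<lambda>_. 0) = 0"
  by (simp_all add: ell2_def ell2_norm_def)

lemma ell2_norm_eq_0:
  assumes "f \<in> ell2 S" "ell2_norm f \<le> 0" shows "f = (\<lambda>_. 0)"
proof
  fix t have "cmod (f t) \<le> 0" using cmod_le_ell2_norm[OF assms(1), of t] assms(2) by (rule order_trans)
  then show "f t = 0" by simp
qed

lemma ell2_add:
  assumes "f \<in> ell2 S" "g \<in> ell2 S"
  shows "(\<lambda>t. f t + g t) \<in> ell2 S" "ell2_norm (\<lambda>t. f t + g t) \<le> ell2_norm f + ell2_norm g"
proof -
  have "L2_set (\<lambda>t. cmod (f t + g t)) F \<le> ell2_norm f + ell2_norm g" if "finite F" for F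
  proof -
    have "L2_set (\<lambda>t. cmod (f t + g t)) F \<le> L2_set (\<lambda>t. cmod (f t) + cmod (g t)) F"
      by (rule L2_set_mono) (auto intro: norm_triangle_ineq)
    also have "\<dots> \<le> L2_set (\<lambda>t. cmod (f t)) F + L2_set (\<lambda>t. cmod (g t)) F"
      by (rule L2_set_triangle_ineq)
    finally show ?thesis
      using L2_set_le_ell2_norm[OF assms(1) that] L2_set_le_ell2_norm[OF assms(2) that] by linarith
  qed
  note b = ell2_bound[of S "\<lambda>t. f t + g t" "ell2_norm f + ell2_norm g", OF _ _ this]
  show "(\<lambda>t. f t + g t) \<in> ell2 S" "ell2_norm (\<lambda>t. f t + g t) \<le> ell2_norm f + ell2_norm g"
    by (rule b; use assms in \<open>auto simp: ell2_outside\<close>)+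
qed

lemma ell2_scale:
  assumes "f \<in> ell2 S"
  shows "(\<lambda>t. c * f t) \<in> ell2 S" "ell2_norm (\<lambda>t. c * f t) = cmod c * ell2_norm f"
proof -
  show "(\<lambda>t. c * f t) \<in> ell2 S"
    using assms by (auto simp: ell2_def norm_mult power_mult_distrib intro: summable_on_cmult_right)
  show "ell2_norm (\<lambda>t. c * f t) = cmod c * ell2_norm f"
    by (simp add: ell2_norm_def norm_mult power_mult_distrib infsum_cmult_right' real_sqrt_mult)
qed

lemma ell2_uminus:
  assumes "f \<in> ell2 S" shows "(\<lambda>t. - f t) \<in> ell2 S" "ell2_norm (\<lambda>t. - f t) = ell2_norm f"
  using ell2_scale[OF assms, of "-1"] by simp_all

lemma ell2_diff:
  assumes "f \<in> ell2 S" "g \<in> ell2 S"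
  shows "(\<lambda>t. f t - g t) \<in> ell2 S" "ell2_norm (\<lambda>t. f t - g t) \<le> ell2_norm f + ell2_norm g"
  using ell2_add[OF assms(1) ell2_uminus(1)[OF assms(2)]] ell2_uminus(2)[OF assms(2)] by simp_all

lemma ell2_lincomb:
  assumes "f \<in> ell2 S" "g \<in> ell2 S" shows "(\<lambda>t. c * f t + g t) \<in> ell2 S"
  using ell2_add(1)[OF ell2_scale(1)[OF assms(1)] assms(2)] .

lemma ell2_sum:
  assumes "\<And>i. i \<in> I \<Longrightarrow> f i \<in> ell2 S"
  shows "(\<lambda>t. \<Sum>i\<in>I. c i * f i t) \<in> ell2 S"
  using assms
  by (induction I rule: infinite_finite_induct) (auto intro: ell2_lincomb)

lemma ell2_inner_aux:
  assumes "f \<in> ell2 S" "g \<in> ell2 S"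
  shows "(\<lambda>t. cmod (f t * cnj (g t))) summable_on UNIV"
    and "(\<Sum>\<^sub>\<infinity>t. cmod (f t * cnj (g t))) \<le> ell2_norm f * ell2_norm g"
proof -
  have b: "(\<Sum>t\<in>F. cmod (f t * cnj (g t))) \<le> ell2_norm f * ell2_norm g" if "finite F" for F
  proof -
    have "(\<Sum>t\<in>F. cmod (f t * cnj (g t))) \<le> L2_set (\<lambda>t. cmod (f t)) F * L2_set (\<lambda>t. cmod (g t)) F"
      using L2_set_mult_ineq[of "\<lambda>t. cmod (f t)" "\<lambda>t. cmod (g t)" F] by (simp add: norm_mult)
    also have "\<dots> \<le> ell2_norm f * ell2_norm g"
      by (intro mult_mono L2_set_le_ell2_norm[OF assms(1) that] L2_set_le_ell2_norm[OF assms(2) that])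
         (auto simp: L2_set_nonneg)
    finally show ?thesis .
  qed
  show s: "(\<lambda>t. cmod (f t * cnj (g t))) summable_on UNIV"
    by (rule nonneg_bdd_above_summable_on) (auto intro!: bdd_aboveI2 b)
  show "(\<Sum>\<^sub>\<infinity>t. cmod (f t * cnj (g t))) \<le> ell2_norm f * ell2_norm g"
    by (rule infsum_le_finite_sums[OF s]) (use b in auto)
qed

lemma ell2_inner_summable:
  "f \<in> ell2 S \<Longrightarrow> g \<in> ell2 S \<Longrightarrow> (\<lambda>t. f t * cnj (g t)) summable_on UNIV"
  using abs_summable_summable[OF ell2_inner_aux(1)] .

lemma ell2_Cauchy_Schwarz:
  assumes "f \<in> ell2 S" "g \<in> ell2 S"
  shows "cmod (ell2_inner f g) \<le> ell2_norm f * ell2_norm g"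
  unfolding ell2_inner_def
  using norm_infsum_bound[OF ell2_inner_aux(1)[OF assms]] ell2_inner_aux(2)[OF assms] by linarith

lemma ell2_inner_lincomb:
  assumes "f \<in> ell2 S" "f' \<in> ell2 S" "g \<in> ell2 S"
  shows "ell2_inner (\<lambda>t. c * f t + f' t) g = c * ell2_inner f g + ell2_inner f' g"
proof -
  have "ell2_inner (\<lambda>t. c * f t + f' t) g = (\<Sum>\<^sub>\<infinity>t. c * (f t * cnj (g t)) + f' t * cnj (g t))"
    by (simp add: ell2_inner_def algebra_simps)
  also have "\<dots> = (\<Sum>\<^sub>\<infinity>t. c * (f t * cnj (g t))) + (\<Sum>\<^sub>\<infinity>t. f' t * cnj (g t))"
    by (intro infsum_add summable_on_cmult_right ell2_inner_summable[OF assms(1,3)]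
        ell2_inner_summable[OF assms(2,3)])
  also have "\<dots> = c * ell2_inner f g + ell2_inner f' g"
    by (simp add: ell2_inner_def infsum_cmult_right')
  finally show ?thesis .
qed

lemma ell2_inner_commute: "ell2_inner g f = cnj (ell2_inner f g)"
  by (simp add: ell2_inner_def infsum_cnj[symmetric] mult.commute del: infsum_cnj)

lemma ell2_inner_zero [simp]: "ell2_inner (\<lambda>_. 0) g = 0"
  by (simp add: ell2_inner_def)

lemma ell2_inner_scale:
  assumes "f \<in> ell2 S" "g \<in> ell2 S"
  shows "ell2_inner (\<lambda>t. c * f t) g = c * ell2_inner f g"
  using ell2_inner_lincomb[OF assms(1) ell2_zero assms(2), of c] by simp

lemma ell2_inner_add:
  assumes "f \<in> ell2 S" "f' \<in> ell2 S" "g \<in> ell2 S"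
  shows "ell2_inner (\<lambda>t. f t + f' t) g = ell2_inner f g + ell2_inner f' g"
  using ell2_inner_lincomb[OF assms, of 1] by simp

lemma ell2_inner_diff:
  assumes "f \<in> ell2 S" "f' \<in> ell2 S" "g \<in> ell2 S"
  shows "ell2_inner (\<lambda>t. f t - f' t) g = ell2_inner f g - ell2_inner f' g"
  using ell2_inner_lincomb[OF assms(2,1,3), of "-1"] by simp

lemma ell2_inner_diff_right:
  assumes "f \<in> ell2 S" "f' \<in> ell2 S" "g \<in> ell2 S"
  shows "ell2_inner g (\<lambda>t. f t - f' t) = ell2_inner g f - ell2_inner g f'"
  using ell2_inner_diff[OF assms] by (metis ell2_inner_commute complex_cnj_diff)

lemma ell2_inner_lincomb_right:
  assumes "f \<in> ell2 S" "f' \<in> ell2 S" "g \<in> ell2 S"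
  shows "ell2_inner g (\<lambda>t. c * f t + f' t) = cnj c * ell2_inner g f + ell2_inner g f'"
  using ell2_inner_lincomb[OF assms] 
  by (metis ell2_inner_commute complex_cnj_add complex_cnj_mult)

lemma ell2_inner_self:
  assumes "f \<in> ell2 S"
  shows "ell2_inner f f = of_real ((ell2_norm f)\<^sup>2)"
proof -
  have "((\<lambda>t. of_real ((cmod (f t))\<^sup>2) :: complex) has_sum of_real ((ell2_norm f)\<^sup>2)) UNIV"
    unfolding has_sum_of_real_iff ell2_norm_sq by (rule has_sum_infsum[OF ell2_summable[OF assms]])
  moreover have "ell2_inner f f = (\<Sum>\<^sub>\<infinity>t. of_real ((cmod (f t))\<^sup>2))"
    unfolding ell2_inner_def by (intro infsum_cong) (simp only: complex_norm_square)
  ultimately show ?thesis by (simp add: infsumI del: of_real_power)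
qed

text \<open>Takes the place of a basis expansion: it carries the adjoint relation from finitely
  supported vectors to all of \<open>ell2 S\<close>.\<close>

lemma ell2_finite_approx:
  assumes "f \<in> ell2 S" "e > 0"
  obtains F where "finite F" "F \<subseteq> S" "(\<lambda>t. if t \<in> F then f t else 0) \<in> ell2 S"
    "ell2_norm (\<lambda>t. f t - (if t \<in> F then f t else 0)) \<le> e"
proof -
  let ?q = "\<lambda>t. (cmod (f t))\<^sup>2"
  have s: "?q summable_on UNIV" by (rule ell2_summable[OF assms(1)])
  have "(?q has_sum infsum ?q UNIV) UNIV" using s by (rule has_sum_infsum)
  then have "\<forall>\<^sub>F F in finite_subsets_at_top UNIV. dist (sum ?q F) (infsum ?q UNIV) < e\<^sup>2"
    unfolding has_sum_def tendsto_iff using assms(2) by (meson zero_less_power)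
  then obtain F0 where F0: "finite F0" "dist (sum ?q F0) (infsum ?q UNIV) < e\<^sup>2"
    unfolding eventually_finite_subsets_at_top by blast
  define F where "F = F0 \<inter> S"
  have F: "finite F" "F \<subseteq> S" using F0 by (auto simp: F_def)
  have eq: "sum ?q F = sum ?q F0"
    by (rule sum.mono_neutral_left) (use F0 assms in \<open>auto simp: F_def ell2_outside\<close>)
  let ?g = "\<lambda>t. f t - (if t \<in> F then f t else 0)"
  have b: "L2_set (\<lambda>t. cmod (?g t)) G \<le> e" if "finite G" for G
  proof -
    have "(\<Sum>t\<in>G. (cmod (?g t))\<^sup>2) = (\<Sum>t\<in>G - F. ?q t)"
      by (rule sum.mono_neutral_cong_right) (use that in auto)
    also have "\<dots> = sum ?q (G \<union> F) - sum ?q F"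
      using sum_diff[of "G \<union> F" F ?q] that F by (simp add: Un_Diff)
    also have "sum ?q (G \<union> F) \<le> infsum ?q UNIV"
      by (rule finite_sum_le_infsum[OF s]) (use that F in auto)
    also have "infsum ?q UNIV - sum ?q F \<le> e\<^sup>2" using F0(2) eq by (simp add: dist_real_def)
    finally show ?thesis unfolding L2_set_def using assms(2) by (simp add: real_le_lsqrt sum_nonneg)
  qed
  have "?g \<in> ell2 S" "ell2_norm ?g \<le> e"
    by (rule ell2_bound[OF _ _ b]; use assms F in \<open>auto simp: ell2_outside\<close>)+
  moreover from ell2_diff(1)[OF assms(1) this(1)] have "(\<lambda>t. if t \<in> F then f t else 0) \<in> ell2 S"
    by simp
  ultimately show thesis using that F by blast
qed

section \<open>Bounded operators and the operator norm\<close>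

lemma bounded_opsD:
  assumes "T \<in> bounded_ops S"
  shows "f \<in> ell2 S \<Longrightarrow> T f \<in> ell2 S" "f \<notin> ell2 S \<Longrightarrow> T f = (\<lambda>_. 0)"
    "f \<in> ell2 S \<Longrightarrow> g \<in> ell2 S \<Longrightarrow> T (\<lambda>t. c * f t + g t) = (\<lambda>t. c * T f t + T g t)"
  using assms unfolding bounded_ops_def by blast+

lemma bounded_opsI:
  assumes "\<And>f. f \<in> ell2 S \<Longrightarrow> T f \<in> ell2 S" "\<And>f. f \<notin> ell2 S \<Longrightarrow> T f = (\<lambda>_. 0)"
    "\<And>f g c. f \<in> ell2 S \<Longrightarrow> g \<in> ell2 S \<Longrightarrow> T (\<lambda>t. c * f t + g t) = (\<lambda>t. c * T f t + T g t)"
    "\<And>f. f \<in> ell2 S \<Longrightarrow> ell2_norm (T f) \<le> C * ell2_norm f"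
  shows "T \<in> bounded_ops S"
  using assms unfolding bounded_ops_def by blast

lemma bounded_ops_ell2 [simp]: "T \<in> bounded_ops S \<Longrightarrow> T f \<in> ell2 S"
  by (cases "f \<in> ell2 S") (auto simp: bounded_opsD)

lemma bounded_ops_zero [simp]: "T \<in> bounded_ops S \<Longrightarrow> T (\<lambda>_. 0) = (\<lambda>_. 0)"
  using bounded_opsD(3)[of T S "\<lambda>_. 0" "\<lambda>_. 0" "-1"] by (simp add: fun_eq_iff)

lemma bounded_ops_scale: "T \<in> bounded_ops S \<Longrightarrow> f \<in> ell2 S \<Longrightarrow> T (\<lambda>t. c * f t) = (\<lambda>t. c * T f t)"
  using bounded_opsD(3)[of T S f "\<lambda>_. 0" c] by (simp add: fun_eq_iff)

lemma bounded_ops_add: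
  "T \<in> bounded_ops S \<Longrightarrow> f \<in> ell2 S \<Longrightarrow> g \<in> ell2 S \<Longrightarrow> T (\<lambda>t. f t + g t) = (\<lambda>t. T f t + T g t)"
  using bounded_opsD(3)[of T S f g 1] by (simp add: fun_eq_iff)

lemma bounded_ops_diff:
  "T \<in> bounded_ops S \<Longrightarrow> f \<in> ell2 S \<Longrightarrow> g \<in> ell2 S \<Longrightarrow> T (\<lambda>t. f t - g t) = (\<lambda>t. T f t - T g t)"
  using bounded_opsD(3)[of T S g f "-1"] by (simp add: fun_eq_iff)

lemma bounded_ops_sum:
  assumes "T \<in> bounded_ops S" "\<And>i. i \<in> I \<Longrightarrow> f i \<in> ell2 S"
  shows "T (\<lambda>t. \<Sum>i\<in>I. c i * f i t) = (\<lambda>t. \<Sum>i\<in>I. c i * T (f i) t)"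
  using assms(2)
proof (induction I rule: infinite_finite_induct)
  case (insert i I)
  have "T (\<lambda>t. c i * f i t + (\<Sum>i\<in>I. c i * f i t)) = (\<lambda>t. c i * T (f i) t + T (\<lambda>t. (\<Sum>i\<in>I. c i * f i t)) t)"
    by (rule bounded_opsD(3)[OF assms(1)]) (use insert in \<open>auto intro: ell2_sum\<close>)
  with insert show ?case by simp
qed (use assms in auto)

lemma op_norm_bdd:
  assumes "T \<in> bounded_ops S"
  shows "bdd_above ((\<lambda>f. ell2_norm (T f)) ` {f \<in> ell2 S. ell2_norm f \<le> 1})"
proof -
  obtain C where C: "\<forall>f\<in>ell2 S. ell2_norm (T f) \<le> C * ell2_norm f"
    using assms unfolding bounded_ops_def by blast
  have "ell2_norm (T f) \<le> \<bar>C\<bar>" if "f \<in> ell2 S" "ell2_norm f \<le> 1" for f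
  proof -
    have "ell2_norm (T f) \<le> C * ell2_norm f" using C that by blast
    also have "\<dots> \<le> \<bar>C\<bar> * 1" by (rule mult_mono) (use that in auto)
    finally show ?thesis by simp
  qed
  then show ?thesis by (intro bdd_aboveI2) auto
qed

lemma op_norm_nonneg: "T \<in> bounded_ops S \<Longrightarrow> 0 \<le> op_norm S T"
  unfolding op_norm_def
  by (rule cSUP_upper2[OF op_norm_bdd, of T S "\<lambda>_. 0"]) auto

lemma op_norm_bound:
  assumes "T \<in> bounded_ops S" "f \<in> ell2 S"
  shows "ell2_norm (T f) \<le> op_norm S T * ell2_norm f"
proof (cases "ell2_norm f = 0")
  case True
  then have "f = (\<lambda>_. 0)" by (intro ell2_norm_eq_0[OF assms(2)]) simp
  then show ?thesis using assms by simp
next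
  case False
  define a where "a = ell2_norm f"
  have a: "a > 0" using False ell2_norm_nonneg[of f] unfolding a_def by linarith
  let ?g = "\<lambda>t. of_real (1 / a) * f t"
  have g: "?g \<in> ell2 S" "ell2_norm ?g = 1"
    using ell2_scale[OF assms(2), of "of_real (1 / a)"] a by (auto simp: a_def norm_divide)
  have "ell2_norm (T ?g) \<le> op_norm S T"
    unfolding op_norm_def by (rule cSUP_upper[OF _ op_norm_bdd]) (use g assms in auto)
  moreover have "ell2_norm (T ?g) = ell2_norm (T f) / a"
    unfolding bounded_ops_scale[OF assms] ell2_scale(2)[OF bounded_ops_ell2[OF assms(1)]]
    using a by (simp add: norm_divide)
  ultimately show ?thesis using a by (simp add: a_def field_simps)
qed

lemma op_norm_le:
  assumes "0 \<le> C" "\<And>f. f \<in> ell2 S \<Longrightarrow> ell2_norm (T f) \<le> C * ell2_norm f"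
  shows "op_norm S T \<le> C"
  unfolding op_norm_def
proof (rule cSUP_least)
  show "{f \<in> ell2 S. ell2_norm f \<le> 1} \<noteq> {}" using ell2_zero[of S] ell2_norm_zero by fastforce
  fix f assume f: "f \<in> {f \<in> ell2 S. ell2_norm f \<le> 1}"
  then have "ell2_norm (T f) \<le> C * ell2_norm f" using assms by simp
  also have "\<dots> \<le> C" using f assms(1) mult_left_le by auto
  finally show "ell2_norm (T f) \<le> C" .
qed

lemma op_eqI:
  assumes "T \<in> bounded_ops S" "U \<in> bounded_ops S" "\<And>f. f \<in> ell2 S \<Longrightarrow> T f = U f"
  shows "T = U"
proof
  fix f show "T f = U f" using assms by (cases "f \<in> ell2 S") (auto simp: bounded_opsD)
qed

lemma op_norm_eq_0:
  assumes "T \<in> bounded_ops S" "U \<in> bounded_ops S" "op_norm S (op_diff T U) \<le> 0"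
    "op_diff T U \<in> bounded_ops S"
  shows "T = U"
proof (rule op_eqI[OF assms(1,2)])
  fix f assume f: "f \<in> ell2 S"
  have "ell2_norm (op_diff T U f) \<le> op_norm S (op_diff T U) * ell2_norm f"
    by (rule op_norm_bound[OF assms(4) f])
  also have "\<dots> \<le> 0" using assms(3) by (simp add: mult_nonpos_nonneg)
  finally have "op_diff T U f = (\<lambda>_. 0)" by (rule ell2_norm_eq_0[OF bounded_ops_ell2[OF assms(4)]])
  then show "T f = U f" by (simp add: op_diff_def fun_eq_iff)
qed

lemma op_one_bounded [simp]: "op_one S \<in> bounded_ops S"
  by (rule bounded_opsI[of _ _ 1]) (auto simp: op_one_def intro: ell2_lincomb)

lemma op_add_bounded:
  assumes "T \<in> bounded_ops S" "U \<in> bounded_ops S"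
  shows "op_add T U \<in> bounded_ops S" "op_norm S (op_add T U) \<le> op_norm S T + op_norm S U"
proof -
  have b: "ell2_norm (op_add T U f) \<le> (op_norm S T + op_norm S U) * ell2_norm f" if "f \<in> ell2 S" for f
    using ell2_add(2)[of "T f" S "U f"] op_norm_bound[OF assms(1) that] op_norm_bound[OF assms(2) that] assms
    by (simp add: op_add_def algebra_simps)
  show "op_add T U \<in> bounded_ops S"
    by (rule bounded_opsI[OF _ _ _ b])
       (use assms in \<open>auto simp: op_add_def bounded_opsD fun_eq_iff distrib_left intro!: ell2_add\<close>)
  show "op_norm S (op_add T U) \<le> op_norm S T + op_norm S U"
    by (rule op_norm_le[OF _ b]) (use assms op_norm_nonneg in \<open>auto intro: add_nonneg_nonneg\<close>)
qed

lemma op_scale_bounded: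
  assumes "T \<in> bounded_ops S"
  shows "op_scale c T \<in> bounded_ops S" "op_norm S (op_scale c T) \<le> cmod c * op_norm S T"
proof -
  have b: "ell2_norm (op_scale c T f) \<le> (cmod c * op_norm S T) * ell2_norm f" if "f \<in> ell2 S" for f
    using ell2_scale(2)[of "T f" S c] op_norm_bound[OF assms(1) that] assms
    by (simp add: op_scale_def mult.assoc mult_left_mono)
  show "op_scale c T \<in> bounded_ops S"
    by (rule bounded_opsI[OF _ _ _ b])
       (use assms in \<open>auto simp: op_scale_def bounded_opsD fun_eq_iff distrib_left mult_ac intro!: ell2_scale\<close>)
  show "op_norm S (op_scale c T) \<le> cmod c * op_norm S T"
    by (rule op_norm_le[OF _ b]) (use assms in \<open>auto intro!: mult_nonneg_nonneg op_norm_nonneg\<close>)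
qed

lemma op_diff_eq: "op_diff T U = op_add T (op_scale (-1) U)"
  by (simp add: op_diff_def op_add_def op_scale_def)

lemma op_diff_bounded:
  assumes "T \<in> bounded_ops S" "U \<in> bounded_ops S"
  shows "op_diff T U \<in> bounded_ops S" "op_norm S (op_diff T U) \<le> op_norm S T + op_norm S U"
  unfolding op_diff_eq
  using op_add_bounded[OF assms(1) op_scale_bounded(1)[OF assms(2), of "-1"]]
    op_scale_bounded(2)[OF assms(2), of "-1"] by auto

lemma op_comp_bounded:
  assumes "T \<in> bounded_ops S" "U \<in> bounded_ops S"
  shows "T \<circ> U \<in> bounded_ops S" "op_norm S (T \<circ> U) \<le> op_norm S T * op_norm S U"
proof -
  have b: "ell2_norm ((T \<circ> U) f) \<le> (op_norm S T * op_norm S U) * ell2_norm f" if "f \<in> ell2 S" for f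
    using order_trans[OF op_norm_bound[OF assms(1) bounded_ops_ell2[OF assms(2)], of f]
        mult_left_mono[OF op_norm_bound[OF assms(2) that] op_norm_nonneg[OF assms(1)]]]
    by (simp add: mult.assoc)
  show "T \<circ> U \<in> bounded_ops S"
    by (rule bounded_opsI[OF _ _ _ b]) (use assms in \<open>auto simp: bounded_opsD\<close>)
  show "op_norm S (T \<circ> U) \<le> op_norm S T * op_norm S U"
    by (rule op_norm_le[OF _ b]) (use assms in \<open>auto intro!: mult_nonneg_nonneg op_norm_nonneg\<close>)
qed

lemma op_norm_diff_commute: "op_norm S (op_diff T U) = op_norm S (op_diff U T)"
proof -
  have "ell2_norm (op_diff T U f) = ell2_norm (op_diff U T f)" for f
    by (simp add: ell2_norm_def op_diff_def norm_minus_commute)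
  then show ?thesis by (simp add: op_norm_def)
qed

lemma op_norm_triangle:
  assumes "T \<in> bounded_ops S" "U \<in> bounded_ops S" "X \<in> bounded_ops S"
  shows "op_norm S (op_diff T U) \<le> op_norm S (op_diff T X) + op_norm S (op_diff X U)"
proof -
  have "op_diff T U = op_add (op_diff T X) (op_diff X U)" by (simp add: op_diff_def op_add_def)
  then show ?thesis using op_add_bounded(2)[OF op_diff_bounded(1) op_diff_bounded(1)] assms by metis
qed

section \<open>Adjoints\<close>

text \<open>The adjoint is written down by its coordinates, the conjugates of <T e_t, g>, so that no
  representation theorem for functionals is invoked. Square summability follows by testing T on
  truncations of U g itself; the adjoint relation is clear for finitely supported f and extends by
  approximation.\<close>

lemma adjoint_exists:
  assumes T: "T \<in> bounded_ops S"
  shows "\<exists>U\<in>bounded_ops S. \<forall>f\<in>ell2 S. \<forall>g\<in>ell2 S. ell2_inner (T f) g = ell2_inner f (U g)"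
proof -
  define U where "U g = (\<lambda>t. if g \<in> ell2 S \<and> t \<in> S then cnj (ell2_inner (T (ket t)) g) else 0)" for g
  have fin: "ell2_inner (T (\<lambda>t. if t \<in> F then f t else 0)) g = (\<Sum>t\<in>F. f t * cnj (U g t))"
    if F: "finite F" "F \<subseteq> S" and g: "g \<in> ell2 S" for F f g
  proof -
    have "(\<lambda>t. if t \<in> F then f t else 0) = (\<lambda>u. \<Sum>t\<in>F. f t * ket t u)"
      using F by (auto simp: fun_eq_iff ket_def if_distrib[of "(*) _"] cong: if_cong)
    then have "T (\<lambda>t. if t \<in> F then f t else 0) = (\<lambda>u. \<Sum>t\<in>F. f t * T (ket t) u)"
      using bounded_ops_sum[OF T, of F ket f] F ket_in_ell2 by (metis subset_eq)
    then have "ell2_inner (T (\<lambda>t. if t \<in> F then f t else 0)) g = ell2_inner (\<lambda>u. \<Sum>t\<in>F. f t * T (ket t) u) g"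
      by simp
    also have "\<dots> = (\<Sum>t\<in>F. f t * ell2_inner (T (ket t)) g)"
      using F(1)
    proof (induction F rule: finite_induct)
      case (insert x F)
      then show ?case
        using ell2_inner_lincomb[of "T (ket x)" S "\<lambda>u. \<Sum>t\<in>F. f t * T (ket t) u" g "f x"] T g
        by (simp add: ell2_sum)
    qed simp
    also have "\<dots> = (\<Sum>t\<in>F. f t * cnj (U g t))"
      by (rule sum.cong) (use F g in \<open>auto simp: U_def\<close>)
    finally show ?thesis .
  qed
  have bnd: "L2_set (\<lambda>t. cmod (U g t)) F \<le> op_norm S T * ell2_norm g"
    if g: "g \<in> ell2 S" and "finite F" for g F
  proof -
    define G where "G = F \<inter> S"
    have G: "finite G" "G \<subseteq> S" using that by (auto simp: G_def)
    have eqL: "L2_set (\<lambda>t. cmod (U g t)) F = L2_set (\<lambda>t. cmod (U g t)) G"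
      unfolding L2_set_def G_def
      by (intro arg_cong[where f=sqrt] sum.mono_neutral_right) (use that in \<open>auto simp: U_def\<close>)
    let ?L = "L2_set (\<lambda>t. cmod (U g t)) G"
    let ?h = "\<lambda>t. if t \<in> G then U g t else 0"
    have h: "?h \<in> ell2 S" "ell2_norm ?h \<le> ?L"
    proof -
      have "L2_set (\<lambda>t. cmod (?h t)) F' \<le> ?L" if "finite F'" for F'
      proof -
        have "(\<Sum>t\<in>F'. (cmod (?h t))\<^sup>2) = (\<Sum>t\<in>F' \<inter> G. (cmod (U g t))\<^sup>2)"
          by (rule sum.mono_neutral_cong_right) (use that in auto)
        also have "\<dots> \<le> (\<Sum>t\<in>G. (cmod (U g t))\<^sup>2)" by (rule sum_mono2) (use G in auto)
        finally show ?thesis unfolding L2_set_def by simp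
      qed
      then show "?h \<in> ell2 S" "ell2_norm ?h \<le> ?L"
        by (rule ell2_bound[of S ?h ?L, rotated 2]; use G in \<open>auto simp: L2_set_nonneg\<close>)+
    qed
    \<comment> \<open>Duality: with h the truncation of U g, |h|^2 = <T h, g> is at most |T| |h|
      |g|, and one factor |h| cancels.\<close>
    have "?L\<^sup>2 = (\<Sum>t\<in>G. (cmod (U g t))\<^sup>2)" by (simp add: L2_set_def sum_nonneg)
    also have "of_real \<dots> = (\<Sum>t\<in>G. U g t * cnj (U g t))"
      by (simp add: complex_norm_square del: of_real_power)
    also have "\<dots> = ell2_inner (T ?h) g" by (rule fin[OF G g, symmetric])
    finally have "?L\<^sup>2 = cmod (ell2_inner (T ?h) g)"
      by (metis abs_of_nonneg norm_of_real zero_le_power2)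
    also have "\<dots> \<le> ell2_norm (T ?h) * ell2_norm g"
      using ell2_Cauchy_Schwarz T g by (meson bounded_ops_ell2)
    also have "\<dots> \<le> (op_norm S T * ?L) * ell2_norm g"
      using op_norm_bound[OF T h(1)] h(2) op_norm_nonneg[OF T]
      by (intro mult_right_mono) (auto intro: order_trans[OF _ mult_left_mono])
    finally have *: "?L * ?L \<le> ?L * (op_norm S T * ell2_norm g)" by (simp add: power2_eq_square mult_ac)
    have "?L \<le> op_norm S T * ell2_norm g"
    proof (cases "?L = 0")
      case True then show ?thesis using op_norm_nonneg[OF T] by simp
    next
      case False
      then have "?L > 0" using L2_set_nonneg[of "\<lambda>t. cmod (U g t)" G] by linarith
      with * show ?thesis by simp
    qed
    then show ?thesis by (simp add: eqL)
  qed
  have Ug: "U g \<in> ell2 S" "ell2_norm (U g) \<le> op_norm S T * ell2_norm g" if "g \<in> ell2 S" for g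
    by (rule ell2_bound[OF _ _ bnd]; use that op_norm_nonneg[OF T] in \<open>auto simp: U_def\<close>)+
  have U: "U \<in> bounded_ops S"
  proof (rule bounded_opsI[OF _ _ _ Ug(2)])
    show "U (\<lambda>t. c * f t + g t) = (\<lambda>t. c * U f t + U g t)" if "f \<in> ell2 S" "g \<in> ell2 S" for f g c
      using that ell2_lincomb[OF that] T
      by (auto simp: U_def fun_eq_iff ell2_inner_lincomb_right)
  qed (use Ug in \<open>auto simp: U_def fun_eq_iff\<close>)
  moreover have "ell2_inner (T f) g = ell2_inner f (U g)" if f: "f \<in> ell2 S" and g: "g \<in> ell2 S" for f g
  proof -
    have "cmod (ell2_inner (T f) g - ell2_inner f (U g)) \<le> e * (op_norm S T * ell2_norm g + ell2_norm (U g))"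
      if e: "e > 0" for e
    proof -
      obtain F where F: "finite F" "F \<subseteq> S" "(\<lambda>t. if t \<in> F then f t else 0) \<in> ell2 S"
        "ell2_norm (\<lambda>t. f t - (if t \<in> F then f t else 0)) \<le> e"
        using ell2_finite_approx[OF f e] by blast
      let ?h = "\<lambda>t. if t \<in> F then f t else 0"
      let ?d = "\<lambda>t. f t - ?h t"
      have d: "?d \<in> ell2 S" using ell2_diff f F by blast
      have "ell2_inner ?h (U g) = (\<Sum>\<^sub>\<infinity>t\<in>F. f t * cnj (U g t))"
        unfolding ell2_inner_def by (rule infsum_cong_neutral) auto
      then have "ell2_inner ?h (U g) = ell2_inner (T ?h) g" using F g by (simp add: fin)
      moreover have "ell2_inner ?d (U g) = ell2_inner f (U g) - ell2_inner ?h (U g)"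
        by (rule ell2_inner_diff) (use f F U in auto)
      moreover have "ell2_inner (T ?d) g = ell2_inner (T f) g - ell2_inner (T ?h) g"
        unfolding bounded_ops_diff[OF T f F(3)] by (rule ell2_inner_diff) (use T g in auto)
      ultimately have "ell2_inner (T f) g - ell2_inner f (U g) = ell2_inner (T ?d) g - ell2_inner ?d (U g)"
        by simp
      then have "cmod (ell2_inner (T f) g - ell2_inner f (U g))
          \<le> cmod (ell2_inner (T ?d) g) + cmod (ell2_inner ?d (U g))"
        by (simp only: norm_triangle_ineq4)
      moreover have "cmod (ell2_inner ?d (U g)) \<le> e * ell2_norm (U g)"
        using ell2_Cauchy_Schwarz[OF d, of "U g"] U F(4) 
        by (meson bounded_ops_ell2 ell2_norm_nonneg mult_right_mono order_trans)
      moreover have "cmod (ell2_inner (T ?d) g) \<le> ell2_norm (T ?d) * ell2_norm g"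
        by (rule ell2_Cauchy_Schwarz[OF _ g]) (use T in simp)
      moreover have "ell2_norm (T ?d) \<le> op_norm S T * e"
        using op_norm_bound[OF T d] F(4) op_norm_nonneg[OF T] by (meson mult_left_mono order_trans)
      then have "ell2_norm (T ?d) * ell2_norm g \<le> (op_norm S T * e) * ell2_norm g"
        by (rule mult_right_mono) simp
      ultimately show ?thesis by (simp add: algebra_simps)
    qed
    then have *: "\<And>e. e > 0 \<Longrightarrow> cmod (ell2_inner (T f) g - ell2_inner f (U g)) \<le> e * (op_norm S T * ell2_norm g + ell2_norm (U g))" .
    let ?K = "op_norm S T * ell2_norm g + ell2_norm (U g)"
    have K: "?K \<ge> 0" using op_norm_nonneg[OF T] by simp
    have "cmod (ell2_inner (T f) g - ell2_inner f (U g)) \<le> 0 + e" if "e > 0" for e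
    proof -
      have "e / (?K + 1) > 0" using that K by simp
      from *[OF this] have "cmod (ell2_inner (T f) g - ell2_inner f (U g)) \<le> e / (?K + 1) * ?K" .
      also have "\<dots> \<le> e" using that K by (simp add: field_simps)
      finally show ?thesis by simp
    qed
    from field_le_epsilon[OF this] show ?thesis by simp
  qed
  ultimately show ?thesis by blast
qed

lemma adjoint_unique:
  assumes "U \<in> bounded_ops S" "U' \<in> bounded_ops S"
    "\<And>f g. f \<in> ell2 S \<Longrightarrow> g \<in> ell2 S \<Longrightarrow> ell2_inner f (U g) = ell2_inner f (U' g)"
  shows "U = U'"
proof (rule op_eqI[OF assms(1,2)])
  fix g assume g: "g \<in> ell2 S"
  let ?d = "\<lambda>t. U g t - U' g t"
  have d: "?d \<in> ell2 S" using assms by (intro ell2_diff) auto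
  have "ell2_inner ?d ?d = 0"
    using ell2_inner_diff_right[of "U g" S "U' g" ?d] assms d g by simp
  then have "ell2_norm ?d \<le> 0" unfolding ell2_inner_self[OF d] by simp
  from ell2_norm_eq_0[OF d this] show "U g = U' g" by (simp add: fun_eq_iff)
qed

lemma op_adj_props:
  assumes "T \<in> bounded_ops S"
  shows "op_adj S T \<in> bounded_ops S"
    and "\<And>f g. f \<in> ell2 S \<Longrightarrow> g \<in> ell2 S \<Longrightarrow> ell2_inner (T f) g = ell2_inner f (op_adj S T g)"
proof -
  let ?P = "\<lambda>U. U \<in> bounded_ops S \<and> (\<forall>f\<in>ell2 S. \<forall>g\<in>ell2 S. ell2_inner (T f) g = ell2_inner f (U g))"
  obtain U where U: "?P U" using adjoint_exists[OF assms] by blast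
  have "?P (op_adj S T)"
    unfolding op_adj_def
  proof (rule theI[of ?P, OF U])
    fix U' assume "?P U'"
    then show "U' = U" using U by (intro adjoint_unique) auto
  qed
  then show "op_adj S T \<in> bounded_ops S"
    "\<And>f g. f \<in> ell2 S \<Longrightarrow> g \<in> ell2 S \<Longrightarrow> ell2_inner (T f) g = ell2_inner f (op_adj S T g)"
    by auto
qed

lemma op_adj_eqI:
  assumes "T \<in> bounded_ops S" "U \<in> bounded_ops S"
    "\<And>f g. f \<in> ell2 S \<Longrightarrow> g \<in> ell2 S \<Longrightarrow> ell2_inner (T f) g = ell2_inner f (U g)"
  shows "op_adj S T = U"
  by (rule adjoint_unique) (use assms op_adj_props[OF assms(1)] in auto)

lemma op_adj_left:
  assumes "T \<in> bounded_ops S" "f \<in> ell2 S" "g \<in> ell2 S"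
  shows "ell2_inner (op_adj S T f) g = ell2_inner f (T g)"
  using op_adj_props(2)[OF assms(1,3,2)] by (metis ell2_inner_commute)

lemma op_adj_comp:
  assumes "T \<in> bounded_ops S" "U \<in> bounded_ops S"
  shows "op_adj S (T \<circ> U) = op_adj S U \<circ> op_adj S T"
  by (rule op_adj_eqI) (use assms in \<open>auto simp: op_adj_props op_comp_bounded\<close>)

lemma op_adj_lincomb:
  assumes "T \<in> bounded_ops S" "U \<in> bounded_ops S"
  shows "op_adj S (op_add (op_scale c T) U) = op_add (op_scale (cnj c) (op_adj S T)) (op_adj S U)"
proof (rule op_adj_eqI)
  fix f g assume fg: "f \<in> ell2 S" "g \<in> ell2 S"
  then show "ell2_inner (op_add (op_scale c T) U f) g
     = ell2_inner f (op_add (op_scale (cnj c) (op_adj S T)) (op_adj S U) g)"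
    using assms
      ell2_inner_lincomb[of "T f" S "U f" g c] 
      ell2_inner_lincomb_right[of "op_adj S T g" S "op_adj S U g" f "cnj c"]
    by (simp add: op_add_def op_scale_def op_adj_props)
qed (use assms in \<open>auto intro!: op_add_bounded op_scale_bounded op_adj_props\<close>)

lemma op_adj_scale:
  assumes "T \<in> bounded_ops S"
  shows "op_adj S (op_scale c T) = op_scale (cnj c) (op_adj S T)"
proof -
  have "op_scale d U = op_add (op_scale (d - 1) U) U" for d and U :: "'a oper"
    by (simp add: op_scale_def op_add_def algebra_simps)
  from this[of c T] this[of "cnj c" "op_adj S T"] show ?thesis
    using op_adj_lincomb[OF assms assms, of "c - 1"] by simp
qed

lemma op_adj_add:
  assumes "T \<in> bounded_ops S" "U \<in> bounded_ops S"
  shows "op_adj S (op_add T U) = op_add (op_adj S T) (op_adj S U)"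
  using op_adj_lincomb[OF assms, of 1] by (simp add: op_scale_def)

text \<open>With h the adjoint applied to g, |h|^2 = <T h, g> is at most |T| |h| |g|, and a factor
  |h| cancels.\<close>

lemma op_adj_norm_le:
  assumes T: "T \<in> bounded_ops S"
  shows "op_norm S (op_adj S T) \<le> op_norm S T"
proof (rule op_norm_le[OF op_norm_nonneg[OF T]])
  fix g assume g: "g \<in> ell2 S"
  let ?h = "op_adj S T g"
  have h: "?h \<in> ell2 S" using op_adj_props(1)[OF T] by simp
  have "of_real ((ell2_norm ?h)\<^sup>2) = ell2_inner (T ?h) g"
    unfolding ell2_inner_self[OF h, symmetric] using op_adj_props(2)[OF T h g] by simp
  then have "(ell2_norm ?h)\<^sup>2 = cmod (ell2_inner (T ?h) g)"
    by (metis abs_of_nonneg norm_of_real zero_le_power2)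
  also have "\<dots> \<le> ell2_norm (T ?h) * ell2_norm g"
    by (rule ell2_Cauchy_Schwarz[OF _ g]) (use T in simp)
  also have "\<dots> \<le> (op_norm S T * ell2_norm ?h) * ell2_norm g"
    by (rule mult_right_mono[OF op_norm_bound[OF T h]]) simp
  finally have *: "ell2_norm ?h * ell2_norm ?h \<le> ell2_norm ?h * (op_norm S T * ell2_norm g)"
    by (simp add: power2_eq_square mult_ac)
  show "ell2_norm ?h \<le> op_norm S T * ell2_norm g"
  proof (cases "ell2_norm ?h = 0")
    case True then show ?thesis using op_norm_nonneg[OF T] by simp
  next
    case False
    then have "ell2_norm ?h > 0" using ell2_norm_nonneg[of ?h] by linarith
    with * show ?thesis by simp
  qed
qed

lemma bounded_ops_cstar: "cstar_subalgebra S (bounded_ops S)"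
  unfolding cstar_subalgebra_def
proof (intro conjI)
  show "bounded_ops S \<noteq> {}" using op_one_bounded[of S] by (metis empty_iff)
qed (simp_all add: op_add_bounded op_scale_bounded op_comp_bounded op_adj_props)

section \<open>Completeness and automatic continuity\<close>

text \<open>A Fatou argument: the norm over each finite set is continuous in the coordinates and
  keeps the bound \<open>C\<close>.\<close>

lemma ell2_pointwise_limit:
  assumes "\<And>k. g k \<in> ell2 S" "\<And>k. ell2_norm (g k) \<le> C" "\<And>t. (\<lambda>k. g k t) \<longlonglongrightarrow> h t"
  shows "h \<in> ell2 S" "ell2_norm h \<le> C"
proof -
  have C: "0 \<le> C" using assms(2)[of 0] ell2_norm_nonneg[of "g 0"] by linarith
  have z: "h t = 0" if "t \<notin> S" for t
    using assms(3)[of t] ell2_outside[OF assms(1) that] by (simp add: LIMSEQ_const_iff)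
  have b: "L2_set (\<lambda>t. cmod (h t)) F \<le> C" if "finite F" for F
  proof (rule LIMSEQ_le_const2)
    show "(\<lambda>k. L2_set (\<lambda>t. cmod (g k t)) F) \<longlonglongrightarrow> L2_set (\<lambda>t. cmod (h t)) F"
      unfolding L2_set_def by (intro tendsto_intros assms(3))
    show "\<exists>N. \<forall>k\<ge>N. L2_set (\<lambda>t. cmod (g k t)) F \<le> C"
      using order_trans[OF L2_set_le_ell2_norm[OF assms(1) that] assms(2)] by blast
  qed
  show "h \<in> ell2 S" "ell2_norm h \<le> C" by (rule ell2_bound[OF z C b]; assumption)+
qed

text \<open>The limit is formed coordinate by coordinate. The Cauchy rate \<open>e\<close> survives
  the limit by \<open>ell2_pointwise_limit\<close>, which gives boundedness and norm convergence at
  the same time. The explicit rate suits the geometric tails of the Neumann series.\<close>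

lemma bounded_ops_complete:
  assumes X: "\<And>k. X k \<in> bounded_ops S"
    and e: "\<And>k l. k \<le> l \<Longrightarrow> op_norm S (op_diff (X l) (X k)) \<le> e k" "e \<longlonglongrightarrow> (0::real)"
  obtains T where "T \<in> bounded_ops S" "(\<lambda>k. op_norm S (op_diff (X k) T)) \<longlonglongrightarrow> 0"
proof -
  have D: "op_diff (X l) (X k) \<in> bounded_ops S" for k l using X by (simp add: op_diff_bounded)
  have e0: "0 \<le> e k" for k using op_norm_nonneg[OF D] e(1)[of k k] order_trans by blast
  have d: "ell2_norm (\<lambda>t. X l f t - X k f t) \<le> e k * ell2_norm f" if "k \<le> l" "f \<in> ell2 S" for k l f
    using order_trans[OF op_norm_bound[OF D that(2)] mult_right_mono[OF e(1)[OF that(1)]]]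
    by (simp add: op_diff_def)
  have de: "(\<lambda>t. X l f t - X k f t) \<in> ell2 S" for k l f
    using X by (intro ell2_diff) auto
  have conv: "convergent (\<lambda>k. X k f t)" if f: "f \<in> ell2 S" for f t
  proof (rule Cauchy_convergent, rule CauchyI')
    fix r :: real assume r: "0 < r"
    have "(\<lambda>k. e k * ell2_norm f) \<longlonglongrightarrow> 0" using tendsto_mult_left_zero[OF e(2)] by simp
    have "\<exists>M. \<forall>k\<ge>M. e k * ell2_norm f < r / 2"
      using order_tendstoD(2)[OF \<open>(\<lambda>k. e k * ell2_norm f) \<longlonglongrightarrow> 0\<close>, of "r/2"] r
      by (simp add: eventually_sequentially)
    then obtain M where M: "\<And>k. k \<ge> M \<Longrightarrow> e k * ell2_norm f < r / 2" by blast
    show "\<exists>M. \<forall>m\<ge>M. \<forall>n>m. dist (X m f t) (X n f t) < r"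
    proof (intro exI allI impI)
      fix m n assume mn: "m \<ge> M" "n > m"
      have "cmod (X n f t - X m f t) \<le> e m * ell2_norm f"
        using order_trans[OF cmod_le_ell2_norm[OF de] d[of m n f]] mn f by simp
      with M[OF mn(1)] r show "dist (X m f t) (X n f t) < r"
        by (simp add: dist_norm norm_minus_commute)
    qed
  qed
  define T where "T f = (if f \<in> ell2 S then (\<lambda>t. lim (\<lambda>k. X k f t)) else (\<lambda>_. 0))" for f
  have lim: "(\<lambda>k. X k f t) \<longlonglongrightarrow> T f t" if "f \<in> ell2 S" for f t
    using conv[OF that] that by (simp add: T_def convergent_LIMSEQ_iff)
  have Td: "(\<lambda>t. T f t - X k f t) \<in> ell2 S" "ell2_norm (\<lambda>t. T f t - X k f t) \<le> e k * ell2_norm f"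
    if f: "f \<in> ell2 S" for f k
  proof -
    have l: "(\<lambda>l. X (l + k) f t - X k f t) \<longlonglongrightarrow> T f t - X k f t" for t
      by (rule tendsto_diff[OF LIMSEQ_ignore_initial_segment[OF lim[OF f], of k] tendsto_const])
    have "ell2_norm (\<lambda>t. X (l + k) f t - X k f t) \<le> e k * ell2_norm f" for l
      using d[OF le_add2 f] .
    note lims = ell2_pointwise_limit[where g = "\<lambda>l t. X (l + k) f t - X k f t", OF de this l]
    show "(\<lambda>t. T f t - X k f t) \<in> ell2 S" by (rule lims(1))
    show "ell2_norm (\<lambda>t. T f t - X k f t) \<le> e k * ell2_norm f" by (rule lims(2))
  qed
  have Te: "T f \<in> ell2 S" if "f \<in> ell2 S" for f
    using ell2_add(1)[OF Td(1)[OF that, of 0] bounded_ops_ell2[OF X[of 0]], of f] by simp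
  have Tb: "ell2_norm (T f) \<le> (e 0 + op_norm S (X 0)) * ell2_norm f" if "f \<in> ell2 S" for f
    using ell2_add(2)[OF Td(1)[OF that, of 0] bounded_ops_ell2[OF X[of 0]], of f] Td(2)[OF that, of 0]
      op_norm_bound[OF X[of 0] that] by (simp add: distrib_right)
  have T: "T \<in> bounded_ops S"
  proof (rule bounded_opsI[OF Te _ _ Tb])
    fix f g c assume fg: "f \<in> ell2 S" "g \<in> ell2 S"
    show "T (\<lambda>t. c * f t + g t) = (\<lambda>t. c * T f t + T g t)"
    proof
      fix t
      have "(\<lambda>k. c * X k f t + X k g t) \<longlonglongrightarrow> c * T f t + T g t"
        by (intro tendsto_intros lim fg)
      moreover have "(\<lambda>k. c * X k f t + X k g t) \<longlonglongrightarrow> T (\<lambda>t. c * f t + g t) t"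
        using lim[OF ell2_lincomb[OF fg, of c], of t] by (simp add: bounded_opsD(3)[OF X fg])
      ultimately show "T (\<lambda>t. c * f t + g t) t = c * T f t + T g t" by (rule LIMSEQ_unique[symmetric])
    qed
  qed (simp_all add: T_def)
  have n: "op_norm S (op_diff (X k) T) \<le> e k" for k
    unfolding op_norm_diff_commute[of S "X k"]
    by (rule op_norm_le[OF e0]) (use Td in \<open>simp add: op_diff_def\<close>)
  have "(\<lambda>k. op_norm S (op_diff (X k) T)) \<longlonglongrightarrow> 0"
    by (rule tendsto_sandwich[OF _ _ tendsto_const e(2)])
       (use n op_norm_nonneg[OF op_diff_bounded(1)[OF X T]] in \<open>auto intro!: always_eventually\<close>)
  with T that show thesis by blast
qed

lemma cstar_subalgebraD:
  assumes "cstar_subalgebra S A"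
  shows "T \<in> A \<Longrightarrow> T \<in> bounded_ops S"
    "T \<in> A \<Longrightarrow> U \<in> A \<Longrightarrow> op_add T U \<in> A" "T \<in> A \<Longrightarrow> op_scale c T \<in> A"
    "T \<in> A \<Longrightarrow> U \<in> A \<Longrightarrow> T \<circ> U \<in> A" "T \<in> A \<Longrightarrow> op_adj S T \<in> A"
    "T \<in> A \<Longrightarrow> U \<in> A \<Longrightarrow> op_diff T U \<in> A"
    "T \<in> bounded_ops S \<Longrightarrow> (\<And>i::nat. X i \<in> A) \<Longrightarrow> (\<lambda>i. op_norm S (op_diff (X i) T)) \<longlonglongrightarrow> 0 \<Longrightarrow> T \<in> A"
  using assms unfolding cstar_subalgebra_def op_diff_eq by blast+

lemma op_norm_one_le: "op_norm S (op_one S) \<le> 1"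
  by (rule op_norm_le) (auto simp: op_one_def)

text \<open>The partial sums obey X_(k+1) = 1 + X_k x, so their limit solves y = 1 + y x. Norm
  closedness keeps y in A. Only this one-sided inverse of 1 - x is needed for the contractivity of
  star-automorphisms.\<close>

lemma neumann_series:
  assumes A: "cstar_subalgebra S A" "op_one S \<in> A" and x: "x \<in> A" "op_norm S x < 1"
  obtains y where "y \<in> A" "op_diff y (y \<circ> x) = op_one S"
proof -
  let ?q = "op_norm S x"
  note cd = cstar_subalgebraD[OF A(1)]
  have xb: "x \<in> bounded_ops S" using x cd(1) by blast
  have q: "0 \<le> ?q" by (rule op_norm_nonneg[OF xb])
  define X where "X = rec_nat (op_one S) (\<lambda>_ T. op_add (op_one S) (T \<circ> x))"
  have X0: "X 0 = op_one S" and XS: "X (Suc k) = op_add (op_one S) (X k \<circ> x)" for k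
    by (simp_all add: X_def)
  have XA: "X k \<in> A" for k by (induction k) (auto simp: X0 XS intro: cd(2,4) A x)
  have Xb: "X k \<in> bounded_ops S" for k using XA cd(1) by blast
  have D: "op_diff (X l) (X k) \<in> bounded_ops S" for k l using Xb by (simp add: op_diff_bounded)
  have step: "op_norm S (op_diff (X (Suc k)) (X k)) \<le> ?q ^ k" for k
  proof (induction k)
    case 0
    have "op_diff (X (Suc 0)) (X 0) = op_one S \<circ> x"
      by (simp add: X0 XS op_diff_def op_add_def fun_eq_iff)
    then have "op_norm S (op_diff (X (Suc 0)) (X 0)) \<le> op_norm S (op_one S) * ?q"
      using op_comp_bounded(2)[OF op_one_bounded xb] by simp
    also have "\<dots> \<le> 1 * 1" by (rule mult_mono) (use op_norm_one_le q x in auto)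
    finally show ?case by simp
  next
    case (Suc k)
    have "op_diff (op_add (op_one S) (X (Suc k) \<circ> x)) (op_add (op_one S) (X k \<circ> x))
        = op_diff (X (Suc k)) (X k) \<circ> x"
      by (simp add: op_diff_def op_add_def fun_eq_iff)
    then have "op_diff (X (Suc (Suc k))) (X (Suc k)) = op_diff (X (Suc k)) (X k) \<circ> x"
      by (simp only: XS)
    then have "op_norm S (op_diff (X (Suc (Suc k))) (X (Suc k))) \<le> op_norm S (op_diff (X (Suc k)) (X k)) * ?q"
      using op_comp_bounded(2)[OF D xb] by simp
    also have "\<dots> \<le> ?q ^ k * ?q" by (rule mult_right_mono[OF Suc q])
    finally show ?case by (simp add: mult.commute)
  qed
  have tail: "op_norm S (op_diff (X l) (X k)) \<le> ?q ^ k / (1 - ?q)" if "k \<le> l" for k l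
  proof -
    have "op_norm S (op_diff (X l) (X k)) \<le> (?q ^ k - ?q ^ l) / (1 - ?q)"
      using that
    proof (induction l rule: dec_induct)
      case base
      have "op_norm S (op_diff (X k) (X k)) \<le> 0"
        by (rule op_norm_le) (auto simp: op_diff_def)
      then show ?case by simp
    next
      case (step l)
      have "op_norm S (op_diff (X (Suc l)) (X k)) \<le> ?q ^ l + (?q ^ k - ?q ^ l) / (1 - ?q)"
        using op_norm_triangle[OF Xb[of "Suc l"] Xb[of k] Xb[of l]] step.IH \<open>\<And>k. op_norm S (op_diff (X (Suc k)) (X k)) \<le> ?q ^ k\<close>[of l]
        by linarith
      also have "\<dots> = (?q ^ k - ?q ^ Suc l) / (1 - ?q)" using x(2) by (simp add: field_simps)
      finally show ?case .
    qed
    also have "\<dots> \<le> ?q ^ k / (1 - ?q)" using x(2) q by (intro divide_right_mono) auto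
    finally show ?thesis .
  qed
  have "(\<lambda>k. ?q ^ k / (1 - ?q)) \<longlonglongrightarrow> 0 / (1 - ?q)"
    using x(2) q by (intro tendsto_divide LIMSEQ_power_zero tendsto_const) auto
  then have "(\<lambda>k. ?q ^ k / (1 - ?q)) \<longlonglongrightarrow> 0" by simp
  from bounded_ops_complete[OF Xb tail this]
  obtain y where y: "y \<in> bounded_ops S" and lim: "(\<lambda>k. op_norm S (op_diff (X k) y)) \<longlonglongrightarrow> 0"
    by blast
  have yA: "y \<in> A" by (rule cd(7)[OF y XA lim])
  have "op_diff y (y \<circ> x) = op_one S"
  proof (rule op_norm_eq_0)
    let ?L = "op_diff (op_diff y (y \<circ> x)) (op_one S)"
    have yx: "y \<circ> x \<in> bounded_ops S" using y xb by (rule op_comp_bounded)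
    show L: "?L \<in> bounded_ops S" "op_diff y (y \<circ> x) \<in> bounded_ops S"
      by (intro op_diff_bounded y yx op_one_bounded)+
    have "op_norm S ?L \<le> op_norm S (op_diff (X (Suc k)) y) + op_norm S (op_diff (X k) y) * ?q" for k
    proof -
      have "?L = op_diff (op_diff (X k) y \<circ> x) (op_diff (X (Suc k)) y)"
        unfolding XS by (simp add: op_diff_def op_add_def fun_eq_iff)
      then have "op_norm S ?L \<le> op_norm S (op_diff (X k) y \<circ> x) + op_norm S (op_diff (X (Suc k)) y)"
        using op_diff_bounded(2)[OF op_comp_bounded(1)[OF _ xb], of "op_diff (X k) y" "op_diff (X (Suc k)) y"]
          Xb y by (simp add: op_diff_bounded)
      then show ?thesis
        using op_comp_bounded(2)[OF op_diff_bounded(1)[OF Xb[of k] y] xb] by linarith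
    qed
    moreover have "(\<lambda>k. op_norm S (op_diff (X (Suc k)) y) + op_norm S (op_diff (X k) y) * ?q) \<longlonglongrightarrow> 0 + 0 * ?q"
      by (intro tendsto_intros LIMSEQ_Suc lim)
    ultimately have "op_norm S ?L \<le> 0 + 0 * ?q"
      by (intro LIMSEQ_le_const) auto
    then show "op_norm S ?L \<le> 0" by simp
  qed simp
  with yA that show thesis by blast
qed

lemma ell2_norm_diff_sq:
  assumes "f \<in> ell2 S" "g \<in> ell2 S"
  shows "(ell2_norm (\<lambda>t. f t - g t))\<^sup>2 = (ell2_norm f)\<^sup>2 - 2 * Re (ell2_inner f g) + (ell2_norm g)\<^sup>2"
proof -
  let ?d = "\<lambda>t. f t - g t"
  have d: "?d \<in> ell2 S" using ell2_diff assms by blast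
  have "complex_of_real ((ell2_norm ?d)\<^sup>2) = ell2_inner f ?d - ell2_inner g ?d"
    unfolding ell2_inner_self[OF d, symmetric] by (rule ell2_inner_diff[OF assms d])
  also have "\<dots> = ell2_inner f f - ell2_inner f g - (ell2_inner g f - ell2_inner g g)"
    using ell2_inner_diff_right[OF assms assms(1)] ell2_inner_diff_right[OF assms assms(2)] by simp
  also have "\<dots> = of_real ((ell2_norm f)\<^sup>2) - (ell2_inner f g + cnj (ell2_inner f g)) + of_real ((ell2_norm g)\<^sup>2)"
    using ell2_inner_self[OF assms(1)] ell2_inner_self[OF assms(2)] ell2_inner_commute[of g f] by simp
  also have "\<dots> = of_real ((ell2_norm f)\<^sup>2 - 2 * Re (ell2_inner f g) + (ell2_norm g)\<^sup>2)"
    by (simp add: complex_add_cnj)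
  finally show ?thesis unfolding of_real_eq_iff .
qed

lemma star_automorphismD:
  assumes "star_automorphism S A \<alpha>"
  shows "\<alpha> \<in> extensional A" "bij_betw \<alpha> A A"
    "T \<in> A \<Longrightarrow> U \<in> A \<Longrightarrow> \<alpha> (op_add T U) = op_add (\<alpha> T) (\<alpha> U)"
    "T \<in> A \<Longrightarrow> \<alpha> (op_scale c T) = op_scale c (\<alpha> T)"
    "T \<in> A \<Longrightarrow> U \<in> A \<Longrightarrow> \<alpha> (T \<circ> U) = \<alpha> T \<circ> \<alpha> U"
    "T \<in> A \<Longrightarrow> \<alpha> (op_adj S T) = op_adj S (\<alpha> T)" "T \<in> A \<Longrightarrow> \<alpha> T \<in> A"
  using assms unfolding star_automorphism_def bij_betw_def by blast+

lemma star_automorphism_diff: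
  assumes "star_automorphism S A \<alpha>" "cstar_subalgebra S A" "T \<in> A" "U \<in> A"
  shows "\<alpha> (op_diff T U) = op_diff (\<alpha> T) (\<alpha> U)"
  unfolding op_diff_eq
  using star_automorphismD[OF assms(1)] cstar_subalgebraD(3)[OF assms(2)] assms(3,4) by simp

lemma op_one_comp: "T \<in> bounded_ops S \<Longrightarrow> op_one S \<circ> T = T" "T \<in> bounded_ops S \<Longrightarrow> T \<circ> op_one S = T"
  by (auto simp: op_one_def fun_eq_iff bounded_opsD)

lemma star_automorphism_one:
  assumes "star_automorphism S A \<alpha>" "cstar_subalgebra S A" "op_one S \<in> A"
  shows "\<alpha> (op_one S) = op_one S"
proof -
  note sd = star_automorphismD[OF assms(1)]
  obtain U where U: "U \<in> A" "\<alpha> U = op_one S"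
    using sd(2) assms(3) unfolding bij_betw_def by (metis imageE)
  have b: "\<alpha> (op_one S) \<in> bounded_ops S" "U \<in> bounded_ops S" 
    using sd(7) assms U cstar_subalgebraD(1) by blast+
  have "\<alpha> (op_one S) = \<alpha> (op_one S) \<circ> \<alpha> U" using U(2) op_one_comp b by metis
  also have "\<dots> = \<alpha> U" using sd(5)[OF assms(3) U(1)] op_one_comp(1)[OF b(2)] by simp
  finally show ?thesis using U by simp
qed

text \<open>If \<open>\<parallel>\<alpha> T\<parallel> > \<parallel>T\<parallel>\<close>, then \<open>\<lambda> = \<parallel>\<alpha> T\<parallel>\<^sup>2\<close> is an approximate eigenvalue of \<open>\<alpha> (T\<^sup>* T)\<close>, while
  \<open>\<lambda> - T\<^sup>* T\<close> has an inverse in \<open>A\<close>, given by the Neumann series.\<close>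

lemma star_automorphism_contractive:
  assumes aut: "star_automorphism S A \<alpha>" and A: "cstar_subalgebra S A" "op_one S \<in> A" and T: "T \<in> A"
  shows "op_norm S (\<alpha> T) \<le> op_norm S T"
proof (rule ccontr)
  note sd = star_automorphismD[OF aut]
  note cd = cstar_subalgebraD[OF A(1)]
  let ?T = "\<alpha> T"
  have Tb: "T \<in> bounded_ops S" "?T \<in> bounded_ops S" using T sd(7) cd(1) by blast+
  assume "\<not> ?thesis"
  then have lt: "op_norm S T < op_norm S ?T" by simp
  define \<mu> where "\<mu> = op_norm S ?T"
  have nT: "0 \<le> op_norm S T" by (rule op_norm_nonneg[OF Tb(1)])
  then have mu: "\<mu> > 0" using lt unfolding \<mu>_def by linarith
  define x where "x = op_scale (of_real (1 / \<mu>\<^sup>2)) (op_adj S T \<circ> T)"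
  have xA: "x \<in> A" unfolding x_def by (intro cd(3,4,5) T)
  have "op_norm S x \<le> (1 / \<mu>\<^sup>2) * op_norm S (op_adj S T \<circ> T)"
    using op_scale_bounded(2)[OF op_comp_bounded(1)[OF op_adj_props(1)[OF Tb(1)] Tb(1)], of "of_real (1 / \<mu>\<^sup>2)"]
    unfolding x_def by (simp only: norm_of_real) simp
  also have "\<dots> \<le> (1 / \<mu>\<^sup>2) * (op_norm S T * op_norm S T)"
    using op_comp_bounded(2)[OF op_adj_props(1)[OF Tb(1)] Tb(1)] 
      mult_right_mono[OF op_adj_norm_le[OF Tb(1)] nT]
    by (intro mult_left_mono) auto
  also have "\<dots> < 1" using lt nT mu unfolding \<mu>_def[symmetric]
    by (simp add: field_simps power2_eq_square mult_strict_mono)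
  finally obtain y where y: "y \<in> A" "op_diff y (y \<circ> x) = op_one S"
    using neumann_series[OF A xA] by blast
  let ?y = "\<alpha> y"
  have yb: "?y \<in> bounded_ops S" using y sd(7) cd(1) by blast
  have ax: "\<alpha> x = op_scale (of_real (1 / \<mu>\<^sup>2)) (op_adj S ?T \<circ> ?T)"
    unfolding x_def using sd(4,5,6) T cd(3,4,5) by simp
  have ay: "op_diff ?y (?y \<circ> \<alpha> x) = op_one S"
    using star_automorphism_diff[OF aut A(1) y(1), of "y \<circ> x"] y cd(4)[OF y(1) xA] sd(5)[OF y(1) xA]
      star_automorphism_one[OF aut A] by simp
  \<comment> \<open>The added 1 gives \<open>K \<ge> 1\<close>, hence \<open>c \<ge> 0\<close>
    below.\<close>
  define K where "K = (op_norm S ?y)\<^sup>2 + 1"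
  have K: "K > 0" unfolding K_def by (simp add: add_nonneg_pos)
  \<comment> \<open>This factor results from solving |f|^2 \<le> K (2 |f|^2 - 2 |g|^2 / \<mu>^2) for
    |g|^2, where g is \<open>\<alpha> T\<close> applied to f.\<close>
  define c where "c = 1 - 1 / (2 * K)"
  have c: "0 \<le> c" "c < 1" using K unfolding c_def K_def by (auto simp: field_simps)
  have main: "(ell2_norm (?T f))\<^sup>2 \<le> (\<mu>\<^sup>2 * c) * (ell2_norm f)\<^sup>2" if f: "f \<in> ell2 S" for f
  proof -
    let ?B = "op_adj S ?T \<circ> ?T"
    let ?g = "\<alpha> x f"
    have adjb: "op_adj S ?T \<in> bounded_ops S" by (rule op_adj_props(1)[OF Tb(2)])
    have g: "?g = (\<lambda>t. of_real (1 / \<mu>\<^sup>2) * op_adj S ?T (?T f) t)" by (simp add: ax op_scale_def)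
    have h: "op_adj S ?T (?T f) \<in> ell2 S" using adjb by simp
    have ge: "?g \<in> ell2 S" unfolding g by (rule ell2_scale(1)[OF h])
    have gn: "ell2_norm ?g \<le> ell2_norm f"
    proof -
      have "ell2_norm (op_adj S ?T (?T f)) \<le> \<mu> * (\<mu> * ell2_norm f)"
        using         order_trans[OF op_norm_bound[OF adjb bounded_ops_ell2[OF Tb(2)], of f] mult_mono[OF op_adj_norm_le[OF Tb(2)] op_norm_bound[OF Tb(2) f]]] op_norm_nonneg[OF Tb(2)]
        by (simp add: \<mu>_def[symmetric])
      moreover have "ell2_norm ?g = (1 / \<mu>\<^sup>2) * ell2_norm (op_adj S ?T (?T f))"
        unfolding g ell2_scale(2)[OF h] norm_of_real by simp
      ultimately have "\<mu> * (\<mu> * ell2_norm ?g) \<le> \<mu> * (\<mu> * ell2_norm f)"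
        using mu by (simp add: field_simps power2_eq_square)
      then show ?thesis using mu by (simp only: mult_le_cancel_left_pos)
    qed
    have ip: "ell2_inner f ?g = of_real ((ell2_norm (?T f))\<^sup>2 / \<mu>\<^sup>2)"
    proof -
      have "ell2_inner ?g f = of_real (1 / \<mu>\<^sup>2) * ell2_inner (op_adj S ?T (?T f)) f"
        unfolding g by (rule ell2_inner_scale[OF h f])
      also have "ell2_inner (op_adj S ?T (?T f)) f = of_real ((ell2_norm (?T f))\<^sup>2)"
        using op_adj_left[OF Tb(2) bounded_ops_ell2[OF Tb(2)] f] ell2_inner_self[OF bounded_ops_ell2[OF Tb(2)]] by simp
      finally show ?thesis by (subst ell2_inner_commute) simp
    qed
    let ?d = "\<lambda>t. f t - ?g t"
    have d: "?d \<in> ell2 S" by (rule ell2_diff(1)[OF f ge])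
    \<comment> \<open>The relation y (1 - x) = 1 is preserved by \<alpha>. So f is recovered from d
      = f - \<alpha>(x) f by a bounded operator, and |d| cannot be small compared with |f|.\<close>
    have "?y ?d = f"
      using fun_cong[OF ay, of f] f by (simp add: bounded_ops_diff[OF yb f ge] op_diff_def op_one_def)
    then have "ell2_norm f \<le> op_norm S ?y * ell2_norm ?d" using op_norm_bound[OF yb d] by simp
    then have "(ell2_norm f)\<^sup>2 \<le> (op_norm S ?y * ell2_norm ?d)\<^sup>2" by (rule power_mono) simp
    also have "\<dots> \<le> K * (ell2_norm ?d)\<^sup>2" unfolding K_def power_mult_distrib by (simp add: distrib_right)
    also have "\<dots> \<le> K * (2 * (ell2_norm f)\<^sup>2 - 2 * (ell2_norm (?T f))\<^sup>2 / \<mu>\<^sup>2)"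
      using ell2_norm_diff_sq[OF f ge] power_mono[OF gn ell2_norm_nonneg, of 2] K
      by (intro mult_left_mono) (auto simp: ip)
    finally show ?thesis unfolding c_def using K mu by (simp add: field_simps)
  qed
  \<comment> \<open>The estimate holds for all f with the same c < 1, which is incompatible with
    \<mu> being the operator norm.\<close>
  have "\<mu> \<le> \<mu> * sqrt c"
    unfolding \<mu>_def
  proof (rule op_norm_le, fold \<mu>_def)
    show "0 \<le> \<mu> * sqrt c" using mu c by simp
    show "ell2_norm (?T f) \<le> \<mu> * sqrt c * ell2_norm f" if "f \<in> ell2 S" for f
    proof (rule power2_le_imp_le)
      show "(ell2_norm (?T f))\<^sup>2 \<le> (\<mu> * sqrt c * ell2_norm f)\<^sup>2"
        using main[OF that] c by (simp add: power_mult_distrib)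
    qed (use mu c in simp)
  qed
  moreover have "sqrt c < 1" using c by simp
  ultimately show False using mu by (simp add: mult_less_cancel_left)
qed

section \<open>Toeplitz algebras\<close>

text \<open>The algebra of all bounded operators belongs to the family that is intersected, so the
  intersection is not over an empty family and consists of bounded operators.\<close>

lemma toeplitz_cstar:
  assumes "left_shift M ` carrier M \<subseteq> bounded_ops (carrier M)" "carrier M \<noteq> {}"
  shows "cstar_subalgebra (carrier M) (toeplitz_algebra M)"
    and "s \<in> carrier M \<Longrightarrow> left_shift M s \<in> toeplitz_algebra M"
proof -
  let ?F = "{A. cstar_subalgebra (carrier M) A \<and> left_shift M ` carrier M \<subseteq> A}"
  have top: "bounded_ops (carrier M) \<in> ?F" using assms bounded_ops_cstar by blast
  show gen: "left_shift M s \<in> toeplitz_algebra M" if "s \<in> carrier M" for s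
    unfolding toeplitz_algebra_def using that by blast
  show "cstar_subalgebra (carrier M) (toeplitz_algebra M)"
    unfolding cstar_subalgebra_def
  proof (intro conjI ballI allI impI)
    show "toeplitz_algebra M \<subseteq> bounded_ops (carrier M)"
      unfolding toeplitz_algebra_def using top by blast
    show "toeplitz_algebra M \<noteq> {}" using gen assms(2) by blast
  next
    fix X T assume "T \<in> bounded_ops (carrier M)"
      "(\<forall>i::nat. X i \<in> toeplitz_algebra M) \<and> (\<lambda>i. op_norm (carrier M) (op_diff (X i) T)) \<longlonglongrightarrow> 0"
    then show "T \<in> toeplitz_algebra M"
      unfolding toeplitz_algebra_def by (auto intro: cstar_subalgebraD(7)[where X = X])
  qed (auto simp: toeplitz_algebra_def intro: cstar_subalgebraD)
qed

text \<open>The set on which the two maps agree is a C*-subalgebra containing the generators. Its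
  norm closedness is the only analytic point: \<open>star_automorphism\<close> asks for no
  continuity, and \<open>star_automorphism_contractive\<close> provides it.\<close>

lemma star_automorphism_eqI:
  assumes gen: "left_shift M ` carrier M \<subseteq> bounded_ops (carrier M)" "carrier M \<noteq> {}"
    and one: "op_one (carrier M) \<in> toeplitz_algebra M"
    and aut: "star_automorphism (carrier M) (toeplitz_algebra M) \<alpha>"
      "star_automorphism (carrier M) (toeplitz_algebra M) \<alpha>'"
    and eq: "\<And>s. s \<in> carrier M \<Longrightarrow> \<alpha> (left_shift M s) = \<alpha>' (left_shift M s)"
  shows "\<alpha> = \<alpha>'"
proof -
  let ?S = "carrier M" and ?A = "toeplitz_algebra M"
  note A = toeplitz_cstar(1)[OF gen]
  note cd = cstar_subalgebraD[OF A]
  note sd = star_automorphismD[OF aut(1)] and sd' = star_automorphismD[OF aut(2)]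
  define E where "E = {T \<in> ?A. \<alpha> T = \<alpha>' T}"
  have lim: "T \<in> E"
    if T: "T \<in> bounded_ops ?S" and X: "\<And>i::nat. X i \<in> E" "(\<lambda>i. op_norm ?S (op_diff (X i) T)) \<longlonglongrightarrow> 0" for X T
  proof -
    have XA: "X i \<in> ?A" and Xe: "\<alpha> (X i) = \<alpha>' (X i)" for i using X(1) by (auto simp: E_def)
    have TA: "T \<in> ?A" by (rule cd(7)[OF T XA X(2)])
    have "op_norm ?S (op_diff (\<alpha> T) (\<alpha>' T)) \<le> 2 * op_norm ?S (op_diff (X i) T)" for i
    proof -
      have "op_norm ?S (op_diff (\<alpha> T) (\<alpha>' T))
          \<le> op_norm ?S (op_diff (\<alpha> T) (\<alpha> (X i))) + op_norm ?S (op_diff (\<alpha> (X i)) (\<alpha>' T))"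
        by (rule op_norm_triangle) (intro cd(1) sd(7) sd'(7) TA XA)+
      also have "op_norm ?S (op_diff (\<alpha> T) (\<alpha> (X i))) \<le> op_norm ?S (op_diff (X i) T)"
        using star_automorphism_contractive[OF aut(1) A one cd(6)[OF TA XA]]
          star_automorphism_diff[OF aut(1) A TA XA] by (simp add: op_norm_diff_commute[of ?S T])
      also have "op_norm ?S (op_diff (\<alpha> (X i)) (\<alpha>' T)) \<le> op_norm ?S (op_diff (X i) T)"
        using star_automorphism_contractive[OF aut(2) A one cd(6)[OF XA TA]]
          star_automorphism_diff[OF aut(2) A XA TA] by (simp add: Xe)
      finally show ?thesis by simp
    qed
    moreover have "(\<lambda>i. 2 * op_norm ?S (op_diff (X i) T)) \<longlonglongrightarrow> 2 * 0"
      by (intro tendsto_intros X(2))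
    ultimately have "op_norm ?S (op_diff (\<alpha> T) (\<alpha>' T)) \<le> 2 * 0"
      using LIMSEQ_le_const[of "\<lambda>i. 2 * op_norm ?S (op_diff (X i) T)"] by blast
    moreover have ab: "\<alpha> T \<in> bounded_ops ?S" "\<alpha>' T \<in> bounded_ops ?S"
      using cd(1) sd(7) sd'(7) TA by blast+
    ultimately have "\<alpha> T = \<alpha>' T"
      using op_norm_eq_0[OF ab _ op_diff_bounded(1)[OF ab]] by simp
    then show ?thesis using TA by (simp add: E_def)
  qed
  have "cstar_subalgebra ?S E"
    unfolding cstar_subalgebra_def
  proof (intro conjI ballI allI impI)
    show "E \<noteq> {}" using toeplitz_cstar(2)[OF gen] eq gen(2) by (auto simp: E_def)
    show "E \<subseteq> bounded_ops ?S" using cd(1) by (auto simp: E_def)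
  next
    fix X T assume "T \<in> bounded_ops ?S"
      "(\<forall>i::nat. X i \<in> E) \<and> (\<lambda>i. op_norm ?S (op_diff (X i) T)) \<longlonglongrightarrow> 0"
    then show "T \<in> E" using lim[of T X] by blast
  qed (auto simp: E_def sd sd' cd(2-5))
  moreover have "left_shift M ` ?S \<subseteq> E" using toeplitz_cstar(2)[OF gen] eq by (auto simp: E_def)
  ultimately have "?A \<subseteq> E" unfolding toeplitz_algebra_def by blast
  then have "\<alpha> T = \<alpha>' T" if "T \<in> ?A" for T using that by (auto simp: E_def)
  then show ?thesis using sd(1) sd'(1) by (intro extensionalityI[of _ ?A])
qed

section \<open>States\<close>

lemma stateD:
  assumes "state S A \<phi>"
  shows "\<phi> \<in> extensional A" "T \<in> A \<Longrightarrow> U \<in> A \<Longrightarrow> \<phi> (op_add T U) = \<phi> T + \<phi> U"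
    "T \<in> A \<Longrightarrow> \<phi> (op_scale c T) = c * \<phi> T" "T \<in> A \<Longrightarrow> \<phi> (op_adj S T \<circ> T) \<in> \<real>\<^sub>\<ge>\<^sub>0"
    "T \<in> A \<Longrightarrow> cmod (\<phi> T) \<le> op_norm S T" "\<phi> (op_one S) = 1"
  using assms unfolding state_def by blast+

lemma state_diff:
  assumes "state S A \<phi>" "cstar_subalgebra S A" "T \<in> A" "U \<in> A"
  shows "\<phi> (op_diff T U) = \<phi> T - \<phi> U"
  unfolding op_diff_eq using stateD[OF assms(1)] cstar_subalgebraD(3)[OF assms(2)] assms(3,4) by simp

lemma vector_state:
  assumes A: "cstar_subalgebra S A" "op_one S \<in> A" and xi: "\<xi> \<in> ell2 S" "ell2_norm \<xi> = 1"
  shows "state S A (\<lambda>T\<in>A. ell2_inner (T \<xi>) \<xi>)"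
  unfolding state_def
proof (intro conjI ballI allI)
  note cd = cstar_subalgebraD[OF A(1)]
  fix T U assume T: "T \<in> A" and U: "U \<in> A"
  then show "(\<lambda>T\<in>A. ell2_inner (T \<xi>) \<xi>) (op_add T U) = (\<lambda>T\<in>A. ell2_inner (T \<xi>) \<xi>) T + (\<lambda>T\<in>A. ell2_inner (T \<xi>) \<xi>) U"
    using ell2_inner_add[of "T \<xi>" S "U \<xi>" \<xi>] cd(1,2) xi by (simp add: op_add_def)
next
  note cd = cstar_subalgebraD[OF A(1)]
  fix T assume T: "T \<in> A"
  then have Tb: "T \<in> bounded_ops S" using cd(1) by blast
  then have TX: "T \<xi> \<in> ell2 S" by simp
  show "(\<lambda>T\<in>A. ell2_inner (T \<xi>) \<xi>) (op_scale c T) = c * (\<lambda>T\<in>A. ell2_inner (T \<xi>) \<xi>) T" for c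
    using ell2_inner_scale[OF TX xi(1)] cd(3) T by (simp add: op_scale_def)
  have "ell2_inner (op_adj S T (T \<xi>)) \<xi> = of_real ((ell2_norm (T \<xi>))\<^sup>2)"
    using op_adj_left[OF Tb TX xi(1)] ell2_inner_self[OF TX] by simp
  then show "(\<lambda>T\<in>A. ell2_inner (T \<xi>) \<xi>) (op_adj S T \<circ> T) \<in> \<real>\<^sub>\<ge>\<^sub>0"
    using cd(4,5) T by (simp del: of_real_power)
  show "cmod ((\<lambda>T\<in>A. ell2_inner (T \<xi>) \<xi>) T) \<le> op_norm S T"
    using ell2_Cauchy_Schwarz[OF TX xi(1)] op_norm_bound[OF Tb xi(1)] T xi(2) by simp
next
  show "(\<lambda>T\<in>A. ell2_inner (T \<xi>) \<xi>) (op_one S) = 1"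
    using A(2) xi ell2_inner_self[OF xi(1)] by (simp add: op_one_def)
qed simp

lemma state_mixture_summable:
  assumes w: "\<And>i. i \<in> I \<Longrightarrow> 0 \<le> w i" "(w has_sum 1) I"
    and st: "\<And>i. i \<in> I \<Longrightarrow> state S A (\<phi> i)" and T: "T \<in> A"
  shows "(\<lambda>i. cmod (of_real (w i) * \<phi> i T)) summable_on I"
    "(\<lambda>i. of_real (w i) * \<phi> i T) summable_on I"
    "cmod (\<Sum>\<^sub>\<infinity>i\<in>I. of_real (w i) * \<phi> i T) \<le> op_norm S T"
proof -
  have b: "cmod (of_real (w i) * \<phi> i T) \<le> w i * op_norm S T" if "i \<in> I" for i
    using stateD(5)[OF st[OF that] T] w(1)[OF that] by (simp add: norm_mult mult_left_mono)
  have ws: "((\<lambda>i. w i * op_norm S T) has_sum (1 * op_norm S T)) I"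
    by (rule has_sum_cmult_left[OF w(2)])
  show s: "(\<lambda>i. cmod (of_real (w i) * \<phi> i T)) summable_on I"
    by (rule summable_on_comparison_test[OF has_sum_imp_summable[OF ws] b]) auto
  show "(\<lambda>i. of_real (w i) * \<phi> i T) summable_on I" by (rule abs_summable_summable[OF s])
  have "cmod (\<Sum>\<^sub>\<infinity>i\<in>I. of_real (w i) * \<phi> i T) \<le> (\<Sum>\<^sub>\<infinity>i\<in>I. cmod (of_real (w i) * \<phi> i T))"
    by (rule norm_infsum_bound[OF s])
  also have "\<dots> \<le> (\<Sum>\<^sub>\<infinity>i\<in>I. w i * op_norm S T)"
    by (rule infsum_mono[OF s has_sum_imp_summable[OF ws] b])
  also have "\<dots> = op_norm S T" using infsumI[OF ws] by simp
  finally show "cmod (\<Sum>\<^sub>\<infinity>i\<in>I. of_real (w i) * \<phi> i T) \<le> op_norm S T" .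
qed

lemma state_mixture:
  assumes A: "cstar_subalgebra S A" "op_one S \<in> A"
    and w: "\<And>i. i \<in> I \<Longrightarrow> 0 \<le> w i" "(w has_sum 1) I"
    and st: "\<And>i. i \<in> I \<Longrightarrow> state S A (\<phi> i)"
  shows "state S A (\<lambda>T\<in>A. \<Sum>\<^sub>\<infinity>i\<in>I. of_real (w i) * \<phi> i T)"
  unfolding state_def
proof (intro conjI ballI allI)
  note cd = cstar_subalgebraD[OF A(1)]
  have sm: "(\<lambda>i. cmod (of_real (w i) * \<phi> i T)) summable_on I"
    "(\<lambda>i. of_real (w i) * \<phi> i T) summable_on I"
    "cmod (\<Sum>\<^sub>\<infinity>i\<in>I. of_real (w i) * \<phi> i T) \<le> op_norm S T" if "T \<in> A" for T
    using state_mixture_summable[of I w S A \<phi> T] w st that by blast+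
  let ?\<psi> = "\<lambda>T\<in>A. \<Sum>\<^sub>\<infinity>i\<in>I. of_real (w i) * \<phi> i T"
  fix T assume T: "T \<in> A"
  show "?\<psi> (op_add T U) = ?\<psi> T + ?\<psi> U" if U: "U \<in> A" for U
  proof -
    have "(\<Sum>\<^sub>\<infinity>i\<in>I. of_real (w i) * \<phi> i (op_add T U))
        = (\<Sum>\<^sub>\<infinity>i\<in>I. of_real (w i) * \<phi> i T + of_real (w i) * \<phi> i U)"
      by (rule infsum_cong) (simp add: stateD(2)[OF st] T U distrib_left)
    also have "\<dots> = (\<Sum>\<^sub>\<infinity>i\<in>I. of_real (w i) * \<phi> i T) + (\<Sum>\<^sub>\<infinity>i\<in>I. of_real (w i) * \<phi> i U)"
      by (rule infsum_add[OF sm(2)[OF T] sm(2)[OF U]])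
    finally show ?thesis using T U cd(2) by simp
  qed
  show "?\<psi> (op_scale c T) = c * ?\<psi> T" for c
  proof -
    have "(\<Sum>\<^sub>\<infinity>i\<in>I. of_real (w i) * \<phi> i (op_scale c T)) = (\<Sum>\<^sub>\<infinity>i\<in>I. c * (of_real (w i) * \<phi> i T))"
      by (rule infsum_cong) (simp add: stateD(3)[OF st] T)
    then show ?thesis using T cd(3) by (simp add: infsum_cmult_right')
  qed
  show "?\<psi> (op_adj S T \<circ> T) \<in> \<real>\<^sub>\<ge>\<^sub>0"
  proof -
    let ?X = "op_adj S T \<circ> T"
    have X: "?X \<in> A" using cd(4,5) T by blast
    have nn: "0 \<le> Re (of_real (w i) * \<phi> i ?X) \<and> Im (of_real (w i) * \<phi> i ?X) = 0" if "i \<in> I" for i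
      using stateD(4)[OF st[OF that] T] w(1)[OF that] by (simp add: complex_nonneg_Reals_iff)
    have "0 \<le> Re (\<Sum>\<^sub>\<infinity>i\<in>I. of_real (w i) * \<phi> i ?X)"
      unfolding infsum_Re[OF sm(2)[OF X], symmetric] by (rule infsum_nonneg) (use nn in blast)
    moreover have "Im (\<Sum>\<^sub>\<infinity>i\<in>I. of_real (w i) * \<phi> i ?X) = 0"
      unfolding infsum_Im[OF sm(2)[OF X], symmetric] by (rule infsum_0) (use nn in blast)
    ultimately show ?thesis using X by (simp add: complex_nonneg_Reals_iff)
  qed
  show "cmod (?\<psi> T) \<le> op_norm S T" using sm(3)[OF T] T by simp
next
  have "(\<Sum>\<^sub>\<infinity>i\<in>I. of_real (w i) * \<phi> i (op_one S)) = (\<Sum>\<^sub>\<infinity>i\<in>I. complex_of_real (w i))"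
    by (rule infsum_cong) (simp add: stateD(6)[OF st])
  also have "((\<lambda>i. complex_of_real (w i)) has_sum of_real 1) I"
    using w(2) unfolding has_sum_of_real_iff .
  then have "(\<Sum>\<^sub>\<infinity>i\<in>I. complex_of_real (w i)) = 1" by (simp add: infsumI)
  finally show "(\<lambda>T\<in>A. \<Sum>\<^sub>\<infinity>i\<in>I. of_real (w i) * \<phi> i T) (op_one S) = 1" using A(2) by simp
qed simp

lemma state_limit:
  assumes A: "cstar_subalgebra S A" "op_one S \<in> A"
    and st: "\<And>k::nat. state S A (\<phi> k)" and lim: "\<And>T. T \<in> A \<Longrightarrow> (\<lambda>k. \<phi> k T) \<longlonglongrightarrow> \<psi> T"
    and ext: "\<psi> \<in> extensional A"
  shows "state S A \<psi>"
  unfolding state_def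
proof (intro conjI ballI allI ext)
  note cd = cstar_subalgebraD[OF A(1)]
  fix T assume T: "T \<in> A"
  show "\<psi> (op_add T U) = \<psi> T + \<psi> U" if U: "U \<in> A" for U
  proof (rule LIMSEQ_unique[OF lim])
    show "(\<lambda>k. \<phi> k (op_add T U)) \<longlonglongrightarrow> \<psi> T + \<psi> U"
      unfolding stateD(2)[OF st T U] by (rule tendsto_add[OF lim[OF T] lim[OF U]])
  qed (use T U cd(2) in blast)
  show "\<psi> (op_scale c T) = c * \<psi> T" for c
  proof (rule LIMSEQ_unique[OF lim])
    show "(\<lambda>k. \<phi> k (op_scale c T)) \<longlonglongrightarrow> c * \<psi> T"
      unfolding stateD(3)[OF st T] by (rule tendsto_mult_left[OF lim[OF T]])
  qed (use T cd(3) in blast)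
  show "\<psi> (op_adj S T \<circ> T) \<in> \<real>\<^sub>\<ge>\<^sub>0"
  proof (rule closed_sequentially[OF closed_nonneg_Reals_complex])
    show "\<phi> k (op_adj S T \<circ> T) \<in> \<real>\<^sub>\<ge>\<^sub>0" for k using stateD(4)[OF st T] by blast
    show "(\<lambda>k. \<phi> k (op_adj S T \<circ> T)) \<longlonglongrightarrow> \<psi> (op_adj S T \<circ> T)" by (rule lim) (use T cd(4,5) in blast)
  qed
  show "cmod (\<psi> T) \<le> op_norm S T"
    by (rule LIMSEQ_le_const2[OF tendsto_norm[OF lim[OF T]]]) (use stateD(5)[OF st T] in blast)
next
  show "\<psi> (op_one S) = 1"
    using lim[OF A(2)] by (simp add: stateD(6)[OF st] LIMSEQ_const_iff)
qed

text \<open>States are bounded by the operator norm uniformly in k, so convergence on a dense set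
  makes the values at every T a Cauchy sequence. No subsequence or weak* compactness is
  involved.\<close>

lemma state_limit_exists:
  assumes A: "cstar_subalgebra S A" "op_one S \<in> A" and D: "D \<subseteq> A"
    and dense: "\<And>T e. T \<in> A \<Longrightarrow> 0 < e \<Longrightarrow> \<exists>X\<in>D. op_norm S (op_diff T X) < e"
    and st: "\<And>k::nat. state S A (\<phi> k)" and lim: "\<And>X. X \<in> D \<Longrightarrow> convergent (\<lambda>k. \<phi> k X)"
  obtains \<psi> where "state S A \<psi>" "\<And>T. T \<in> A \<Longrightarrow> (\<lambda>k. \<phi> k T) \<longlonglongrightarrow> \<psi> T"
proof -
  define \<psi> where "\<psi> = (\<lambda>T\<in>A. Topological_Spaces.lim (\<lambda>k. \<phi> k T))"
  have conv: "convergent (\<lambda>k. \<phi> k T)" if T: "T \<in> A" for T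
  proof (rule Cauchy_convergent, rule metric_CauchyI)
    fix e :: real assume e: "0 < e"
    obtain X where X: "X \<in> D" "op_norm S (op_diff T X) < e / 3" using dense[OF T, of "e / 3"] e by auto
    have XA: "X \<in> A" using X D by blast
    have d: "cmod (\<phi> k T - \<phi> k X) < e / 3" for k
      using stateD(5)[OF st cstar_subalgebraD(6)[OF A(1) T XA], of k] X(2) state_diff[OF st A(1) T XA, of k] by simp
    obtain N where N: "\<And>m k. m \<ge> N \<Longrightarrow> k \<ge> N \<Longrightarrow> dist (\<phi> m X) (\<phi> k X) < e / 3"
      using metric_CauchyD[OF convergent_Cauchy[OF lim[OF X(1)]], of "e / 3"] e by auto
    show "\<exists>M. \<forall>m\<ge>M. \<forall>k\<ge>M. dist (\<phi> m T) (\<phi> k T) < e"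
    proof (intro exI allI impI)
      fix m k assume "m \<ge> N" "k \<ge> N"
      then have "dist (\<phi> m X) (\<phi> k X) < e / 3" by (rule N)
      moreover have "dist (\<phi> m T) (\<phi> k T) \<le> dist (\<phi> m T) (\<phi> m X) + dist (\<phi> m X) (\<phi> k X) + dist (\<phi> k T) (\<phi> k X)"
        using dist_triangle[of "\<phi> m T" "\<phi> k T" "\<phi> m X"] dist_triangle[of "\<phi> m X" "\<phi> k T" "\<phi> k X"]
        by (simp add: dist_commute)
      ultimately show "dist (\<phi> m T) (\<phi> k T) < e" using d[of m] d[of k] by (simp add: dist_norm)
    qed
  qed
  then have l: "(\<lambda>k. \<phi> k T) \<longlonglongrightarrow> \<psi> T" if "T \<in> A" for T
    using that by (simp add: \<psi>_def convergent_LIMSEQ_iff)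
  moreover have "state S A \<psi>" by (rule state_limit[OF A st l]) (simp_all only: \<psi>_def restrict_extensional)
  ultimately show thesis using that by blast
qed

section \<open>Partial permutation operators\<close>

text \<open>Operators that permute part of the basis are given by pullback along \<open>h\<close> on
  \<open>D\<close>. Boundedness is then injectivity of \<open>h\<close>, and the adjoint is pullback
  along the inverse map.\<close>

definition pmap_op :: "'a set \<Rightarrow> 'a set \<Rightarrow> ('a \<Rightarrow> 'a) \<Rightarrow> 'a oper" where
  "pmap_op S D h = (\<lambda>f. if f \<in> ell2 S then (\<lambda>s. if s \<in> D then f (h s) else 0) else (\<lambda>_. 0))"

lemma pmap_op_ell2:
  assumes "inj_on h D" "D \<subseteq> S" "f \<in> ell2 S"
  shows "pmap_op S D h f \<in> ell2 S" "ell2_norm (pmap_op S D h f) \<le> ell2_norm f"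
proof -
  let ?g = "\<lambda>s. if s \<in> D then f (h s) else 0"
  have b: "L2_set (\<lambda>s. cmod (?g s)) F \<le> ell2_norm f" if "finite F" for F
  proof -
    have "(\<Sum>s\<in>F. (cmod (?g s))\<^sup>2) = (\<Sum>s\<in>F \<inter> D. (cmod (f (h s)))\<^sup>2)"
      by (rule sum.mono_neutral_cong_right) (use that in auto)
    also have "\<dots> = (\<Sum>u\<in>h ` (F \<inter> D). (cmod (f u))\<^sup>2)"
      by (rule sum.reindex_cong[symmetric, of h "F \<inter> D"])
         (use inj_on_subset[OF assms(1), of "F \<inter> D"] in auto)
    finally have "L2_set (\<lambda>s. cmod (?g s)) F = L2_set (\<lambda>u. cmod (f u)) (h ` (F \<inter> D))"
      by (simp add: L2_set_def)
    then show ?thesis using L2_set_le_ell2_norm[OF assms(3), of "h ` (F \<inter> D)"] that by simp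
  qed
  have z: "\<And>t. t \<notin> S \<Longrightarrow> ?g t = 0" using assms(2) by auto
  show "pmap_op S D h f \<in> ell2 S" "ell2_norm (pmap_op S D h f) \<le> ell2_norm f"
    using ell2_bound[OF z ell2_norm_nonneg b] assms(3) by (simp_all add: pmap_op_def)
qed

lemma pmap_op_bounded:
  assumes "inj_on h D" "D \<subseteq> S"
  shows "pmap_op S D h \<in> bounded_ops S"
proof (rule bounded_opsI[of S _ 1])
  show "pmap_op S D h (\<lambda>t. c * f t + g t) = (\<lambda>t. c * pmap_op S D h f t + pmap_op S D h g t)"
    if "f \<in> ell2 S" "g \<in> ell2 S" for f g c
    using that ell2_lincomb[OF that] by (auto simp: pmap_op_def fun_eq_iff)
qed (use pmap_op_ell2[OF assms] in \<open>auto simp: pmap_op_def\<close>)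

lemma pmap_op_adj:
  assumes "D \<subseteq> S" "D' \<subseteq> S" and bij: "bij_betw h D D'" and inv: "\<And>s. s \<in> D \<Longrightarrow> h' (h s) = s"
  shows "op_adj S (pmap_op S D h) = pmap_op S D' h'"
proof (rule op_adj_eqI)
  have inj: "inj_on h D" using bij by (rule bij_betw_imp_inj_on)
  have inj': "inj_on h' D'"
  proof (rule inj_onI)
    fix x y assume "x \<in> D'" "y \<in> D'" "h' x = h' y"
    moreover obtain s t where "s \<in> D" "t \<in> D" "x = h s" "y = h t"
      using \<open>x \<in> D'\<close> \<open>y \<in> D'\<close> bij unfolding bij_betw_def by blast
    ultimately show "x = y" using inv by simp
  qed
  show "pmap_op S D h \<in> bounded_ops S" "pmap_op S D' h' \<in> bounded_ops S"
    using pmap_op_bounded inj inj' assms(1,2) by blast+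
  fix f g assume fg: "f \<in> ell2 S" "g \<in> ell2 S"
  have "ell2_inner (pmap_op S D h f) g = (\<Sum>\<^sub>\<infinity>s\<in>D. f (h s) * cnj (g s))"
    unfolding ell2_inner_def by (rule infsum_cong_neutral) (use fg in \<open>auto simp: pmap_op_def\<close>)
  also have "\<dots> = (\<Sum>\<^sub>\<infinity>s\<in>D. f (h s) * cnj (g (h' (h s))))"
    by (rule infsum_cong) (simp add: inv)
  also have "\<dots> = (\<Sum>\<^sub>\<infinity>u\<in>D'. f u * cnj (g (h' u)))"
    by (rule infsum_reindex_bij_betw[OF bij])
  also have "\<dots> = ell2_inner f (pmap_op S D' h' g)"
    unfolding ell2_inner_def by (rule infsum_cong_neutral) (use fg in \<open>auto simp: pmap_op_def\<close>)
  finally show "ell2_inner (pmap_op S D h f) g = ell2_inner f (pmap_op S D' h' g)" .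
qed

section \<open>The spanning operators\<close>

text \<open>\<open>W n a k b\<close> is an explicit form of \<open>V\<^sub>a R\<^sup>k V\<^sub>b\<^sup>*\<close>; the term \<open>(n - 1) * k\<close>
  represents \<open>- k\<close> modulo \<open>n\<close>.\<close>

definition W :: "nat \<Rightarrow> nat \<Rightarrow> nat \<Rightarrow> nat \<Rightarrow> (nat \<times> nat) oper" where
  "W n a k b = pmap_op (nz_carrier n) {(c, y). 1 \<le> c \<and> y < n \<and> a dvd c}
     (\<lambda>(c, y). (b * (c div a), (y + (n - 1) * k * (c div a)) mod n))"

lemma nz_carrier_iff: "(c, y) \<in> nz_carrier n \<longleftrightarrow> 1 \<le> c \<and> y < n"
  by (simp add: nz_monoid_def)

lemma W_apply:
  assumes "f \<in> ell2 (nz_carrier n)"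
  shows "W n a k b f (c, y) = (if 1 \<le> c \<and> y < n \<and> a dvd c
    then f (b * (c div a), (y + (n - 1) * k * (c div a)) mod n) else 0)"
  using assms by (simp add: W_def pmap_op_def)

lemma mod_add_left_cancel_nat:
  fixes y y' k n :: nat
  assumes "(y + k) mod n = (y' + k) mod n" "y < n" "y' < n"
  shows "y = y'"
proof -
  have "[y + k = y' + k] (mod n)" using assms by (simp add: cong_def)
  then have "[y = y'] (mod n)" by (simp add: cong_add_rcancel_nat)
  then show ?thesis using assms by (simp add: cong_def)
qed

text \<open>Replacing k by \<open>(n - 1) * k\<close> reverses the rotation of each fibre, and
  swapping a and b reverses the change of fibre. The inverse map therefore has the shape of the map
  itself, which is how the adjoint of \<open>W n a k b\<close> is again a \<open>W\<close>.\<close>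

lemma W_bij:
  fixes n a b k :: nat
  assumes "1 \<le> a" "1 \<le> b"
  shows "bij_betw (\<lambda>(c, y). (b * (c div a), (y + (n - 1) * k * (c div a)) mod n))
    {(c, y). 1 \<le> c \<and> y < n \<and> a dvd c} {(c, y). 1 \<le> c \<and> y < n \<and> b dvd c}" (is "bij_betw ?h ?D ?D'")
    and "s \<in> {(c, y). 1 \<le> c \<and> y < n \<and> a dvd c} \<Longrightarrow>
      (\<lambda>(c, y). (a * (c div b), (y + (n - 1) * ((n - 1) * k) * (c div b)) mod n))
      ((\<lambda>(c, y). (b * (c div a), (y + (n - 1) * k * (c div a)) mod n)) s) = s"
proof -
  have inv: "(\<lambda>(c, y). (a * (c div b), (y + (n - 1) * ((n - 1) * k) * (c div b)) mod n))
      ((\<lambda>(c, y). (b * (c div a), (y + (n - 1) * k * (c div a)) mod n)) s) = s"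
    if s: "s \<in> {(c, y). 1 \<le> c \<and> y < n \<and> a dvd c}" and ab: "1 \<le> a" "1 \<le> b"
    for s :: "nat \<times> nat" and a b k :: nat
  proof -
    obtain q y where q: "s = (a * q, y)" "y < n" using s by (auto elim: dvdE)
    have "y + (n - 1) * k * q + (n - 1) * ((n - 1) * k) * q = y + n * ((n - 1) * k * q)"
    proof -
      have "n = Suc (n - 1)" using q(2) by simp
      then show ?thesis by (metis add.assoc mult.assoc mult_Suc)
    qed
    then have "(y + (n - 1) * k * q + (n - 1) * ((n - 1) * k) * q) mod n = y"
      using q(2) by (simp only: mod_mult_self2 mod_less)
    then show ?thesis using q ab by (simp add: mod_add_left_eq)
  qed
  then show "s \<in> {(c, y). 1 \<le> c \<and> y < n \<and> a dvd c} \<Longrightarrow>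
      (\<lambda>(c, y). (a * (c div b), (y + (n - 1) * ((n - 1) * k) * (c div b)) mod n))
      ((\<lambda>(c, y). (b * (c div a), (y + (n - 1) * k * (c div a)) mod n)) s) = s"
    using assms by blast
  \<comment> \<open>Negating k twice in the form \<open>(n - 1) * ((n - 1) * k)\<close> returns k
    only modulo n, because (n - 1)^2 = 1 modulo n.\<close>
  have kk: "(y + (n - 1) * ((n - 1) * ((n - 1) * k)) * q) mod n = (y + (n - 1) * k * q) mod n"
    if yn: "y < n" for y q :: nat
  proof -
    obtain m where m: "n = Suc m" using yn by (cases n) auto
    have "[m * m = 1] (mod n)"
    proof -
      have "int (m * m) - 1 = int n * (int m - 1)" by (simp add: m algebra_simps)
      then show ?thesis by (metis cong_int_iff cong_iff_dvd_diff dvd_triv_left of_nat_1)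
    qed
    then have "[y + m * m * (m * k * q) = y + 1 * (m * k * q)] (mod n)"
      by (intro cong_add cong_mult cong_refl)
    then show ?thesis by (simp add: m cong_def mult_ac)
  qed
  show "bij_betw ?h ?D ?D'"
  proof (rule bij_betwI[where g = "\<lambda>(c, y). (a * (c div b), (y + (n - 1) * ((n - 1) * k) * (c div b)) mod n)"])
    show "?h \<in> ?D \<rightarrow> ?D'" using assms by (auto elim!: dvdE)
    show "(\<lambda>(c, y). (a * (c div b), (y + (n - 1) * ((n - 1) * k) * (c div b)) mod n)) \<in> ?D' \<rightarrow> ?D"
      using assms by (auto elim!: dvdE)
    show "(case ?h x of (c, y) \<Rightarrow> (a * (c div b), (y + (n - 1) * ((n - 1) * k) * (c div b)) mod n)) = x"
      if "x \<in> ?D" for x using inv[OF that assms, of k] .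
    show "?h (case y of (c, y) \<Rightarrow> (a * (c div b), (y + (n - 1) * ((n - 1) * k) * (c div b)) mod n)) = y"
      if yD: "y \<in> ?D'" for y
    proof -
      obtain c z where y: "y = (c, z)" "z < n" using yD by auto
      show ?thesis
        using inv[OF yD assms(2,1), of "(n - 1) * k"] kk[of "(z + (n - 1) * ((n - 1) * k) * (c div b)) mod n" "a * (c div b) div a",
            OF mod_less_divisor[OF le_less_trans[OF le0 y(2)]]]
        by (simp only: y(1) prod.case)
    qed
  qed
qed

lemma W_bounded:
  assumes "1 \<le> a" "1 \<le> b" shows "W n a k b \<in> bounded_ops (nz_carrier n)"
  unfolding W_def
  by (rule pmap_op_bounded[OF bij_betw_imp_inj_on[OF W_bij(1)[OF assms]]]) (auto simp: nz_monoid_def)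

lemma W_adj:
  assumes "1 \<le> a" "1 \<le> b"
  shows "op_adj (nz_carrier n) (W n a k b) = W n b ((n - 1) * k) a"
  unfolding W_def
  by (rule pmap_op_adj[OF _ _ W_bij(1)[OF assms] W_bij(2)[OF assms]]) (auto simp: nz_monoid_def)

lemma W_cong:
  assumes "[k = l] (mod n)" shows "W n a k b = W n a l b"
proof -
  have "(y + (n - 1) * k * q) mod n = (y + (n - 1) * l * q) mod n" for y q
    using cong_add[OF cong_refl cong_mult[OF cong_mult[OF cong_refl assms] cong_refl]]
    unfolding cong_def by blast
  then show ?thesis by (simp add: W_def)
qed

text \<open>The formula combines three relations: V_b^* V_c = V_c' V_b'^* where b' and c' are the
  quotients of b and c by their gcd, R^k V_c' = V_c' R^(k c'), and V_b'^* R^l = R^(l b') V_b'^*. It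
  is verified on coordinates, where the first relation becomes: c divides b q exactly when c'
  divides q.\<close>

lemma W_comp:
  assumes "1 \<le> a" "1 \<le> b" "1 \<le> c" "1 \<le> d"
  shows "W n a k b \<circ> W n c l d =
    W n (a * (c div gcd b c)) (k * (c div gcd b c) + l * (b div gcd b c)) (d * (b div gcd b c))"
proof (rule op_eqI)
  define g where "g = gcd b c"
  define c' where "c' = c div g"
  define b' where "b' = b div g"
  have g: "g \<ge> 1" using assms by (simp add: g_def Suc_le_eq)
  have cb: "c = c' * g" "b = b' * g" by (simp_all add: c'_def b'_def g_def)
  have cop: "coprime c' b'" unfolding c'_def b'_def g_def
    using div_gcd_coprime[of b c] assms by (simp add: coprime_commute)
  have c'1: "c' \<ge> 1" "b' \<ge> 1" using cb assms by (auto intro: Suc_leI gr0I)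
  show "W n a k b \<circ> W n c l d \<in> bounded_ops (nz_carrier n)"
    using W_bounded assms by (intro op_comp_bounded) auto
  show "W n (a * (c div gcd b c)) (k * (c div gcd b c) + l * (b div gcd b c)) (d * (b div gcd b c))
      \<in> bounded_ops (nz_carrier n)"
    unfolding g_def[symmetric] c'_def[symmetric] b'_def[symmetric]
    using assms c'1 by (intro W_bounded) auto
  fix f assume f: "f \<in> ell2 (nz_carrier n)"
  have f': "W n c l d f \<in> ell2 (nz_carrier n)" using W_bounded assms f by (meson bounded_ops_ell2)
  show "(W n a k b \<circ> W n c l d) f =
    W n (a * (c div gcd b c)) (k * (c div gcd b c) + l * (b div gcd b c)) (d * (b div gcd b c)) f"
    unfolding g_def[symmetric] c'_def[symmetric] b'_def[symmetric]
  proof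
    fix s :: "nat \<times> nat"
    obtain m y where s: "s = (m, y)" by (cases s)
    show "(W n a k b \<circ> W n c l d) f s = W n (a * c') (k * c' + l * b') (d * b') f s"
    proof (cases "1 \<le> m \<and> y < n \<and> a dvd m")
      case False
      then have "\<not> (1 \<le> m \<and> y < n \<and> a * c' dvd m)" using dvd_mult_left by blast
      with False show ?thesis by (auto simp: s W_apply[OF f] W_apply[OF f'])
    next
      case True
      then obtain q where q: "m = a * q" by blast
      have q1: "q \<ge> 1" using True q by (auto intro: Suc_leI gr0I)
      have dv: "c dvd b * q \<longleftrightarrow> c' dvd q"
      proof -
        have "c dvd b * q \<longleftrightarrow> c' dvd b' * q" using cb g by (simp add: mult_ac)
        also have "\<dots> \<longleftrightarrow> c' dvd q" using cop by (rule coprime_dvd_mult_right_iff)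
        finally show ?thesis .
      qed
      have dv2: "a * c' dvd m \<longleftrightarrow> c' dvd q" using q assms by simp
      show ?thesis
      proof (cases "c' dvd q")
        case False
        with True show ?thesis
          using dv dv2 by (auto simp: s W_apply[OF f] W_apply[OF f'] q)
      next
        case dvt: True
        then obtain r where r: "q = c' * r" by blast
        have e1: "b * q = c * (b' * r)" by (simp add: cb r mult_ac)
        have e2: "b * q div c = b' * r" using e1 assms by simp
        have e3: "m div (a * c') = r" using q r assms c'1 by simp
        have "b * q \<ge> 1" using q1 assms by (simp add: Suc_le_eq)
        then have "(W n a k b \<circ> W n c l d) f s
           = f (d * (b' * r), ((y + (n - 1) * k * q) mod n + (n - 1) * l * (b' * r)) mod n)"
          using True q assms dv dvt e2 by (simp add: s W_apply[OF f] W_apply[OF f'])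
        also have "((y + (n - 1) * k * q) mod n + (n - 1) * l * (b' * r)) mod n
           = (y + (n - 1) * (k * c' + l * b') * r) mod n"
        proof -
          have "y + j * k * q + j * l * (b' * r) = y + j * (k * c' + l * b') * r" for j
            by (simp add: r algebra_simps)
          from this[of "n - 1"] show ?thesis by (simp only: mod_add_left_eq)
        qed
        also have "f (d * (b' * r), (y + (n - 1) * (k * c' + l * b') * r) mod n)
           = W n (a * c') (k * c' + l * b') (d * b') f s"
          using True dv2 dvt e3 by (simp add: s W_apply[OF f] mult.assoc)
        finally show ?thesis .
      qed
    qed
  qed
qed

lemma op_one_eq_W: "op_one (nz_carrier n) = W n 1 0 1"
proof (rule op_eqI[of _ "nz_carrier n"])
  fix f assume f: "f \<in> ell2 (nz_carrier n)"
  show "op_one (nz_carrier n) f = W n 1 0 1 f"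
  proof
    fix s :: "nat \<times> nat"
    obtain c y where s: "s = (c, y)" by (cases s)
    show "op_one (nz_carrier n) f s = W n 1 0 1 f s"
      using f ell2_outside[OF f, of s] by (auto simp: s op_one_def W_apply nz_carrier_iff)
  qed
qed (simp_all add: W_bounded)

lemma left_shift_eq_W:
  assumes "1 \<le> a" "x < n"
  shows "left_shift (nz_monoid n) (a, x) = W n a x 1"
proof
  fix f :: "nat \<times> nat \<Rightarrow> complex"
  show "left_shift (nz_monoid n) (a, x) f = W n a x 1 f"
  proof (cases "f \<in> ell2 (nz_carrier n)")
    case f: True
    show ?thesis
    proof
      fix s :: "nat \<times> nat"
      obtain c y where s: "s = (c, y)" by (cases s)
      let ?A = "{t \<in> nz_carrier n. (a, x) \<otimes>\<^bsub>nz_monoid n\<^esub> t = s}"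
      show "left_shift (nz_monoid n) (a, x) f s = W n a x 1 f s"
      proof (cases "1 \<le> c \<and> y < n \<and> a dvd c")
        case False
        then have A: "{t \<in> nz_carrier n. (a, x) \<otimes>\<^bsub>nz_monoid n\<^esub> t = (c, y)} = {}"
          using assms by (auto simp: nz_monoid_def)
        show ?thesis
          by (simp only: left_shift_def s W_apply[OF f] f if_True False if_False A infsum_empty)
      next
        case True
        then obtain q where q: "c = a * q" by blast
        have q1: "q \<ge> 1" using True q by (auto intro: Suc_leI gr0I)
        \<comment> \<open>The only solution t of (a, x) t = (c, y): its second entry is y - q x
          modulo n.\<close>
        let ?t = "(q, (y + (n - 1) * x * q) mod n)"
        have t: "?t \<in> ?A"
        proof -
          have "q * x + (y + (n - 1) * x * q) = y + n * (x * q)"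
          proof -
            have "n = Suc (n - 1)" using assms(2) by simp
            then have "n * (x * q) = x * q + (n - 1) * (x * q)" by (metis mult_Suc)
            then show ?thesis by (simp add: mult_ac)
          qed
          then have "(q * x + (y + (n - 1) * x * q) mod n) mod n = y"
            using True by (simp only: mod_add_right_eq mod_mult_self2 mod_less)
          then show ?thesis using q q1 assms True by (simp add: s nz_monoid_def)
        qed
        have "?A = {?t}"
        proof (intro equalityI subsetI)
          fix u assume u: "u \<in> ?A"
          have "u = ?t"
            by (rule nz_monoid_left_cancel[of "(a, x)" n])
               (use u t assms in \<open>auto simp: nz_carrier_iff\<close>)
          then show "u \<in> {?t}" by simp
        qed (use t in simp)
        then show ?thesis using f True q assms by (simp add: left_shift_def s W_apply)
      qed
    qed
  qed (simp add: left_shift_def W_def pmap_op_def)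
qed

lemma nz_V_eq_W: "1 \<le> n \<Longrightarrow> 1 \<le> a \<Longrightarrow> nz_V n a = W n a 0 1"
  unfolding nz_V_def by (rule left_shift_eq_W) auto

lemma nz_R_eq_W: "1 \<le> n \<Longrightarrow> nz_R n = W n 1 1 1"
proof -
  assume "1 \<le> n"
  then have "nz_R n = W n 1 (1 mod n) 1" unfolding nz_R_def by (intro left_shift_eq_W) auto
  also have "\<dots> = W n 1 1 1" by (rule W_cong) (simp add: cong_def)
  finally show ?thesis .
qed

lemma VRV_eq_W:
  assumes "1 \<le> n" "1 \<le> a" "1 \<le> b" shows "VRV n a k b = W n a k b"
proof -
  have "nz_V n a \<circ> (nz_R n ^^ k) = W n a k 1"
  proof (induction k)
    case 0
    then show ?case using assms by (simp add: nz_V_eq_W)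
  next
    case (Suc k)
    have "nz_V n a \<circ> (nz_R n ^^ Suc k) = (nz_V n a \<circ> (nz_R n ^^ k)) \<circ> nz_R n"
      by (simp add: funpow_Suc_right comp_assoc del: funpow.simps)
    also have "\<dots> = W n a (Suc k) 1" unfolding Suc using assms by (simp add: nz_R_eq_W W_comp)
    finally show ?case .
  qed
  then show ?thesis
    unfolding VRV_def using assms by (simp add: nz_V_eq_W W_adj W_comp)
qed

section \<open>The Toeplitz algebra as a closed span\<close>

text \<open>Finite linear combinations of monomials, as an inductive set so that continuity and
  convergence can be proved by rule induction.\<close>

inductive_set nz_span :: "nat \<Rightarrow> (nat \<times> nat) oper set" for n where
  gen: "1 \<le> a \<Longrightarrow> 1 \<le> b \<Longrightarrow> op_scale c (W n a k b) \<in> nz_span n"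
| add: "X \<in> nz_span n \<Longrightarrow> Y \<in> nz_span n \<Longrightarrow> op_add X Y \<in> nz_span n"

lemma nz_span_bounded: "X \<in> nz_span n \<Longrightarrow> X \<in> bounded_ops (nz_carrier n)"
  by (induction rule: nz_span.induct) (blast intro: op_scale_bounded(1) op_add_bounded(1) W_bounded)+

lemma op_scale_scale: "op_scale c (op_scale d T) = op_scale (c * d) T"
  by (simp add: op_scale_def mult.assoc)

lemma op_scale_one: "op_scale 1 T = T"
  by (simp add: op_scale_def)

lemma op_scale_add: "op_scale c (op_add T U) = op_add (op_scale c T) (op_scale c U)"
  by (simp add: op_scale_def op_add_def distrib_left)

lemma op_add_comp: "op_add T U \<circ> X = op_add (T \<circ> X) (U \<circ> X)"
  by (simp add: op_add_def fun_eq_iff)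

lemma op_scale_comp: "op_scale c T \<circ> X = op_scale c (T \<circ> X)"
  by (simp add: op_scale_def fun_eq_iff)

lemma op_comp_add:
  assumes "X \<in> bounded_ops S" "T \<in> bounded_ops S" "U \<in> bounded_ops S"
  shows "X \<circ> op_add T U = op_add (X \<circ> T) (X \<circ> U)"
  using bounded_ops_add[OF assms(1) bounded_ops_ell2[OF assms(2)] bounded_ops_ell2[OF assms(3)]]
  by (simp add: op_add_def fun_eq_iff)

lemma op_comp_scale:
  assumes "X \<in> bounded_ops S" "T \<in> bounded_ops S"
  shows "X \<circ> op_scale c T = op_scale c (X \<circ> T)"
  using bounded_ops_scale[OF assms(1) bounded_ops_ell2[OF assms(2)]]
  by (simp add: op_scale_def fun_eq_iff)

lemma op_diff_comp: "op_diff T U \<circ> X = op_diff (T \<circ> X) (U \<circ> X)"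
  by (simp add: op_diff_def fun_eq_iff)

lemma op_comp_diff:
  assumes "X \<in> bounded_ops S" "T \<in> bounded_ops S" "U \<in> bounded_ops S"
  shows "X \<circ> op_diff T U = op_diff (X \<circ> T) (X \<circ> U)"
  using bounded_ops_diff[OF assms(1) bounded_ops_ell2[OF assms(2)] bounded_ops_ell2[OF assms(3)]]
  by (simp add: op_diff_def fun_eq_iff)

lemma op_adj_diff:
  assumes "T \<in> bounded_ops S" "U \<in> bounded_ops S"
  shows "op_adj S (op_diff T U) = op_diff (op_adj S T) (op_adj S U)"
  unfolding op_diff_eq
  using op_adj_add[OF assms(1) op_scale_bounded(1)[OF assms(2)]] op_adj_scale[OF assms(2), of "-1"] by simp

lemma W_in_span: "1 \<le> a \<Longrightarrow> 1 \<le> b \<Longrightarrow> W n a k b \<in> nz_span n"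
  using nz_span.gen[of a b 1 n k] by (simp add: op_scale_one)

lemma nz_span_scale: "X \<in> nz_span n \<Longrightarrow> op_scale c X \<in> nz_span n"
  by (induction rule: nz_span.induct) (auto simp: op_scale_scale op_scale_add intro: nz_span.intros)

lemma nz_span_comp:
  assumes "X \<in> nz_span n" "Y \<in> nz_span n" shows "X \<circ> Y \<in> nz_span n"
  using assms
proof (induction rule: nz_span.induct)
  case (gen a b c k)
  note ab = gen(1,2)
  from gen(3) show ?case
  proof (induction rule: nz_span.induct)
    case (gen a' b' c' k')
    have "op_scale c (W n a k b) \<circ> op_scale c' (W n a' k' b') = op_scale (c * c') (W n a k b \<circ> W n a' k' b')"
      using W_bounded ab gen by (simp add: op_scale_comp op_comp_scale[of _ "nz_carrier n"] op_scale_scale)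
    also have "\<dots> \<in> nz_span n" unfolding W_comp[OF ab gen]
    proof (rule nz_span.gen)
      have "gcd b a' dvd a'" "gcd b a' dvd b" by simp_all
      then have "a' div gcd b a' \<noteq> 0" "b div gcd b a' \<noteq> 0" using ab gen
        by (auto simp: dvd_div_eq_0_iff)
      then show "1 \<le> a * (a' div gcd b a')" "1 \<le> b' * (b div gcd b a')"
        using ab gen by (simp_all add: Suc_le_eq)
    qed
    finally show ?case .
  next
    case (add X Y)
    show ?case
      unfolding op_comp_add[OF nz_span_bounded[OF nz_span.gen[OF ab]] nz_span_bounded[OF add.hyps(1)]
          nz_span_bounded[OF add.hyps(2)]]
      by (rule nz_span.add[OF add.IH])
  qed
qed (auto simp: op_add_comp intro: nz_span.add)

lemma nz_span_adj: "X \<in> nz_span n \<Longrightarrow> op_adj (nz_carrier n) X \<in> nz_span n"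
  by (induction rule: nz_span.induct)
     (auto simp: op_adj_scale op_adj_add W_bounded W_adj nz_span_bounded intro: nz_span.intros)

text \<open>The norm closure of the span. The Toeplitz algebra is defined as an intersection, which
  gives no hold on single elements; \<open>nz_toeplitz_eq\<close> identifies the two.\<close>

definition nz_alg :: "nat \<Rightarrow> (nat \<times> nat) oper set" where
  "nz_alg n = {T \<in> bounded_ops (nz_carrier n).
     \<forall>e>0. \<exists>X\<in>nz_span n. op_norm (nz_carrier n) (op_diff T X) < e}"

lemma nz_span_subset_alg: "nz_span n \<subseteq> nz_alg n"
proof
  fix X assume X: "X \<in> nz_span n"
  have "op_norm (nz_carrier n) (op_diff X X) \<le> 0"
    by (rule op_norm_le) (auto simp: op_diff_def)
  then show "X \<in> nz_alg n" using X nz_span_bounded unfolding nz_alg_def by force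
qed

lemma nz_alg_cstar: "cstar_subalgebra (nz_carrier n) (nz_alg n)"
  unfolding cstar_subalgebra_def
proof (intro conjI ballI allI impI)
  let ?S = "nz_carrier n"
  show "nz_alg n \<subseteq> bounded_ops ?S" by (auto simp: nz_alg_def)
  show "nz_alg n \<noteq> {}" using nz_span_subset_alg W_in_span[of 1 1 n 0] by auto
  fix T assume T: "T \<in> nz_alg n"
  then have Tb: "T \<in> bounded_ops ?S"
    and Ta: "\<And>e. e > 0 \<Longrightarrow> \<exists>X\<in>nz_span n. op_norm ?S (op_diff T X) < e" by (auto simp: nz_alg_def)
  show "op_scale c T \<in> nz_alg n" for c
    unfolding nz_alg_def
  proof (intro CollectI conjI allI impI op_scale_bounded(1)[OF Tb])
    fix e :: real assume "e > 0"
    then have "e / (cmod c + 1) > 0" by (simp add: add_nonneg_pos)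
    then obtain X where X: "X \<in> nz_span n" "op_norm ?S (op_diff T X) < e / (cmod c + 1)" using Ta by blast
    have "op_diff (op_scale c T) (op_scale c X) = op_scale c (op_diff T X)"
      by (simp add: op_diff_def op_scale_def algebra_simps)
    then have "op_norm ?S (op_diff (op_scale c T) (op_scale c X)) \<le> cmod c * op_norm ?S (op_diff T X)"
      using op_scale_bounded(2)[OF op_diff_bounded(1)[OF Tb nz_span_bounded[OF X(1)]]] by simp
    also have "\<dots> \<le> cmod c * (e / (cmod c + 1))" using X(2) by (intro mult_left_mono) auto
    also have "\<dots> < e" using \<open>e > 0\<close> by (simp add: field_simps add_pos_nonneg)
    finally show "\<exists>X\<in>nz_span n. op_norm ?S (op_diff (op_scale c T) X) < e"
      using nz_span_scale[OF X(1)] by blast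
  qed
  show "op_adj ?S T \<in> nz_alg n"
    unfolding nz_alg_def
  proof (intro CollectI conjI allI impI op_adj_props(1)[OF Tb])
    fix e :: real assume "e > 0"
    then obtain X where X: "X \<in> nz_span n" "op_norm ?S (op_diff T X) < e" using Ta by blast
    have "op_norm ?S (op_diff (op_adj ?S T) (op_adj ?S X)) < e"
      using op_adj_norm_le[OF op_diff_bounded(1)[OF Tb nz_span_bounded[OF X(1)]]] X(2)
        op_adj_diff[OF Tb nz_span_bounded[OF X(1)]] by simp
    then show "\<exists>X\<in>nz_span n. op_norm ?S (op_diff (op_adj ?S T) X) < e"
      using nz_span_adj[OF X(1)] by blast
  qed
  fix U assume U: "U \<in> nz_alg n"
  then have Ub: "U \<in> bounded_ops ?S"
    and Ua: "\<And>e. e > 0 \<Longrightarrow> \<exists>X\<in>nz_span n. op_norm ?S (op_diff U X) < e" by (auto simp: nz_alg_def)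
  show "op_add T U \<in> nz_alg n"
    unfolding nz_alg_def
  proof (intro CollectI conjI allI impI op_add_bounded(1)[OF Tb Ub])
    fix e :: real assume e: "e > 0"
    obtain X where X: "X \<in> nz_span n" "op_norm ?S (op_diff T X) < e / 2" using Ta[of "e/2"] e by auto
    obtain Y where Y: "Y \<in> nz_span n" "op_norm ?S (op_diff U Y) < e / 2" using Ua[of "e/2"] e by auto
    have "op_diff (op_add T U) (op_add X Y) = op_add (op_diff T X) (op_diff U Y)"
      by (simp add: op_diff_def op_add_def fun_eq_iff)
    then have "op_norm ?S (op_diff (op_add T U) (op_add X Y)) < e"
      using op_add_bounded(2)[OF op_diff_bounded(1)[OF Tb nz_span_bounded[OF X(1)]]
        op_diff_bounded(1)[OF Ub nz_span_bounded[OF Y(1)]]] X(2) Y(2) by simp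
    then show "\<exists>X\<in>nz_span n. op_norm ?S (op_diff (op_add T U) X) < e"
      using nz_span.add[OF X(1) Y(1)] by blast
  qed
  show "T \<circ> U \<in> nz_alg n"
    unfolding nz_alg_def
  proof (intro CollectI conjI allI impI op_comp_bounded(1)[OF Tb Ub])
    fix e :: real assume e: "e > 0"
    define K where "K = op_norm ?S T + op_norm ?S U + 2"
    have nT: "0 \<le> op_norm ?S T" and nU: "0 \<le> op_norm ?S U" using op_norm_nonneg Tb Ub by blast+
    have K: "K > 0" using nT nU by (simp add: K_def)
    \<comment> \<open>The bound 1 keeps the norm of Y below |U| + 1; the error is then less than d
      (|T| + |U| + 2) = d K.\<close>
    define d where "d = min 1 (e / K)"
    have d: "d > 0" "d \<le> 1" "d * K \<le> e" using e K by (auto simp: d_def min_def field_simps)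
    obtain X where X: "X \<in> nz_span n" "op_norm ?S (op_diff T X) < d" using Ta d by blast
    obtain Y where Y: "Y \<in> nz_span n" "op_norm ?S (op_diff U Y) < d" using Ua d by blast
    note Xb = nz_span_bounded[OF X(1)] and Yb = nz_span_bounded[OF Y(1)]
    have dT: "op_diff T X \<in> bounded_ops ?S" and dU: "op_diff U Y \<in> bounded_ops ?S"
      using op_diff_bounded(1) Tb Ub Xb Yb by blast+
    have "Y = op_diff U (op_diff U Y)" by (simp add: op_diff_def)
    then have nY: "op_norm ?S Y \<le> op_norm ?S U + 1"
      using op_diff_bounded(2)[OF Ub dU] Y(2) d(2) by simp
    have eq: "op_diff (T \<circ> U) (X \<circ> Y) = op_add (T \<circ> op_diff U Y) (op_diff T X \<circ> Y)"
      unfolding op_comp_diff[OF Tb Ub Yb] op_diff_comp by (simp add: op_diff_def op_add_def fun_eq_iff)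
    have "op_norm ?S (op_diff (T \<circ> U) (X \<circ> Y)) \<le> op_norm ?S (T \<circ> op_diff U Y) + op_norm ?S (op_diff T X \<circ> Y)"
      unfolding eq by (rule op_add_bounded(2)[OF op_comp_bounded(1)[OF Tb dU] op_comp_bounded(1)[OF dT Yb]])
    also have "\<dots> \<le> op_norm ?S T * op_norm ?S (op_diff U Y) + op_norm ?S (op_diff T X) * op_norm ?S Y"
      by (intro add_mono op_comp_bounded(2) Tb dU dT Yb)
    also have "\<dots> \<le> op_norm ?S T * d + d * (op_norm ?S U + 1)"
      by (intro add_mono mult_mono) (use X Y nY nT nU d op_norm_nonneg[OF Yb] op_norm_nonneg[OF dU] in auto)
    also have "\<dots> < d * K" using d by (simp add: K_def algebra_simps)
    also have "\<dots> \<le> e" by (rule d(3))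
    finally show "\<exists>X\<in>nz_span n. op_norm ?S (op_diff (T \<circ> U) X) < e"
      using nz_span_comp[OF X(1) Y(1)] by blast
  qed
next
  let ?S = "nz_carrier n"
  fix X T assume T: "T \<in> bounded_ops ?S"
    and X: "(\<forall>i::nat. X i \<in> nz_alg n) \<and> (\<lambda>i. op_norm ?S (op_diff (X i) T)) \<longlonglongrightarrow> 0"
  show "T \<in> nz_alg n"
    unfolding nz_alg_def
  proof (intro CollectI conjI allI impI T)
    fix e :: real assume e: "e > 0"
    have "\<forall>\<^sub>F i in sequentially. op_norm ?S (op_diff (X i) T) < e / 2"
      using X e by (intro order_tendstoD(2)[where y = 0]) auto
    then obtain i where i: "op_norm ?S (op_diff (X i) T) < e / 2"
      by (auto simp: eventually_sequentially)
    have Xi: "X i \<in> nz_alg n" using X by blast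
    then obtain Y where Y: "Y \<in> nz_span n" "op_norm ?S (op_diff (X i) Y) < e / 2"
      using half_gt_zero[OF e] unfolding nz_alg_def by blast
    have "op_norm ?S (op_diff T Y) \<le> op_norm ?S (op_diff T (X i)) + op_norm ?S (op_diff (X i) Y)"
      by (rule op_norm_triangle[OF T nz_span_bounded[OF Y(1)]]) (use Xi in \<open>simp add: nz_alg_def\<close>)
    then show "\<exists>X\<in>nz_span n. op_norm ?S (op_diff T X) < e"
      using i Y op_norm_diff_commute[of ?S T "X i"] by (intro bexI[OF _ Y(1)]) linarith
  qed
qed

section \<open>The Toeplitz algebra as the norm closure of the monomials\<close>

context
  fixes n :: nat
  assumes n: "1 \<le> n"
begin

lemma nz_shift_bounded:
  "left_shift (nz_monoid n) ` nz_carrier n \<subseteq> bounded_ops (nz_carrier n)" "nz_carrier n \<noteq> {}"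
proof -
  have "(1, 0) \<in> nz_carrier n" using n by (simp add: nz_carrier_iff)
  then show "nz_carrier n \<noteq> {}" by blast
  show "left_shift (nz_monoid n) ` nz_carrier n \<subseteq> bounded_ops (nz_carrier n)"
  proof (rule image_subsetI)
    fix s assume "s \<in> nz_carrier n"
    then obtain a x where s: "s = (a, x)" "1 \<le> a" "x < n" by (cases s) (auto simp: nz_carrier_iff)
    then show "left_shift (nz_monoid n) s \<in> bounded_ops (nz_carrier n)"
      using W_bounded[of a 1 n x] by (simp add: left_shift_eq_W)
  qed
qed

lemmas nz_toeplitz_cstar = toeplitz_cstar(1)[OF nz_shift_bounded]

lemma W_in_toeplitz: "1 \<le> a \<Longrightarrow> 1 \<le> b \<Longrightarrow> W n a k b \<in> nz_toeplitz n"
proof -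
  note cd = cstar_subalgebraD[OF nz_toeplitz_cstar]
  assume ab: "1 \<le> a" "1 \<le> b"
  have s: "W n c l 1 \<in> nz_toeplitz n" if "1 \<le> c" for c l
  proof -
    have "W n c l 1 = W n c (l mod n) 1" by (rule W_cong) (simp add: cong_def)
    also have "\<dots> = left_shift (nz_monoid n) (c, l mod n)"
      using that n by (simp add: left_shift_eq_W)
    also have "\<dots> \<in> nz_toeplitz n"
      by (rule toeplitz_cstar(2)[OF nz_shift_bounded]) (use that n in \<open>simp add: nz_carrier_iff\<close>)
    finally show ?thesis .
  qed
  have "W n a k b = W n a k 1 \<circ> op_adj (nz_carrier n) (W n b 0 1)"
    using ab by (simp add: W_adj W_comp)
  then show ?thesis using cd(4)[OF s[OF ab(1)] cd(5)[OF s[OF ab(2)]]] by simp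
qed

lemma nz_span_subset_toeplitz: "nz_span n \<subseteq> nz_toeplitz n"
proof
  note cd = cstar_subalgebraD[OF nz_toeplitz_cstar]
  fix X assume "X \<in> nz_span n"
  then show "X \<in> nz_toeplitz n"
    by (induction rule: nz_span.induct) (blast intro: cd(2,3) W_in_toeplitz)+
qed

lemma nz_toeplitz_eq: "nz_toeplitz n = nz_alg n"
proof
  note cd = cstar_subalgebraD[OF nz_toeplitz_cstar]
  have "left_shift (nz_monoid n) ` nz_carrier n \<subseteq> nz_alg n"
  proof (rule image_subsetI)
    fix s assume "s \<in> nz_carrier n"
    then obtain a x where s: "s = (a, x)" "1 \<le> a" "x < n" by (cases s) (auto simp: nz_carrier_iff)
    then show "left_shift (nz_monoid n) s \<in> nz_alg n"
      using W_in_span[of a 1 n x] nz_span_subset_alg by (auto simp: left_shift_eq_W)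
  qed
  then show "nz_toeplitz n \<subseteq> nz_alg n"
    using nz_alg_cstar unfolding toeplitz_algebra_def by blast
  show "nz_alg n \<subseteq> nz_toeplitz n"
  proof
    fix T assume T: "T \<in> nz_alg n"
    then have "\<exists>X\<in>nz_span n. op_norm (nz_carrier n) (op_diff T X) < 1 / Suc i" for i
      unfolding nz_alg_def by simp
    then obtain X where X: "\<And>i. X i \<in> nz_span n"
      "\<And>i. op_norm (nz_carrier n) (op_diff T (X i)) < 1 / Suc i" by metis
    have Tb: "T \<in> bounded_ops (nz_carrier n)" using T by (simp add: nz_alg_def)
    have "(\<lambda>i. op_norm (nz_carrier n) (op_diff (X i) T)) \<longlonglongrightarrow> 0"
    proof (rule tendsto_sandwich[OF _ _ tendsto_const LIMSEQ_inverse_real_of_nat])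
      show "\<forall>\<^sub>F i in sequentially. 0 \<le> op_norm (nz_carrier n) (op_diff (X i) T)"
        by (intro always_eventually allI op_norm_nonneg op_diff_bounded(1) nz_span_bounded[OF X(1)] Tb)
      show "\<forall>\<^sub>F i in sequentially. op_norm (nz_carrier n) (op_diff (X i) T) \<le> inverse (real (Suc i))"
        using X(2) by (simp add: op_norm_diff_commute[of _ _ T] inverse_eq_divide less_imp_le always_eventually)
    qed
    then show "T \<in> nz_toeplitz n"
      using X(1) nz_span_subset_toeplitz by (intro cd(7)[OF Tb, of X]) auto
  qed
qed

lemma nz_one: "op_one (nz_carrier n) \<in> nz_toeplitz n"
  by (simp add: op_one_eq_W W_in_toeplitz)

lemma nz_dense:
  "T \<in> nz_toeplitz n \<Longrightarrow> 0 < e \<Longrightarrow> \<exists>X\<in>nz_span n. op_norm (nz_carrier n) (op_diff T X) < e"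
  by (simp add: nz_toeplitz_eq nz_alg_def)

text \<open>The density argument behind all later identities: a bounded linear expression in T that
  vanishes on monomials vanishes everywhere. \<open>F\<close> is a bare function, so differences
  such as \<phi>(T U) - \<kappa> \<phi>(U T) can be inserted directly.\<close>

lemma nz_functional_zero:
  assumes add: "\<And>T U. T \<in> nz_toeplitz n \<Longrightarrow> U \<in> nz_toeplitz n \<Longrightarrow> F (op_add T U) = F T + F U"
    and scale: "\<And>T c. T \<in> nz_toeplitz n \<Longrightarrow> F (op_scale c T) = c * F T"
    and bound: "\<And>T. T \<in> nz_toeplitz n \<Longrightarrow> cmod (F T) \<le> C * op_norm (nz_carrier n) T"
    and zero: "\<And>a k b. 1 \<le> a \<Longrightarrow> 1 \<le> b \<Longrightarrow> F (W n a k b) = 0"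
    and T: "T \<in> nz_toeplitz n"
  shows "F T = 0"
proof -
  note cd = cstar_subalgebraD[OF nz_toeplitz_cstar]
  have span: "F X = 0" if "X \<in> nz_span n" for X
    using that
  proof (induction rule: nz_span.induct)
    case (add X Y)
    then have "X \<in> nz_toeplitz n" "Y \<in> nz_toeplitz n" using nz_span_subset_toeplitz by auto
    with add assms(1) show ?case by simp
  qed (simp add: scale zero W_in_toeplitz)
  have "cmod (F T) \<le> 0 + e" if e: "e > 0" for e
  proof -
    \<comment> \<open>\<open>C\<close> carries no sign, hence the absolute value; the 1 prevents
      division by zero.\<close>
    have "e / (\<bar>C\<bar> + 1) > 0" using e by (simp add: add_nonneg_pos)
    then obtain X where X: "X \<in> nz_span n" "op_norm (nz_carrier n) (op_diff T X) < e / (\<bar>C\<bar> + 1)"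
      using nz_dense[OF T] by blast
    have XA: "X \<in> nz_toeplitz n" using X nz_span_subset_toeplitz by auto
    have "F (op_diff T X) = F T"
      unfolding op_diff_eq using add[OF T cd(3)[OF XA]] scale[OF XA] span[OF X(1)] by simp
    then have "cmod (F T) \<le> C * op_norm (nz_carrier n) (op_diff T X)"
      using bound[OF cd(6)[OF T XA]] by simp
    also have "\<dots> \<le> \<bar>C\<bar> * op_norm (nz_carrier n) (op_diff T X)"
      by (rule mult_right_mono) (use op_norm_nonneg[OF cd(1)[OF cd(6)[OF T XA]]] in auto)
    also have "\<dots> \<le> \<bar>C\<bar> * (e / (\<bar>C\<bar> + 1))" using X(2) by (intro mult_left_mono) auto
    also have "\<dots> \<le> e" using e by (simp add: field_simps add_nonneg_pos)
    finally show ?thesis by simp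
  qed
  from field_le_epsilon[OF this] show ?thesis by simp
qed

lemma nz_state_eqI:
  assumes "nz_state n \<phi>" "nz_state n \<psi>"
    and "\<And>a k b. 1 \<le> a \<Longrightarrow> 1 \<le> b \<Longrightarrow> \<phi> (W n a k b) = \<psi> (W n a k b)"
  shows "\<phi> = \<psi>"
proof -
  note sd = stateD[OF assms(1)] stateD[OF assms(2)]
  have "\<phi> T - \<psi> T = 0" if "T \<in> nz_toeplitz n" for T
  proof (rule nz_functional_zero[where F = "\<lambda>T. \<phi> T - \<psi> T" and C = 2])
    fix T assume T: "T \<in> nz_toeplitz n"
    show "cmod (\<phi> T - \<psi> T) \<le> 2 * op_norm (nz_carrier n) T"
      using norm_triangle_ineq4[of "\<phi> T" "\<psi> T"] sd(5)[OF T] sd(11)[OF T] by linarith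
  qed (use that assms(3) sd(2,3,8,9) in \<open>auto simp: algebra_simps\<close>)
  then have "\<And>T. T \<in> nz_toeplitz n \<Longrightarrow> \<phi> T = \<psi> T" by simp
  then show ?thesis using extensionalityI sd(1,7) by blast
qed

end

section \<open>The dynamics\<close>

text \<open>The unitary that acts as the scalar c^(it) on the fibre over c. Conjugation by it
  implements the dynamics, so existence needs no universal property of the algebra.\<close>

definition phase_op :: "nat \<Rightarrow> real \<Rightarrow> (nat \<times> nat) oper" where
  "phase_op n t = (\<lambda>f. if f \<in> ell2 (nz_carrier n)
     then (\<lambda>s. cis (t * ln (real (fst s))) * f s) else (\<lambda>_. 0))"

lemma phase_op_ell2:
  assumes "f \<in> ell2 (nz_carrier n)"
  shows "phase_op n t f \<in> ell2 (nz_carrier n)" "ell2_norm (phase_op n t f) = ell2_norm f"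
  using assms by (simp_all add: phase_op_def ell2_def ell2_norm_def norm_mult)

lemma phase_op_bounded: "phase_op n t \<in> bounded_ops (nz_carrier n)"
proof (rule bounded_opsI[of _ _ 1])
  show "phase_op n t (\<lambda>s. c * f s + g s) = (\<lambda>s. c * phase_op n t f s + phase_op n t g s)"
    if "f \<in> ell2 (nz_carrier n)" "g \<in> ell2 (nz_carrier n)" for f g c
    using that ell2_lincomb[OF that] by (auto simp: phase_op_def fun_eq_iff algebra_simps)
qed (use phase_op_ell2 in \<open>auto simp: phase_op_def\<close>)

lemma phase_op_comp: "phase_op n s \<circ> phase_op n t = phase_op n (s + t)"
proof
  fix f show "(phase_op n s \<circ> phase_op n t) f = phase_op n (s + t) f"
    using phase_op_ell2(1)[of f n t]
    by (cases "f \<in> ell2 (nz_carrier n)")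
       (auto simp: phase_op_def fun_eq_iff cis_mult distrib_right mult.assoc[symmetric])
qed

lemma phase_op_zero: "phase_op n 0 = op_one (nz_carrier n)"
  by (auto simp: phase_op_def op_one_def fun_eq_iff)

lemma phase_op_adj: "op_adj (nz_carrier n) (phase_op n t) = phase_op n (- t)"
proof (rule op_adj_eqI[OF phase_op_bounded phase_op_bounded])
  fix f g assume "f \<in> ell2 (nz_carrier n)" "g \<in> ell2 (nz_carrier n)"
  then show "ell2_inner (phase_op n t f) g = ell2_inner f (phase_op n (- t) g)"
    by (simp add: ell2_inner_def phase_op_def cis_cnj mult_ac)
qed

definition conj_op :: "nat \<Rightarrow> real \<Rightarrow> (nat \<times> nat) oper \<Rightarrow> (nat \<times> nat) oper" where
  "conj_op n t T = phase_op n t \<circ> T \<circ> phase_op n (- t)"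

lemma conj_op_bounded:
  assumes "T \<in> bounded_ops (nz_carrier n)"
  shows "conj_op n t T \<in> bounded_ops (nz_carrier n)"
    "op_norm (nz_carrier n) (conj_op n t T) \<le> op_norm (nz_carrier n) T"
proof -
  show "conj_op n t T \<in> bounded_ops (nz_carrier n)"
    unfolding conj_op_def by (intro op_comp_bounded(1) phase_op_bounded assms)
  show "op_norm (nz_carrier n) (conj_op n t T) \<le> op_norm (nz_carrier n) T"
  proof (rule op_norm_le[OF op_norm_nonneg[OF assms]])
    fix f assume f: "f \<in> ell2 (nz_carrier n)"
    have "ell2_norm (conj_op n t T f) = ell2_norm (T (phase_op n (- t) f))"
      unfolding conj_op_def using phase_op_ell2(2)[OF bounded_ops_ell2[OF assms]] by simp
    also have "\<dots> \<le> op_norm (nz_carrier n) T * ell2_norm (phase_op n (- t) f)"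
      by (rule op_norm_bound[OF assms phase_op_ell2(1)[OF f]])
    finally show "ell2_norm (conj_op n t T f) \<le> op_norm (nz_carrier n) T * ell2_norm f"
      using phase_op_ell2(2)[OF f] by simp
  qed
qed

lemma conj_op_add:
  assumes "T \<in> bounded_ops (nz_carrier n)" "U \<in> bounded_ops (nz_carrier n)"
  shows "conj_op n t (op_add T U) = op_add (conj_op n t T) (conj_op n t U)"
  unfolding conj_op_def op_comp_add[OF phase_op_bounded assms] op_add_comp ..

lemma conj_op_scale:
  assumes "T \<in> bounded_ops (nz_carrier n)"
  shows "conj_op n t (op_scale c T) = op_scale c (conj_op n t T)"
  unfolding conj_op_def op_comp_scale[OF phase_op_bounded assms] op_scale_comp ..

lemma conj_op_diff:
  assumes "T \<in> bounded_ops (nz_carrier n)" "U \<in> bounded_ops (nz_carrier n)"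
  shows "conj_op n t (op_diff T U) = op_diff (conj_op n t T) (conj_op n t U)"
  unfolding conj_op_def op_comp_diff[OF phase_op_bounded assms] op_diff_comp ..

lemma conj_op_comp:
  assumes "U \<in> bounded_ops (nz_carrier n)"
  shows "conj_op n t (T \<circ> U) = conj_op n t T \<circ> conj_op n t U"
proof -
  have "phase_op n (- t) \<circ> (phase_op n t \<circ> (U \<circ> phase_op n (- t))) = U \<circ> phase_op n (- t)"
    unfolding comp_assoc[symmetric, of "phase_op n (- t)" "phase_op n t"] phase_op_comp
    using op_one_comp(1)[OF op_comp_bounded(1)[OF assms phase_op_bounded]] by (simp add: phase_op_zero)
  then show ?thesis unfolding conj_op_def by (simp only: comp_assoc)
qed

lemma conj_op_adj:
  assumes "T \<in> bounded_ops (nz_carrier n)"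
  shows "conj_op n t (op_adj (nz_carrier n) T) = op_adj (nz_carrier n) (conj_op n t T)"
  unfolding conj_op_def
  unfolding op_adj_comp[OF op_comp_bounded(1)[OF phase_op_bounded assms] phase_op_bounded]
      op_adj_comp[OF phase_op_bounded assms]
  unfolding phase_op_adj minus_minus comp_assoc ..

lemma conj_op_conj_op:
  assumes "T \<in> bounded_ops (nz_carrier n)"
  shows "conj_op n s (conj_op n t T) = conj_op n (s + t) T"
proof -
  have "conj_op n s (conj_op n t T) = (phase_op n s \<circ> phase_op n t) \<circ> T \<circ> (phase_op n (- t) \<circ> phase_op n (- s))"
    unfolding conj_op_def by (simp only: comp_assoc)
  then show ?thesis unfolding phase_op_comp conj_op_def by (simp add: add.commute)
qed

lemma conj_op_0: "T \<in> bounded_ops (nz_carrier n) \<Longrightarrow> conj_op n 0 T = T"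
  using op_one_comp(1)[of T "nz_carrier n"] op_one_comp(2)[of T "nz_carrier n"]
  unfolding conj_op_def by (simp add: phase_op_zero)

text \<open>The operator connects the fibre over b q with the fibre over a q, and the two phases
  combine to (a/b)^(it) whatever q is.\<close>

lemma conj_op_W:
  assumes "1 \<le> a" "1 \<le> b"
  shows "conj_op n t (W n a k b) = op_scale (cis (t * (ln (real a) - ln (real b)))) (W n a k b)"
proof (rule op_eqI)
  show "conj_op n t (W n a k b) \<in> bounded_ops (nz_carrier n)"
    "op_scale (cis (t * (ln (real a) - ln (real b)))) (W n a k b) \<in> bounded_ops (nz_carrier n)"
    using W_bounded[OF assms] by (simp_all add: conj_op_bounded op_scale_bounded)
  fix f assume f: "f \<in> ell2 (nz_carrier n)"
  note pf = phase_op_ell2(1)[OF f, of "- t"]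
  have Wf: "W n a k b (phase_op n (- t) f) \<in> ell2 (nz_carrier n)"
    using W_bounded[OF assms] by simp
  show "conj_op n t (W n a k b) f = op_scale (cis (t * (ln (real a) - ln (real b)))) (W n a k b) f"
  proof
    fix s :: "nat \<times> nat"
    obtain c y where s: "s = (c, y)" by (cases s)
    show "conj_op n t (W n a k b) f s = op_scale (cis (t * (ln (real a) - ln (real b)))) (W n a k b) f s"
    proof (cases "1 \<le> c \<and> y < n \<and> a dvd c")
      case False
      then have "W n a k b (phase_op n (- t) f) s = 0" "W n a k b f s = 0"
        unfolding s W_apply[OF f] W_apply[OF pf] by (simp_all only: if_False)
      then show ?thesis using Wf by (simp add: conj_op_def op_scale_def phase_op_def)
    next
      case True
      then obtain q where q: "c = a * q" by blast
      have q0: "q > 0" using True q by (auto intro: gr0I)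
      have "t * ln (real c) + - t * ln (real (b * q)) = t * (ln (real a) - ln (real b))"
        using q q0 assms by (simp add: ln_mult algebra_simps)
      then have "cis (t * ln (real c)) * cis (- t * ln (real (b * q))) = cis (t * (ln (real a) - ln (real b)))"
        unfolding cis_mult by simp
      moreover have "conj_op n t (W n a k b) f s
          = cis (t * ln (real c)) * W n a k b (phase_op n (- t) f) (c, y)"
        using Wf unfolding conj_op_def s by (simp add: phase_op_def[of n t])
      moreover have "W n a k b (phase_op n (- t) f) (c, y) = cis (- t * ln (real (b * q))) * W n a k b f (c, y)"
        unfolding W_apply[OF f] W_apply[OF pf] using True f q assms by (simp add: phase_op_def)
      ultimately show ?thesis unfolding s op_scale_def by simp
    qed
  qed
qed

definition nz_sigma :: "nat \<Rightarrow> real \<Rightarrow> (nat \<times> nat) oper \<Rightarrow> (nat \<times> nat) oper" where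
  "nz_sigma n t = (\<lambda>T\<in>nz_toeplitz n. conj_op n t T)"

lemma of_nat_powr_imaginary:
  assumes "1 \<le> a" shows "of_nat a powr (\<i> * of_real t) = cis (t * ln (real a))"
  using assms by (simp add: powr_def cis_conv_exp Ln_of_nat mult_ac)

lemma conj_op_span: "X \<in> nz_span n \<Longrightarrow> conj_op n t X \<in> nz_span n"
proof (induction rule: nz_span.induct)
  case (gen a b c k)
  then show ?case
    by (simp only: conj_op_scale[OF W_bounded[OF gen]] conj_op_W[OF gen] op_scale_scale)
       (rule nz_span.gen)
next
  case (add X Y)
  then show ?case by (simp only: conj_op_add[OF nz_span_bounded nz_span_bounded] nz_span.add)
qed

context
  fixes n :: nat
  assumes n: "1 \<le> n"
begin

lemma nz_toeplitz_bounded: "T \<in> nz_toeplitz n \<Longrightarrow> T \<in> bounded_ops (nz_carrier n)"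
  using cstar_subalgebraD(1)[OF nz_toeplitz_cstar[OF n]] .

lemma conj_op_toeplitz:
  assumes T: "T \<in> nz_toeplitz n" shows "conj_op n t T \<in> nz_toeplitz n"
  unfolding nz_toeplitz_eq[OF n] nz_alg_def
proof (intro CollectI conjI allI impI conj_op_bounded(1) nz_toeplitz_bounded T)
  fix e :: real assume "e > 0"
  then obtain X where X: "X \<in> nz_span n" "op_norm (nz_carrier n) (op_diff T X) < e"
    using nz_dense[OF n T] by blast
  have "op_norm (nz_carrier n) (op_diff (conj_op n t T) (conj_op n t X)) < e"
    using conj_op_bounded(2)[OF op_diff_bounded(1)[OF nz_toeplitz_bounded[OF T] nz_span_bounded[OF X(1)]], of t] X(2)
      conj_op_diff[OF nz_toeplitz_bounded[OF T] nz_span_bounded[OF X(1)], of t] by simp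
  then show "\<exists>X\<in>nz_span n. op_norm (nz_carrier n) (op_diff (conj_op n t T) X) < e"
    using conj_op_span[OF X(1)] by blast
qed

lemma nz_sigma_automorphism: "star_automorphism (nz_carrier n) (nz_toeplitz n) (nz_sigma n t)"
  unfolding star_automorphism_def
proof (intro conjI ballI allI)
  note cd = cstar_subalgebraD[OF nz_toeplitz_cstar[OF n]]
  show "nz_sigma n t \<in> extensional (nz_toeplitz n)" by (simp add: nz_sigma_def)
  show "bij_betw (nz_sigma n t) (nz_toeplitz n) (nz_toeplitz n)"
    by (rule bij_betw_byWitness[of _ "nz_sigma n (- t)"])
       (auto simp: nz_sigma_def conj_op_toeplitz conj_op_conj_op conj_op_0 nz_toeplitz_bounded)
qed (simp_all add: nz_sigma_def conj_op_add conj_op_scale conj_op_comp conj_op_adj nz_toeplitz_bounded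
      cstar_subalgebraD(2-5)[OF nz_toeplitz_cstar[OF n]])

lemma conj_op_continuous_span:
  assumes "X \<in> nz_span n"
  shows "((\<lambda>s. op_norm (nz_carrier n) (op_diff (conj_op n s X) (conj_op n t X))) \<longlongrightarrow> 0) (at t)"
  using assms
proof (induction rule: nz_span.induct)
  case (gen a b c k)
  let ?T = "op_scale c (W n a k b)" and ?l = "ln (real a) - ln (real b)"
  have Tb: "?T \<in> bounded_ops (nz_carrier n)" by (rule op_scale_bounded(1)[OF W_bounded[OF gen]])
  have eq: "op_diff (conj_op n s ?T) (conj_op n t ?T) = op_scale (cis (s * ?l) - cis (t * ?l)) ?T" for s
    unfolding conj_op_scale[OF W_bounded[OF gen]] conj_op_W[OF gen]
    by (simp add: op_diff_def op_scale_def algebra_simps)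
  show ?case
    unfolding eq
  proof (rule tendsto_sandwich[OF _ _ tendsto_const])
    show "\<forall>\<^sub>F s in at t. 0 \<le> op_norm (nz_carrier n) (op_scale (cis (s * ?l) - cis (t * ?l)) ?T)"
      by (intro always_eventually allI op_norm_nonneg op_scale_bounded(1) Tb)
    show "\<forall>\<^sub>F s in at t. op_norm (nz_carrier n) (op_scale (cis (s * ?l) - cis (t * ?l)) ?T)
        \<le> cmod (cis (s * ?l) - cis (t * ?l)) * op_norm (nz_carrier n) ?T"
      by (intro always_eventually allI op_scale_bounded(2) Tb)
    have "isCont (\<lambda>s. cmod (cis (s * ?l) - cis (t * ?l)) * op_norm (nz_carrier n) ?T) t"
      unfolding cis_conv_exp by (intro continuous_intros)
    then show "((\<lambda>s. cmod (cis (s * ?l) - cis (t * ?l)) * op_norm (nz_carrier n) ?T) \<longlongrightarrow> 0) (at t)"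
      by (simp add: isCont_def)
  qed
next
  case (add X Y)
  note Xb = nz_span_bounded[OF add.hyps(1)] and Yb = nz_span_bounded[OF add.hyps(2)]
  let ?N = "op_norm (nz_carrier n)"
  let ?dX = "\<lambda>s. op_diff (conj_op n s X) (conj_op n t X)" and ?dY = "\<lambda>s. op_diff (conj_op n s Y) (conj_op n t Y)"
  have b: "?dX s \<in> bounded_ops (nz_carrier n)" "?dY s \<in> bounded_ops (nz_carrier n)" for s
    by (intro op_diff_bounded(1) conj_op_bounded(1) Xb Yb)+
  have eq: "op_diff (conj_op n s (op_add X Y)) (conj_op n t (op_add X Y)) = op_add (?dX s) (?dY s)" for s
    unfolding conj_op_add[OF Xb Yb] by (simp add: op_diff_def op_add_def algebra_simps)
  show ?case
    unfolding eq
  proof (rule tendsto_sandwich[OF _ _ tendsto_const])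
    show "\<forall>\<^sub>F s in at t. 0 \<le> ?N (op_add (?dX s) (?dY s))"
      by (intro always_eventually allI op_norm_nonneg op_add_bounded(1) b)
    show "\<forall>\<^sub>F s in at t. ?N (op_add (?dX s) (?dY s)) \<le> ?N (?dX s) + ?N (?dY s)"
      by (intro always_eventually allI op_add_bounded(2) b)
    show "((\<lambda>s. ?N (?dX s) + ?N (?dY s)) \<longlongrightarrow> 0) (at t)"
      using tendsto_add[OF add.IH] by simp
  qed
qed

text \<open>Conjugation is contractive for every time, so continuity passes from the span to its
  closure by an e/3 argument.\<close>

lemma conj_op_continuous:
  assumes T: "T \<in> nz_toeplitz n"
  shows "((\<lambda>s. op_norm (nz_carrier n) (op_diff (conj_op n s T) (conj_op n t T))) \<longlongrightarrow> 0) (at t)"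
proof (rule tendstoI)
  fix e :: real assume e: "e > 0"
  let ?N = "op_norm (nz_carrier n)"
  note Tb = nz_toeplitz_bounded[OF T]
  obtain X where X: "X \<in> nz_span n" "?N (op_diff T X) < e / 3" using nz_dense[OF n T, of "e / 3"] e by auto
  note Xb = nz_span_bounded[OF X(1)]
  have "\<forall>\<^sub>F s in at t. ?N (op_diff (conj_op n s X) (conj_op n t X)) < e / 3"
    by (rule order_tendstoD(2)[OF conj_op_continuous_span[OF X(1)]]) (use e in simp)
  then show "\<forall>\<^sub>F s in at t. dist (?N (op_diff (conj_op n s T) (conj_op n t T))) 0 < e"
  proof eventually_elim
    case (elim s)
    have c: "?N (op_diff (conj_op n r T) (conj_op n r X)) < e / 3" for r
      using conj_op_bounded(2)[OF op_diff_bounded(1)[OF Tb Xb], of r] X(2) conj_op_diff[OF Tb Xb, of r] by simp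
    note bb = conj_op_bounded(1)[OF Tb] conj_op_bounded(1)[OF Xb]
    have "?N (op_diff (conj_op n s T) (conj_op n t T)) < e"
      using op_norm_triangle[OF bb(1,1) bb(2), of s t s]  op_norm_triangle[OF bb(2,1) bb(2), of s t t]
        c[of s] c[of t] elim op_norm_diff_commute[of "nz_carrier n" "conj_op n t X" "conj_op n t T"] by linarith
    then show ?case
      using op_norm_nonneg[OF op_diff_bounded(1)[OF bb(1,1)], of s t] by simp
  qed
qed

lemma nz_V_in: "1 \<le> a \<Longrightarrow> nz_V n a \<in> nz_toeplitz n"
  using n by (simp add: nz_V_eq_W W_in_toeplitz)

lemma nz_R_in: "nz_R n \<in> nz_toeplitz n"
  using n by (simp add: nz_R_eq_W W_in_toeplitz)

lemma nz_sigma_dynamics: "nz_dynamics n (nz_sigma n)"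
  unfolding nz_dynamics_def dynamics_def
proof (intro conjI allI ballI impI)
  show "star_automorphism (nz_carrier n) (nz_toeplitz n) (nz_sigma n t)" for t
    by (rule nz_sigma_automorphism)
  show "nz_sigma n (s + t) T = nz_sigma n s (nz_sigma n t T)" if "T \<in> nz_toeplitz n" for s t T
    using that by (simp add: nz_sigma_def conj_op_toeplitz conj_op_conj_op nz_toeplitz_bounded)
  show "((\<lambda>s. op_norm (nz_carrier n) (op_diff (nz_sigma n s T) (nz_sigma n t T))) \<longlongrightarrow> 0) (at t)"
    if "T \<in> nz_toeplitz n" for T t
    using conj_op_continuous[OF that] that by (simp add: nz_sigma_def)
  show "nz_sigma n t (nz_V n a) = op_scale (of_nat a powr (\<i> * of_real t)) (nz_V n a)" if "1 \<le> a" for t a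
    using nz_V_in[OF that] that n unfolding of_nat_powr_imaginary[OF that]
    by (simp add: nz_sigma_def nz_V_eq_W conj_op_W)
  show "nz_sigma n t (nz_R n) = nz_R n" for t
    using nz_R_in n by (simp add: nz_sigma_def nz_R_eq_W conj_op_W op_scale_one)
qed

text \<open>Every generator is a product V_a R^k, so multiplicativity fixes the dynamics on
  generators, and \<open>star_automorphism_eqI\<close> extends the agreement to the whole
  algebra.\<close>

lemma nz_dynamics_unique:
  assumes s: "nz_dynamics n \<sigma>" shows "\<sigma> = nz_sigma n"
proof
  fix t
  have gen: "\<tau> t (W n a k 1) = op_scale (of_nat a powr (\<i> * of_real t)) (W n a k 1)"
    if d: "nz_dynamics n \<tau>" and a: "1 \<le> a" for \<tau> a k
  proof (induction k)
    case 0
    then show ?case using d a n by (simp add: nz_dynamics_def nz_V_eq_W)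
  next
    case (Suc k)
    have aut: "star_automorphism (nz_carrier n) (nz_toeplitz n) (\<tau> t)" and R: "\<tau> t (nz_R n) = nz_R n"
      using d by (auto simp: nz_dynamics_def dynamics_def)
    have e: "W n a (Suc k) 1 = W n a k 1 \<circ> nz_R n" using a n by (simp add: nz_R_eq_W W_comp)
    show ?case
      unfolding e star_automorphismD(5)[OF aut W_in_toeplitz[OF n a order_refl] nz_R_in] Suc R
      by (simp only: op_scale_comp)
  qed
  show "\<sigma> t = nz_sigma n t"
  proof (rule star_automorphism_eqI[OF nz_shift_bounded[OF n] nz_one[OF n] _ nz_sigma_automorphism])
    show "star_automorphism (nz_carrier n) (nz_toeplitz n) (\<sigma> t)"
      using s by (auto simp: nz_dynamics_def dynamics_def)
    fix u assume "u \<in> nz_carrier n"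
    then obtain a x where u: "u = (a, x)" "1 \<le> a" "x < n" by (cases u) (auto simp: nz_carrier_iff)
    then show "\<sigma> t (left_shift (nz_monoid n) u) = nz_sigma n t (left_shift (nz_monoid n) u)"
      using gen[OF s u(2)] gen[OF nz_sigma_dynamics u(2)] by (simp add: left_shift_eq_W)
  qed
qed

section \<open>KMS states\<close>

text \<open>The KMS condition reduced to values on monomials. No dynamics occurs in it, and it is
  stable under convex combinations.\<close>

definition kms_formula :: "real \<Rightarrow> ((nat \<times> nat) oper \<Rightarrow> complex) \<Rightarrow> bool" where
  "kms_formula \<beta> \<phi> \<longleftrightarrow> (\<forall>a\<ge>1. \<forall>b\<ge>1. \<forall>k.
     \<phi> (W n a k b) = (if a = b then of_real (real a powr (- \<beta>)) * \<phi> (W n 1 k 1) else 0))"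

text \<open>This is the entire function (a/b)^(iz). At z = i\<beta> it takes the value
  (a/b)^(-\<beta>), the factor in the KMS relation for monomials.\<close>

lemma W_analytic:
  assumes ab: "1 \<le> a" "1 \<le> b"
  shows "analytic_extension (nz_carrier n) (nz_toeplitz n) (nz_sigma n) (W n a k b)
    (\<lambda>z. op_scale (exp (\<i> * z * of_real (ln (real a) - ln (real b)))) (W n a k b))"
  unfolding analytic_extension_def
proof (intro conjI allI)
  let ?l = "of_real (ln (real a) - ln (real b)) :: complex" and ?T = "W n a k b"
  let ?E = "\<lambda>z. exp (\<i> * z * ?l)"
  note WA = W_in_toeplitz[OF n ab]
  note sc = cstar_subalgebraD(3)[OF nz_toeplitz_cstar[OF n]]
  show "op_scale (?E z) ?T \<in> nz_toeplitz n" for z by (rule sc[OF WA])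
  show "op_scale (?E (of_real t)) ?T = nz_sigma n t ?T" for t
    using WA ab by (simp add: nz_sigma_def conj_op_W cis_conv_exp mult.assoc)
  fix z
  show "\<exists>D\<in>nz_toeplitz n. ((\<lambda>w. op_norm (nz_carrier n) (op_diff (op_scale (1 / (w - z))
      (op_diff (op_scale (?E w) ?T) (op_scale (?E z) ?T))) D)) \<longlongrightarrow> 0) (at z)"
  proof (rule bexI[OF _ sc[OF WA]])
    let ?D = "\<i> * ?l * ?E z"
    have eq: "op_diff (op_scale (1 / (w - z)) (op_diff (op_scale (?E w) ?T) (op_scale (?E z) ?T))) (op_scale ?D ?T)
       = op_scale ((?E w - ?E z) / (w - z) - ?D) ?T" for w
      by (simp add: op_diff_def op_scale_def algebra_simps diff_divide_distrib)
    have "(?E has_field_derivative ?D) (at z)"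
      by (auto intro!: derivative_eq_intros)
    then have "((\<lambda>w. (?E w - ?E z) / (w - z)) \<longlongrightarrow> ?D) (at z)" by (simp add: has_field_derivative_iff)
    then have "((\<lambda>w. (?E w - ?E z) / (w - z) - ?D) \<longlongrightarrow> 0) (at z)" by (simp add: LIM_zero)
    then have lim: "((\<lambda>w. cmod ((?E w - ?E z) / (w - z) - ?D) * op_norm (nz_carrier n) ?T) \<longlongrightarrow> 0) (at z)"
      by (intro tendsto_mult_left_zero tendsto_norm_zero)
    show "((\<lambda>w. op_norm (nz_carrier n) (op_diff (op_scale (1 / (w - z))
        (op_diff (op_scale (?E w) ?T) (op_scale (?E z) ?T))) (op_scale ?D ?T))) \<longlongrightarrow> 0) (at z)"
      unfolding eq
    proof (rule tendsto_sandwich[OF _ _ tendsto_const lim])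
      show "\<forall>\<^sub>F w in at z. 0 \<le> op_norm (nz_carrier n) (op_scale ((?E w - ?E z) / (w - z) - ?D) ?T)"
        by (intro always_eventually allI op_norm_nonneg op_scale_bounded(1) W_bounded ab)
      show "\<forall>\<^sub>F w in at z. op_norm (nz_carrier n) (op_scale ((?E w - ?E z) / (w - z) - ?D) ?T)
         \<le> cmod ((?E w - ?E z) / (w - z) - ?D) * op_norm (nz_carrier n) ?T"
        by (intro always_eventually allI op_scale_bounded(2) W_bounded ab)
    qed
  qed
qed

lemma powr_exp: "1 \<le> (a::nat) \<Longrightarrow> real a powr x = exp (x * ln (real a))"
  by (simp add: powr_def)

text \<open>For a = b the KMS relation is applied to V_a R^k and V_a^*, whose product in the other
  order is R^k. For distinct a and b it is applied to the monomial and the identity: the value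
  equals itself times (a/b)^(-\<beta>), and this factor differs from 1 because \<beta> > 0.\<close>

lemma kms_imp_formula:
  assumes "0 < \<beta>" and phi: "\<phi> \<in> nz_kms n (nz_sigma n) \<beta>"
  shows "nz_state n \<phi>" "kms_formula \<beta> \<phi>"
proof -
  show st: "nz_state n \<phi>" using phi by (simp add: kms_states_def)
  note sd = stateD[OF st]
  have kms: "\<phi> (W n a k b \<circ> U) = exp (- of_real (\<beta> * (ln (real a) - ln (real b)))) * \<phi> (U \<circ> W n a k b)"
    if ab: "1 \<le> a" "1 \<le> b" and U: "U \<in> nz_toeplitz n" for a b k U
  proof -
    note WA = W_in_toeplitz[OF n ab]
    have "\<phi> (W n a k b \<circ> U)
      = \<phi> (U \<circ> op_scale (exp (\<i> * (\<i> * of_real \<beta>) * of_real (ln (real a) - ln (real b)))) (W n a k b))"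
      using phi W_analytic[OF ab, of k] WA U unfolding kms_states_def by blast
    also have "\<i> * (\<i> * of_real \<beta>) * of_real (ln (real a) - ln (real b)) = - of_real (\<beta> * (ln (real a) - ln (real b)))"
      by (simp add: mult.assoc[symmetric])
    finally show ?thesis
      unfolding op_comp_scale[OF nz_toeplitz_bounded[OF U] W_bounded[OF ab]]
        sd(3)[OF cstar_subalgebraD(4)[OF nz_toeplitz_cstar[OF n] U WA]] .
  qed
  show "kms_formula \<beta> \<phi>"
    unfolding kms_formula_def
  proof (intro allI impI)
    fix a b k :: nat assume ab: "1 \<le> a" "1 \<le> b"
    show "\<phi> (W n a k b) = (if a = b then of_real (real a powr (- \<beta>)) * \<phi> (W n 1 k 1) else 0)"
    proof (cases "a = b")
      case True
      have "W n a k 1 \<circ> W n 1 0 a = W n a k a" "W n 1 0 a \<circ> W n a k 1 = W n 1 k 1"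
        using ab by (simp_all add: W_comp)
      then have "\<phi> (W n a k a) = exp (- of_real (\<beta> * ln (real a))) * \<phi> (W n 1 k 1)"
        using kms[OF ab(1) order_refl W_in_toeplitz[OF n order_refl ab(1)], of k 0] by simp
      moreover have "exp (- of_real (\<beta> * ln (real a))) = complex_of_real (real a powr (- \<beta>))"
        unfolding powr_exp[OF ab(1)] by (simp add: exp_of_real[symmetric])
      ultimately show ?thesis using True by simp
    next
      case False
      let ?e = "exp (- of_real (\<beta> * (ln (real a) - ln (real b)))) :: complex"
      have "\<phi> (W n a k b) = ?e * \<phi> (W n a k b)"
        using kms[OF ab nz_one[OF n], of k] op_one_comp[OF W_bounded[OF ab]] by simp
      moreover have "?e \<noteq> 1"
      proof
        assume "?e = 1"
        then have "complex_of_real (exp (- (\<beta> * (ln (real a) - ln (real b))))) = of_real 1"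
          by (simp add: exp_of_real[symmetric])
        then have "exp (- (\<beta> * (ln (real a) - ln (real b)))) = 1" unfolding of_real_eq_iff .
        then have "ln (real a) = ln (real b)" using assms(1) by simp
        then show False using False ab by simp
      qed
      ultimately have "\<phi> (W n a k b) = 0" by (metis mult_cancel_right1)
      then show ?thesis using False by simp
    qed
  qed
qed

text \<open>By \<open>W_comp\<close> both products are single monomials, and both are diagonal
  exactly when ac = bd. In that case the reduced quotients coincide, so both contain the same power
  of R, and only the powers of the diagonal indices differ, by (a/b)^\<beta>.\<close>

lemma kms_formula_swap:
  assumes st: "nz_state n \<phi>" and kf: "kms_formula \<beta> \<phi>"
    and ab: "1 \<le> a" "1 \<le> b" and cd: "1 \<le> c" "1 \<le> d"
  shows "\<phi> (W n c l d \<circ> W n a k b)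
    = of_real (exp (\<beta> * (ln (real a) - ln (real b)))) * \<phi> (W n a k b \<circ> W n c l d)"
    and "a * c \<noteq> b * d \<Longrightarrow> \<phi> (W n a k b \<circ> W n c l d) = 0"
proof -
  define g where "g = gcd d a"
  define h where "h = gcd b c"
  have g: "g \<ge> 1" "h \<ge> 1" using ab cd by (simp_all add: g_def h_def Suc_le_eq)
  obtain a' d' where ad: "a = a' * g" "d = d' * g" by (metis g_def gcd_dvd1 gcd_dvd2 dvd_div_mult_self)
  obtain b' c' where bc: "b = b' * h" "c = c' * h" by (metis h_def gcd_dvd1 gcd_dvd2 dvd_div_mult_self)
  have q: "a div g = a'" "d div g = d'" "b div h = b'" "c div h = c'" using ad bc g by simp_all
  have pos: "a' \<ge> 1" "b' \<ge> 1" "c' \<ge> 1" "d' \<ge> 1" using ad bc ab cd by (auto intro: Suc_leI gr0I)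
  have TU: "W n c l d \<circ> W n a k b = W n (c * a') (l * a' + k * d') (b * d')"
    using W_comp[OF cd ab, of n l k] by (simp only: g_def[symmetric] q)
  have UT: "W n a k b \<circ> W n c l d = W n (a * c') (k * c' + l * b') (d * b')"
    using W_comp[OF ab cd, of n k l] by (simp only: h_def[symmetric] q)
  have val: "\<phi> (W n x m y) = (if x = y then of_real (real x powr (- \<beta>)) * \<phi> (W n 1 m 1) else 0)"
    if "1 \<le> x" "1 \<le> y" for x y m using kf that unfolding kms_formula_def by blast
  have p1: "1 \<le> c * a'" "1 \<le> b * d'" "1 \<le> a * c'" "1 \<le> d * b'"
    using pos ab cd by (simp_all add: Suc_le_eq)
  have e1: "c * a' = b * d' \<longleftrightarrow> a * c = b * d"
    using g by (simp add: ad mult_ac)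
  have e2: "a * c' = d * b' \<longleftrightarrow> a * c = b * d"
    using g by (simp add: bc mult_ac)
  show "a * c \<noteq> b * d \<Longrightarrow> \<phi> (W n a k b \<circ> W n c l d) = 0"
    unfolding UT val[OF p1(3,4)] e2 by simp
  show "\<phi> (W n c l d \<circ> W n a k b)
    = of_real (exp (\<beta> * (ln (real a) - ln (real b)))) * \<phi> (W n a k b \<circ> W n c l d)"
  proof (cases "a * c = b * d")
    case True
    \<comment> \<open>Both sides are gcd(ab, ac), written once with ac and once with bd. Cancelling
      g h from a' g h = b' h g yields a' = b'.\<close>
    have "a * h = b * g"
    proof -
      have "a * h = gcd (a * b) (a * c)" unfolding h_def by (simp add: gcd_mult_distrib_nat)
      also have "\<dots> = b * g" unfolding g_def True by (simp add: gcd_mult_distrib_nat gcd.commute mult.commute)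
      finally show ?thesis .
    qed
    then have ab': "a' = b'" using ad bc g by (simp add: mult_ac)
    have "d * h = c * g"
    proof -
      have "d * h = gcd (b * d) (c * d)" unfolding h_def by (simp add: gcd_mult_distrib_nat mult.commute)
      also have "\<dots> = c * g" unfolding g_def True[symmetric] by (simp add: gcd_mult_distrib_nat gcd.commute mult.commute)
      finally show ?thesis .
    qed
    then have cd': "d' = c'" using ad bc g by (simp add: mult_ac)
    have "real (c * a') powr (- \<beta>) = exp (\<beta> * (ln (real a) - ln (real b))) * real (a * c') powr (- \<beta>)"
    proof -
      have "c * a' = b * c'" unfolding ab' bc by (simp add: mult_ac)
      then have "real (c * a') powr (- \<beta>) = exp (- \<beta> * (ln (real b) + ln (real c')))"
        using ab pos unfolding powr_exp[OF p1(1)] by (simp add: ln_mult)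
      moreover have "real (a * c') powr (- \<beta>) = exp (- \<beta> * (ln (real a) + ln (real c')))"
        using ab pos unfolding powr_exp[OF p1(3)] by (simp add: ln_mult)
      ultimately show ?thesis by (simp add: exp_add[symmetric] algebra_simps)
    qed
    moreover have "l * a' + k * d' = k * c' + l * b'" by (simp add: ab' cd')
    ultimately show ?thesis
      unfolding TU UT val[OF p1(1,2)] val[OF p1(3,4)] e1 e2 using True by simp
  next
    case False
    then show ?thesis unfolding TU UT val[OF p1(1,2)] val[OF p1(3,4)] e1 e2 by simp
  qed
qed

lemma state_comp_bound:
  assumes st: "nz_state n \<phi>" and T: "T \<in> nz_toeplitz n" and U: "U \<in> nz_toeplitz n"
  shows "cmod (\<phi> (T \<circ> U)) \<le> op_norm (nz_carrier n) T * op_norm (nz_carrier n) U"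
  using stateD(5)[OF st cstar_subalgebraD(4)[OF nz_toeplitz_cstar[OF n] T U]]
    op_comp_bounded(2)[OF nz_toeplitz_bounded[OF T] nz_toeplitz_bounded[OF U]] by linarith

text \<open>The KMS condition is moved from \<open>T\<close> to the spanning element \<open>U\<close>: the entire function
  \<open>z \<mapsto> \<phi>(U F(z))\<close> is a multiple of an exponential on the real axis, hence everywhere.\<close>

lemma formula_imp_kms:
  assumes st: "nz_state n \<phi>" and kf: "kms_formula \<beta> \<phi>"
  shows "\<phi> \<in> nz_kms n (nz_sigma n) \<beta>"
  unfolding kms_states_def
proof (intro CollectI conjI ballI allI impI st)
  let ?A = "nz_toeplitz n" and ?N = "op_norm (nz_carrier n)"
  note cd = cstar_subalgebraD[OF nz_toeplitz_cstar[OF n]]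
  note sd = stateD[OF st]
  fix T F V assume T: "T \<in> ?A" and F: "analytic_extension (nz_carrier n) ?A (nz_sigma n) T F" and V: "V \<in> ?A"
  have FA: "F z \<in> ?A" for z using F by (simp add: analytic_extension_def)
  let ?Fb = "F (\<i> * of_real \<beta>)"
  have span: "\<phi> (T \<circ> U) = \<phi> (U \<circ> ?Fb)" if U_def: "U = W n a k b" and ab: "1 \<le> a" "1 \<le> b" for U a k b
  proof -
    have U: "U \<in> ?A" unfolding U_def by (rule W_in_toeplitz[OF n ab])
    note Ub = nz_toeplitz_bounded[OF U]
    let ?l = "ln (real a) - ln (real b)"
    define \<kappa> where "\<kappa> = complex_of_real (exp (\<beta> * ?l))"
    \<comment> \<open>For a monomial U the KMS relation can be extended from monomials X to all X by
      density, since no analytic continuation of X occurs in it.\<close>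
    have swap: "\<phi> (X \<circ> U) = \<kappa> * \<phi> (U \<circ> X)" if X: "X \<in> ?A" for X
    proof -
      have "\<phi> (X \<circ> U) - \<kappa> * \<phi> (U \<circ> X) = 0"
      proof (rule nz_functional_zero[OF n, where F = "\<lambda>X. \<phi> (X \<circ> U) - \<kappa> * \<phi> (U \<circ> X)" and C = "(1 + cmod \<kappa>) * ?N U"])
        fix X Y assume X: "X \<in> ?A" and Y: "Y \<in> ?A"
        show "\<phi> (op_add X Y \<circ> U) - \<kappa> * \<phi> (U \<circ> op_add X Y)
          = \<phi> (X \<circ> U) - \<kappa> * \<phi> (U \<circ> X) + (\<phi> (Y \<circ> U) - \<kappa> * \<phi> (U \<circ> Y))"
          unfolding op_add_comp op_comp_add[OF Ub nz_toeplitz_bounded[OF X] nz_toeplitz_bounded[OF Y]]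
            sd(2)[OF cd(4)[OF X U] cd(4)[OF Y U]] sd(2)[OF cd(4)[OF U X] cd(4)[OF U Y]]
          by (simp add: algebra_simps)
      next
        fix X c assume X: "X \<in> ?A"
        show "\<phi> (op_scale c X \<circ> U) - \<kappa> * \<phi> (U \<circ> op_scale c X) = c * (\<phi> (X \<circ> U) - \<kappa> * \<phi> (U \<circ> X))"
          unfolding op_scale_comp op_comp_scale[OF Ub nz_toeplitz_bounded[OF X]]
            sd(3)[OF cd(4)[OF X U]] sd(3)[OF cd(4)[OF U X]]
          by (simp add: algebra_simps)
      next
        fix X assume X: "X \<in> ?A"
        have "cmod (\<phi> (X \<circ> U) - \<kappa> * \<phi> (U \<circ> X)) \<le> cmod (\<phi> (X \<circ> U)) + cmod \<kappa> * cmod (\<phi> (U \<circ> X))"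
          using norm_triangle_ineq4[of "\<phi> (X \<circ> U)" "\<kappa> * \<phi> (U \<circ> X)"] by (simp only: norm_mult)
        also have "\<dots> \<le> ?N X * ?N U + cmod \<kappa> * (?N U * ?N X)"
          by (intro add_mono mult_left_mono state_comp_bound st X U) simp
        finally show "cmod (\<phi> (X \<circ> U) - \<kappa> * \<phi> (U \<circ> X)) \<le> (1 + cmod \<kappa>) * ?N U * ?N X"
          by (simp add: algebra_simps)
      next
        fix c l d :: nat assume "1 \<le> c" "1 \<le> d"
        from kms_formula_swap(1)[OF st kf ab this, of l k]
        show "\<phi> (W n c l d \<circ> U) - \<kappa> * \<phi> (U \<circ> W n c l d) = 0"
          unfolding U_def \<kappa>_def by simp
      qed (rule X)
      then show ?thesis by simp
    qed
    \<comment> \<open>For a monomial X either ac = bd, and then its phase is the inverse of the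
      phase of U, or both sides vanish.\<close>
    have real_axis: "\<phi> (U \<circ> nz_sigma n t X) = cis (- (t * ?l)) * \<phi> (U \<circ> X)" if X: "X \<in> ?A" for X t
    proof -
      let ?e = "cis (- (t * ?l))"
      have "\<phi> (U \<circ> conj_op n t X) - ?e * \<phi> (U \<circ> X) = 0"
      proof (rule nz_functional_zero[OF n, where F = "\<lambda>X. \<phi> (U \<circ> conj_op n t X) - ?e * \<phi> (U \<circ> X)" and C = "2 * ?N U"])
        fix X Y assume X: "X \<in> ?A" and Y: "Y \<in> ?A"
        note Xb = nz_toeplitz_bounded[OF X] and Yb = nz_toeplitz_bounded[OF Y]
        note X' = conj_op_toeplitz[OF X] and Y' = conj_op_toeplitz[OF Y]
        show "\<phi> (U \<circ> conj_op n t (op_add X Y)) - ?e * \<phi> (U \<circ> op_add X Y)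
          = \<phi> (U \<circ> conj_op n t X) - ?e * \<phi> (U \<circ> X) + (\<phi> (U \<circ> conj_op n t Y) - ?e * \<phi> (U \<circ> Y))"
          unfolding conj_op_add[OF Xb Yb] op_comp_add[OF Ub Xb Yb]
            op_comp_add[OF Ub nz_toeplitz_bounded[OF X'] nz_toeplitz_bounded[OF Y']]
            sd(2)[OF cd(4)[OF U X'] cd(4)[OF U Y']] sd(2)[OF cd(4)[OF U X] cd(4)[OF U Y]]
          by (simp add: algebra_simps)
      next
        fix X c assume X: "X \<in> ?A"
        note Xb = nz_toeplitz_bounded[OF X] and X' = conj_op_toeplitz[OF X]
        show "\<phi> (U \<circ> conj_op n t (op_scale c X)) - ?e * \<phi> (U \<circ> op_scale c X)
          = c * (\<phi> (U \<circ> conj_op n t X) - ?e * \<phi> (U \<circ> X))"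
          unfolding conj_op_scale[OF Xb] op_comp_scale[OF Ub Xb] op_comp_scale[OF Ub nz_toeplitz_bounded[OF X']]
            sd(3)[OF cd(4)[OF U X]] sd(3)[OF cd(4)[OF U X']]
          by (simp add: algebra_simps)
      next
        fix X assume X: "X \<in> ?A"
        note X' = conj_op_toeplitz[OF X]
        have "cmod (\<phi> (U \<circ> conj_op n t X) - ?e * \<phi> (U \<circ> X)) \<le> cmod (\<phi> (U \<circ> conj_op n t X)) + cmod (\<phi> (U \<circ> X))"
          using norm_triangle_ineq4[of "\<phi> (U \<circ> conj_op n t X)" "?e * \<phi> (U \<circ> X)"]
          by (simp only: norm_mult norm_cis mult_1)
        also have "\<dots> \<le> ?N U * ?N (conj_op n t X) + ?N U * ?N X"
          by (intro add_mono state_comp_bound st X X' U)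
        also have "\<dots> \<le> ?N U * ?N X + ?N U * ?N X"
          by (intro add_mono mult_left_mono conj_op_bounded(2) nz_toeplitz_bounded X op_norm_nonneg Ub order_refl)
        finally show "cmod (\<phi> (U \<circ> conj_op n t X) - ?e * \<phi> (U \<circ> X)) \<le> 2 * ?N U * ?N X"
          by simp
      next
        fix c l d :: nat assume c: "1 \<le> c" "1 \<le> d"
        show "\<phi> (U \<circ> conj_op n t (W n c l d)) - ?e * \<phi> (U \<circ> W n c l d) = 0"
          unfolding conj_op_W[OF c] op_comp_scale[OF Ub W_bounded[OF c]]
            sd(3)[OF cd(4)[OF U W_in_toeplitz[OF n c]]]
        proof (cases "a * c = b * d")
          case True
          then have "real (a * c) = real (b * d)" by (simp only:)
          then have "ln (real a * real c) = ln (real b * real d)" by (simp only: of_nat_mult)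
          then have "ln (real a) + ln (real c) = ln (real b) + ln (real d)"
            using ab c by (simp add: ln_mult)
          then have "ln (real c) - ln (real d) = - ?l" by linarith
          then have "t * (ln (real c) - ln (real d)) = - (t * ?l)" by (simp only: mult_minus_right)
          then show "cis (t * (ln (real c) - ln (real d))) * \<phi> (U \<circ> W n c l d) - ?e * \<phi> (U \<circ> W n c l d) = 0"
            by simp
        next
          case False
          then show "cis (t * (ln (real c) - ln (real d))) * \<phi> (U \<circ> W n c l d) - ?e * \<phi> (U \<circ> W n c l d) = 0"
            using kms_formula_swap(2)[OF st kf ab c, of k l] unfolding U_def by simp
        qed
      qed (rule X)
      then show ?thesis using X by (simp add: nz_sigma_def)
    qed
    \<comment> \<open>Both terms are entire, the first because \<open>F\<close> is norm
      differentiable and \<phi> is bounded. They agree on the real axis by \<open>real_axis\<close>,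
      so the identity theorem applies.\<close>
    define h where "h z = \<phi> (U \<circ> F z) - exp (- \<i> * z * of_real ?l) * \<phi> (U \<circ> T)" for z
    have "\<exists>D. ((\<lambda>z. \<phi> (U \<circ> F z)) has_field_derivative D) (at z)" for z
    proof -
      obtain D where D: "D \<in> ?A"
        "((\<lambda>w. ?N (op_diff (op_scale (1 / (w - z)) (op_diff (F w) (F z))) D)) \<longlongrightarrow> 0) (at z)"
        using F unfolding analytic_extension_def by blast
      have "((\<lambda>w. (\<phi> (U \<circ> F w) - \<phi> (U \<circ> F z)) / (w - z) - \<phi> (U \<circ> D)) \<longlongrightarrow> 0) (at z)"
      proof (rule Lim_null_comparison)
        show "((\<lambda>w. ?N U * ?N (op_diff (op_scale (1 / (w - z)) (op_diff (F w) (F z))) D)) \<longlongrightarrow> 0) (at z)"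
          using tendsto_mult_right_zero[OF D(2)] .
        show "\<forall>\<^sub>F w in at z. norm ((\<phi> (U \<circ> F w) - \<phi> (U \<circ> F z)) / (w - z) - \<phi> (U \<circ> D))
          \<le> ?N U * ?N (op_diff (op_scale (1 / (w - z)) (op_diff (F w) (F z))) D)"
        proof (intro always_eventually allI)
          fix w
          let ?q = "op_scale (1 / (w - z)) (op_diff (F w) (F z))"
          have q: "op_diff (F w) (F z) \<in> ?A" "?q \<in> ?A" by (intro cd(3,6) FA)+
          have "\<phi> (U \<circ> op_diff ?q D) = \<phi> (U \<circ> ?q) - \<phi> (U \<circ> D)"
            unfolding op_comp_diff[OF Ub nz_toeplitz_bounded[OF q(2)] nz_toeplitz_bounded[OF D(1)]]
            by (rule state_diff[OF st nz_toeplitz_cstar[OF n] cd(4)[OF U q(2)] cd(4)[OF U D(1)]])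
          also have "\<phi> (U \<circ> ?q) = (\<phi> (U \<circ> F w) - \<phi> (U \<circ> F z)) / (w - z)"
            unfolding op_comp_scale[OF Ub nz_toeplitz_bounded[OF q(1)]]
            unfolding sd(3)[OF cd(4)[OF U q(1)]]
            unfolding op_comp_diff[OF Ub nz_toeplitz_bounded[OF FA] nz_toeplitz_bounded[OF FA]]
              state_diff[OF st nz_toeplitz_cstar[OF n] cd(4)[OF U FA] cd(4)[OF U FA]]
            by simp
          finally show "norm ((\<phi> (U \<circ> F w) - \<phi> (U \<circ> F z)) / (w - z) - \<phi> (U \<circ> D)) \<le> ?N U * ?N (op_diff ?q D)"
            using state_comp_bound[OF st U cd(6)[OF q(2) D(1)]] by (simp only:)
        qed
      qed
      then have "((\<lambda>z. \<phi> (U \<circ> F z)) has_field_derivative \<phi> (U \<circ> D)) (at z)"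
        unfolding has_field_derivative_iff by (rule LIM_zero_cancel)
      then show ?thesis by blast
    qed
    then have "(\<lambda>z. \<phi> (U \<circ> F z)) holomorphic_on UNIV"
      by (auto simp: holomorphic_on_def field_differentiable_def)
    then have hol: "h holomorphic_on UNIV" unfolding h_def by (intro holomorphic_intros)
    have "h z = 0" for z
    proof (rule analytic_continuation[OF hol open_UNIV connected_UNIV, of \<real> 0])
      show "0 islimpt (\<real> :: complex set)"
        unfolding islimpt_approachable
      proof (intro allI impI)
        fix e :: real assume "e > 0"
        then show "\<exists>x'\<in>\<real>. x' \<noteq> (0::complex) \<and> dist x' 0 < e"
          by (intro bexI[of _ "of_real (e / 2)"]) (auto simp: norm_divide)
      qed
      fix w :: complex assume "w \<in> \<real>"
      then obtain t where w: "w = of_real t" by (rule Reals_cases)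
      have "F w = nz_sigma n t T" using F unfolding analytic_extension_def w by blast
      moreover have "exp (- \<i> * w * of_real ?l) = cis (- (t * ?l))" unfolding w cis_conv_exp by (simp add: mult_ac)
      ultimately show "h w = 0" unfolding h_def by (simp only: real_axis[OF T]) simp
    qed auto
    from this[of "\<i> * of_real \<beta>"]
    have "\<phi> (U \<circ> ?Fb) = exp (- \<i> * (\<i> * of_real \<beta>) * of_real ?l) * \<phi> (U \<circ> T)" unfolding h_def by simp
    also have "exp (- \<i> * (\<i> * of_real \<beta>) * of_real ?l) = \<kappa>"
      unfolding \<kappa>_def by (simp add: mult.assoc[symmetric] exp_of_real[symmetric])
    finally show ?thesis unfolding swap[OF T] by (rule sym)
  qed
  \<comment> \<open>With T and its continuation fixed, both sides are bounded and linear in V, so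
    the case of monomials is enough.\<close>
  have "\<phi> (T \<circ> V) - \<phi> (V \<circ> ?Fb) = 0"
  proof (rule nz_functional_zero[OF n, where F = "\<lambda>V. \<phi> (T \<circ> V) - \<phi> (V \<circ> ?Fb)" and C = "?N T + ?N ?Fb"])
    note Tb = nz_toeplitz_bounded[OF T]
    fix X Y assume X: "X \<in> ?A" and Y: "Y \<in> ?A"
    show "\<phi> (T \<circ> op_add X Y) - \<phi> (op_add X Y \<circ> ?Fb)
      = \<phi> (T \<circ> X) - \<phi> (X \<circ> ?Fb) + (\<phi> (T \<circ> Y) - \<phi> (Y \<circ> ?Fb))"
      unfolding op_add_comp op_comp_add[OF Tb nz_toeplitz_bounded[OF X] nz_toeplitz_bounded[OF Y]]
        sd(2)[OF cd(4)[OF X FA] cd(4)[OF Y FA]] sd(2)[OF cd(4)[OF T X] cd(4)[OF T Y]]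
      by (simp add: algebra_simps)
  next
    note Tb = nz_toeplitz_bounded[OF T]
    fix X c assume X: "X \<in> ?A"
    show "\<phi> (T \<circ> op_scale c X) - \<phi> (op_scale c X \<circ> ?Fb) = c * (\<phi> (T \<circ> X) - \<phi> (X \<circ> ?Fb))"
      unfolding op_scale_comp op_comp_scale[OF Tb nz_toeplitz_bounded[OF X]]
        sd(3)[OF cd(4)[OF X FA]] sd(3)[OF cd(4)[OF T X]]
      by (simp add: algebra_simps)
  next
    fix X assume X: "X \<in> ?A"
    have "cmod (\<phi> (T \<circ> X) - \<phi> (X \<circ> ?Fb)) \<le> cmod (\<phi> (T \<circ> X)) + cmod (\<phi> (X \<circ> ?Fb))"
      by (rule norm_triangle_ineq4)
    also have "\<dots> \<le> ?N T * ?N X + ?N X * ?N ?Fb"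
      by (intro add_mono state_comp_bound st X T FA)
    finally show "cmod (\<phi> (T \<circ> X) - \<phi> (X \<circ> ?Fb)) \<le> (?N T + ?N ?Fb) * ?N X" by (simp add: algebra_simps)
  next
    fix a k b :: nat assume ab: "1 \<le> a" "1 \<le> b"
    then show "\<phi> (T \<circ> W n a k b) - \<phi> (W n a k b \<circ> ?Fb) = 0" using span[OF refl ab] by simp
  qed (rule V)
  then show "\<phi> (T \<circ> V) = \<phi> (V \<circ> ?Fb)" by simp
qed

lemma kms_iff:
  "0 < \<beta> \<Longrightarrow> \<phi> \<in> nz_kms n (nz_sigma n) \<beta> \<longleftrightarrow> nz_state n \<phi> \<and> kms_formula \<beta> \<phi>"
  using kms_imp_formula formula_imp_kms by blast

end

section \<open>Moebius inversion\<close>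

lemma prime_factors_prod_primes:
  assumes "finite X" "\<And>p. p \<in> X \<Longrightarrow> prime (p::nat)"
  shows "prime_factors (\<Prod>X) = X"
proof -
  have "prime_factors (\<Prod>X) = \<Union> ((prime_factors \<circ> (\<lambda>p. p)) ` X)"
    using assms by (intro prime_factors_prod) (auto dest: prime_gt_0_nat)
  also have "\<dots> = X" using assms by (auto simp: prime_prime_factors)
  finally show ?thesis .
qed

lemma prod_primes_dvd:
  assumes "finite X" "\<And>p. p \<in> X \<Longrightarrow> prime (p::nat) \<and> p dvd d"
  shows "\<Prod>X dvd d"
  using assms
proof (induction X rule: finite_induct)
  case (insert p X)
  have "coprime p (\<Prod>X)"
    using insert by (intro prod_coprime_right) (auto intro: primes_coprime)
  then show ?case using insert by (auto intro: divides_mult)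
qed simp

text \<open>Only squarefree divisors contribute. They correspond to sets of prime factors of d, and
  expanding the product over primes gives the sum over these sets. The cases used are f = 1 and f(e)
  = e^(-\<beta>).\<close>

lemma moebius_sum_prod:
  fixes f :: "nat \<Rightarrow> real"
  assumes d: "d > 0" and f1: "f 1 = 1" and fm: "\<And>a b. f (a * b) = f a * f b"
  shows "(\<Sum>e | e dvd d. moebius e * f e) = (\<Prod>p\<in>prime_factors d. 1 - f p)"
proof -
  let ?P = "prime_factors d"
  have fin: "finite {e. e dvd d}" using d by simp
  have fprod: "f (\<Prod>X) = (\<Prod>p\<in>X. f p)" if "finite X" for X
    using that f1 by (induction X rule: finite_induct) (auto simp: fm)
  have bij: "bij_betw (\<lambda>X. \<Prod>X) (Pow ?P) {e. e dvd d \<and> squarefree e}"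
  proof (rule bij_betwI[where g = prime_factors])
    show "(\<lambda>X. \<Prod>X) \<in> Pow ?P \<rightarrow> {e. e dvd d \<and> squarefree e}"
    proof
      fix X assume "X \<in> Pow ?P"
      then have X: "finite X" "\<And>p. p \<in> X \<Longrightarrow> prime p \<and> p dvd d"
        using finite_subset[of X ?P] by (auto simp: prime_factors_dvd)
      moreover have "squarefree (\<Prod>X)"
        using X by (intro squarefree_prod_coprime) (auto intro: primes_coprime squarefree_prime)
      ultimately show "\<Prod>X \<in> {e. e dvd d \<and> squarefree e}" using prod_primes_dvd by auto
    qed
    show "prime_factors \<in> {e. e dvd d \<and> squarefree e} \<rightarrow> Pow ?P"
      using d by (auto simp: prime_factors_dvd)
    show "prime_factors (\<Prod>X) = X" if "X \<in> Pow ?P" for X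
      using that finite_subset[of X ?P] by (intro prime_factors_prod_primes) auto
    show "\<Prod>(prime_factors e) = e" if "e \<in> {e. e dvd d \<and> squarefree e}" for e
    proof -
      have e: "e \<noteq> 0" "squarefree e" using that d by auto
      have "e = (\<Prod>p\<in>prime_factors e. p ^ multiplicity p e)"
        using e(1) by (intro prime_factorization_nat) simp
      also have "\<dots> = (\<Prod>p\<in>prime_factors e. p)"
      proof (rule prod.cong)
        fix p assume p: "p \<in> prime_factors e"
        then have "multiplicity p e > 0" "prime p" by (auto simp: prime_factors_multiplicity)
        moreover have "multiplicity p e \<le> 1"
          using e \<open>prime p\<close> by (simp add: squarefree_factorial_semiring'')
        ultimately have "multiplicity p e = 1" by simp
        then show "p ^ multiplicity p e = p" by simp
      qed simp
      finally show ?thesis by simp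
    qed
  qed
  have "(\<Sum>e | e dvd d. moebius e * f e) = (\<Sum>e | e dvd d \<and> squarefree e. moebius e * f e)"
    by (rule sum.mono_neutral_right) (use fin in \<open>auto simp: moebius_def\<close>)
  also have "\<dots> = (\<Sum>X\<in>Pow ?P. moebius (\<Prod>X) * f (\<Prod>X))"
    by (rule sum.reindex_bij_betw[OF bij, symmetric])
  also have "\<dots> = (\<Sum>X\<in>Pow ?P. (-1) ^ card X * (\<Prod>p\<in>X. f p) * (\<Prod>p\<in>?P - X. 1))"
  proof (rule sum.cong)
    fix X assume X: "X \<in> Pow ?P"
    then have fX: "finite X" using finite_subset[of X ?P] by auto
    have "squarefree (\<Prod>X)" using bij_betw_apply[OF bij X] by simp
    moreover have "prime_factors (\<Prod>X) = X"
      using X fX by (intro prime_factors_prod_primes) auto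
    ultimately show "moebius (\<Prod>X) * f (\<Prod>X) = (-1) ^ card X * (\<Prod>p\<in>X. f p) * (\<Prod>p\<in>?P - X. 1)"
      using fprod[OF fX] by (simp add: moebius_def)
  qed simp
  also have "\<dots> = (\<Prod>p\<in>?P. 1 - f p)"
    by (rule prod_diff_conv_sum[symmetric]) simp
  finally show ?thesis .
qed

lemma moebius_sum:
  assumes "d > 0" shows "(\<Sum>e | e dvd d. moebius e) = (if d = 1 then 1 else 0)"
proof -
  have "(\<Sum>e | e dvd d. moebius e) = (\<Prod>p\<in>prime_factors d. 0)"
    using moebius_sum_prod[OF assms, of "\<lambda>_. 1"] by simp
  also have "\<dots> = (if d = 1 then 1 else 0)"
  proof (cases "d = 1")
    case False
    then obtain p where "prime p" "p dvd d" using prime_factor_nat by blast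
    then have "p \<in> prime_factors d" using assms by (simp add: prime_factors_dvd)
    then have "(\<Prod>p\<in>prime_factors d. 0 :: real) = 0" by (intro prod_zero) auto
    then show ?thesis using False by simp
  qed simp
  finally show ?thesis .
qed

lemma abs_moebius_le: "\<bar>moebius d\<bar> \<le> 1"
  by (simp add: moebius_def power_abs)

section \<open>Finite Fourier analysis\<close>

definition omega :: "nat \<Rightarrow> complex" where
  "omega n = cis (2 * pi / real n)"

lemma omega_power: "omega n ^ k = exp (2 * of_real pi * \<i> * of_nat k / of_nat n)"
proof -
  have "omega n ^ k = cis (real k * (2 * pi / real n))"
    unfolding omega_def by (rule Complex.DeMoivre)
  also have "\<dots> = exp (\<i> * of_real (real k * (2 * pi / real n)))" by (rule cis_conv_exp)
  also have "\<i> * of_real (real k * (2 * pi / real n)) = 2 * of_real pi * \<i> * of_nat k / of_nat n"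
    by simp
  finally show ?thesis .
qed

lemma omega_power_eq_1_iff:
  assumes "1 \<le> n" shows "omega n ^ k = 1 \<longleftrightarrow> n dvd k"
  unfolding omega_power by (rule complex_root_unity_eq_1[OF assms])

lemma omega_power_cong:
  assumes "1 \<le> n" "[k = l] (mod n)" shows "omega n ^ k = omega n ^ l"
proof -
  have "omega n ^ k = omega n ^ (k mod n)" for k
  proof -
    have "omega n ^ k = omega n ^ (n * (k div n)) * omega n ^ (k mod n)"
      by (simp flip: power_add)
    moreover have "omega n ^ (n * (k div n)) = 1"
      using omega_power_eq_1_iff[OF assms(1), of "n * (k div n)"] by (simp only: dvd_triv_left simp_thms)
    ultimately show ?thesis by (simp only: mult_1)
  qed
  from this[of k] this[of l] show ?thesis using assms(2) unfolding cong_def by (simp only:)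
qed

lemma norm_omega_power [simp]: "norm (omega n ^ k) = 1"
  by (simp add: omega_def norm_power)

lemma omega_sum:
  assumes n: "1 \<le> n"
  shows "(\<Sum>k<n. omega n ^ (m * k)) = (if n dvd m then of_nat n else 0)"
proof (cases "n dvd m")
  case True
  then have "omega n ^ (m * k) = 1" for k using omega_power_eq_1_iff[OF n] by simp
  then show ?thesis using True by simp
next
  case False
  have "(\<Sum>k<n. omega n ^ (m * k)) = (\<Sum>k<n. (omega n ^ m) ^ k)" by (simp add: power_mult)
  also have "\<dots> = ((omega n ^ m) ^ n - 1) / (omega n ^ m - 1)"
    using False omega_power_eq_1_iff[OF n] by (intro geometric_sum) simp
  also have "(omega n ^ m) ^ n = 1"
    using omega_power_eq_1_iff[OF n, of "m * n"] by (simp add: power_mult)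
  finally show ?thesis using False by simp
qed

text \<open>\<open>(n - 1) * i\<close> stands for -i modulo n, so that all exponents of roots of
  unity remain natural numbers.\<close>

lemma dvd_sub_index:
  fixes i j n :: nat
  assumes "i < n" "j < n" shows "n dvd (n - 1) * i + j \<longleftrightarrow> i = j"
proof -
  let ?x = "(n - 1) * i + j"
  have "?x + i = j + n * i"
    using assms by (cases n) auto
  then have c: "[?x + i = j] (mod n)" by (simp only: cong_def mod_mult_self2)
  show ?thesis
  proof
    assume "n dvd ?x"
    then have "[?x = 0] (mod n)" by (simp only: cong_0_iff)
    then have "[?x + i = 0 + i] (mod n)" by (rule cong_add[OF _ cong_refl])
    then have "[i = j] (mod n)" using c by (metis add_0 cong_sym cong_trans)
    then show "i = j" using assms by (simp add: cong_def)
  next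
    assume "i = j"
    then have "[?x + i = 0 + i] (mod n)" using c by simp
    then have "[?x = 0] (mod n)" by (simp only: cong_add_rcancel_nat)
    then show "n dvd ?x" by (simp only: cong_0_iff)
  qed
qed

lemma omega_mult: "omega n ^ (a * k) * (x * omega n ^ (b * k)) = x * omega n ^ ((a + b) * k)"
  by (simp add: distrib_right power_add)

text \<open>Orthogonality of characters, recovering coefficients from values. The companion
  \<open>fourier_inversion'\<close> goes the other way and recovers an n-periodic function from its
  coefficients.\<close>

lemma fourier_inversion:
  assumes n: "1 \<le> n" and i: "i < n"
  shows "(1 / of_nat n) * (\<Sum>k<n. omega n ^ ((n - 1) * i * k) * (\<Sum>j<n. x j * omega n ^ (j * k))) = (x i :: complex)"
proof -
  have "(\<Sum>k<n. omega n ^ ((n - 1) * i * k) * (\<Sum>j<n. x j * omega n ^ (j * k)))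
    = (\<Sum>k<n. \<Sum>j<n. x j * omega n ^ (((n - 1) * i + j) * k))"
    unfolding sum_distrib_left omega_mult ..
  also have "\<dots> = (\<Sum>j<n. x j * (\<Sum>k<n. omega n ^ (((n - 1) * i + j) * k)))"
    by (subst sum.swap) (simp add: sum_distrib_left)
  also have "\<dots> = (\<Sum>j<n. if j = i then x j * of_nat n else 0)"
    unfolding omega_sum[OF n] by (rule sum.cong) (use i dvd_sub_index[OF i] in auto)
  also have "\<dots> = x i * of_nat n" using i by simp
  finally show ?thesis using n by simp
qed

lemma fourier_inversion':
  assumes n: "1 \<le> n" and per: "\<And>k. w (k mod n) = (w k :: complex)"
  shows "(\<Sum>j<n. ((1 / of_nat n) * (\<Sum>k<n. omega n ^ ((n - 1) * j * k) * w k)) * omega n ^ (j * l)) = w l"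
proof -
  have "l mod n < n" using n by simp
  have "(\<Sum>j<n. ((1 / of_nat n) * (\<Sum>k<n. omega n ^ ((n - 1) * j * k) * w k)) * omega n ^ (j * l))
    = (1 / of_nat n) * (\<Sum>j<n. \<Sum>k<n. w k * omega n ^ (((n - 1) * k + l) * j))"
  proof -
    have "(omega n ^ ((n - 1) * j * k) * w k) * omega n ^ (j * l) = w k * omega n ^ (((n - 1) * k + l) * j)" for j k
      using omega_mult[of n "(n - 1) * k" j "w k" l] by (simp only: mult_ac)
    then show ?thesis
      unfolding mult.assoc[of "1 / of_nat n"] sum_distrib_left[symmetric, of "1 / of_nat n"]
      by (simp only: sum_distrib_right)
  qed
  also have "(\<Sum>j<n. \<Sum>k<n. w k * omega n ^ (((n - 1) * k + l) * j))
    = (\<Sum>k<n. w k * (\<Sum>j<n. omega n ^ (((n - 1) * k + l) * j)))"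
    by (subst sum.swap) (simp add: sum_distrib_left)
  also have "\<dots> = (\<Sum>k<n. if k = l mod n then w k * of_nat n else 0)"
  proof (rule sum.cong)
    fix k assume "k \<in> {..<n}"
    then have "n dvd (n - 1) * k + l \<longleftrightarrow> k = l mod n"
      using dvd_sub_index[of k n "l mod n"] n
      by (metis \<open>l mod n < n\<close> dvd_eq_mod_eq_0 lessThan_iff mod_add_right_eq)
    then show "w k * (\<Sum>j<n. omega n ^ (((n - 1) * k + l) * j)) = (if k = l mod n then w k * of_nat n else 0)"
      unfolding omega_sum[OF n] by simp
  qed simp
  also have "\<dots> = w l * of_nat n" using \<open>l mod n < n\<close> per by simp
  finally show ?thesis using n by simp
qed

section \<open>Divisor-closed multiplicative systems\<close>

lemma infsum_finite_sum:
  fixes f :: "'a \<Rightarrow> 'b \<Rightarrow> 'c::banach"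
  assumes "finite J" "\<And>j. j \<in> J \<Longrightarrow> f j summable_on A"
  shows "(\<lambda>x. \<Sum>j\<in>J. f j x) summable_on A"
    "(\<Sum>\<^sub>\<infinity>x\<in>A. \<Sum>j\<in>J. f j x) = (\<Sum>j\<in>J. \<Sum>\<^sub>\<infinity>x\<in>A. f j x)"
proof -
  have "((\<lambda>x. \<Sum>j\<in>J. f j x) has_sum (\<Sum>j\<in>J. \<Sum>\<^sub>\<infinity>x\<in>A. f j x)) A"
    using assms
  proof (induction J rule: finite_induct)
    case (insert j J)
    have "(f j has_sum infsum (f j) A) A" using insert by (intro has_sum_infsum) auto
    from has_sum_add[OF this insert.IH] insert show ?case by simp
  qed simp
  then show "(\<lambda>x. \<Sum>j\<in>J. f j x) summable_on A"
    "(\<Sum>\<^sub>\<infinity>x\<in>A. \<Sum>j\<in>J. f j x) = (\<Sum>j\<in>J. \<Sum>\<^sub>\<infinity>x\<in>A. f j x)"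
    by (auto simp: infsumI has_sum_imp_summable)
qed

lemma summable_on_product_nonneg:
  fixes f :: "'a \<Rightarrow> real" and g :: "'b \<Rightarrow> real"
  assumes "f summable_on A" "g summable_on B"
    and "\<And>x. x \<in> A \<Longrightarrow> 0 \<le> f x" "\<And>y. y \<in> B \<Longrightarrow> 0 \<le> g y"
  shows "(\<lambda>(x, y). f x * g y) summable_on (A \<times> B)"
proof -
  have "(\<lambda>z. norm (case z of (x, y) \<Rightarrow> f x * g y)) summable_on (A \<times> B)"
    unfolding Infinite_Sum.abs_summable_on_Sigma_iff
  proof (intro conjI ballI)
    have g: "(\<lambda>y. \<bar>g y\<bar>) summable_on B"
      using assms(2,4) by (simp cong: summable_on_cong)
    have f: "(\<lambda>x. \<bar>f x\<bar>) summable_on A"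
      using assms(1,3) by (simp cong: summable_on_cong)
    show "(\<lambda>y. norm (case (x, y) of (x, y) \<Rightarrow> f x * g y)) summable_on B" for x
      using summable_on_cmult_right[OF g, of "\<bar>f x\<bar>"] by (simp add: abs_mult)
    show "(\<lambda>x. norm (\<Sum>\<^sub>\<infinity>y\<in>B. norm (case (x, y) of (x, y) \<Rightarrow> f x * g y))) summable_on A"
      using summable_on_cmult_left[OF f, of "\<bar>\<Sum>\<^sub>\<infinity>y\<in>B. \<bar>g y\<bar>\<bar>"]
      by (simp add: abs_mult infsum_cmult_right')
  qed
  then show ?thesis by (rule abs_summable_summable)
qed

text \<open>A common frame for all positive integers when \<beta> > 1 and for the integers with
  prime factors in a fixed finite set when \<beta> > 0. Closure under products and under divisors
  together make (c, d) -> (cd, d) a bijection onto the pairs (N, d) with d dividing N, which is what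
  moebius inversion inside C requires.\<close>

locale divisor_system =
  fixes C :: "nat set" and \<beta> :: real
  assumes one: "1 \<in> C" and zero: "0 \<notin> C"
    and mult: "a \<in> C \<Longrightarrow> b \<in> C \<Longrightarrow> a * b \<in> C"
    and dvd: "a \<in> C \<Longrightarrow> d dvd a \<Longrightarrow> d \<in> C"
    and summable: "(\<lambda>c. real c powr (- \<beta>)) summable_on C"
begin

definition Z :: real where "Z = (\<Sum>\<^sub>\<infinity>c\<in>C. real c powr (- \<beta>))"

text \<open>Multiplicative convolution with c^(-\<beta>) over C, acting on the variable k.
  \<open>dir_inv\<close>, the convolution with the moebius function times d^(-\<beta>), is its
  inverse on bounded functions.\<close>

definition dir :: "(nat \<Rightarrow> complex) \<Rightarrow> nat \<Rightarrow> complex" where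
  "dir L k = (\<Sum>\<^sub>\<infinity>c\<in>C. of_real (real c powr (- \<beta>)) * L (k * c))"

definition dir_inv :: "(nat \<Rightarrow> complex) \<Rightarrow> nat \<Rightarrow> complex" where
  "dir_inv L k = (\<Sum>\<^sub>\<infinity>d\<in>C. of_real (moebius d * real d powr (- \<beta>)) * L (k * d))"

lemma Z_ge_1: "1 \<le> Z"
proof -
  have "(\<Sum>c\<in>{1}. real c powr (- \<beta>)) \<le> Z"
    unfolding Z_def by (rule finite_sum_le_infsum[OF summable]) (use one in auto)
  then show ?thesis by simp
qed

lemma dir_summable:
  assumes "\<And>x. norm (L x :: complex) \<le> B"
  shows "(\<lambda>c. of_real (real c powr (- \<beta>)) * L (k * c)) summable_on C"
    "(\<lambda>d. of_real (moebius d * real d powr (- \<beta>)) * L (k * d)) summable_on C"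
proof -
  have B: "0 \<le> B" using assms[of 0] norm_ge_zero order_trans by blast
  have s: "(\<lambda>c. real c powr (- \<beta>) * B) summable_on C" by (rule summable_on_cmult_left[OF summable])
  show "(\<lambda>c. of_real (real c powr (- \<beta>)) * L (k * c)) summable_on C"
    by (rule abs_summable_summable[OF summable_on_comparison_test[OF s]])
       (use assms in \<open>auto simp: norm_mult intro!: mult_left_mono\<close>)
  show "(\<lambda>d. of_real (moebius d * real d powr (- \<beta>)) * L (k * d)) summable_on C"
  proof (rule abs_summable_summable[OF summable_on_comparison_test[OF s]])
    fix d assume "d \<in> C"
    have "norm (of_real (moebius d * real d powr (- \<beta>)) * L (k * d))
      = \<bar>moebius d\<bar> * (real d powr (- \<beta>) * norm (L (k * d)))" by (simp add: norm_mult abs_mult)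
    also have "\<dots> \<le> 1 * (real d powr (- \<beta>) * B)"
      by (rule mult_mono) (use assms abs_moebius_le in \<open>auto intro!: mult_left_mono\<close>)
    finally show "norm (of_real (moebius d * real d powr (- \<beta>)) * L (k * d)) \<le> real d powr (- \<beta>) * B" by simp
  qed auto
qed

text \<open>The absolutely convergent double sum is regrouped by N = cd; the moebius function summed
  over the divisors of N removes every N except 1. Reading the same sum in the two orders of
  iteration gives \<open>dir_dir_inv\<close> and \<open>dir_inv_dir\<close>.\<close>

lemma double_sum:
  fixes k :: nat
  assumes L: "\<And>x. norm (L x :: complex) \<le> B"
  defines "H \<equiv> \<lambda>(c, d). of_real (moebius d * real (c * d) powr (- \<beta>)) * L (k * (c * d))"
  shows "H summable_on C \<times> C" "(\<Sum>\<^sub>\<infinity>x\<in>C \<times> C. H x) = L k"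
proof -
  have B: "0 \<le> B" using L[of 0] norm_ge_zero order_trans by blast
  let ?w = "\<lambda>c. real c powr (- \<beta>)"
  have s2: "(\<lambda>(c, d). ?w c * ?w d) summable_on (C \<times> C)"
    by (rule summable_on_product_nonneg[OF summable summable]) auto
  have "(\<lambda>x. norm (H x)) summable_on (C \<times> C)"
  proof (rule summable_on_comparison_test[OF summable_on_cmult_right[OF s2, of B]])
    fix x assume "x \<in> C \<times> C"
    then obtain c d where x: "x = (c, d)" by auto
    have "norm (H x) = \<bar>moebius d\<bar> * (?w c * ?w d) * norm (L (k * (c * d)))"
      by (simp add: x H_def norm_mult abs_mult powr_mult)
    also have "\<dots> \<le> (1 * (?w c * ?w d)) * B"
      by (intro mult_mono mult_right_mono abs_moebius_le L) auto
    finally show "norm (H x) \<le> B * (case x of (c, d) \<Rightarrow> ?w c * ?w d)" by (simp add: x mult_ac)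
  qed auto
  then show s: "H summable_on C \<times> C" by (rule abs_summable_summable)
  let ?S = "SIGMA N:C. {d. d dvd N}" and ?g = "\<lambda>(N, d). (N div d, d)"
  have bij: "bij_betw ?g ?S (C \<times> C)"
  proof (rule bij_betwI[where g = "\<lambda>(c, d). (c * d, d)"])
    show "?g \<in> ?S \<rightarrow> C \<times> C" using dvd by (auto elim!: dvdE) 
    show "(\<lambda>(c, d). (c * d, d)) \<in> C \<times> C \<rightarrow> ?S" using mult by auto
    show "\<And>x. x \<in> C \<times> C \<Longrightarrow> ?g ((\<lambda>(c, d). (c * d, d)) x) = x" using zero by (auto intro: gr0I)
  qed (use zero in auto)
  have "(\<Sum>\<^sub>\<infinity>x\<in>C \<times> C. H x) = (\<Sum>\<^sub>\<infinity>x\<in>?S. H (?g x))"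
    by (rule infsum_reindex_bij_betw[OF bij, symmetric])
  also have "\<dots> = (\<Sum>\<^sub>\<infinity>N\<in>C. \<Sum>\<^sub>\<infinity>d\<in>{d. d dvd N}. H (?g (N, d)))"
    by (rule infsum_Sigma_banach[symmetric])
       (use summable_on_reindex_bij_betw[OF bij, of H] s in simp)
  also have "\<dots> = (\<Sum>\<^sub>\<infinity>N\<in>C. if N = 1 then L k else 0)"
  proof (rule infsum_cong)
    fix N assume N: "N \<in> C"
    then have N0: "N > 0" using zero by (auto intro: gr0I)
    have "(\<Sum>\<^sub>\<infinity>d\<in>{d. d dvd N}. H (?g (N, d))) = (\<Sum>d | d dvd N. H (?g (N, d)))"
      using N0 by simp
    also have "\<dots> = (\<Sum>d | d dvd N. of_real (moebius d) * (of_real (?w N) * L (k * N)))"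
    proof (rule sum.cong)
      fix d assume "d \<in> {d. d dvd N}"
      then have "N div d * d = N" by simp
      then have "H (?g (N, d)) = of_real (moebius d * ?w N) * L (k * N)"
        unfolding H_def prod.case by (simp only:)
      then show "H (?g (N, d)) = of_real (moebius d) * (of_real (?w N) * L (k * N))" by simp
    qed simp
    also have "\<dots> = of_real (\<Sum>d | d dvd N. moebius d) * (of_real (?w N) * L (k * N))"
      by (simp add: sum_distrib_right)
    finally show "(\<Sum>\<^sub>\<infinity>d\<in>{d. d dvd N}. H (?g (N, d))) = (if N = 1 then L k else 0)"
      using N0 by (simp add: moebius_sum)
  qed
  also have "\<dots> = (\<Sum>\<^sub>\<infinity>N\<in>{1::nat}. L k)"
    by (rule infsum_cong_neutral) (use one in auto)
  finally show "(\<Sum>\<^sub>\<infinity>x\<in>C \<times> C. H x) = L k" by simp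
qed

lemma dir_dir_inv:
  assumes L: "\<And>x. norm (L x :: complex) \<le> B"
  shows "dir (dir_inv L) k = L k"
proof -
  let ?H = "\<lambda>(c, d). of_real (moebius d * real (c * d) powr (- \<beta>)) * L (k * (c * d))"
  have "dir (dir_inv L) k = (\<Sum>\<^sub>\<infinity>c\<in>C. \<Sum>\<^sub>\<infinity>d\<in>C. ?H (c, d))"
    unfolding dir_def dir_inv_def infsum_cmult_right'[symmetric]
    by (intro infsum_cong) (simp add: powr_mult mult_ac)
  also have "\<dots> = L k"
    using infsum_Sigma_banach[OF double_sum(1)[where L = L and k = k, OF L]] double_sum(2)[where L = L and k = k, OF L]
    by simp
  finally show ?thesis .
qed

lemma dir_inv_dir:
  assumes L: "\<And>x. norm (L x :: complex) \<le> B"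
  shows "dir_inv (dir L) k = L k"
proof -
  let ?H = "\<lambda>(c, d). of_real (moebius d * real (c * d) powr (- \<beta>)) * L (k * (c * d))"
  note ds = double_sum[where L = L and k = k, OF L]
  have "dir_inv (dir L) k = (\<Sum>\<^sub>\<infinity>d\<in>C. \<Sum>\<^sub>\<infinity>c\<in>C. ?H (c, d))"
    unfolding dir_def dir_inv_def infsum_cmult_right'[symmetric]
    by (intro infsum_cong) (simp add: powr_mult mult_ac)
  also have "\<dots> = (\<Sum>\<^sub>\<infinity>c\<in>C. \<Sum>\<^sub>\<infinity>d\<in>C. ?H (c, d))"
    by (rule infsum_swap_banach[symmetric]) (use ds(1) in simp)
  also have "\<dots> = L k" using infsum_Sigma_banach[OF ds(1)] ds(2) by simp
  finally show ?thesis .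
qed

text \<open>For periodic L an infinite sum over C involves only n values of L. This is why the
  weights of a KMS state depend on finitely many of its values and are weak* continuous.\<close>

lemma infsum_mod_classes:
  assumes n: "1 \<le> n" and per: "\<And>x. L (x mod n) = (L x :: complex)" and g: "g summable_on C"
  shows "(\<Sum>\<^sub>\<infinity>d\<in>C. g d * L (k * d)) = (\<Sum>r<n. (\<Sum>\<^sub>\<infinity>d\<in>{d \<in> C. k * d mod n = r}. g d) * L r)"
proof -
  have sub: "g summable_on {d \<in> C. k * d mod n = r}" for r
    by (rule summable_on_subset_banach[OF g]) auto
  have "(\<Sum>\<^sub>\<infinity>d\<in>C. g d * L (k * d)) = (\<Sum>\<^sub>\<infinity>d\<in>(\<Union>r\<in>{..<n}. {d \<in> C. k * d mod n = r}). g d * L (k * d mod n))"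
    using n by (intro infsum_cong_neutral) (auto simp: per)
  also have "\<dots> = (\<Sum>r<n. \<Sum>\<^sub>\<infinity>d\<in>{d \<in> C. k * d mod n = r}. g d * L (k * d mod n))"
  proof (rule sum_infsum[symmetric])
    show "(\<lambda>d. g d * L (k * d mod n)) summable_on {d \<in> C. k * d mod n = r}" for r
      using summable_on_cmult_left[OF sub[of r], of "L r"] by (rule summable_on_cong[THEN iffD1, rotated]) auto
  qed auto
  also have "\<dots> = (\<Sum>r<n. (\<Sum>\<^sub>\<infinity>d\<in>{d \<in> C. k * d mod n = r}. g d) * L r)"
    unfolding infsum_cmult_left'[symmetric] by (intro sum.cong infsum_cong) auto
  finally show ?thesis .
qed

text \<open>Positivity of a state is available only for sums over the divisors of a single D. The
  products of all elements of C up to i have divisor sets that exhaust C, so these finite sums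
  converge to the full moebius sum.\<close>

lemma dir_inv_limit:
  assumes L: "\<And>x. norm (L x :: complex) \<le> B"
  shows "(\<lambda>i. \<Sum>d | d dvd (\<Prod>c\<in>C \<inter> {..i}. c). of_real (moebius d * real d powr (- \<beta>)) * L (k * d))
    \<longlonglongrightarrow> dir_inv L k" "\<And>i. (\<Prod>c\<in>C \<inter> {..i}. c) \<in> C"
proof -
  let ?D = "\<lambda>i. \<Prod>c\<in>C \<inter> {..i}. c"
  have DC: "\<Prod>X \<in> C" if "finite X" "X \<subseteq> C" for X
    using that by (induction X rule: finite_induct) (use one mult in auto)
  show D: "?D i \<in> C" for i by (rule DC) auto
  have D0: "?D i \<noteq> 0" for i using D[of i] zero by metis
  have "filterlim (\<lambda>i. {d. d dvd ?D i}) (finite_subsets_at_top C) sequentially"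
    unfolding filterlim_finite_subsets_at_top
  proof (intro allI impI)
    fix X assume X: "finite X \<and> X \<subseteq> C"
    show "\<forall>\<^sub>F i in sequentially. finite {d. d dvd ?D i} \<and> X \<subseteq> {d. d dvd ?D i} \<and> {d. d dvd ?D i} \<subseteq> C"
      using eventually_ge_at_top[of "Max (insert 0 X)"]
    proof eventually_elim
      case (elim i)
      have "finite {d. d dvd ?D i}"
        by (rule finite_divisors_nat) (use D0[of i] in \<open>simp only: neq0_conv\<close>)
      moreover have "d dvd ?D i" if "d \<in> X" for d
      proof -
        have "d \<le> i" using elim X that by (meson Max_ge finite_insert insertCI le_trans)
        then show ?thesis using X that by (intro dvd_prodI) auto
      qed
      moreover have "{d. d dvd ?D i} \<subseteq> C" using D dvd by auto
      ultimately show ?case by auto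
    qed
  qed
  moreover have "((\<lambda>d. of_real (moebius d * real d powr (- \<beta>)) * L (k * d)) has_sum dir_inv L k) C"
    unfolding dir_inv_def by (rule has_sum_infsum[OF dir_summable(2)[OF L]])
  ultimately show "(\<lambda>i. \<Sum>d | d dvd ?D i. of_real (moebius d * real d powr (- \<beta>)) * L (k * d)) \<longlonglongrightarrow> dir_inv L k"
    unfolding has_sum_def by (rule filterlim_compose[rotated])
qed

definition G :: "nat \<Rightarrow> nat \<Rightarrow> complex" where
  "G n k = of_real (1 / Z) * (\<Sum>\<^sub>\<infinity>c\<in>C. of_real (real c powr (- \<beta>)) * omega n ^ (k * c))"

lemma G_eq_dir: "G n k = of_real (1 / Z) * dir (\<lambda>x. omega n ^ x) k"
  by (simp add: G_def dir_def)

lemma dir_sum: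
  assumes "\<And>j x. norm (f j x :: complex) \<le> B" "finite J"
  shows "dir (\<lambda>x. \<Sum>j\<in>J. a j * f j x) k = (\<Sum>j\<in>J. a j * dir (f j) k)"
proof -
  have "dir (\<lambda>x. \<Sum>j\<in>J. a j * f j x) k
    = (\<Sum>\<^sub>\<infinity>c\<in>C. \<Sum>j\<in>J. a j * (of_real (real c powr (- \<beta>)) * f j (k * c)))"
    unfolding dir_def by (simp add: sum_distrib_left mult_ac)
  also have "\<dots> = (\<Sum>j\<in>J. \<Sum>\<^sub>\<infinity>c\<in>C. a j * (of_real (real c powr (- \<beta>)) * f j (k * c)))"
    by (intro infsum_finite_sum(2) summable_on_cmult_right assms(2) dir_summable(1)[OF assms(1)])
  finally show ?thesis by (simp add: dir_def infsum_cmult_right')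
qed

lemma sum_G_eq_dir:
  assumes "1 \<le> n"
  shows "(\<Sum>j<n. x j * G n (j * k)) = dir (\<lambda>l. of_real (1 / Z) * (\<Sum>j<n. x j * omega n ^ (j * l))) k"
proof -
  have "dir (\<lambda>l. \<Sum>j<n. (of_real (1 / Z) * x j) * omega n ^ (j * l)) k
     = (\<Sum>j<n. (of_real (1 / Z) * x j) * dir (\<lambda>l. omega n ^ (j * l)) k)"
    by (rule dir_sum[of _ 1]) auto
  moreover have "dir (\<lambda>l. omega n ^ (j * l)) k = dir (\<lambda>l. omega n ^ l) (j * k)" for j
    by (simp add: dir_def mult.assoc)
  ultimately show ?thesis by (simp add: G_eq_dir sum_distrib_left mult_ac)
qed

text \<open>The coefficient of G_j in an expansion of L: \<open>dir_inv\<close> undoes the sum over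
  c, and the inverse Fourier transform, with \<open>(n - 1) * j\<close> for -j, isolates j.\<close>

definition weight :: "nat \<Rightarrow> (nat \<Rightarrow> complex) \<Rightarrow> nat \<Rightarrow> complex" where
  "weight n L j = of_real Z * ((1 / of_nat n) * (\<Sum>k<n. omega n ^ ((n - 1) * j * k) * dir_inv L k))"

lemma weight_sum_G:
  assumes n: "1 \<le> n" and i: "i < n"
  shows "weight n (\<lambda>k. \<Sum>j<n. x j * G n (j * k)) i = x i"
proof -
  let ?l = "\<lambda>l. of_real (1 / Z) * (\<Sum>j<n. x j * omega n ^ (j * l))"
  have "norm (?l y) \<le> 1 / Z * (\<Sum>j<n. norm (x j))" for y
  proof -
    have "norm (\<Sum>j<n. x j * omega n ^ (j * y)) \<le> (\<Sum>j<n. norm (x j * omega n ^ (j * y)))" by (rule norm_sum)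
    then show ?thesis using Z_ge_1 by (simp add: norm_mult norm_divide divide_right_mono)
  qed
  then have d: "dir_inv (dir ?l) k = ?l k" for k by (rule dir_inv_dir)
  have "weight n (dir ?l) i = (1 / of_nat n) * (\<Sum>k<n. omega n ^ ((n - 1) * i * k) * (\<Sum>j<n. x j * omega n ^ (j * k)))"
    unfolding weight_def d using Z_ge_1 by (simp add: sum_distrib_left mult_ac)
  then show ?thesis
    unfolding sum_G_eq_dir[OF n] fourier_inversion[OF n i] .
qed

text \<open>The assumption \<open>pos\<close> is phi(e_D E_j) \<ge> 0 written in terms of L alone.
  It passes to the limit along \<open>dir_inv_limit\<close>, while the expansion itself is inversion
  of \<open>dir\<close> followed by Fourier inversion.\<close>

lemma decomposition:
  assumes n: "1 \<le> n" and per: "\<And>k. L (k mod n) = (L k :: complex)"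
    and L0: "L 0 = 1" and L1: "\<And>k. norm (L k) \<le> 1"
    and pos: "\<And>D j. 1 \<le> D \<Longrightarrow> j < n \<Longrightarrow> (1 / of_nat n) * (\<Sum>k<n. omega n ^ ((n - 1) * j * k) *
       (\<Sum>d | d dvd D. of_real (moebius d * real d powr (- \<beta>)) * L (k * d))) \<in> \<real>\<^sub>\<ge>\<^sub>0"
  shows "j < n \<Longrightarrow> weight n L j \<in> \<real>\<^sub>\<ge>\<^sub>0" "(\<Sum>j<n. weight n L j) = 1"
    "L k = (\<Sum>j<n. weight n L j * G n (j * k))"
proof -
  have per': "dir_inv L (k mod n) = dir_inv L k" for k
    unfolding dir_inv_def by (intro infsum_cong) (metis per mod_mult_left_eq)
  have inv: "(\<Sum>j<n. weight n L j * omega n ^ (j * k)) = of_real Z * dir_inv L k" for k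
  proof -
    have "(\<Sum>j<n. weight n L j * omega n ^ (j * k)) = of_real Z * (\<Sum>j<n. ((1 / of_nat n) *
      (\<Sum>k<n. omega n ^ ((n - 1) * j * k) * dir_inv L k)) * omega n ^ (j * k))"
      unfolding weight_def sum_distrib_left[of "of_real Z"] by (intro sum.cong refl mult.assoc)
    then show ?thesis using fourier_inversion'[of n "dir_inv L" k] n per' by (simp only:)
  qed
  have Z0: "Z \<noteq> 0" using Z_ge_1 by simp
  \<comment> \<open>At k = 0 all arguments kc are 0, so \<open>dir\<close> only multiplies by Z.
    This makes the weights add up to L(0).\<close>
  have "of_real Z * dir_inv L 0 = dir (dir_inv L) 0"
  proof -
    have "dir (dir_inv L) 0 = (\<Sum>\<^sub>\<infinity>c\<in>C. of_real (real c powr (- \<beta>)) * dir_inv L 0)" by (simp add: dir_def)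
    also have "\<dots> = (\<Sum>\<^sub>\<infinity>c\<in>C. of_real (real c powr (- \<beta>))) * dir_inv L 0" by (rule infsum_cmult_left')
    also have "((\<lambda>c. complex_of_real (real c powr (- \<beta>))) has_sum of_real Z) C"
      unfolding has_sum_of_real_iff Z_def by (rule has_sum_infsum[OF summable])
    then have "(\<Sum>\<^sub>\<infinity>c\<in>C. complex_of_real (real c powr (- \<beta>))) = of_real Z" by (rule infsumI)
    finally show ?thesis by simp
  qed
  then show "(\<Sum>j<n. weight n L j) = 1"
    using inv[of 0] dir_dir_inv[of L 1 0] L1 L0 by simp
  have "L k = dir (dir_inv L) k" using dir_dir_inv[of L 1 k] L1 by simp
  also have "dir_inv L = (\<lambda>l. of_real (1 / Z) * (\<Sum>j<n. weight n L j * omega n ^ (j * l)))"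
    unfolding inv using Z0 by (simp add: fun_eq_iff)
  finally show "L k = (\<Sum>j<n. weight n L j * G n (j * k))" unfolding sum_G_eq_dir[OF n] .
  assume j: "j < n"
  have "(\<lambda>i. (1 / of_nat n) * (\<Sum>k<n. omega n ^ ((n - 1) * j * k) *
       (\<Sum>d | d dvd (\<Prod>c\<in>C \<inter> {..i}. c). of_real (moebius d * real d powr (- \<beta>)) * L (k * d))))
    \<longlonglongrightarrow> (1 / of_nat n) * (\<Sum>k<n. omega n ^ ((n - 1) * j * k) * dir_inv L k)"
    by (intro tendsto_mult_left tendsto_sum dir_inv_limit(1)[OF L1])
  then have "(1 / of_nat n) * (\<Sum>k<n. omega n ^ ((n - 1) * j * k) * dir_inv L k) \<in> \<real>\<^sub>\<ge>\<^sub>0"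
  proof (rule closed_sequentially[OF closed_nonneg_Reals_complex, rotated])
    show "(1 / of_nat n) * (\<Sum>k<n. omega n ^ ((n - 1) * j * k) *
       (\<Sum>d | d dvd (\<Prod>c\<in>C \<inter> {..i}. c). of_real (moebius d * real d powr (- \<beta>)) * L (k * d))) \<in> \<real>\<^sub>\<ge>\<^sub>0" for i
      using dir_inv_limit(2)[OF L1, of i] zero by (intro pos j) (metis One_nat_def Suc_leI gr0I)
  qed
  moreover have "complex_of_real Z \<in> \<real>\<^sub>\<ge>\<^sub>0" using Z_ge_1 by simp
  ultimately show "weight n L j \<in> \<real>\<^sub>\<ge>\<^sub>0" unfolding weight_def by (metis nonneg_Reals_mult_I)
qed

end

section \<open>Primes outside a subgroup of units\<close>

text \<open>Members of one class modulo p are told apart by their quotients by p, which are at most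
  \<open>K div p\<close>; the quotient 0 accounts for the summand 1.\<close>

lemma card_residue_class_le:
  fixes p :: nat
  assumes "p > 0" and A: "A \<subseteq> {..<K}" and same: "\<And>k l. k \<in> A \<Longrightarrow> l \<in> A \<Longrightarrow> [k = l] (mod p)"
  shows "real (card A) \<le> real K / real p + 1"
proof -
  have "inj_on (\<lambda>k. k div p) A"
  proof (rule inj_onI)
    fix k l assume kl: "k \<in> A" "l \<in> A" "k div p = l div p"
    have "k mod p = l mod p" using same[OF kl(1,2)] by (simp only: cong_def)
    have "k = k div p * p + k mod p" by simp
    also have "\<dots> = l div p * p + l mod p" by (simp only: kl(3) \<open>k mod p = l mod p\<close>)
    also have "\<dots> = l" by simp
    finally show "k = l" .
  qed
  moreover have "(\<lambda>k. k div p) ` A \<subseteq> {..K div p}" using A by (force intro!: div_le_mono)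
  ultimately have "card A \<le> card {..K div p}" by (rule card_inj_on_le) simp
  then have "real (card A) \<le> real (K div p) + 1" by simp
  also have "real (K div p) \<le> real K / real p" by (rule of_nat_div_le_of_nat)
  finally show ?thesis by simp
qed

text \<open>Elementary replacement for Dirichlet's theorem: in the progression
  \<open>c \<equiv> u (mod n)\<close>, \<open>c \<equiv> 1 (mod \<Prod>B\<^sub>0)\<close> every term has a prime factor outside \<open>H\<close> and outside the
  finite set \<open>B\<^sub>0\<close>, so the reciprocals of such primes cannot have a small sum.\<close>

lemma units_subset_of_summable_primes:
  fixes H :: "nat set"
  assumes n: "1 \<le> n" and H1: "1 \<in> H" and Hm: "\<And>a b. a \<in> H \<Longrightarrow> b \<in> H \<Longrightarrow> a * b \<in> H"
    and Hc: "\<And>a b. [a = b] (mod n) \<Longrightarrow> a \<in> H \<Longrightarrow> b \<in> H"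
    and sm: "(\<lambda>p. 1 / real p) summable_on {p. prime p \<and> coprime p n \<and> p \<notin> H}"
    and u: "coprime u n"
  shows "u \<in> H"
proof (rule ccontr)
  assume uH: "u \<notin> H"
  define B where "B = {p::nat. prime p \<and> coprime p n \<and> p \<notin> H}"
  let ?f = "\<lambda>p. 1 / real p"
  have sB: "?f summable_on B" using sm by (simp add: B_def)
  have tail: "\<exists>F. finite F \<and> F \<subseteq> B \<and> (\<forall>X. finite X \<longrightarrow> X \<subseteq> B - F \<longrightarrow> sum ?f X < e)" if "e > 0" for e
  proof -
    have "(?f has_sum infsum ?f B) B" using sB by (rule has_sum_infsum)
    then have "\<forall>\<^sub>F F in finite_subsets_at_top B. dist (sum ?f F) (infsum ?f B) < e"
      unfolding has_sum_def tendsto_iff using \<open>e > 0\<close> by blast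
    then obtain F where F: "finite F" "F \<subseteq> B" "dist (sum ?f F) (infsum ?f B) < e"
      unfolding eventually_finite_subsets_at_top by blast
    have "sum ?f X < e" if X: "finite X" "X \<subseteq> B - F" for X
    proof -
      have "sum ?f X + sum ?f F = sum ?f (X \<union> F)"
        using X F by (intro sum.union_disjoint[symmetric]) auto
      also have "\<dots> \<le> infsum ?f B"
        using X F by (intro finite_sum_le_infsum[OF sB]) auto
      finally show ?thesis using F(3) by (simp add: dist_real_def)
    qed
    then show ?thesis using F by blast
  qed
  \<comment> \<open>The tail 1/4 bounds the share of the indices k < K that primes of B outside B0
    can cover through their densities 1/p.\<close>
  obtain B0 where B0: "finite B0" "B0 \<subseteq> B" "\<And>X. finite X \<Longrightarrow> X \<subseteq> B - B0 \<Longrightarrow> sum ?f X < 1 / 4"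
    using tail[of "1/4"] by auto
  define M where "M = \<Prod>B0"
  define N where "N = n * M"
  have primeB: "prime p \<and> coprime p n \<and> p \<notin> H" if "p \<in> B" for p using that by (simp add: B_def)
  have M0: "M > 0" unfolding M_def
  proof (rule prod_pos)
    fix p assume "p \<in> B0"
    then show "0 < p" using primeB B0(2) prime_gt_0_nat by blast
  qed
  have N0: "N > 0" using n M0 by (simp add: N_def)
  have "coprime n M" unfolding M_def using B0 primeB by (intro prod_coprime_right) (auto simp: coprime_commute)
  then obtain a0 where a0: "[a0 = u] (mod n)" "[a0 = 1] (mod M)"
    using binary_chinese_remainder_nat by blast
  \<comment> \<open>Adding N preserves both congruences and makes every term of the progression
    positive.\<close>
  define a where "a = a0 + N"
  have a: "[a = u] (mod n)" "[a = 1] (mod M)" "a > 0"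
    using a0 N0 by (simp_all add: a_def N_def cong_def)
  \<comment> \<open>A second, much smaller tail shows that B has at most |F| + X/(8N) elements up to
    X. It controls the rounding error 1 per prime in \<open>card_residue_class_le\<close>, with
    primes ranging up to a + NK.\<close>
  obtain F where F: "finite F" "F \<subseteq> B" "\<And>X. finite X \<Longrightarrow> X \<subseteq> B - F \<Longrightarrow> sum ?f X < 1 / (8 * real N)"
    using tail[of "1 / (8 * real N)"] N0 by auto
  define y where "y = card F"
  have count: "real (card (B \<inter> {..X})) \<le> real y + real X / (8 * real N)" for X
  proof -
    have "B \<inter> {..X} \<subseteq> F \<union> (B \<inter> {..X} - F)" by blast
    then have "card (B \<inter> {..X}) \<le> card (F \<union> (B \<inter> {..X} - F))"
      using F by (intro card_mono) auto
    also have "\<dots> \<le> card F + card (B \<inter> {..X} - F)" by (rule card_Un_le)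
    finally have "real (card (B \<inter> {..X})) \<le> real y + real (card (B \<inter> {..X} - F))" by (simp add: y_def)
    moreover have "real (card (B \<inter> {..X} - F)) \<le> real X / (8 * real N)"
    proof -
      have "real (card (B \<inter> {..X} - F)) = (\<Sum>p\<in>B \<inter> {..X} - F. 1)" by simp
      also have "\<dots> \<le> (\<Sum>p\<in>B \<inter> {..X} - F. real X * ?f p)"
      proof (rule sum_mono)
        fix p assume "p \<in> B \<inter> {..X} - F"
        then have "p > 0" "p \<le> X" using primeB prime_gt_0_nat by auto
        then show "1 \<le> real X * ?f p" by simp
      qed
      also have "\<dots> = real X * sum ?f (B \<inter> {..X} - F)" by (rule sum_distrib_left[symmetric])
      also have "\<dots> \<le> real X * (1 / (8 * real N))"
        by (rule mult_left_mono[OF less_imp_le[OF F(3)]]) auto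
      finally show ?thesis by simp
    qed
    ultimately show ?thesis by linarith
  qed
  have bound: "real K \<le> real K / 4 + real y + real (a + N * K) / (8 * real N)" for K
  proof -
    let ?P = "(B - B0) \<inter> {..a + N * K}"
    let ?A = "\<lambda>p. {k \<in> {..<K}. p dvd a + N * k}"
    have finP: "finite ?P" by simp
    have cover: "{..<K} \<subseteq> (\<Union>p\<in>?P. ?A p)"
    proof
      fix k assume k: "k \<in> {..<K}"
      let ?c = "a + N * k"
      have c0: "?c > 0" using a by simp
      have cu: "[?c = u] (mod n)" using a(1) by (simp add: N_def cong_def mult.assoc)
      have cM: "[?c = 1] (mod M)" using a(2) by (simp add: N_def cong_def mult.assoc mult.left_commute[of n])
      have ccop: "coprime ?c n" using cong_imp_coprime[OF cong_sym[OF cu]] u by (simp add: coprime_commute)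
      have cH: "?c \<notin> H" using Hc[OF cu] uH by blast
      have "\<exists>p. prime p \<and> p dvd ?c \<and> p \<notin> H"
      proof (rule ccontr)
        assume "\<nexists>p. prime p \<and> p dvd ?c \<and> p \<notin> H"
        then have all: "\<And>p. p \<in># prime_factorization ?c \<Longrightarrow> p \<in> H"
          by (auto simp: in_prime_factors_iff)
        have "prod_mset X \<in> H" if "\<And>p. p \<in># X \<Longrightarrow> p \<in> H" for X
          using that by (induction X) (use H1 Hm in auto)
        then have "prod_mset (prime_factorization ?c) \<in> H" using all by blast
        then show False using cH c0 by (simp add: prod_mset_prime_factorization_nat)
      qed
      then obtain p where p: "prime p" "p dvd ?c" "p \<notin> H" by blast
      have "coprime p n" using ccop p(2) coprime_divisors[OF p(2) dvd_refl] by blast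
      then have pB: "p \<in> B" using p by (simp add: B_def)
      have "p \<notin> B0"
      proof
        assume "p \<in> B0"
        then have "p dvd M" unfolding M_def using B0 by (intro dvd_prodI) auto
        then have "[?c = 1] (mod p)" using cM cong_dvd_modulus_nat by blast
        moreover have "[?c = 0] (mod p)" using p(2) by (simp add: cong_0_iff)
        ultimately have "[1 = 0] (mod p)" using cong_sym cong_trans by blast
        then have "p dvd 1" by (simp only: cong_0_iff)
        then show False using p(1) by (simp add: prime_nat_iff)
      qed
      moreover have "p \<le> a + N * K"
      proof -
        have "p \<le> ?c" using p(2) c0 by (rule dvd_imp_le)
        also have "\<dots> \<le> a + N * K" using k by simp
        finally show ?thesis .
      qed
      ultimately show "k \<in> (\<Union>p\<in>?P. ?A p)" using k p pB by auto
    qed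
    have "K = card {..<K}" by simp
    also have "\<dots> \<le> card (\<Union>p\<in>?P. ?A p)" using finP by (intro card_mono[OF _ cover]) auto
    also have "\<dots> \<le> (\<Sum>p\<in>?P. card (?A p))" by (rule card_UN_le[OF finP])
    finally have "real K \<le> real (\<Sum>p\<in>?P. card (?A p))" by (simp only: of_nat_le_iff)
    also have "\<dots> = (\<Sum>p\<in>?P. real (card (?A p)))" by (rule of_nat_sum)
    also have "\<dots> \<le> (\<Sum>p\<in>?P. real K / real p + 1)"
    proof (rule sum_mono)
      fix p assume "p \<in> ?P"
      then have p: "prime p" "coprime p n" "p \<in> B" "p \<notin> B0" using primeB by auto
      have "coprime p M"
        unfolding M_def using p primeB B0 by (intro prod_coprime_right primes_coprime) auto
      then have cop: "coprime p N" using p by (simp add: N_def)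
      show "real (card (?A p)) \<le> real K / real p + 1"
      proof (rule card_residue_class_le)
        fix k l assume "k \<in> ?A p" "l \<in> ?A p"
        then have "[a + N * k = a + N * l] (mod p)"
          by (auto simp: cong_def mod_eq_0_iff_dvd)
        then have "[N * k = N * l] (mod p)" by (simp only: cong_add_lcancel_nat)
        then show "[k = l] (mod p)" using cop by (simp add: cong_mult_lcancel_nat coprime_commute)
      qed (use p prime_gt_0_nat in auto)
    qed
    also have "\<dots> = real K * sum ?f ?P + real (card ?P)"
      by (simp add: sum.distrib sum_distrib_left)
    also have "real K * sum ?f ?P \<le> real K * (1 / 4)"
      by (rule mult_left_mono[OF less_imp_le[OF B0(3)]]) (use finP in auto)
    also have "real (card ?P) \<le> real (card (B \<inter> {..a + N * K}))"
      by (intro of_nat_mono card_mono) auto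
    also have "\<dots> \<le> real y + real (a + N * K) / (8 * real N)" by (rule count)
    finally show ?thesis by simp
  qed
  have b2: "real (a + N * K) / (8 * real N) \<le> real a + real K / 8" for K
  proof -
    have "real (a + N * K) / (8 * real N) = real a / (8 * real N) + real K / 8" using N0 by (simp add: field_simps)
    moreover have "real a / (8 * real N) \<le> real a" using N0 by (simp add: divide_le_eq mult_le_cancel_left1)
    ultimately show ?thesis by simp
  qed
  \<comment> \<open>The two estimates give 5K/8 \<le> y + a, which this K violates.\<close>
  define K where "K = 4 * (y + a) + 4"
  have "real K = 4 * (real y + real a) + 4" by (simp add: K_def)
  moreover have "real K \<le> real K / 4 + real y + (real a + real K / 8)"
    using order_trans[OF bound[of K] add_left_mono[OF b2[of K]]] .
  ultimately show False by (simp add: field_simps)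
qed

section \<open>Invariance under units at low temperature\<close>

text \<open>|x - ty|^2 = (1 - t)|x|^2 + (t^2 - t)|y|^2 + t|x - y|^2. Summed along a permutation the
  first two terms merge, and (1 - t) + (t^2 - t) = (1 - t)^2.\<close>

lemma contraction_step:
  fixes g :: "nat \<Rightarrow> complex" and \<pi> :: "nat \<Rightarrow> nat" and t :: real
  assumes "bij_betw \<pi> {..<n} {..<n}"
  shows "(\<Sum>k<n. (cmod (g k - of_real t * g (\<pi> k)))\<^sup>2)
    = (1 - t)\<^sup>2 * (\<Sum>k<n. (cmod (g k))\<^sup>2) + t * (\<Sum>k<n. (cmod (g k - g (\<pi> k)))\<^sup>2)"
proof -
  have id: "(cmod (x - of_real t * y))\<^sup>2 = (1 - t) * (cmod x)\<^sup>2 + (t\<^sup>2 - t) * (cmod y)\<^sup>2 + t * (cmod (x - y))\<^sup>2"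
    for x y :: complex
    unfolding cmod_power2 by (simp add: algebra_simps power2_eq_square)
  have perm: "(\<Sum>k<n. (cmod (g (\<pi> k)))\<^sup>2) = (\<Sum>k<n. (cmod (g k))\<^sup>2)"
    by (rule sum.reindex_bij_betw[OF assms])
  have "(\<Sum>k<n. (cmod (g k - of_real t * g (\<pi> k)))\<^sup>2)
    = (1 - t) * (\<Sum>k<n. (cmod (g k))\<^sup>2) + (t\<^sup>2 - t) * (\<Sum>k<n. (cmod (g (\<pi> k)))\<^sup>2)
      + t * (\<Sum>k<n. (cmod (g k - g (\<pi> k)))\<^sup>2)"
    unfolding id by (simp add: sum.distrib sum_distrib_left)
  then show ?thesis unfolding perm by (simp add: algebra_simps power2_eq_square)
qed

lemma unit_mult_bij:
  fixes n r :: nat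
  assumes "1 \<le> n" "coprime r n"
  shows "bij_betw (\<lambda>k. r * k mod n) {..<n} {..<n}"
proof -
  have "inj_on (\<lambda>k. r * k mod n) {..<n}"
  proof (rule inj_onI)
    fix k l assume "k \<in> {..<n}" "l \<in> {..<n}" "r * k mod n = r * l mod n"
    then have "[r * k = r * l] (mod n)" by (simp add: cong_def)
    then have "[k = l] (mod n)" using assms(2) by (simp add: cong_mult_lcancel_nat)
    then show "k = l" using \<open>k \<in> {..<n}\<close> \<open>l \<in> {..<n}\<close> by (simp add: cong_def)
  qed
  moreover have "(\<lambda>k. r * k mod n) ` {..<n} \<subseteq> {..<n}" using assms by auto
  ultimately show ?thesis by (simp add: bij_betw_def endo_inj_surj)
qed

text \<open>For L(k) = phi(R^k) with phi a KMS state this is phi(e_D R^k), from the expansion of e_D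
  as the sum of moebius(d) V_d V_d^* over the divisors d of D.\<close>

definition local_L :: "real \<Rightarrow> (nat \<Rightarrow> complex) \<Rightarrow> nat \<Rightarrow> nat \<Rightarrow> complex" where
  "local_L \<beta> L D k = (\<Sum>d | d dvd D. of_real (moebius d * real d powr (- \<beta>)) * L (k * d))"

lemma moebius_mult_prime:
  assumes "prime p" "coprime p d" "d > 0"
  shows "moebius (p * d) = - moebius d"
proof (cases "squarefree d")
  case True
  then have "squarefree (p * d)"
    using squarefree_mult_coprime[OF assms(2) squarefree_prime[OF assms(1)]] by blast
  moreover have "p \<notin> prime_factors d" using assms by (auto simp: in_prime_factors_iff coprime_absorb_left)
  moreover have "prime_factors (p * d) = insert p (prime_factors d)"
    using assms by (auto simp: prime_factors_product prime_prime_factors prime_gt_0_nat)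
  ultimately show ?thesis using True by (simp add: moebius_def)
next
  case False
  then have "\<not> squarefree (p * d)" using squarefree_mono[of d "p * d"] by auto
  then show ?thesis using False by (simp add: moebius_def)
qed

text \<open>The divisors of pD are those of D and their multiples by p, on which the moebius
  function changes sign. In operator terms, e_(pD) = e_D - V_p e_D V_p^*.\<close>

lemma local_L_mult_prime:
  assumes p: "prime p" and D: "D > 0" "coprime p D"
  shows "local_L \<beta> L (p * D) k = local_L \<beta> L D k - of_real (real p powr (- \<beta>)) * local_L \<beta> L D (k * p)"
proof -
  let ?h = "\<lambda>d. of_real (moebius d * real d powr (- \<beta>)) * L (k * d)"
  have p0: "p > 0" using p prime_gt_0_nat by blast
  have un: "{d. d dvd p * D} = {d. d dvd D} \<union> (*) p ` {d. d dvd D}"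
  proof (intro equalityI subsetI)
    fix d assume d: "d \<in> {d. d dvd p * D}"
    show "d \<in> {d. d dvd D} \<union> (*) p ` {d. d dvd D}"
    proof (cases "p dvd d")
      case True
      then obtain e where "d = p * e" by blast
      then show ?thesis using d p0 by auto
    next
      case False
      then have "coprime d p" using p prime_imp_coprime coprime_commute by blast
      then show ?thesis using d by (simp add: coprime_dvd_mult_right_iff)
    qed
  qed auto
  have disj: "{d. d dvd D} \<inter> (*) p ` {d. d dvd D} = {}"
  proof -
    have "\<not> p * e dvd D" for e
      using D(2) p by (metis coprime_absorb_left dvd_mult_left not_prime_unit)
    then show ?thesis by auto
  qed
  have "local_L \<beta> L (p * D) k = (\<Sum>d | d dvd D. ?h d) + (\<Sum>d\<in>(*) p ` {d. d dvd D}. ?h d)"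
    unfolding local_L_def un using D by (intro sum.union_disjoint disj) auto
  also have "(\<Sum>d\<in>(*) p ` {d. d dvd D}. ?h d) = (\<Sum>d | d dvd D. ?h (p * d))"
    using p0 by (subst sum.reindex) (auto simp: inj_on_def)
  also have "\<dots> = (\<Sum>d | d dvd D. - (of_real (real p powr (- \<beta>)) * (of_real (moebius d * real d powr (- \<beta>)) * L (k * p * d))))"
  proof (rule sum.cong)
    fix d assume "d \<in> {d. d dvd D}"
    then have "coprime p d" "d > 0" using D coprime_divisors[of p p d D] by (auto intro: gr0I)
    then show "?h (p * d) = - (of_real (real p powr (- \<beta>)) * (of_real (moebius d * real d powr (- \<beta>)) * L (k * p * d)))"
      using moebius_mult_prime[OF p] by (simp add: powr_mult mult_ac)
  qed simp
  finally show ?thesis unfolding local_L_def by (simp add: sum_negf sum_distrib_left)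
qed

text \<open>Let t = p^(-\<beta>), Q the product of the 1 - t and S the sum of the t over F. By
  \<open>contraction_step\<close>, adjoining p to D multiplies the square sum of
  \<open>local_L\<close> by (1 - t)^2 and adds t times the square sum of the differences under k ->
  rk; the latter shrinks at most by (1 - t)^2 as well. Hence the square sum is at least Q^2 S times
  the square sum of L(k) - L(rk). On the other hand \<open>bd\<close> bounds every value by the
  value Q at 0, so the square sum is at most n Q^2.\<close>

lemma unit_invariance_step:
  fixes L :: "nat \<Rightarrow> complex"
  assumes n: "1 \<le> n" and per: "\<And>k. L (k mod n) = L k" and L0: "L 0 = 1" and beta: "0 < \<beta>"
    and bd: "\<And>D k. 1 \<le> D \<Longrightarrow> cmod (local_L \<beta> L D k) \<le> Re (local_L \<beta> L D 0)"
    and r: "coprime r n" and F: "finite F" "\<And>p. p \<in> F \<Longrightarrow> prime p \<and> [p = r] (mod n)"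
  shows "(\<Sum>p\<in>F. real p powr (- \<beta>)) * (\<Sum>k<n. (cmod (L k - L (r * k)))\<^sup>2) \<le> real n"
proof -
  define \<pi> where "\<pi> k = r * k mod n" for k
  have bij: "bij_betw \<pi> {..<n} {..<n}" unfolding \<pi>_def by (rule unit_mult_bij[OF n r])
  define nrm where "nrm g = (\<Sum>k<n. (cmod (g k))\<^sup>2)" for g :: "nat \<Rightarrow> complex"
  have nrm0: "nrm g \<ge> 0" for g by (simp add: nrm_def sum_nonneg)
  let ?\<delta> = "\<lambda>D k. local_L \<beta> L D k - local_L \<beta> L D (\<pi> k)"
  have lper: "local_L \<beta> L D (k mod n) = local_L \<beta> L D k" for D k
    unfolding local_L_def by (intro sum.cong refl) (metis per mod_mult_left_eq)
  have F2: "\<forall>q\<in>F. prime q \<and> [q = r] (mod n)" using F(2) by blast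
  \<comment> \<open>One joint induction, since \<open>main\<close> for the enlarged set relies on
    \<open>mono\<close> for the smaller one.\<close>
  have zero: "local_L \<beta> L (\<Prod>F) 0 = of_real (\<Prod>p\<in>F. 1 - real p powr (- \<beta>))"
    and main: "nrm (local_L \<beta> L (\<Prod>F)) \<ge> (\<Prod>p\<in>F. 1 - real p powr (- \<beta>))\<^sup>2 * ((\<Sum>p\<in>F. real p powr (- \<beta>)) * nrm (?\<delta> 1))"
    and mono: "nrm (?\<delta> (\<Prod>F)) \<ge> (\<Prod>p\<in>F. 1 - real p powr (- \<beta>))\<^sup>2 * nrm (?\<delta> 1)"
    using F(1) F2
  proof (induction F rule: finite_induct)
    case empty
    { case 1 show ?case using L0 by (simp add: local_L_def moebius_def) }
    { case 2 show ?case using nrm0 by simp }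
    { case 3 show ?case by simp }
  next
    case (insert p F)
    have p: "prime p" "[p = r] (mod n)" and F: "\<forall>q\<in>F. prime q \<and> [q = r] (mod n)"
      if "\<forall>q\<in>insert p F. prime q \<and> [q = r] (mod n)"
      using that by auto
    let ?D = "\<Prod>F" and ?t = "real p powr (- \<beta>)"
    have step: "local_L \<beta> L (p * ?D) k = local_L \<beta> L ?D k - of_real ?t * local_L \<beta> L ?D (\<pi> k)"
      "0 \<le> ?t" "?t < 1"
      if h: "\<forall>q\<in>insert p F. prime q \<and> [q = r] (mod n)" for k
    proof -
      note pp = p[OF h] and FF = F[OF h]
      have "?D > 0" using FF by (intro prod_pos) (use prime_gt_0_nat in blast)
      moreover have "coprime p ?D" using FF pp insert.hyps by (intro prod_coprime_right primes_coprime) auto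
      ultimately have "local_L \<beta> L (p * ?D) k = local_L \<beta> L ?D k - of_real ?t * local_L \<beta> L ?D (k * p)"
        by (intro local_L_mult_prime pp)
      also have "local_L \<beta> L ?D (k * p) = local_L \<beta> L ?D (\<pi> k)"
      proof -
        have "[k * p = r * k] (mod n)" using cong_mult[OF cong_refl pp(2), of k] by (simp add: mult.commute)
        then show ?thesis unfolding \<pi>_def using lper[of ?D "k * p"] by (simp add: cong_def)
      qed
      finally show "local_L \<beta> L (p * ?D) k = local_L \<beta> L ?D k - of_real ?t * local_L \<beta> L ?D (\<pi> k)" .
      show "0 \<le> ?t" by simp
      have "real p > 1" using prime_gt_1_nat[OF pp(1)] by simp
      then show "?t < 1" using powr_less_mono[of "- \<beta>" 0 "real p"] beta by simp
    qed
    have eqs: "nrm (local_L \<beta> L (p * ?D)) = (1 - ?t)\<^sup>2 * nrm (local_L \<beta> L ?D) + ?t * nrm (?\<delta> ?D)"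
      "nrm (?\<delta> (p * ?D)) \<ge> (1 - ?t)\<^sup>2 * nrm (?\<delta> ?D)"
      if h: "\<forall>q\<in>insert p F. prime q \<and> [q = r] (mod n)"
    proof -
      show "nrm (local_L \<beta> L (p * ?D)) = (1 - ?t)\<^sup>2 * nrm (local_L \<beta> L ?D) + ?t * nrm (?\<delta> ?D)"
        unfolding nrm_def step(1)[OF h] by (rule contraction_step[OF bij])
      have e: "?\<delta> (p * ?D) k = ?\<delta> ?D k - of_real ?t * ?\<delta> ?D (\<pi> k)" for k
        unfolding step(1)[OF h] by (simp add: algebra_simps)
      have "nrm (?\<delta> (p * ?D)) = (1 - ?t)\<^sup>2 * nrm (?\<delta> ?D) + ?t * (\<Sum>k<n. (cmod (?\<delta> ?D k - ?\<delta> ?D (\<pi> k)))\<^sup>2)"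
        unfolding nrm_def e by (rule contraction_step[OF bij])
      then show "nrm (?\<delta> (p * ?D)) \<ge> (1 - ?t)\<^sup>2 * nrm (?\<delta> ?D)" by (simp add: sum_nonneg)
    qed
    { case 1
      have "\<pi> 0 = 0" by (simp add: \<pi>_def)
      then show ?case using step(1)[OF 1, of 0] insert.IH(1)[OF F[OF 1]] insert.hyps by (simp add: algebra_simps) }
    { case 2
      let ?Q = "\<Prod>p\<in>F. 1 - real p powr (- \<beta>)" and ?S = "\<Sum>p\<in>F. real p powr (- \<beta>)"
      have t: "0 \<le> ?t" "?t < 1" using step(2,3)[OF 2] by auto
      have "?t * nrm (?\<delta> ?D) \<ge> ?t * (?Q\<^sup>2 * nrm (?\<delta> 1))"
        by (rule mult_left_mono[OF insert.IH(3)[OF F[OF 2]] t(1)])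
      \<comment> \<open>A factor (1 - t)^2 \<le> 1 is given away so that the new term carries the
        square of the enlarged product, like the old ones.\<close>
      moreover have "?t * (?Q\<^sup>2 * nrm (?\<delta> 1)) \<ge> (1 - ?t)\<^sup>2 * (?t * (?Q\<^sup>2 * nrm (?\<delta> 1)))"
      proof -
        have "(1 - ?t)\<^sup>2 \<le> 1" using t by (simp add: power_le_one)
        then show ?thesis using t nrm0 by (intro mult_left_le_one_le) (auto intro!: mult_nonneg_nonneg)
      qed
      moreover have "(1 - ?t)\<^sup>2 * nrm (local_L \<beta> L ?D) \<ge> (1 - ?t)\<^sup>2 * (?Q\<^sup>2 * (?S * nrm (?\<delta> 1)))"
        by (rule mult_left_mono[OF insert.IH(2)[OF F[OF 2]]]) simp
      ultimately have "nrm (local_L \<beta> L (p * ?D)) \<ge> (1 - ?t)\<^sup>2 * (?Q\<^sup>2 * (?S * nrm (?\<delta> 1))) + (1 - ?t)\<^sup>2 * (?t * (?Q\<^sup>2 * nrm (?\<delta> 1)))"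
        unfolding eqs(1)[OF 2] by linarith
      then show ?case using insert.hyps
        by (simp add: power_mult_distrib distrib_left distrib_right mult_ac) }
    { case 3
      have "nrm (?\<delta> (p * ?D)) \<ge> (1 - ?t)\<^sup>2 * nrm (?\<delta> ?D)" by (rule eqs(2)[OF 3])
      moreover have "(1 - ?t)\<^sup>2 * nrm (?\<delta> ?D) \<ge> (1 - ?t)\<^sup>2 * ((\<Prod>p\<in>F. 1 - real p powr (- \<beta>))\<^sup>2 * nrm (?\<delta> 1))"
        by (rule mult_left_mono[OF insert.IH(3)[OF F[OF 3]]]) simp
      ultimately show ?case using insert.hyps by (simp add: power_mult_distrib mult.assoc) }
  qed
  let ?Q = "\<Prod>p\<in>F. 1 - real p powr (- \<beta>)"
  have Q: "?Q > 0"
  proof (rule prod_pos)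
    fix p assume "p \<in> F"
    then have "real p > 1" using F(2) prime_gt_1_nat by simp
    then show "0 < 1 - real p powr (- \<beta>)" using powr_less_mono[of "- \<beta>" 0 "real p"] beta by simp
  qed
  have D1: "1 \<le> \<Prod>F" using F(2) prime_gt_0_nat by (metis One_nat_def Suc_leI prod_pos)
  have "nrm (local_L \<beta> L (\<Prod>F)) \<le> (\<Sum>k<n. ?Q\<^sup>2)"
    unfolding nrm_def
  proof (rule sum_mono)
    fix k
    have "cmod (local_L \<beta> L (\<Prod>F) k) \<le> ?Q" using bd[OF D1, of k] unfolding zero by (simp only: Re_complex_of_real)
    then show "(cmod (local_L \<beta> L (\<Prod>F) k))\<^sup>2 \<le> ?Q\<^sup>2" by (rule power_mono) simp
  qed
  then have "?Q\<^sup>2 * ((\<Sum>p\<in>F. real p powr (- \<beta>)) * nrm (?\<delta> 1)) \<le> ?Q\<^sup>2 * real n"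
    using main by (simp add: mult.commute)
  then have "(\<Sum>p\<in>F. real p powr (- \<beta>)) * nrm (?\<delta> 1) \<le> real n" using Q by simp
  moreover have "local_L \<beta> L 1 k = L k" for k by (simp add: local_L_def moebius_def)
  ultimately show ?thesis by (simp add: nrm_def \<pi>_def per)
qed

text \<open>H, the set of multipliers that leave L invariant, is closed under products and
  congruence. For a unit class outside H the preceding bound makes the reciprocals of its primes
  summable; finitely many classes cover all primes outside H that are coprime to n, so
  \<open>units_subset_of_summable_primes\<close> puts every unit into H.\<close>

lemma unit_invariance:
  fixes L :: "nat \<Rightarrow> complex"
  assumes n: "1 \<le> n" and per: "\<And>k. L (k mod n) = L k" and L0: "L 0 = 1" and beta: "0 < \<beta>" "\<beta> \<le> 1"
    and bd: "\<And>D k. 1 \<le> D \<Longrightarrow> cmod (local_L \<beta> L D k) \<le> Re (local_L \<beta> L D 0)"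
    and u: "coprime u n"
  shows "L (u * k) = L k"
proof -
  define H where "H = {r. \<forall>k. L (r * k) = L k}"
  have cls: "(\<lambda>p. 1 / real p) summable_on {p. prime p \<and> [p = r] (mod n)}"
    if r: "coprime r n" "r \<notin> H" for r
  proof -
    let ?S = "\<Sum>k<n. (cmod (L k - L (r * k)))\<^sup>2"
    obtain k where k: "L (r * k) \<noteq> L k" using r by (auto simp: H_def)
    have "L (r * (k mod n)) = L (r * k)" using per by (metis mod_mult_right_eq)
    then have "L (k mod n) - L (r * (k mod n)) \<noteq> 0" using k per[of k] by simp
    then have "0 < (cmod (L (k mod n) - L (r * (k mod n))))\<^sup>2" by simp
    also have "\<dots> \<le> ?S" using n by (intro member_le_sum) auto
    finally have S: "?S > 0" .
    show ?thesis
    proof (rule nonneg_bdd_above_summable_on)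
      show "bdd_above (sum (\<lambda>p. 1 / real p) ` {F. F \<subseteq> {p. prime p \<and> [p = r] (mod n)} \<and> finite F})"
      proof (rule bdd_aboveI2)
        fix F assume F: "F \<in> {F. F \<subseteq> {p. prime p \<and> [p = r] (mod n)} \<and> finite F}"
        have "(\<Sum>p\<in>F. 1 / real p) \<le> (\<Sum>p\<in>F. real p powr (- \<beta>))"
        proof (rule sum_mono)
          fix p assume "p \<in> F"
          then have "prime p" using F by blast
          then have p: "real p \<ge> 1" using prime_ge_1_nat by simp
          \<comment> \<open>This comparison is where \<beta> \<le> 1 enters.\<close>
          have "real p powr (-1) \<le> real p powr (- \<beta>)" using p beta by (intro powr_mono) auto
          then show "1 / real p \<le> real p powr (- \<beta>)" using p by (simp add: powr_minus_divide)
        qed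
        also have "\<dots> \<le> real n / ?S"
        proof -
          have "(\<Sum>p\<in>F. real p powr (- \<beta>)) * ?S \<le> real n"
            by (rule unit_invariance_step[where L = L, OF n per L0 beta(1) bd r(1)]) (use F in blast)+
          then show ?thesis using S by (simp only: pos_le_divide_eq)
        qed
        finally show "(\<Sum>p\<in>F. 1 / real p) \<le> real n / ?S" .
      qed
    qed simp
  qed
  have "u \<in> H"
  proof (rule units_subset_of_summable_primes[OF n _ _ _ _ u])
    show "1 \<in> H" by (simp add: H_def)
    show "a * b \<in> H" if "a \<in> H" "b \<in> H" for a b
      using that by (simp add: H_def mult.assoc)
    show "b \<in> H" if "[a = b] (mod n)" "a \<in> H" for a b
    proof -
      have "L (b * k) = L (a * k)" for k
        using cong_mult[OF that(1) cong_refl, of k] per by (metis cong_def)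
      then show ?thesis using that by (simp add: H_def)
    qed
    show "(\<lambda>p. 1 / real p) summable_on {p. prime p \<and> coprime p n \<and> p \<notin> H}"
    proof (rule summable_on_subset_banach)
      let ?R = "{r \<in> {..<n}. coprime r n \<and> r \<notin> H}"
      have fin: "(\<lambda>p. 1 / real p) summable_on (\<Union>r\<in>R. {p. prime p \<and> [p = r] (mod n)})"
        if "finite R" "R \<subseteq> ?R" for R
        using that
      proof (induction R rule: finite_induct)
        case (insert r R)
        then show ?case using cls[of r] by (auto intro: summable_on_union)
      qed simp
      show "(\<lambda>p. 1 / real p) summable_on (\<Union>r\<in>?R. {p. prime p \<and> [p = r] (mod n)})"
        by (rule fin) auto
      show "{p. prime p \<and> coprime p n \<and> p \<notin> H} \<subseteq> (\<Union>r\<in>?R. {p. prime p \<and> [p = r] (mod n)})"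
      proof
        fix p assume p: "p \<in> {p. prime p \<and> coprime p n \<and> p \<notin> H}"
        have "p mod n \<notin> H"
        proof
          assume "p mod n \<in> H"
          then have "L (p * k) = L k" for k
            unfolding H_def using per by (metis (mono_tags, lifting) mem_Collect_eq mod_mult_left_eq)
          then show False using p by (simp add: H_def)
        qed
        then show "p \<in> (\<Union>r\<in>?R. {p. prime p \<and> [p = r] (mod n)})"
          using p n by (intro UN_I[of "p mod n"]) (auto simp: cong_def)
      qed
    qed
  qed
  then show ?thesis by (simp add: H_def)
qed

section \<open>Examples of divisor-closed systems\<close>

lemma all_system:
  assumes "1 < \<beta>" shows "divisor_system {1..} \<beta>"
proof
  show "(\<lambda>c. real c powr (- \<beta>)) summable_on {1..}"
  proof (rule summable_on_subset_banach)
    show "(\<lambda>c. real c powr (- \<beta>)) summable_on UNIV"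
      by (rule summable_nonneg_imp_summable_on) (use assms in \<open>auto simp: summable_real_powr_iff\<close>)
  qed simp
  show "d \<in> {1..}" if "a \<in> {1..}" "d dvd a" for a d :: nat
    using that by (auto intro!: Suc_leI gr0I)
qed (auto simp: Suc_le_eq)

definition smooth :: "nat set \<Rightarrow> nat set" where
  "smooth P = {c. 0 < c \<and> prime_factors c \<subseteq> P}"

text \<open>A finite Euler product: splitting off the full power of p embeds the sum for
  \<open>insert p P\<close> into the product of a geometric series and the sum for
  \<open>P\<close>.\<close>

lemma smooth_summable:
  assumes "finite P" "\<And>p. p \<in> P \<Longrightarrow> prime p" "0 < \<beta>"
  shows "(\<lambda>c. real c powr (- \<beta>)) summable_on smooth P"
  using assms(1,2)
proof (induction P rule: finite_induct)
  case empty
  have "smooth {} \<subseteq> {1}" by (auto simp: smooth_def set_mset_eq_empty_iff prime_factorization_empty_iff)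
  then show ?case using finite_subset by (intro summable_on_finite) blast
next
  case (insert p P)
  have p: "prime p" using insert by simp
  then have p1: "real p > 1" using prime_gt_1_nat by simp
  define q where "q = real p powr (- \<beta>)"
  have q: "0 \<le> q" "q < 1" using powr_less_mono[of "- \<beta>" 0 "real p"] p1 assms(3) by (simp_all add: q_def)
  let ?g = "\<lambda>m. (multiplicity p m, m div p ^ multiplicity p m)"
  let ?h = "\<lambda>(j, c). q ^ j * real c powr (- \<beta>)"
  have "(\<lambda>j. q ^ j) summable_on UNIV"
    by (rule summable_nonneg_imp_summable_on) (use q in \<open>auto intro: summable_geometric\<close>)
  then have "?h summable_on UNIV \<times> smooth P"
    by (rule summable_on_product_nonneg) (use insert q in auto)
  moreover have sub: "?g ` smooth (insert p P) \<subseteq> UNIV \<times> smooth P"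
  proof (rule image_subsetI)
    fix m assume m: "m \<in> smooth (insert p P)"
    then have m0: "m > 0" by (simp add: smooth_def)
    let ?c = "m div p ^ multiplicity p m"
    have mc: "m = p ^ multiplicity p m * ?c" by (simp add: multiplicity_dvd)
    have c0: "?c > 0" using mc m0 by (metis gr0I mult_0_right)
    have "prime_factors ?c \<subseteq> P"
    proof
      fix r assume r: "r \<in> prime_factors ?c"
      then have "prime r" "r dvd ?c" by (auto simp: in_prime_factors_iff)
      then have "r dvd m" using mc by (metis dvd_mult)
      then have "r \<in> insert p P" using m \<open>prime r\<close> m0 by (auto simp: smooth_def in_prime_factors_iff)
      moreover have "\<not> p dvd ?c"
        using m0 p by (intro multiplicity_decompose) auto
      ultimately show "r \<in> P" using \<open>r dvd ?c\<close> by auto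
    qed
    then show "?g m \<in> UNIV \<times> smooth P" using c0 by (simp add: smooth_def)
  qed
  ultimately have "?h summable_on ?g ` smooth (insert p P)" by (rule summable_on_subset_banach)
  moreover have "inj_on ?g (smooth (insert p P))"
    by (rule inj_onI) (metis dvd_mult_div_cancel multiplicity_dvd prod.inject)
  ultimately have "(?h \<circ> ?g) summable_on smooth (insert p P)" by (simp only: summable_on_reindex)
  moreover have "?h \<circ> ?g = (\<lambda>m. real m powr (- \<beta>))"
  proof
    fix m
    let ?c = "m div p ^ multiplicity p m"
    have "real m = real p ^ multiplicity p m * real ?c"
      by (metis dvd_mult_div_cancel multiplicity_dvd of_nat_mult of_nat_power)
    then have "real m powr (- \<beta>) = (real p ^ multiplicity p m) powr (- \<beta>) * real ?c powr (- \<beta>)"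
      by (simp add: powr_mult)
    also have "(real p ^ multiplicity p m) powr (- \<beta>) = q ^ multiplicity p m"
      using p1 by (simp add: q_def powr_power powr_realpow[symmetric] powr_powr mult.commute)
    finally show "(?h \<circ> ?g) m = real m powr (- \<beta>)" by simp
  qed
  ultimately show ?case by (simp only:)
qed

lemma smooth_system:
  assumes "0 < \<beta>" shows "divisor_system (smooth (prime_factors N)) \<beta>"
proof
  show "(\<lambda>c. real c powr (- \<beta>)) summable_on smooth (prime_factors N)"
    by (rule smooth_summable) (use assms in auto)
  show "a * b \<in> smooth (prime_factors N)" if "a \<in> smooth (prime_factors N)" "b \<in> smooth (prime_factors N)" for a b
    using that by (auto simp: smooth_def prime_factors_product)
  show "d \<in> smooth (prime_factors N)" if "a \<in> smooth (prime_factors N)" "d dvd a" for a d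
    using that dvd_prime_factors[of a d] by (auto simp: smooth_def intro: gr0I)
qed (auto simp: smooth_def)

context divisor_system
begin

lemma pos: "c \<in> C \<Longrightarrow> c > 0"
  using zero by (auto intro: gr0I)

lemma multiples_bij:
  assumes "e \<in> C" shows "bij_betw ((*) e) {c \<in> C. R c} {c \<in> C. e dvd c \<and> R (c div e)}"
  by (rule bij_betwI[where g = "\<lambda>c. c div e"]) (use assms mult dvd pos in \<open>auto elim!: dvdE\<close>)

lemma multiples_sum:
  assumes "e \<in> C"
  shows "(\<Sum>\<^sub>\<infinity>c\<in>{c \<in> C. e dvd c \<and> R (c div e)}. real c powr (- \<beta>))
    = real e powr (- \<beta>) * (\<Sum>\<^sub>\<infinity>c\<in>{c \<in> C. R c}. real c powr (- \<beta>))"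
proof -
  have "(\<Sum>\<^sub>\<infinity>c\<in>{c \<in> C. e dvd c \<and> R (c div e)}. real c powr (- \<beta>))
    = (\<Sum>\<^sub>\<infinity>c\<in>{c \<in> C. R c}. real (e * c) powr (- \<beta>))"
    by (rule infsum_reindex_bij_betw[OF multiples_bij[OF assms], symmetric])
  then show ?thesis by (simp add: powr_mult infsum_cmult_right')
qed

text \<open>Inclusion and exclusion: coprimality to d is the moebius sum over the common divisors e,
  and the multiples of e in C have total mass e^(-\<beta>) Z.\<close>

lemma coprime_sum:
  assumes d: "d \<in> C"
  shows "(\<Sum>\<^sub>\<infinity>c\<in>{c \<in> C. coprime c d}. real c powr (- \<beta>)) = Z * (\<Prod>p\<in>prime_factors d. 1 - real p powr (- \<beta>))"
proof -
  let ?w = "\<lambda>c. real c powr (- \<beta>)"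
  have d0: "d > 0" using pos d by blast
  have fin: "finite {e. e dvd d}" using d0 by simp
  have sub: "?w summable_on {c \<in> C. e dvd c}" for e
    by (rule summable_on_subset_banach[OF summable]) auto
  have ind: "(\<lambda>c. if e dvd c then ?w c else 0) summable_on C"
    "(\<Sum>\<^sub>\<infinity>c\<in>C. if e dvd c then ?w c else 0) = (\<Sum>\<^sub>\<infinity>c\<in>{c \<in> C. e dvd c}. ?w c)" for e
  proof -
    show "(\<lambda>c. if e dvd c then ?w c else 0) summable_on C"
      using sub[of e] by (rule summable_on_cong_neutral[THEN iffD1, rotated -1]) auto
    show "(\<Sum>\<^sub>\<infinity>c\<in>C. if e dvd c then ?w c else 0) = (\<Sum>\<^sub>\<infinity>c\<in>{c \<in> C. e dvd c}. ?w c)"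
      by (rule infsum_cong_neutral) auto
  qed
  have "(\<Sum>\<^sub>\<infinity>c\<in>{c \<in> C. coprime c d}. ?w c) = (\<Sum>\<^sub>\<infinity>c\<in>C. if coprime c d then ?w c else 0)"
    by (rule infsum_cong_neutral) auto
  also have "\<dots> = (\<Sum>\<^sub>\<infinity>c\<in>C. \<Sum>e | e dvd d. moebius e * (if e dvd c then ?w c else 0))"
  proof (rule infsum_cong)
    fix c assume "c \<in> C"
    have "(\<Sum>e | e dvd d. moebius e * (if e dvd c then ?w c else 0)) = (\<Sum>e | e dvd gcd d c. moebius e * ?w c)"
      by (rule sum.mono_neutral_cong_right[OF fin]) auto
    also have "\<dots> = (\<Sum>e | e dvd gcd d c. moebius e) * ?w c" by (rule sum_distrib_right[symmetric])
    also have "\<dots> = (if coprime c d then ?w c else 0)"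
    proof -
      have "gcd d c > 0" using d0 by simp
      moreover have "gcd d c = 1 \<longleftrightarrow> coprime c d"
        by (simp only: coprime_iff_gcd_eq_1 gcd.commute[of d c])
      ultimately show ?thesis by (simp only: moebius_sum) simp
    qed
    finally show "(if coprime c d then ?w c else 0) = (\<Sum>e | e dvd d. moebius e * (if e dvd c then ?w c else 0))" ..
  qed
  also have "\<dots> = (\<Sum>e | e dvd d. \<Sum>\<^sub>\<infinity>c\<in>C. moebius e * (if e dvd c then ?w c else 0))"
    by (rule infsum_finite_sum(2)[OF fin summable_on_cmult_right[OF ind(1)]])
  also have "\<dots> = (\<Sum>e | e dvd d. moebius e * ?w e) * Z"
    unfolding sum_distrib_right
  proof (rule sum.cong)
    fix e assume "e \<in> {e. e dvd d}"
    then have "e \<in> C" using d dvd by auto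
    then show "(\<Sum>\<^sub>\<infinity>c\<in>C. moebius e * (if e dvd c then ?w c else 0)) = moebius e * ?w e * Z"
      unfolding infsum_cmult_right' ind(2) using multiples_sum[of e "\<lambda>_. True"] by (simp add: Z_def)
  qed simp
  also have "(\<Sum>e | e dvd d. moebius e * ?w e) = (\<Prod>p\<in>prime_factors d. 1 - ?w p)"
    by (rule moebius_sum_prod[OF d0]) (simp_all add: powr_mult)
  finally show ?thesis by simp
qed

text \<open>The class with m/gcd(m, c) = d consists of the c = (m/d) x with x coprime to d. By
  \<open>coprime_sum\<close> its mass is Z m^(-\<beta>) times \<open>phi_beta \<beta> d\<close>,
  which is the origin of that function. The system C enters only through Z.\<close>

lemma gcd_class_sum:
  fixes h :: "nat \<Rightarrow> real"
  assumes m: "m \<in> C"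
  shows "(\<Sum>\<^sub>\<infinity>c\<in>C. real c powr (- \<beta>) * h (m div gcd m c))
    = Z * (real m powr (- \<beta>) * (\<Sum>d | d dvd m. h d * phi_beta \<beta> d))"
proof -
  let ?w = "\<lambda>c. real c powr (- \<beta>)"
  have m0: "m > 0" using pos m by blast
  have fin: "finite {d. d dvd m}" using m0 by simp
  define K where "K d = {c \<in> C. m div d dvd c \<and> coprime (c div (m div d)) d}" for d
  have K: "K d = {c \<in> C. m div gcd m c = d}" if d: "d dvd m" for d
  proof -
    obtain e where e: "m = d * e" using d by blast
    have de: "d > 0" "e > 0" using e m0 by auto
    have me: "m div d = e" using e de by simp
    have "e dvd c \<and> coprime (c div e) d \<longleftrightarrow> m div gcd m c = d" for c
    proof
      assume *: "e dvd c \<and> coprime (c div e) d"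
      then obtain x where x: "c = e * x" by blast
      have "gcd d x = 1" using * x de by (simp add: coprime_commute)
      then have "gcd m c = e" unfolding e x by (simp add: mult.commute[of d e] gcd_mult_distrib_nat[symmetric])
      then show "m div gcd m c = d" using e de by simp
    next
      assume *: "m div gcd m c = d"
      have "gcd m c * (m div gcd m c) = m" by simp
      then have "gcd m c * d = m" unfolding * .
      then have "gcd m c * d = d * e" using e by (rule trans)
      then have g: "gcd m c = e" using de(1) by (metis mult.commute mult_cancel1 not_gr_zero)
      then have "e dvd c" by (metis gcd_dvd2)
      moreover have "coprime (m div gcd m c) (c div gcd m c)" by (rule div_gcd_coprime) (use m0 in simp)
      then have "coprime (c div e) d" using * g by (metis coprime_commute)
      ultimately show "e dvd c \<and> coprime (c div e) d" ..
    qed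
    then show ?thesis unfolding K_def me by blast
  qed
  have sub: "?w summable_on K d" for d
    by (rule summable_on_subset_banach[OF summable]) (auto simp: K_def)
  have CU: "C = (\<Union>d\<in>{d. d dvd m}. K d)" 
  proof -
    have "m div gcd m c dvd m" for c by (metis dvd_div_mult_self dvd_triv_left gcd_dvd1)
    then show ?thesis using K by auto
  qed
  have "(\<Sum>\<^sub>\<infinity>c\<in>C. ?w c * h (m div gcd m c)) = (\<Sum>\<^sub>\<infinity>c\<in>(\<Union>d\<in>{d. d dvd m}. K d). ?w c * h (m div gcd m c))"
    by (subst CU) (rule refl)
  also have "\<dots> = (\<Sum>d | d dvd m. \<Sum>\<^sub>\<infinity>c\<in>K d. ?w c * h (m div gcd m c))"
  proof (rule sum_infsum[symmetric, OF fin])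
    show "(\<lambda>c. ?w c * h (m div gcd m c)) summable_on K d" if "d \<in> {d. d dvd m}" for d
      using summable_on_cmult_left[OF sub[of d], of "h d"]
      by (rule summable_on_cong[THEN iffD1, rotated]) (use K that in auto)
  qed (use K in auto)
  also have "\<dots> = (\<Sum>d | d dvd m. Z * (?w m * (h d * phi_beta \<beta> d)))"
  proof (rule sum.cong)
    fix d assume d: "d \<in> {d. d dvd m}"
    then obtain e where e: "m = d * e" by blast
    have de: "d > 0" "e > 0" using e m0 by auto
    have C: "d \<in> C" "e \<in> C" using m dvd[of m] e by auto
    have "(\<Sum>\<^sub>\<infinity>c\<in>K d. ?w c * h (m div gcd m c)) = (\<Sum>\<^sub>\<infinity>c\<in>K d. ?w c * h d)"
      by (rule infsum_cong) (use K d in auto)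
    also have "\<dots> = (\<Sum>\<^sub>\<infinity>c\<in>K d. ?w c) * h d" by (rule infsum_cmult_left')
    also have "(\<Sum>\<^sub>\<infinity>c\<in>K d. ?w c) = ?w e * (Z * (\<Prod>p\<in>prime_factors d. 1 - ?w p))"
      unfolding coprime_sum[OF C(1), symmetric]
      using multiples_sum[OF C(2), of "\<lambda>c. coprime c d"] e de by (simp add: K_def)
    also have "?w e = ?w m * real d powr \<beta>"
      using de by (simp add: e powr_mult powr_minus)
    finally show "(\<Sum>\<^sub>\<infinity>c\<in>K d. ?w c * h (m div gcd m c)) = Z * (?w m * (h d * phi_beta \<beta> d))"
      by (simp add: phi_beta_def mult_ac)
  qed simp
  finally show ?thesis by (simp add: sum_distrib_left)
qed

end

section \<open>Orbits of the units and Ramanujan sums\<close>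

text \<open>An orbit of the units acting on the residues modulo n. For m dividing n it consists of
  the exponents j for which \<open>omega n ^ j\<close> has exact order m.\<close>

definition orbit :: "nat \<Rightarrow> nat \<Rightarrow> nat set" where
  "orbit n m = {j. j < n \<and> gcd j n = n div m}"

text \<open>For n = 1 this is {0}, so the set is nonempty for every positive n and averages over it
  make sense.\<close>

definition units :: "nat \<Rightarrow> nat set" where
  "units n = {u. u < n \<and> coprime u n}"

lemma finite_orbit [simp]: "finite (orbit n m)" and finite_units [simp]: "finite (units n)"
  by (auto simp: orbit_def units_def)

text \<open>To v one adds n' times the product of the prime factors of n that do not divide v. Each
  prime factor of n then divides exactly one of the two summands, hence not their sum.\<close>

lemma lift_unit:
  fixes v n' n :: nat
  assumes "n > 0" "coprime v n'"
  shows "\<exists>u. coprime u n \<and> [u = v] (mod n')"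
proof -
  define s where "s = \<Prod>{p \<in> prime_factors n. \<not> p dvd v}"
  have ps: "p dvd s \<longleftrightarrow> \<not> p dvd v" if p: "p \<in> prime_factors n" for p
  proof
    assume "p dvd s"
    then obtain q where "q \<in> prime_factors n" "\<not> q dvd v" "p dvd q"
      unfolding s_def using p by (auto simp: prime_dvd_prod_iff in_prime_factors_iff)
    moreover from this p have "p = q" by (auto simp: in_prime_factors_iff dest: primes_dvd_imp_eq)
    ultimately show "\<not> p dvd v" by simp
  next
    assume "\<not> p dvd v"
    then show "p dvd s" unfolding s_def using p by (intro dvd_prodI) auto
  qed
  have "coprime (v + n' * s) n"
  proof (rule ccontr)
    assume "\<not> ?thesis"
    then have "gcd (v + n' * s) n \<noteq> 1" by (simp only: coprime_iff_gcd_eq_1 not_False_eq_True)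
    then obtain p where p: "prime p" "p dvd gcd (v + n' * s) n" using prime_factor_nat by blast
    then have pn: "p \<in> prime_factors n" and d: "p dvd v + n' * s" using assms(1) by (auto simp: in_prime_factors_iff)
    show False
    proof (cases "p dvd v")
      case True
      then have "p dvd n' * s" using d by (simp add: dvd_add_right_iff)
      moreover have "\<not> p dvd s" using ps[OF pn] True by simp
      ultimately have "p dvd n'" using p(1) by (simp add: prime_dvd_mult_iff)
      then show False using True assms(2) p(1) by (metis coprime_common_divisor not_prime_unit)
    next
      case False
      then have "p dvd n' * s" using ps[OF pn] by simp
      then show False using d False by (simp add: dvd_add_left_iff)
    qed
  qed
  moreover have "[v + n' * s = v] (mod n')" by (simp add: cong_def)
  ultimately show ?thesis by blast
qed

text \<open>After division by the common gcd d, the cofactor of i is invertible modulo n/d. The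
  resulting unit modulo n/d carries i/d to j/d and is lifted to modulus n by
  \<open>lift_unit\<close>.\<close>

lemma unit_transitive:
  fixes i j n :: nat
  assumes n: "n > 0" and g: "gcd i n = gcd j n"
  shows "\<exists>u. coprime u n \<and> [u * i = j] (mod n)"
proof -
  define d where "d = gcd i n"
  have d0: "d > 0" using n by (simp add: d_def)
  obtain i' n' where in': "i = d * i'" "n = d * n'" "coprime i' n'"
    unfolding d_def using gcd_coprime_exists[of i n] n by (metis gcd_eq_0_iff mult.commute not_gr_zero)
  obtain j' where j': "j = d * j'" unfolding d_def g by (metis gcd_dvd1 dvdE)
  have cj: "coprime j' n'"
  proof -
    have "d * gcd j' n' = d" using g in' j' d_def by (metis gcd_mult_distrib_nat)
    then have "gcd j' n' = 1" using d0 by (metis mult_cancel1 mult.right_neutral not_gr_zero)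
    then show ?thesis by (rule gcd_eq_1_imp_coprime)
  qed
  obtain x where x: "[i' * x = Suc 0] (mod n')" using cong_solve_coprime_nat[OF in'(3)] by blast
  then have "coprime (i' * x) n'" using cong_imp_coprime[OF cong_sym[OF x]] by simp
  then have "coprime (x * j') n'" using cj by simp
  then obtain u where u: "coprime u n" "[u = x * j'] (mod n')" using lift_unit[OF n] by blast
  have "[u * i' = x * j' * i'] (mod n')" by (rule cong_mult[OF u(2) cong_refl])
  also have "x * j' * i' = i' * x * j'" by (simp add: mult_ac)
  also have "[i' * x * j' = Suc 0 * j'] (mod n')" by (rule cong_mult[OF x cong_refl])
  finally have "[u * i' = j'] (mod n')" by simp
  then have "[d * (u * i') = d * j'] (mod (d * n'))" by (simp add: cong_def mult_mod_right[symmetric])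
  then have "[u * i = j] (mod n)" using in' j' by (simp add: mult_ac)
  with u show ?thesis by blast
qed

lemma unit_permutes:
  fixes u n :: nat
  assumes n: "n > 0" and u: "coprime u n" and X: "X \<subseteq> {..<n}"
    and inv: "\<And>j. j \<in> X \<Longrightarrow> u * j mod n \<in> X"
  shows "bij_betw (\<lambda>j. u * j mod n) X X"
proof -
  have "inj_on (\<lambda>j. u * j mod n) X"
    using bij_betw_imp_inj_on[OF unit_mult_bij[of n u]] n u X by (auto intro: inj_on_subset)
  moreover have "finite X" using X finite_subset by blast
  ultimately have "(\<lambda>j. u * j mod n) ` X = X" using inv by (intro endo_inj_surj) auto
  with \<open>inj_on (\<lambda>j. u * j mod n) X\<close> show ?thesis by (simp add: bij_betw_def)
qed

text \<open>Replacing the residue 0 by n does not change the gcd with n and moves the orbit into the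
  range 1 to n, where elements of given gcd are counted by a totient.\<close>

lemma card_orbit:
  assumes n: "n > 0" and m: "m dvd n"
  shows "card (orbit n m) = totient m"
proof -
  have "bij_betw (\<lambda>k. k mod n) {k \<in> {0<..n}. gcd k n = n div m} (orbit n m)"
    by (rule bij_betwI[where g = "\<lambda>j. if j = 0 then n else j"])
       (use n in \<open>auto simp: orbit_def le_less\<close>)
  then have "card (orbit n m) = card {k \<in> {0<..n}. gcd k n = n div m}" by (simp add: bij_betw_same_card)
  also have "\<dots> = totient (n div (n div m))" using n m by (intro card_gcd_eq_totient) auto
  also have "n div (n div m) = m" using n m by (auto elim!: dvdE)
  finally show ?thesis .
qed

text \<open>The mean of the Galois conjugates of \<open>omega n ^ i\<close>, a normalised Ramanujan
  sum. It depends on i only through gcd(i, n).\<close>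

definition unit_avg :: "nat \<Rightarrow> nat \<Rightarrow> complex" where
  "unit_avg n i = (\<Sum>u\<in>units n. omega n ^ (u * i)) / of_nat (card (units n))"

lemma unit_avg_gcd:
  assumes n: "n > 0" and g: "gcd i n = gcd j n"
  shows "unit_avg n i = unit_avg n j"
proof -
  obtain v where v: "coprime v n" "[v * i = j] (mod n)" using unit_transitive[OF n g] by blast
  have bij: "bij_betw (\<lambda>u. v * u mod n) (units n) (units n)"
    by (rule unit_permutes[OF n v(1)]) (use n v in \<open>auto simp: units_def\<close>)
  have "(\<Sum>u\<in>units n. omega n ^ (u * i)) = (\<Sum>u\<in>units n. omega n ^ ((v * u mod n) * i))"
    by (rule sum.reindex_bij_betw[OF bij, symmetric])
  also have "\<dots> = (\<Sum>u\<in>units n. omega n ^ (u * j))"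
  proof (intro sum.cong refl omega_power_cong)
    fix u
    have "[(v * u mod n) * i = v * u * i] (mod n)" by (simp add: cong_def mod_mult_left_eq)
    also have "v * u * i = u * (v * i)" by (simp add: mult_ac)
    also have "[u * (v * i) = u * j] (mod n)" by (rule cong_mult[OF cong_refl v(2)])
    finally show "[(v * u mod n) * i = u * j] (mod n)" .
  qed (use n in simp)
  finally show ?thesis by (simp add: unit_avg_def)
qed

text \<open>The orbit sum does not change when its exponents are multiplied by a unit, so each term
  may be replaced by its average over the units. All jk with j in the orbit have the same gcd with
  n, namely n/q for q = m/gcd(m, k).\<close>

lemma orbit_sum_avg:
  assumes n: "n > 0" and m: "m dvd n"
  shows "(\<Sum>j\<in>orbit n m. omega n ^ (j * k)) = of_nat (totient m) * unit_avg n (n div (m div gcd m k))"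
proof -
  have fixd: "(\<Sum>j\<in>orbit n m. omega n ^ (j * k)) = (\<Sum>j\<in>orbit n m. omega n ^ (u * (j * k)))" if u: "u \<in> units n" for u
  proof -
    have "bij_betw (\<lambda>j. u * j mod n) (orbit n m) (orbit n m)"
      by (rule unit_permutes[OF n]) (use n u in \<open>auto simp: orbit_def units_def gcd_mult_left_left_cancel coprime_commute\<close>)
    then have "(\<Sum>j\<in>orbit n m. omega n ^ (j * k)) = (\<Sum>j\<in>orbit n m. omega n ^ ((u * j mod n) * k))"
      by (rule sum.reindex_bij_betw[symmetric])
    also have "\<dots> = (\<Sum>j\<in>orbit n m. omega n ^ (u * (j * k)))"
      by (intro sum.cong refl omega_power_cong) (use n in \<open>auto simp: cong_def mod_mult_left_eq mult.assoc\<close>)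
    finally show ?thesis .
  qed
  have U: "card (units n) \<noteq> 0"
  proof -
    have "(if n = 1 then 0 else 1) \<in> units n" using n by (auto simp: units_def)
    then show ?thesis by auto
  qed
  have "of_nat (card (units n)) * (\<Sum>j\<in>orbit n m. omega n ^ (j * k))
    = (\<Sum>u\<in>units n. \<Sum>j\<in>orbit n m. omega n ^ (j * k))" by simp
  also have "\<dots> = (\<Sum>u\<in>units n. \<Sum>j\<in>orbit n m. omega n ^ (u * (j * k)))"
    by (rule sum.cong[OF refl fixd])
  also have "\<dots> = (\<Sum>j\<in>orbit n m. \<Sum>u\<in>units n. omega n ^ (u * (j * k)))" by (rule sum.swap)
  finally have "(\<Sum>j\<in>orbit n m. omega n ^ (j * k)) = (\<Sum>j\<in>orbit n m. unit_avg n (j * k))"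
    using U by (simp add: unit_avg_def sum_divide_distrib[symmetric] nonzero_eq_divide_eq mult.commute)
  also have "\<dots> = (\<Sum>j\<in>orbit n m. unit_avg n (n div (m div gcd m k)))"
  proof (intro sum.cong refl unit_avg_gcd[OF n])
    fix j assume j: "j \<in> orbit n m"
    obtain e where e: "n = m * e" using m by blast
    have me: "m > 0" "e > 0" using e n by auto
    have ge: "gcd j n = e" using j e me by (simp add: orbit_def)
    then obtain j' where j': "j = e * j'" by (metis gcd_dvd1 dvdE)
    have "e * gcd j' m = e" using ge j' e by (simp add: gcd_mult_distrib_nat mult.commute)
    then have "gcd j' m = 1" using me by (metis mult_cancel1 mult.right_neutral not_gr_zero)
    then have c: "coprime j' m" by (rule gcd_eq_1_imp_coprime)
    obtain m' where m': "m = gcd m k * m'" by (metis gcd_dvd1 dvdE)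
    have gm: "gcd m k > 0" using me by simp
    then have mm: "m div gcd m k = m'" using m' by (metis nonzero_mult_div_cancel_left not_gr_zero)
    have m'0: "m' > 0" using m' me by (metis gr0I mult_0_right not_gr_zero)
    have "n = (e * gcd m k) * m'" using e m' by (metis mult.assoc mult.commute)
    then have nm: "n div m' = e * gcd m k" using m'0 by simp
    have "gcd (j * k) n = e * gcd (j' * k) m" unfolding j' e by (simp add: gcd_mult_distrib_nat mult_ac)
    also have "gcd (j' * k) m = gcd m k" using c
      by (metis coprime_commute gcd.commute gcd_mult_left_left_cancel)
    also have "e * gcd m k = gcd (e * gcd m k) n" using \<open>n = (e * gcd m k) * m'\<close> by (metis dvd_triv_left gcd_nat.absorb1)
    finally show "gcd (j * k) n = gcd (n div (m div gcd m k)) n" unfolding mm nm .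
  qed
  finally show ?thesis using card_orbit[OF n m] by simp
qed

lemma orbit_union:
  assumes n: "n > 0" and q: "q dvd n"
  shows "(\<Sum>d | d dvd q. \<Sum>j\<in>orbit n d. f j) = (\<Sum>j | j < n \<and> n div q dvd j. f j :: complex)"
proof -
  have q0: "q > 0" using q n by (auto intro: gr0I)
  have nd: "n div (n div d) = d" "n div d > 0" "n div d dvd n" if "d dvd n" for d
    using that n by (auto elim!: dvdE)
  have iff: "n div q dvd n div d \<longleftrightarrow> d dvd q" if d: "d dvd n" for d
  proof -
    obtain e where e: "n = d * e" using d by blast
    obtain r where r: "n = q * r" using q by blast
    have p: "d > 0" "e > 0" using e n by auto
    have r0: "r > 0" using r n by (metis gr0I mult_0_right)
    have "n div q = r" using r q0 by simp
    moreover have "n div d = e" using e p by simp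
    moreover have "r dvd e \<longleftrightarrow> d * r dvd q * r" using e r p by (metis dvd_times_left_cancel_iff not_gr_zero)
    moreover have "d * r dvd q * r \<longleftrightarrow> d dvd q" using r0 by simp
    ultimately show ?thesis by (simp only:)
  qed
  have "(\<Sum>d | d dvd q. \<Sum>j\<in>orbit n d. f j) = (\<Sum>j\<in>(\<Union>d\<in>{d. d dvd q}. orbit n d). f j)"
  proof (rule sum.UNION_disjoint[symmetric])
    show "\<forall>i\<in>{d. d dvd q}. \<forall>j\<in>{d. d dvd q}. i \<noteq> j \<longrightarrow> orbit n i \<inter> orbit n j = {}"
    proof (intro ballI impI)
      fix i j assume "i \<in> {d. d dvd q}" "j \<in> {d. d dvd q}" and ne: "i \<noteq> j"
      then have "i dvd n" "j dvd n" using q dvd_trans by blast+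
      then have "n div i \<noteq> n div j" using nd(1) ne by metis
      then show "orbit n i \<inter> orbit n j = {}" by (auto simp: orbit_def)
    qed
  qed (use q0 in auto)
  also have "(\<Union>d\<in>{d. d dvd q}. orbit n d) = {j. j < n \<and> n div q dvd j}"
  proof (intro equalityI subsetI)
    fix j assume "j \<in> (\<Union>d\<in>{d. d dvd q}. orbit n d)"
    then obtain d where d: "d dvd q" "j < n" "gcd j n = n div d" by (auto simp: orbit_def)
    then have "n div q dvd n div d" using iff q dvd_trans by blast
    then show "j \<in> {j. j < n \<and> n div q dvd j}" using d by (metis (mono_tags, lifting) dvd_trans gcd_dvd1 mem_Collect_eq)
  next
    fix j assume j: "j \<in> {j. j < n \<and> n div q dvd j}"
    let ?g = "gcd j n"
    have g: "?g dvd n" by simp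
    have "n div q dvd ?g" using j nd(3)[OF q] by simp
    also have "?g = n div (n div ?g)" using nd(1)[OF g] n by (metis dvd_div_mult_self g nonzero_mult_div_cancel_right div_eq_0_iff gr0I mult_0 mult.commute)
    finally have "n div ?g dvd q" using iff[of "n div ?g"] nd(3)[OF g] by blast
    then show "j \<in> (\<Union>d\<in>{d. d dvd q}. orbit n d)"
      using j \<open>?g = n div (n div ?g)\<close> by (auto simp: orbit_def)
  qed
  finally show ?thesis .
qed

text \<open>The orbits for the divisors of q make up all q-th roots of unity, whose sum is 0 unless
  q = 1. This is the recursion satisfied by the moebius function, so strong induction identifies the
  two.\<close>

lemma orbit_sum_moebius:
  assumes n: "n > 0" and "q dvd n"
  shows "(\<Sum>j\<in>orbit n q. omega n ^ j) = of_real (moebius q)"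
  using assms(2)
proof (induction q rule: less_induct)
  case (less q)
  have q0: "q > 0" using less.prems n by (auto intro: gr0I)
  have total: "(\<Sum>d | d dvd q. \<Sum>j\<in>orbit n d. omega n ^ j) = (if q = 1 then 1 else 0)"
  proof -
    obtain r where r: "n = q * r" using less.prems by blast
    have r0: "r > 0" "n div q = r" using r n q0 by auto
    have "{j. j < n \<and> n div q dvd j} = (\<lambda>i. r * i) ` {..<q}"
      unfolding r0(2) using r r0 by (auto elim!: dvdE simp: mult.commute)
    then have "(\<Sum>d | d dvd q. \<Sum>j\<in>orbit n d. omega n ^ j) = (\<Sum>i<q. omega n ^ (r * i))"
      unfolding orbit_union[OF n less.prems] using r0 by (simp add: sum.reindex inj_on_def)
    also have "\<dots> = (\<Sum>i<q. (omega n ^ r) ^ i)" by (simp add: power_mult)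
    also have "\<dots> = (if q = 1 then 1 else 0)"
    proof (cases "q = 1")
      case False
      have "\<not> n dvd r"
      proof
        assume "n dvd r"
        then have "q * r \<le> 1 * r" using r r0 dvd_imp_le by auto
        then show False using False q0 r0 by simp
      qed
      then have ne: "omega n ^ r \<noteq> 1" using omega_power_eq_1_iff n by simp
      have "(omega n ^ r) ^ q = 1"
        using omega_power_eq_1_iff[of n "r * q"] n r by (simp add: power_mult[symmetric] mult.commute)
      then show ?thesis using False geometric_sum[OF ne, of q] by simp
    qed simp
    finally show ?thesis .
  qed
  have split: "{d. d dvd q} = insert q {d. d dvd q \<and> d < q}"
    using q0 by (auto dest: dvd_imp_le)
  have fin: "finite {d. d dvd q \<and> d < q}" by simp
  have "(\<Sum>j\<in>orbit n q. omega n ^ j) + (\<Sum>d | d dvd q \<and> d < q. \<Sum>j\<in>orbit n d. omega n ^ j) = (if q = 1 then 1 else 0)"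
    using total unfolding split by (subst (asm) sum.insert) (use fin in auto)
  moreover have "(\<Sum>d | d dvd q \<and> d < q. \<Sum>j\<in>orbit n d. omega n ^ j) = (\<Sum>d | d dvd q \<and> d < q. of_real (moebius d))"
    using less by (intro sum.cong) (auto intro: dvd_trans)
  moreover have "moebius q + (\<Sum>d | d dvd q \<and> d < q. moebius d) = (if q = 1 then 1 else 0)"
    using moebius_sum[OF q0] unfolding split by (subst (asm) sum.insert) (use fin in auto)
  then have "of_real (moebius q) + (\<Sum>d | d dvd q \<and> d < q. complex_of_real (moebius d)) = (if q = 1 then 1 else 0)"
    by (simp only: of_real_add[symmetric] of_real_sum[symmetric]) simp
  ultimately show ?case by (metis add_right_cancel)
qed

text \<open>Hoelder's evaluation of Ramanujan sums. \<open>orbit_sum_avg\<close> is used twice, for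
  (m, k) and for (q, 1) with q = m/gcd(m, k); both lead to the same unit average, and the second is
  known from \<open>orbit_sum_moebius\<close>.\<close>

lemma ramanujan_sum:
  assumes n: "n > 0" and m: "m dvd n"
  shows "(\<Sum>j\<in>orbit n m. omega n ^ (j * k)) / of_nat (totient m)
    = of_real (moebius (m div gcd m k) / real (totient (m div gcd m k)))"
proof -
  let ?q = "m div gcd m k"
  have m0: "m > 0" using m n by (auto intro: gr0I)
  have q: "?q dvd n" using m by (metis dvd_div_mult_self dvd_triv_left dvd_trans gcd_dvd1)
  have q0: "?q > 0" using m0 by (simp add: div_greater_zero_iff dvd_imp_le)
  have "of_nat (totient ?q) * unit_avg n (n div ?q) = of_real (moebius ?q)"
    using orbit_sum_avg[OF n q, of 1] orbit_sum_moebius[OF n q] by simp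
  then have "unit_avg n (n div ?q) = of_real (moebius ?q) / of_nat (totient ?q)"
    using q0 by (simp add: nonzero_eq_divide_eq mult.commute)
  then show ?thesis using orbit_sum_avg[OF n m, of k] m0 by simp
qed

context divisor_system
begin

text \<open>Hoelder's formula turns the inner root sums into a function of m/gcd(m, kc) alone, so
  \<open>gcd_class_sum\<close> applies. The constant Z cancels, and the value is the same for every
  system that contains m. This independence is what later makes the passage to larger prime sets
  harmless.\<close>

lemma orbit_average_G:
  assumes n: "n > 0" and m: "m dvd n" and mC: "m \<in> C"
  shows "(\<Sum>j\<in>orbit n m. G n (j * k)) / of_nat (totient m)
    = of_real (real (m div gcd m k) powr (- \<beta>) *
        (\<Sum>d | d dvd m div gcd m k. moebius d * phi_beta \<beta> d / real (totient d)))"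
proof -
  let ?w = "\<lambda>c. real c powr (- \<beta>)" and ?q = "m div gcd m k"
  let ?h = "\<lambda>d. moebius d / real (totient d)"
  have m0: "m > 0" using m n by (auto intro: gr0I)
  have qC: "?q \<in> C" using mC dvd by (metis dvd_div_mult_self dvd_triv_left gcd_dvd1)
  have nest: "m div gcd m (k * c) = ?q div gcd ?q c" for c
  proof -
    obtain m' k' where mk: "m = gcd m k * m'" "k = gcd m k * k'" by (metis gcd_dvd1 gcd_dvd2 dvdE)
    define g where "g = gcd m k"
    have g0: "g > 0" using m0 by (simp add: g_def)
    have mk': "m = g * m'" "k = g * k'" using mk by (simp_all add: g_def)
    have "g * gcd m' k' = g" using mk' g_def by (metis gcd_mult_distrib_nat)
    then have "gcd m' k' = 1" using g0 by (metis mult_cancel1 mult.right_neutral not_gr_zero)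
    then have c: "coprime k' m'" using gcd_eq_1_imp_coprime coprime_commute by blast
    have "gcd m (k * c) = g * gcd m' (k' * c)" unfolding mk' by (simp add: gcd_mult_distrib_nat mult.assoc)
    also have "gcd m' (k' * c) = gcd m' c" using c by (metis coprime_commute gcd_mult_left_right_cancel mult.commute gcd_mult_right_left_cancel gcd_mult_right_right_cancel)
    finally have "m div gcd m (k * c) = m' div gcd m' c" using mk'(1) g0 by simp
    moreover have "?q = m'" using mk'(1) g0 unfolding g_def[symmetric] by simp
    ultimately show ?thesis by simp
  qed
  have "(\<Sum>j\<in>orbit n m. G n (j * k)) / of_nat (totient m)
    = dir (\<lambda>x. \<Sum>j\<in>orbit n m. (of_real (1 / Z) / of_nat (totient m)) * omega n ^ (j * x)) k"
  proof -
    have "dir (\<lambda>x. \<Sum>j\<in>orbit n m. (of_real (1 / Z) / of_nat (totient m)) * omega n ^ (j * x)) k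
      = (\<Sum>j\<in>orbit n m. (of_real (1 / Z) / of_nat (totient m)) * dir (\<lambda>x. omega n ^ (j * x)) k)"
      by (rule dir_sum[of _ 1]) auto
    moreover have "dir (\<lambda>l. omega n ^ (j * l)) k = dir (\<lambda>l. omega n ^ l) (j * k)" for j
      by (simp add: dir_def mult.assoc)
    ultimately show ?thesis by (simp add: G_eq_dir sum_divide_distrib)
  qed
  also have "\<dots> = (\<Sum>\<^sub>\<infinity>c\<in>C. of_real (1 / Z) * of_real (?w c * ?h (?q div gcd ?q c)))"
    unfolding dir_def
  proof (rule infsum_cong)
    fix c
    have "(\<Sum>j\<in>orbit n m. of_real (1 / Z) / of_nat (totient m) * omega n ^ (j * (k * c)))
      = of_real (1 / Z) * ((\<Sum>j\<in>orbit n m. omega n ^ (j * (k * c))) / of_nat (totient m))"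
      by (simp add: sum_distrib_left sum_divide_distrib)
    also have "\<dots> = of_real (1 / Z) * of_real (?h (?q div gcd ?q c))"
      unfolding ramanujan_sum[OF n m] nest ..
    finally show "of_real (?w c) * (\<Sum>j\<in>orbit n m. of_real (1 / Z) / of_nat (totient m) * omega n ^ (j * (k * c)))
      = of_real (1 / Z) * of_real (?w c * ?h (?q div gcd ?q c))" by simp
  qed
  also have "\<dots> = of_real (1 / Z) * (\<Sum>\<^sub>\<infinity>c\<in>C. of_real (?w c * ?h (?q div gcd ?q c)))"
    by (rule infsum_cmult_right')
  also have "(\<Sum>\<^sub>\<infinity>c\<in>C. complex_of_real (?w c * ?h (?q div gcd ?q c)))
    = of_real (\<Sum>\<^sub>\<infinity>c\<in>C. ?w c * ?h (?q div gcd ?q c))"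
  proof -
    have hb: "\<bar>?h d\<bar> \<le> 1" for d
    proof (cases "d = 0")
      case False
      then have "0 < totient d" by simp
      then have "1 \<le> real (totient d)" by (simp only: real_of_nat_ge_one_iff Suc_le_eq One_nat_def)
      then show ?thesis using abs_moebius_le[of d] by (simp add: divide_le_eq)
    qed simp
    have "(\<lambda>c. ?w c * ?h (?q div gcd ?q c)) summable_on C"
    proof (rule abs_summable_summable[OF summable_on_comparison_test[OF summable]])
      show "norm (?w c * ?h (?q div gcd ?q c)) \<le> ?w c" for c
        using mult_left_mono[OF hb[of "?q div gcd ?q c"], of "?w c"] by (simp only: real_norm_def abs_mult) simp
    qed auto
    then show ?thesis
      by (intro infsumI) (simp only: has_sum_of_real_iff has_sum_infsum)
  qed
  also have "(\<Sum>\<^sub>\<infinity>c\<in>C. ?w c * ?h (?q div gcd ?q c)) = Z * (?w ?q * (\<Sum>d | d dvd ?q. ?h d * phi_beta \<beta> d))"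
    by (rule gcd_class_sum[OF qC])
  finally show ?thesis using Z_ge_1 by simp
qed

text \<open>The substitution k -> vk in the inverse Fourier sum transfers the unit v from the
  frequency to the argument of L, where the invariance of L absorbs it.\<close>

lemma weight_orbit_const:
  assumes n: "n > 0" and per: "\<And>k. L (k mod n) = (L k :: complex)"
    and inv: "\<And>u k. coprime u n \<Longrightarrow> L (u * k) = L k" and g: "gcd i n = gcd j n"
  shows "weight n L i = weight n L j"
proof -
  obtain v where v: "coprime v n" "[v * i = j] (mod n)" using unit_transitive[OF n g] by blast
  have per': "dir_inv L (k mod n) = dir_inv L k" for k
    unfolding dir_inv_def by (intro infsum_cong) (metis per mod_mult_left_eq)
  have inv': "dir_inv L (v * k) = dir_inv L k" for k
    unfolding dir_inv_def using inv[OF v(1)] by (simp add: mult.assoc)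
  have bij: "bij_betw (\<lambda>k. v * k mod n) {..<n} {..<n}" using unit_mult_bij[of n v] n v by simp
  have "(\<Sum>k<n. omega n ^ ((n - 1) * i * k) * dir_inv L k)
    = (\<Sum>k<n. omega n ^ ((n - 1) * i * (v * k mod n)) * dir_inv L (v * k mod n))"
    by (rule sum.reindex_bij_betw[OF bij, symmetric])
  also have "\<dots> = (\<Sum>k<n. omega n ^ ((n - 1) * j * k) * dir_inv L k)"
  proof (intro sum.cong refl arg_cong2[of _ _ _ _ "(*)"] omega_power_cong)
    fix k
    show "dir_inv L (v * k mod n) = dir_inv L k" using per' inv' by simp
    have "[(n - 1) * i * (v * k mod n) = (n - 1) * i * (v * k)] (mod n)"
      by (simp add: cong_def mod_mult_right_eq)
    also have "(n - 1) * i * (v * k) = (n - 1) * (v * i) * k" by (simp add: mult_ac)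
    also have "[(n - 1) * (v * i) * k = (n - 1) * j * k] (mod n)"
      by (intro cong_mult cong_refl v(2))
    finally show "[(n - 1) * i * (v * k mod n) = (n - 1) * j * k] (mod n)" .
  qed (use n in simp)
  finally show ?thesis by (simp add: weight_def)
qed

end

section \<open>Vector states on a single fibre\<close>

lemma ell2_inner_finite:
  assumes "finite F" "\<And>t. t \<notin> F \<Longrightarrow> f t * cnj (g t) = 0"
  shows "ell2_inner f g = (\<Sum>t\<in>F. f t * cnj (g t))"
proof -
  have "ell2_inner f g = (\<Sum>\<^sub>\<infinity>t\<in>F. f t * cnj (g t))"
    unfolding ell2_inner_def by (rule infsum_cong_neutral) (use assms in auto)
  then show ?thesis using assms(1) by simp
qed

lemma sqrt_mult_self_complex: "complex_of_real (sqrt (real n)) * complex_of_real (sqrt (real n)) = of_nat n"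
  by (simp add: of_real_mult[symmetric] del: of_real_mult)

text \<open>A unit vector on the fibre over c. There R is translation by c, and this vector is an
  eigenvector of it with eigenvalue \<open>omega n ^ (j * c)\<close>.\<close>

definition fibre_vec :: "nat \<Rightarrow> nat \<Rightarrow> nat \<Rightarrow> (nat \<times> nat) vec" where
  "fibre_vec n c j = (\<lambda>(c', y). if c' = c \<and> y < n then omega n ^ ((n - 1) * j * y) / of_real (sqrt (real n)) else 0)"

lemma omega_power_mult_cnj: "omega n ^ k * cnj (omega n ^ k) = 1"
  using complex_norm_square[of "omega n ^ k"] by (simp del: complex_cnj_power)

lemma minus_one_squared_cong:
  fixes n :: nat
  assumes "1 \<le> n" shows "[(n - 1) * (n - 1) = 1] (mod n)"
proof -
  obtain m where m: "n = Suc m" using assms by (cases n) auto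
  have "int (m * m) - 1 = int n * (int m - 1)" by (simp add: m algebra_simps)
  then show ?thesis unfolding m by (metis cong_int_iff cong_iff_dvd_diff dvd_triv_left of_nat_1 m diff_Suc_1)
qed

context
  fixes n :: nat
  assumes n: "1 \<le> n"
begin

lemma fibre_vec_ell2:
  assumes "1 \<le> c"
  shows "fibre_vec n c j \<in> ell2 (nz_carrier n)" "ell2_norm (fibre_vec n c j) = 1"
proof -
  let ?e = "\<lambda>y. omega n ^ ((n - 1) * j * y) / of_real (sqrt (real n))"
  have "fibre_vec n c j = (\<lambda>s. \<Sum>y<n. ?e y * ket (c, y) s)"
  proof
    fix s :: "nat \<times> nat"
    obtain c' y' where s: "s = (c', y')" by (cases s)
    have "(\<Sum>y<n. ?e y * ket (c, y) s) = (\<Sum>y<n. if y = y' then (if c' = c then ?e y' else 0) else 0)"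
      by (rule sum.cong) (auto simp: ket_def s)
    then show "fibre_vec n c j s = (\<Sum>y<n. ?e y * ket (c, y) s)" by (simp add: fibre_vec_def s)
  qed
  moreover have "(\<lambda>s. \<Sum>y<n. ?e y * ket (c, y) s) \<in> ell2 (nz_carrier n)"
    by (rule ell2_sum) (use assms in \<open>auto intro!: ket_in_ell2 simp: nz_carrier_iff\<close>)
  ultimately show e: "fibre_vec n c j \<in> ell2 (nz_carrier n)" by simp
  have "complex_of_real ((ell2_norm (fibre_vec n c j))\<^sup>2) = (\<Sum>s\<in>{c} \<times> {..<n}. fibre_vec n c j s * cnj (fibre_vec n c j s))"
    unfolding ell2_inner_self[OF e, symmetric] by (rule ell2_inner_finite) (auto simp: fibre_vec_def split: if_splits)
  also have "\<dots> = (\<Sum>s\<in>{c} \<times> {..<n}. 1 / of_nat n)"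
  proof (rule sum.cong)
    fix s assume "s \<in> {c} \<times> {..<n}"
    then obtain y where s: "s = (c, y)" "y < n" by auto
    have "fibre_vec n c j s * cnj (fibre_vec n c j s)
      = (omega n ^ ((n - 1) * j * y) * cnj (omega n ^ ((n - 1) * j * y))) / of_real (sqrt (real n) * sqrt (real n))"
      using s by (simp add: fibre_vec_def sqrt_mult_self_complex)
    also have "\<dots> = 1 / of_nat n" unfolding omega_power_mult_cnj by simp
    finally show "fibre_vec n c j s * cnj (fibre_vec n c j s) = 1 / of_nat n" .
  qed simp
  also have "\<dots> = of_real 1" using n by simp
  finally have "(ell2_norm (fibre_vec n c j))\<^sup>2 = 1" unfolding of_real_eq_iff .
  then show "ell2_norm (fibre_vec n c j) = 1"
    using ell2_norm_nonneg[of "fibre_vec n c j"] by (simp add: power2_eq_1_iff)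
qed

text \<open>For distinct a and b the monomial moves the vector to another fibre or annihilates it,
  so it becomes orthogonal to itself. For a = b dividing c the power R^k acts on the fibre over c/a,
  where the translation is by k (c/a).\<close>

lemma fibre_vec_W:
  assumes c: "1 \<le> c" and ab: "1 \<le> a" "1 \<le> b"
  shows "ell2_inner (W n a k b (fibre_vec n c j)) (fibre_vec n c j)
    = (if a = b \<and> a dvd c then omega n ^ (j * k * (c div a)) else 0)"
proof -
  note e = fibre_vec_ell2[OF c, of j]
  let ?\<xi> = "fibre_vec n c j"
  have inner: "ell2_inner (W n a k b ?\<xi>) ?\<xi> = (\<Sum>s\<in>{c} \<times> {..<n}. W n a k b ?\<xi> s * cnj (?\<xi> s))"
    by (rule ell2_inner_finite) (auto simp: fibre_vec_def split: if_splits)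
  show ?thesis
  proof (cases "a = b \<and> a dvd c")
    case True
    then obtain q where q: "c = a * q" and eq: "b = a" by blast
    have cd: "c div a = q" using q ab by simp
    have "W n a k b ?\<xi> s * cnj (?\<xi> s) = omega n ^ (j * k * q) / of_nat n" if sD: "s \<in> {c} \<times> {..<n}" for s
    proof -
      obtain y where s: "s = (c, y)" "y < n" using sD by auto
      let ?y = "(y + (n - 1) * k * q) mod n"
      have "W n a k b ?\<xi> s = ?\<xi> (c, ?y)"
      proof -
        have "1 \<le> c \<and> y < n \<and> a dvd c" using c s True by blast
        moreover have "b * (c div a) = c" unfolding cd eq by (rule q[symmetric])
        ultimately show ?thesis unfolding s(1) W_apply[OF e(1)] cd by (simp only: if_True simp_thms)
      qed
      also have "\<dots> = omega n ^ ((n - 1) * j * ?y) / of_real (sqrt (real n))"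
        using n by (simp add: fibre_vec_def)
      also have "omega n ^ ((n - 1) * j * ?y) = omega n ^ ((n - 1) * j * y + j * k * q)"
      proof (rule omega_power_cong[OF n])
        have "[(n - 1) * j * ?y = (n - 1) * j * (y + (n - 1) * k * q)] (mod n)"
          by (rule cong_mult[OF cong_refl]) (simp add: cong_def)
        also have "(n - 1) * j * (y + (n - 1) * k * q) = (n - 1) * j * y + ((n - 1) * (n - 1)) * (j * k * q)"
          by (simp only: distrib_left mult_ac)
        also have "[\<dots> = (n - 1) * j * y + 1 * (j * k * q)] (mod n)"
          by (intro cong_add cong_mult cong_refl minus_one_squared_cong n)
        finally show "[(n - 1) * j * ?y = (n - 1) * j * y + j * k * q] (mod n)" by simp
      qed
      finally have w: "W n a k b ?\<xi> s = omega n ^ ((n - 1) * j * y) * omega n ^ (j * k * q) / of_real (sqrt (real n))"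
        by (simp add: power_add)
      have "W n a k b ?\<xi> s * cnj (?\<xi> s) = (omega n ^ ((n - 1) * j * y) * cnj (omega n ^ ((n - 1) * j * y)))
         * omega n ^ (j * k * q) / of_real (sqrt (real n) * sqrt (real n))"
        unfolding w using s by (simp add: fibre_vec_def sqrt_mult_self_complex mult_ac)
      then show ?thesis unfolding omega_power_mult_cnj by simp
    qed
    then have "ell2_inner (W n a k b ?\<xi>) ?\<xi> = (\<Sum>s\<in>{c} \<times> {..<n}. omega n ^ (j * k * q) / of_nat n)"
      unfolding inner by (intro sum.cong refl)
    also have "\<dots> = omega n ^ (j * k * q)" using n by simp
    finally show ?thesis unfolding if_P[OF True] cd .
  next
    case False
    have "W n a k b ?\<xi> s * cnj (?\<xi> s) = 0" if sD: "s \<in> {c} \<times> {..<n}" for s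
    proof -
      obtain y where s: "s = (c, y)" "y < n" using sD by auto
      have "W n a k b ?\<xi> s = 0"
      proof (cases "a dvd c")
        case True
        then obtain q where q: "c = a * q" by blast
        then have "q \<noteq> 0" "a \<noteq> b" using c False True by auto
        then have "b * (c div a) \<noteq> c" using q ab by simp
        then show ?thesis unfolding s W_apply[OF e(1)] by (simp add: fibre_vec_def)
      qed (simp add: s W_apply[OF e(1)])
      then show ?thesis by simp
    qed
    then show ?thesis unfolding if_not_P[OF False] inner by (rule sum.neutral[OF ballI])
  qed
qed

definition fibre_state :: "nat \<Rightarrow> nat \<Rightarrow> (nat \<times> nat) oper \<Rightarrow> complex" where
  "fibre_state c j = (\<lambda>T\<in>nz_toeplitz n. ell2_inner (T (fibre_vec n c j)) (fibre_vec n c j))"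

lemma fibre_state_state: "1 \<le> c \<Longrightarrow> nz_state n (fibre_state c j)"
  unfolding fibre_state_def
  by (rule vector_state[OF nz_toeplitz_cstar[OF n] nz_one[OF n] fibre_vec_ell2])

lemma fibre_state_W:
  assumes "1 \<le> c" "1 \<le> a" "1 \<le> b"
  shows "fibre_state c j (W n a k b) = (if a = b \<and> a dvd c then omega n ^ (j * k * (c div a)) else 0)"
  using fibre_vec_W[OF assms] W_in_toeplitz[OF n assms(2,3)] by (simp add: fibre_state_def)

text \<open>A Gibbs mixture of fibre states, the fibre over c having energy ln c and weight
  c^(-\<beta>)/Z.\<close>

definition sys_state :: "nat set \<Rightarrow> real \<Rightarrow> nat \<Rightarrow> (nat \<times> nat) oper \<Rightarrow> complex" where
  "sys_state C \<beta> j = (\<lambda>T\<in>nz_toeplitz n.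
     \<Sum>\<^sub>\<infinity>c\<in>C. of_real (real c powr (- \<beta>) / divisor_system.Z C \<beta>) * fibre_state c j T)"

lemma sys_state_state:
  assumes "divisor_system C \<beta>" shows "nz_state n (sys_state C \<beta> j)"
proof -
  interpret divisor_system C \<beta> by fact
  have "((\<lambda>c. real c powr (- \<beta>) * (1 / Z)) has_sum (Z * (1 / Z))) C"
    by (rule has_sum_cmult_left) (simp add: Z_def has_sum_infsum summable)
  then have "((\<lambda>c. real c powr (- \<beta>) / Z) has_sum 1) C" using Z_ge_1 by simp
  then show ?thesis
    unfolding sys_state_def
    by (rule state_mixture[OF nz_toeplitz_cstar[OF n] nz_one[OF n], rotated])
       (use Z_ge_1 pos fibre_state_state in \<open>auto simp: Suc_le_eq\<close>)
qed

text \<open>Substituting ac for c extracts the factor a^(-\<beta>). If a is not in C, no multiple of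
  a is, and the value is 0. So for C smaller than all positive integers the scaling relation fails
  outside C, and such a state is only an approximation to a KMS state.\<close>

lemma sys_state_W:
  assumes "divisor_system C \<beta>" and ab: "1 \<le> a" "1 \<le> b"
  shows "sys_state C \<beta> j (W n a k b)
    = (if a = b \<and> a \<in> C then of_real (real a powr (- \<beta>)) * divisor_system.G C \<beta> n (j * k) else 0)"
proof -
  interpret divisor_system C \<beta> by fact
  let ?w = "\<lambda>c. real c powr (- \<beta>)"
  have "sys_state C \<beta> j (W n a k b)
    = (\<Sum>\<^sub>\<infinity>c\<in>C. of_real (?w c / Z) * (if a = b \<and> a dvd c then omega n ^ (j * k * (c div a)) else 0))"
    unfolding sys_state_def using W_in_toeplitz[OF n ab]
    by (simp only: restrict_apply if_True) (intro infsum_cong, simp add: fibre_state_W[OF _ ab] Suc_le_eq pos)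
  also have "\<dots> = (if a = b \<and> a \<in> C then of_real (?w a) * G n (j * k) else 0)"
  proof (cases "a = b \<and> a \<in> C")
    case False
    then have "(if a = b \<and> a dvd c then omega n ^ (j * k * (c div a)) else 0) = 0" if "c \<in> C" for c
      using dvd[OF that] by auto
    then show ?thesis unfolding if_not_P[OF False] by (intro infsum_0) simp
  next
    case True
    have "(\<Sum>\<^sub>\<infinity>c\<in>C. of_real (?w c / Z) * (if a = b \<and> a dvd c then omega n ^ (j * k * (c div a)) else 0))
      = (\<Sum>\<^sub>\<infinity>c\<in>{c \<in> C. a dvd c \<and> True}. of_real (?w c / Z) * omega n ^ (j * k * (c div a)))"
      by (rule infsum_cong_neutral) (use True in auto)
    also have "\<dots> = (\<Sum>\<^sub>\<infinity>c\<in>{c \<in> C. True}. of_real (?w (a * c) / Z) * omega n ^ (j * k * (a * c div a)))"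
      by (rule infsum_reindex_bij_betw[symmetric, OF multiples_bij[of a "\<lambda>_. True"]]) (use True in blast)
    also have "\<dots> = (\<Sum>\<^sub>\<infinity>c\<in>C. of_real (?w a) * (of_real (1 / Z) * (of_real (?w c) * omega n ^ (j * k * c))))"
      using ab by (simp add: powr_mult mult_ac)
    also have "\<dots> = of_real (?w a) * G n (j * k)"
      unfolding infsum_cmult_right' G_def ..
    finally show ?thesis unfolding if_P[OF True] .
  qed
  finally show ?thesis .
qed

section \<open>Positivity\<close>

lemma state_lincomb:
  assumes st: "nz_state n \<phi>" and I: "finite I" "\<And>i. i \<in> I \<Longrightarrow> T i \<in> nz_toeplitz n"
  shows "(\<lambda>f t. \<Sum>i\<in>I. a i * T i f t) \<in> nz_toeplitz n"
    "\<phi> (\<lambda>f t. \<Sum>i\<in>I. a i * T i f t) = (\<Sum>i\<in>I. a i * \<phi> (T i))"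
    "op_adj (nz_carrier n) (\<lambda>f t. \<Sum>i\<in>I. a i * T i f t) = (\<lambda>f t. \<Sum>i\<in>I. cnj (a i) * op_adj (nz_carrier n) (T i) f t)"
proof -
  note cd = cstar_subalgebraD[OF nz_toeplitz_cstar[OF n]]
  note sd = stateD[OF st]
  have "(\<lambda>f t. \<Sum>i\<in>I. a i * T i f t) \<in> nz_toeplitz n \<and>
    \<phi> (\<lambda>f t. \<Sum>i\<in>I. a i * T i f t) = (\<Sum>i\<in>I. a i * \<phi> (T i)) \<and>
    op_adj (nz_carrier n) (\<lambda>f t. \<Sum>i\<in>I. a i * T i f t) = (\<lambda>f t. \<Sum>i\<in>I. cnj (a i) * op_adj (nz_carrier n) (T i) f t)"
    using I
  proof (induction I rule: finite_induct)
    case empty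
    have z: "(\<lambda>f t. 0) = op_scale 0 (op_one (nz_carrier n))" by (simp add: op_scale_def)
    have "op_adj (nz_carrier n) (\<lambda>f t. 0) = (\<lambda>f t. 0)"
      unfolding z op_adj_scale[OF op_one_bounded] by (simp add: op_scale_def)
    then show ?case using cd(3)[OF nz_one[OF n], of 0] sd(3)[OF nz_one[OF n], of 0] by (simp add: z[symmetric])
  next
    case (insert i I)
    let ?U = "\<lambda>f t. \<Sum>i\<in>I. a i * T i f t"
    have eq: "(\<lambda>f t. \<Sum>i\<in>insert i I. a i * T i f t) = op_add (op_scale (a i) (T i)) ?U"
      using insert.hyps by (simp add: op_add_def op_scale_def)
    have IH: "?U \<in> nz_toeplitz n" "\<phi> ?U = (\<Sum>i\<in>I. a i * \<phi> (T i))"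
      "op_adj (nz_carrier n) ?U = (\<lambda>f t. \<Sum>i\<in>I. cnj (a i) * op_adj (nz_carrier n) (T i) f t)"
      and Ti: "T i \<in> nz_toeplitz n" using insert by auto
    have "op_adj (nz_carrier n) (op_add (op_scale (a i) (T i)) ?U)
      = (\<lambda>f t. \<Sum>i\<in>insert i I. cnj (a i) * op_adj (nz_carrier n) (T i) f t)"
      unfolding op_adj_lincomb[OF cd(1)[OF Ti] cd(1)[OF IH(1)]] IH(3)
      using insert.hyps by (simp add: op_add_def op_scale_def)
    moreover have "op_add (op_scale (a i) (T i)) ?U \<in> nz_toeplitz n" by (intro cd(2,3) Ti IH(1))
    moreover have "\<phi> (op_add (op_scale (a i) (T i)) ?U) = (\<Sum>i\<in>insert i I. a i * \<phi> (T i))"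
      unfolding sd(2)[OF cd(3)[OF Ti] IH(1)] sd(3)[OF Ti] IH(2) using insert.hyps by simp
    ultimately show ?case unfolding eq by blast
  qed
  then show "(\<lambda>f t. \<Sum>i\<in>I. a i * T i f t) \<in> nz_toeplitz n"
    "\<phi> (\<lambda>f t. \<Sum>i\<in>I. a i * T i f t) = (\<Sum>i\<in>I. a i * \<phi> (T i))"
    "op_adj (nz_carrier n) (\<lambda>f t. \<Sum>i\<in>I. a i * T i f t) = (\<lambda>f t. \<Sum>i\<in>I. cnj (a i) * op_adj (nz_carrier n) (T i) f t)"
    by blast+
qed

lemma kms_formulaD:
  assumes "kms_formula n \<beta> \<phi>" and a: "1 \<le> a"
  shows "\<phi> (W n a k a) = of_real (real a powr (- \<beta>)) * \<phi> (W n 1 k 1)"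
proof -
  have "\<forall>b\<ge>1. \<forall>k. \<phi> (W n a k b) = (if a = b then of_real (real a powr (- \<beta>)) * \<phi> (W n 1 k 1) else 0)"
    by (rule iffD1[OF kms_formula_def[OF n] assms(1), THEN spec, THEN mp, OF a])
  then have "\<forall>k. \<phi> (W n a k a) = (if a = a then of_real (real a powr (- \<beta>)) * \<phi> (W n 1 k 1) else 0)"
    using a by blast
  then show ?thesis by (simp only: refl if_True)
qed

text \<open>The value is \<open>\<phi>(e\<^sub>D E\<^sub>j)\<close>, where \<open>e\<^sub>D\<close> projects onto the fibres \<open>c\<close> coprime to \<open>D\<close> and
  \<open>E\<^sub>j\<close> is a spectral projection of \<open>R\<close>.\<close>

lemma fibre_projection_nonneg:
  assumes st: "nz_state n \<phi>" and kf: "kms_formula n \<beta> \<phi>" and D: "1 \<le> D"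
  shows "(1 / of_nat n) * (\<Sum>k<n. omega n ^ ((n - 1) * j * k) *
     (\<Sum>d | d dvd D. of_real (moebius d * real d powr (- \<beta>)) * \<phi> (W n 1 (k * d) 1))) \<in> \<real>\<^sub>\<ge>\<^sub>0"
proof -
  let ?S = "nz_carrier n"
  let ?I = "{..<n} \<times> {d. d dvd D}"
  \<comment> \<open>X is e_D E_j expanded: E_j is the average of w^(-jk) R^k over k, e_D is the
    moebius sum of the projections V_d V_d^* over d dividing D, and moving R^k past V_d^* turns k
    into kd.\<close>
  define a where "a = (\<lambda>(k, d). (1 / of_nat n) * omega n ^ ((n - 1) * j * k) * of_real (moebius d))"
  define T where "T = (\<lambda>(k, d). W n d (k * d) d)"
  define X where "X = (\<lambda>f t. \<Sum>i\<in>?I. a i * T i f t)"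
  have finD: "finite {d. d dvd D}" using D by simp
  then have finI: "finite ?I" by simp
  have d1: "1 \<le> d" if "d dvd D" for d using that D by (auto intro!: Suc_leI gr0I)
  have TA: "T i \<in> nz_toeplitz n" if "i \<in> ?I" for i
    using that by (auto simp: T_def intro!: W_in_toeplitz[OF n] d1)
  have lin: "X \<in> nz_toeplitz n" "\<phi> X = (\<Sum>i\<in>?I. a i * \<phi> (T i))"
    "op_adj ?S X = (\<lambda>f t. \<Sum>i\<in>?I. cnj (a i) * op_adj ?S (T i) f t)"
    unfolding X_def by (rule state_lincomb[OF st finI TA], assumption)+
  have Xb: "X \<in> bounded_ops ?S" using lin(1) nz_toeplitz_bounded[OF n] by blast
  have bij: "bij_betw (\<lambda>k. (n - 1) * k mod n) {..<n} {..<n}"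
  proof (rule unit_mult_bij[OF n])
    show "coprime (n - 1) n" using coprime_diff_one_left_nat[of n] n by simp
  qed
  \<comment> \<open>Taking adjoints negates k both in the operator and in the root of unity, so the
    substitution k -> -k restores the sum.\<close>
  have "op_adj ?S X = X"
  proof -
    have "(\<lambda>f t. \<Sum>i\<in>?I. cnj (a i) * op_adj ?S (T i) f t) = X"
    proof (intro ext)
      fix f t
      have "(\<Sum>i\<in>?I. cnj (a i) * op_adj ?S (T i) f t)
        = (\<Sum>d | d dvd D. \<Sum>k<n. cnj (a (k, d)) * op_adj ?S (T (k, d)) f t)"
        by (subst sum.swap) (simp add: sum.cartesian_product)
      also have "\<dots> = (\<Sum>d | d dvd D. \<Sum>k<n. a ((n - 1) * k mod n, d) * T ((n - 1) * k mod n, d) f t)"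
      proof (intro sum.cong refl)
        fix d k assume d: "d \<in> {d. d dvd D}"
        let ?k = "(n - 1) * k mod n"
        have "op_adj ?S (T (k, d)) = W n d ((n - 1) * (k * d)) d"
          unfolding T_def prod.case using d d1 by (intro W_adj) auto
        also have "\<dots> = T (?k, d)"
          unfolding T_def prod.case
          by (rule W_cong) (simp add: cong_def mod_mult_left_eq mult.assoc[symmetric])
        moreover have "cnj (a (k, d)) = a (?k, d)"
        proof -
          have "omega n ^ ((n - 1) * j * ?k) * omega n ^ ((n - 1) * j * k) = 1"
          proof -
            have "[(n - 1) * j * ?k + (n - 1) * j * k = (n - 1) * j * ((n - 1) * k) + (n - 1) * j * k] (mod n)"
              by (intro cong_add cong_mult cong_refl) (simp add: cong_def)
            also have "(n - 1) * j * ((n - 1) * k) + (n - 1) * j * k = n * ((n - 1) * j * k)"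
            proof -
              have "Suc (n - 1) = n" using n by simp
              then show ?thesis by (metis add.commute mult.left_commute mult_Suc)
            qed
            also have "[n * ((n - 1) * j * k) = 0] (mod n)" by (simp add: cong_0_iff)
            finally have "n dvd (n - 1) * j * ?k + (n - 1) * j * k" by (simp only: cong_0_iff)
            then show ?thesis unfolding power_add[symmetric] using omega_power_eq_1_iff[OF n] by blast
          qed
          then have "omega n ^ ((n - 1) * j * ?k) = cnj (omega n ^ ((n - 1) * j * k))"
          proof -
            let ?x = "omega n ^ ((n - 1) * j * ?k)" and ?y = "omega n ^ ((n - 1) * j * k)"
            assume xy: "?x * ?y = 1"
            have "?x = ?x * (?y * cnj ?y)" unfolding omega_power_mult_cnj by simp
            also have "\<dots> = cnj ?y" unfolding mult.assoc[symmetric] xy by simp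
            finally show ?thesis .
          qed
          then show ?thesis by (simp add: a_def)
        qed
        ultimately show "cnj (a (k, d)) * op_adj ?S (T (k, d)) f t = a (?k, d) * T (?k, d) f t" by simp
      qed
      also have "\<dots> = (\<Sum>d | d dvd D. \<Sum>k<n. a (k, d) * T (k, d) f t)"
        by (intro sum.cong refl sum.reindex_bij_betw[OF bij, of "\<lambda>k. a (k, d) * T (k, d) f t" for d])
      also have "\<dots> = X f t"
        unfolding X_def by (subst sum.swap) (simp add: sum.cartesian_product)
      finally show "(\<Sum>i\<in>?I. cnj (a i) * op_adj ?S (T i) f t) = X f t" .
    qed
    then show ?thesis using lin(3) by simp
  qed
  \<comment> \<open>On coordinates the moebius sum over d becomes the indicator of c coprime to D,
    and what remains is a Fourier average over k, idempotent by the substitution k' -> k +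
    k'.\<close>
  moreover have "X \<circ> X = X"
  proof (rule op_eqI[OF op_comp_bounded(1)[OF Xb Xb] Xb])
    fix f assume f: "f \<in> ell2 ?S"
    have apply_X: "X g (c, y) = (if 1 \<le> c \<and> y < n \<and> coprime c D
        then (1 / of_nat n) * (\<Sum>k<n. omega n ^ ((n - 1) * j * k) * g (c, (y + (n - 1) * k * c) mod n)) else 0)"
      if g: "g \<in> ell2 ?S" for g c y
    proof -
      let ?h = "\<lambda>k. (1 / of_nat n) * omega n ^ ((n - 1) * j * k) * g (c, (y + (n - 1) * k * c) mod n)"
      have "X g (c, y) = (\<Sum>k<n. \<Sum>d | d dvd D. a (k, d) * T (k, d) g (c, y))"
        unfolding X_def by (simp add: sum.cartesian_product)
      also have "\<dots> = (\<Sum>k<n. \<Sum>d | d dvd D. if 1 \<le> c \<and> y < n \<and> d dvd c then of_real (moebius d) * ?h k else 0)"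
      proof (intro sum.cong refl)
        fix k d assume "d \<in> {d. d dvd D}"
        show "a (k, d) * T (k, d) g (c, y) = (if 1 \<le> c \<and> y < n \<and> d dvd c then of_real (moebius d) * ?h k else 0)"
          unfolding T_def a_def prod.case W_apply[OF g] by (auto simp: mult.assoc)
      qed
      also have "\<dots> = (\<Sum>k<n. if 1 \<le> c \<and> y < n \<and> coprime c D then ?h k else 0)"
      proof (rule sum.cong)
        fix k
        show "(\<Sum>d | d dvd D. if 1 \<le> c \<and> y < n \<and> d dvd c then of_real (moebius d) * ?h k else 0)
          = (if 1 \<le> c \<and> y < n \<and> coprime c D then ?h k else 0)"
        proof (cases "1 \<le> c \<and> y < n")
          case True
          have "(\<Sum>d | d dvd D. if 1 \<le> c \<and> y < n \<and> d dvd c then of_real (moebius d) * ?h k else 0)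
            = (\<Sum>d | d dvd gcd D c. of_real (moebius d) * ?h k)"
            by (rule sum.mono_neutral_cong_right[OF finD]) (use True in auto)
          also have "\<dots> = of_real (\<Sum>d | d dvd gcd D c. moebius d) * ?h k"
            by (simp only: of_real_sum sum_distrib_right)
          also have "\<dots> = (if coprime c D then ?h k else 0)"
          proof -
            have "gcd D c > 0" using D by simp
            moreover have "gcd D c = 1 \<longleftrightarrow> coprime c D"
              by (simp only: coprime_iff_gcd_eq_1 gcd.commute[of D c])
            ultimately show ?thesis by (simp only: moebius_sum) simp
          qed
          finally show ?thesis using True by simp
        next
          case False
          then have "(1 \<le> c \<and> y < n \<and> P) = False" for P by blast
          then show ?thesis by (simp only: if_False sum.neutral_const)
        qed
      qed simp
      finally have e: "X g (c, y) = (\<Sum>k<n. if 1 \<le> c \<and> y < n \<and> coprime c D then ?h k else 0)" .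
      show ?thesis
      proof (cases "1 \<le> c \<and> y < n \<and> coprime c D")
        case True
        show ?thesis unfolding e if_P[OF True] by (simp add: sum_distrib_left mult.assoc)
      next
        case False
        show ?thesis unfolding e if_not_P[OF False] by simp
      qed
    qed
    have Xf: "X f \<in> ell2 ?S" using Xb by simp
    show "(X \<circ> X) f = X f"
    proof
      fix s :: "nat \<times> nat"
      obtain c y where s: "s = (c, y)" by (cases s)
      show "(X \<circ> X) f s = X f s"
      proof (cases "1 \<le> c \<and> y < n \<and> coprime c D")
        case False
        then show ?thesis unfolding s comp_apply apply_X[OF Xf] apply_X[OF f] by (simp only: if_False)
      next
        case True
        let ?F = "\<lambda>k. omega n ^ ((n - 1) * j * k) * f (c, (y + (n - 1) * k * c) mod n)"
        have per: "?F (k mod n) = ?F k" for k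
        proof -
          have "omega n ^ ((n - 1) * j * (k mod n)) = omega n ^ ((n - 1) * j * k)"
            by (intro omega_power_cong[OF n] cong_mult cong_refl) (simp add: cong_def)
          moreover have "(y + (n - 1) * (k mod n) * c) mod n = (y + (n - 1) * k * c) mod n"
            using cong_add[OF cong_refl cong_mult[OF cong_mult[OF cong_refl cong_mod_left[THEN iffD2, OF cong_refl]] cong_refl]]
            unfolding cong_def by blast
          ultimately show ?thesis by simp
        qed
        have shift: "(\<Sum>k'<n. ?F (k + k')) = (\<Sum>k<n. ?F k)" for k
        proof -
          have "bij_betw (\<lambda>k'. (k + k') mod n) {..<n} {..<n}"
          proof -
            have "inj_on (\<lambda>k'. (k + k') mod n) {..<n}"
              by (rule inj_onI) (metis add.commute lessThan_iff mod_add_left_cancel_nat)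
            moreover have "(\<lambda>k'. (k + k') mod n) ` {..<n} \<subseteq> {..<n}" using n by auto
            ultimately show ?thesis by (simp add: bij_betw_def endo_inj_surj)
          qed
          then have "(\<Sum>k'<n. ?F ((k + k') mod n)) = (\<Sum>k<n. ?F k)" by (rule sum.reindex_bij_betw)
          then show ?thesis unfolding per .
        qed
        have "X (X f) (c, y) = (1 / of_nat n) * (\<Sum>k<n. omega n ^ ((n - 1) * j * k) * X f (c, (y + (n - 1) * k * c) mod n))"
          using True unfolding apply_X[OF Xf] by simp
        also have "\<dots> = (1 / of_nat n) * (\<Sum>k<n. (1 / of_nat n) * (\<Sum>k'<n. ?F (k + k')))"
        proof (rule arg_cong2[of _ _ _ _ "(*)", OF refl sum.cong[OF refl]])
          fix k
          let ?y = "(y + (n - 1) * k * c) mod n"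
          have "X f (c, ?y) = (1 / of_nat n) * (\<Sum>k'<n. omega n ^ ((n - 1) * j * k') * f (c, (?y + (n - 1) * k' * c) mod n))"
            using True n unfolding apply_X[OF f] by simp
          then have "omega n ^ ((n - 1) * j * k) * X f (c, ?y) = (1 / of_nat n) * (\<Sum>k'<n. omega n ^ ((n - 1) * j * k) * (omega n ^ ((n - 1) * j * k') * f (c, (?y + (n - 1) * k' * c) mod n)))"
            by (simp add: sum_distrib_left mult_ac)
          also have "\<dots> = (1 / of_nat n) * (\<Sum>k'<n. ?F (k + k'))"
          proof (rule arg_cong2[of _ _ _ _ "(*)", OF refl sum.cong[OF refl]])
            fix k'
            have "(?y + (n - 1) * k' * c) mod n = (y + (n - 1) * (k + k') * c) mod n"
              by (simp only: mod_add_left_eq distrib_left distrib_right add.assoc)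
            then show "omega n ^ ((n - 1) * j * k) * (omega n ^ ((n - 1) * j * k') * f (c, (?y + (n - 1) * k' * c) mod n)) = ?F (k + k')"
              by (simp only: power_add distrib_left mult.assoc)
          qed
          finally show "omega n ^ ((n - 1) * j * k) * X f (c, ?y) = (1 / of_nat n) * (\<Sum>k'<n. ?F (k + k'))" .
        qed
        also have "\<dots> = (1 / of_nat n) * (\<Sum>k<n. ?F k)" unfolding shift using n by simp
        also have "\<dots> = X f (c, y)" using True unfolding apply_X[OF f] by simp
        finally show ?thesis by (simp add: s)
      qed
    qed
  qed
  \<comment> \<open>X is a projection, so its value is the value at X^* X.\<close>
  ultimately have "\<phi> X \<in> \<real>\<^sub>\<ge>\<^sub>0" using stateD(4)[OF st lin(1)] by simp
  also have "\<phi> X = (\<Sum>k<n. \<Sum>d | d dvd D. a (k, d) * \<phi> (T (k, d)))"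
    unfolding lin(2) by (simp add: sum.cartesian_product)
  also have "\<dots> = (\<Sum>k<n. \<Sum>d | d dvd D. (1 / of_nat n) * (omega n ^ ((n - 1) * j * k) *
      (of_real (moebius d * real d powr (- \<beta>)) * \<phi> (W n 1 (k * d) 1))))"
  proof (intro sum.cong refl)
    fix k d assume "d \<in> {d. d dvd D}"
    then have "1 \<le> d" using d1 by blast
    then have "\<phi> (W n d (k * d) d) = of_real (real d powr (- \<beta>)) * \<phi> (W n 1 (k * d) 1)"
      by (rule kms_formulaD[OF kf])
    then show "a (k, d) * \<phi> (T (k, d)) = (1 / of_nat n) * (omega n ^ ((n - 1) * j * k) *
      (of_real (moebius d * real d powr (- \<beta>)) * \<phi> (W n 1 (k * d) 1)))"
      unfolding a_def T_def prod.case by simp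
  qed
  finally show ?thesis by (simp only: sum_distrib_left)
qed

end

section \<open>Simplices with finitely many vertices\<close>

lemma sets_restrict_borel_finite:
  fixes X :: "'x::t1_space set"
  assumes "finite X" shows "sets (restrict_space borel X) = Pow X"
proof
  show "sets (restrict_space borel X) \<subseteq> Pow X" by (auto simp: sets_restrict_space)
  show "Pow X \<subseteq> sets (restrict_space borel X)"
  proof
    fix B assume B: "B \<in> Pow X"
    then have "finite B" using assms finite_subset by blast
    then have "B \<in> sets borel" by (intro borel_closed finite_imp_closed)
    then show "B \<in> sets (restrict_space borel X)" using B by (auto simp: sets_restrict_space)
  qed
qed

lemma prob_measures_finite:
  fixes X :: "'x::t1_space set"
  assumes X: "finite X" and P: "P \<in> prob_measures X"
  shows "prob_space P" "sets P = Pow X" "space P = X" "(\<Sum>x\<in>X. measure P {x}) = 1"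
    "x \<in> X \<Longrightarrow> (\<integral>y. indicator {x} y \<partial>P) = measure P {x}"
proof -
  show ps: "prob_space P" using P by (simp add: prob_measures_def)
  interpret prob_space P by fact
  show sP: "sets P = Pow X" using P sets_restrict_borel_finite[OF X] by (simp add: prob_measures_def)
  show spP: "space P = X" using sets_eq_imp_space_eq[of P "count_space X"] sP by simp
  have "measure P X = (\<Sum>x\<in>X. measure P {x})"
    by (rule measure_eq_sum_singleton) (use X sP in auto)
  then show "(\<Sum>x\<in>X. measure P {x}) = 1" using prob_space spP by simp
  show "(\<integral>y. indicator {x} y \<partial>P) = measure P {x}" if "x \<in> X"
    using that sP spP by simp
qed

lemma prob_measures_point:
  fixes X :: "'x::t1_space set"
  assumes X: "finite X" and p: "\<And>x. x \<in> X \<Longrightarrow> 0 \<le> p x" "(\<Sum>x\<in>X. p x) = 1"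
  shows "point_measure X (\<lambda>x. ennreal (p x)) \<in> prob_measures X"
    "x \<in> X \<Longrightarrow> measure (point_measure X (\<lambda>x. ennreal (p x))) {x} = p x"
    "(\<integral>x. f x \<partial>(point_measure X (\<lambda>x. ennreal (p x)))) = (\<Sum>x\<in>X. p x * f x)"
proof -
  let ?M = "point_measure X (\<lambda>x. ennreal (p x))"
  have em: "emeasure ?M B = ennreal (\<Sum>x\<in>B. p x)" if "B \<subseteq> X" for B
    using that X p by (subst emeasure_point_measure_finite) (auto intro!: sum_ennreal)
  show "?M \<in> prob_measures X"
    unfolding prob_measures_def
  proof (intro CollectI conjI)
    show "prob_space ?M" by (rule prob_spaceI) (simp add: em space_point_measure p)
    show "sets ?M = sets (restrict_space borel X)"
      by (simp add: sets_point_measure sets_restrict_borel_finite[OF X])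
  qed
  show "measure ?M {x} = p x" if "x \<in> X" using em[of "{x}"] that p by (simp add: measure_def)
  show "(\<integral>x. f x \<partial>?M) = (\<Sum>x\<in>X. p x * f x)"
    using lebesgue_integral_point_measure_finite[OF X, of p f] p by simp
qed

text \<open>The abstract part common to both temperature ranges. The barycentric coordinates
  \<open>c x\<close> invert the mixture map by \<open>dec3\<close> and \<open>inj\<close>, and by
  \<open>coef\<close> they are finite combinations of evaluations, hence affine and weak*
  continuous. Extremality and the homeomorphism then follow without Choquet theory.\<close>

lemma simplex_of_states:
  fixes X :: "'x::t1_space set" and \<psi> :: "'x \<Rightarrow> 'a oper \<Rightarrow> complex"
    and c :: "'x \<Rightarrow> ('a oper \<Rightarrow> complex) \<Rightarrow> complex"
  defines "mix \<equiv> \<lambda>A p. \<lambda>T\<in>A. \<Sum>x\<in>X. of_real (p x) * \<psi> x T"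
  assumes X: "finite X" and Kext: "\<And>\<phi>. \<phi> \<in> K \<Longrightarrow> \<phi> \<in> extensional A"
    and psi: "\<And>x. x \<in> X \<Longrightarrow> \<psi> x \<in> K"
    and mixK: "\<And>p. (\<And>x. x \<in> X \<Longrightarrow> 0 \<le> p x) \<Longrightarrow> (\<Sum>x\<in>X. p x) = 1 \<Longrightarrow> mix A p \<in> K"
    and dec1: "\<And>\<phi> x. \<phi> \<in> K \<Longrightarrow> x \<in> X \<Longrightarrow> c x \<phi> \<in> \<real>\<^sub>\<ge>\<^sub>0" and dec2: "\<And>\<phi>. \<phi> \<in> K \<Longrightarrow> (\<Sum>x\<in>X. c x \<phi>) = 1"
    and dec3: "\<And>\<phi> T. \<phi> \<in> K \<Longrightarrow> T \<in> A \<Longrightarrow> \<phi> T = (\<Sum>x\<in>X. c x \<phi> * \<psi> x T)"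
    and I: "finite I" "\<And>i. i \<in> I \<Longrightarrow> B i \<in> A"
    and coef: "\<And>\<phi> x. \<phi> \<in> K \<Longrightarrow> x \<in> X \<Longrightarrow> c x \<phi> = (\<Sum>i\<in>I. a x i * \<phi> (B i))"
    and inj: "\<And>p x. (\<And>x. x \<in> X \<Longrightarrow> 0 \<le> p x) \<Longrightarrow> (\<Sum>x\<in>X. p x) = 1 \<Longrightarrow> x \<in> X \<Longrightarrow> c x (mix A p) = of_real (p x)"
  shows "x \<in> X \<Longrightarrow> \<psi> x \<in> extremal A K" "extends_to_affine_homeo X A K \<psi>"
proof -
  have point: "mix A (\<lambda>y. if y = x then 1 else 0) = \<psi> x" if x: "x \<in> X" for x
  proof (rule extensionalityI[of _ A])
    show "mix A (\<lambda>y. if y = x then 1 else 0) T = \<psi> x T" if "T \<in> A" for T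
    proof -
      have "mix A (\<lambda>y. if y = x then 1 else 0) T = (\<Sum>y\<in>X. if y = x then \<psi> y T else 0)"
        using that unfolding mix_def by (simp add: if_distrib[of "\<lambda>r. of_real r * _"] cong: if_cong)
      then show ?thesis using X x by simp
    qed
    show "\<psi> x \<in> extensional A" by (rule Kext[OF psi[OF x]])
  qed (simp add: mix_def)
  have cpsi: "c y (\<psi> x) = (if y = x then 1 else 0)" if "x \<in> X" "y \<in> X" for x y
    using inj[of "\<lambda>y. if y = x then 1 else 0" y] that X unfolding point[OF that(1)] by simp
  show "\<psi> x \<in> extremal A K" if x: "x \<in> X" for x
    unfolding extremal_def
  proof (intro CollectI conjI ballI allI impI psi[OF x])
    fix \<phi>1 \<phi>2 and t :: real
    assume K: "\<phi>1 \<in> K" "\<phi>2 \<in> K"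
      and t: "0 < t \<and> t < 1 \<and> (\<forall>T\<in>A. \<psi> x T = of_real t * \<phi>1 T + of_real (1 - t) * \<phi>2 T)"
    \<comment> \<open>Coordinates respect convex combinations because \<open>coef\<close> expresses
      them linearly. At a vertex the coordinates for other points are 0, and as they are nonnegative
      they vanish for both components.\<close>
    have lin: "c y (\<psi> x) = of_real t * c y \<phi>1 + of_real (1 - t) * c y \<phi>2" if y: "y \<in> X" for y
    proof -
      have "c y (\<psi> x) = (\<Sum>i\<in>I. a y i * (of_real t * \<phi>1 (B i) + of_real (1 - t) * \<phi>2 (B i)))"
        unfolding coef[OF psi[OF x] y] using t I(2) by (intro sum.cong refl) simp
      also have "\<dots> = of_real t * (\<Sum>i\<in>I. a y i * \<phi>1 (B i)) + of_real (1 - t) * (\<Sum>i\<in>I. a y i * \<phi>2 (B i))"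
        unfolding sum_distrib_left sum.distrib[symmetric] by (intro sum.cong refl) (simp only: distrib_left mult_ac)
      finally show ?thesis unfolding coef[OF K(1) y] coef[OF K(2) y] .
    qed
    have zero: "c y \<phi>1 = 0 \<and> c y \<phi>2 = 0" if y: "y \<in> X" "y \<noteq> x" for y
    proof -
      obtain r1 where r1: "c y \<phi>1 = of_real r1" "0 \<le> r1" using dec1[OF K(1) y(1)] by (rule nonneg_Reals_cases)
      obtain r2 where r2: "c y \<phi>2 = of_real r2" "0 \<le> r2" using dec1[OF K(2) y(1)] by (rule nonneg_Reals_cases)
      have "complex_of_real (t * r1 + (1 - t) * r2) = of_real 0"
        using lin[OF y(1)] cpsi[OF x y(1)] y(2) r1 r2 by simp
      then have s: "t * r1 + (1 - t) * r2 = 0" unfolding of_real_eq_iff .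
      have "0 \<le> t * r1" "0 \<le> (1 - t) * r2" using t r1 r2 by simp_all
      then have "t * r1 = 0 \<and> (1 - t) * r2 = 0" using s by linarith
      then show ?thesis using t r1 r2 by simp
    qed
    have eq: "\<phi> = \<psi> x" if phi: "\<phi> \<in> K" and z: "\<And>y. y \<in> X \<Longrightarrow> y \<noteq> x \<Longrightarrow> c y \<phi> = 0" for \<phi>
    proof (rule extensionalityI[OF Kext[OF phi] Kext[OF psi[OF x]]])
      fix T assume T: "T \<in> A"
      have "(\<Sum>y\<in>X. c y \<phi>) = (\<Sum>y\<in>{x}. c y \<phi>)"
        by (rule sum.mono_neutral_right) (use X x z in auto)
      then have one: "c x \<phi> = 1" using dec2[OF phi] by simp
      have "\<phi> T = (\<Sum>y\<in>{x}. c y \<phi> * \<psi> y T)"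
        unfolding dec3[OF phi T] by (rule sum.mono_neutral_right) (use X x z in auto)
      then show "\<phi> T = \<psi> x T" using one by simp
    qed
    show "\<phi>1 = \<psi> x" by (rule eq[OF K(1)]) (use zero in blast)
    show "\<phi>2 = \<psi> x" by (rule eq[OF K(2)]) (use zero in blast)
  qed
  define \<Psi> where "\<Psi> P = mix A (\<lambda>x. measure P {x})" for P
  \<comment> \<open>The inverse of \<Psi>: the coordinates of a state, read as point masses.\<close>
  define \<Phi> where "\<Phi> \<phi> = point_measure X (\<lambda>x. ennreal (Re (c x \<phi>)))" for \<phi>
  have re: "0 \<le> Re (c x \<phi>)" "of_real (Re (c x \<phi>)) = c x \<phi>" if "\<phi> \<in> K" "x \<in> X" for x \<phi>
    using dec1[OF that] by (auto simp: complex_nonneg_Reals_iff complex_eq_iff)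
  have resum: "(\<Sum>x\<in>X. Re (c x \<phi>)) = 1" if "\<phi> \<in> K" for \<phi>
    using dec2[OF that] by (simp add: Re_sum[symmetric])
  note point_m = prob_measures_point[OF X re(1) resum]
  have PsiK: "\<Psi> P \<in> K" if "P \<in> prob_measures X" for P
    unfolding \<Psi>_def by (rule mixK) (use prob_measures_finite[OF X that] in auto)
  have PhiP: "\<Phi> \<phi> \<in> prob_measures X" if "\<phi> \<in> K" for \<phi>
    unfolding \<Phi>_def by (rule point_m(1)[OF that _ that])
  have PsiPhi: "\<Psi> (\<Phi> \<phi>) = \<phi>" if phi: "\<phi> \<in> K" for \<phi>
  proof (rule extensionalityI[OF Kext[OF PsiK[OF PhiP[OF phi]]] Kext[OF phi]])
    fix T assume T: "T \<in> A"
    have "measure (\<Phi> \<phi>) {x} = Re (c x \<phi>)" if "x \<in> X" for x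
      unfolding \<Phi>_def by (rule point_m(2)[OF phi _ phi that])
    then show "\<Psi> (\<Phi> \<phi>) T = \<phi> T"
      unfolding \<Psi>_def mix_def dec3[OF phi T] using T re(2)[OF phi] by simp
  qed
  have PhiPsi: "\<Phi> (\<Psi> P) = P" if P: "P \<in> prob_measures X" for P
  proof (rule measure_eqI_finite[OF _ _ X])
    note PP = prob_measures_finite[OF X P]
    note QQ = prob_measures_finite[OF X PhiP[OF PsiK[OF P]]]
    show "sets (\<Phi> (\<Psi> P)) = Pow X" "sets P = Pow X" by (rule QQ(2), rule PP(2))
    fix x assume x: "x \<in> X"
    have "measure (\<Phi> (\<Psi> P)) {x} = Re (c x (\<Psi> P))"
      unfolding \<Phi>_def by (rule point_m(2)[OF PsiK[OF P] _ PsiK[OF P] x])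
    also have "c x (\<Psi> P) = of_real (measure P {x})"
      unfolding \<Psi>_def by (rule inj) (use PP x in auto)
    finally have eq: "measure (\<Phi> (\<Psi> P)) {x} = measure P {x}" by simp
    interpret P: prob_space P by (rule PP(1))
    interpret Q: prob_space "\<Phi> (\<Psi> P)" by (rule QQ(1))
    from eq show "emeasure (\<Phi> (\<Psi> P)) {x} = emeasure P {x}"
      by (simp add: P.emeasure_eq_measure Q.emeasure_eq_measure)
  qed
  let ?C = "{f :: 'x \<Rightarrow> real. continuous_on X f}"
  let ?prod = "product_topology (\<lambda>_. euclideanreal) ?C"
  have top1: "topspace (prob_weak_star X) = prob_measures X"
    unfolding prob_weak_star_def topspace_pullback_topology by auto
  have top2: "topspace (weak_star A K) = K"
    using Kext by (auto simp: weak_star_def PiE_def)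
  have cont1: "continuous_map (prob_weak_star X) (weak_star A K) \<Psi>"
    unfolding weak_star_def continuous_map_in_subtopology
  proof (intro conjI)
    show "\<Psi> \<in> topspace (prob_weak_star X) \<rightarrow> K" unfolding top1 using PsiK by blast
    show "continuous_map (prob_weak_star X) (product_topology (\<lambda>_. euclidean) A) \<Psi>"
      unfolding continuous_map_componentwise
    proof (intro conjI ballI)
      show "\<Psi> ` topspace (prob_weak_star X) \<subseteq> extensional A" unfolding top1 using PsiK Kext by blast
      fix T assume T: "T \<in> A"
      let ?g = "\<lambda>h. \<Sum>x\<in>X. complex_of_real (h (indicator {x})) * \<psi> x T"
      \<comment> \<open>On a finite T1 set every function is continuous, so the masses of points are
        among the functions that define the topology on measures.\<close>
      have ind: "indicator {x} \<in> ?C" for x by (simp add: continuous_on_finite[OF X])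
      have "continuous_map ?prod euclidean ?g"
      proof (rule continuous_map_sum[OF X])
        fix x assume "x \<in> X"
        have "continuous_map ?prod euclideanreal (\<lambda>h. h (indicator {x}))"
          by (rule continuous_map_product_projection[OF ind])
        moreover have "continuous_map euclideanreal euclidean (\<lambda>r. complex_of_real r * \<psi> x T)"
          unfolding continuous_map_iff_continuous2 by (intro continuous_intros)
        ultimately show "continuous_map ?prod euclidean (\<lambda>h. complex_of_real (h (indicator {x})) * \<psi> x T)"
          using continuous_map_compose[of ?prod euclideanreal "\<lambda>h. h (indicator {x})" euclidean "\<lambda>r. complex_of_real r * \<psi> x T"]
          by (simp add: o_def)
      qed
      then have "continuous_map (prob_weak_star X) euclidean (?g \<circ> (\<lambda>P. \<lambda>f\<in>?C. \<integral>x. f x \<partial>P))"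
        unfolding prob_weak_star_def by (rule continuous_map_pullback)
      then show "continuous_map (prob_weak_star X) euclidean (\<lambda>P. \<Psi> P T)"
      proof (rule continuous_map_eq)
        fix P assume "P \<in> topspace (prob_weak_star X)"
        then have "P \<in> prob_measures X" by (simp add: top1)
        then show "(?g \<circ> (\<lambda>P. \<lambda>f\<in>?C. \<integral>x. f x \<partial>P)) P = \<Psi> P T"
          using T ind prob_measures_finite(5)[OF X] by (simp add: \<Psi>_def mix_def)
      qed
    qed
  qed
  have cont2: "continuous_map (weak_star A K) (prob_weak_star X) \<Phi>"
    unfolding prob_weak_star_def
  proof (rule continuous_map_pullback')
    show "topspace (weak_star A K) \<subseteq> \<Phi> -` prob_measures X" unfolding top2 using PhiP by blast
    show "continuous_map (weak_star A K) ?prod ((\<lambda>P. \<lambda>f\<in>?C. \<integral>x. f x \<partial>P) \<circ> \<Phi>)"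
      unfolding continuous_map_componentwise
    proof (intro conjI ballI)
      fix f assume f: "f \<in> ?C"
      have "continuous_map (weak_star A K) euclideanreal (\<lambda>\<phi>. \<Sum>x\<in>X. Re (\<Sum>i\<in>I. a x i * \<phi> (B i)) * f x)"
      proof (rule continuous_map_sum[OF X])
        fix x
        have "continuous_map (weak_star A K) euclidean (\<lambda>\<phi>. \<Sum>i\<in>I. a x i * \<phi> (B i))"
        proof (rule continuous_map_sum[OF I(1)])
          fix i assume i: "i \<in> I"
          have "continuous_map (weak_star A K) euclidean (\<lambda>\<phi>. \<phi> (B i))"
            unfolding weak_star_def
            by (rule continuous_map_from_subtopology[OF continuous_map_product_projection[OF I(2)[OF i]]])
          moreover have "continuous_map euclidean euclidean (\<lambda>z. a x i * z)"
            unfolding continuous_map_iff_continuous2 by (intro continuous_intros)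
          ultimately show "continuous_map (weak_star A K) euclidean (\<lambda>\<phi>. a x i * \<phi> (B i))"
            using continuous_map_compose[of "weak_star A K" euclidean "\<lambda>\<phi>. \<phi> (B i)" euclidean "\<lambda>z. a x i * z"]
            by (simp add: o_def)
        qed
        moreover have "continuous_map euclidean euclideanreal (\<lambda>z. Re z * f x)"
          unfolding continuous_map_iff_continuous2 by (intro continuous_intros)
        ultimately show "continuous_map (weak_star A K) euclideanreal (\<lambda>\<phi>. Re (\<Sum>i\<in>I. a x i * \<phi> (B i)) * f x)"
          using continuous_map_compose[of "weak_star A K" euclidean "\<lambda>\<phi>. \<Sum>i\<in>I. a x i * \<phi> (B i)" euclideanreal "\<lambda>z. Re z * f x"]
          by (simp add: o_def)
      qed
      then show "continuous_map (weak_star A K) euclideanreal (\<lambda>\<phi>. ((\<lambda>P. \<lambda>f\<in>?C. \<integral>x. f x \<partial>P) \<circ> \<Phi>) \<phi> f)"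
      proof (rule continuous_map_eq)
        fix \<phi> assume "\<phi> \<in> topspace (weak_star A K)"
        then have phi: "\<phi> \<in> K" by (simp add: top2)
        have "(\<integral>x. f x \<partial>(\<Phi> \<phi>)) = (\<Sum>x\<in>X. Re (c x \<phi>) * f x)"
          unfolding \<Phi>_def by (rule point_m(3)[OF phi _ phi])
        also have "\<dots> = (\<Sum>x\<in>X. Re (\<Sum>i\<in>I. a x i * \<phi> (B i)) * f x)"
          by (rule sum.cong) (simp_all add: coef[OF phi])
        finally show "(\<Sum>x\<in>X. Re (\<Sum>i\<in>I. a x i * \<phi> (B i)) * f x) = ((\<lambda>P. \<lambda>f\<in>?C. \<integral>x. f x \<partial>P) \<circ> \<Phi>) \<phi> f"
          using f by simp
      qed
    qed auto
  qed
  have "homeomorphic_maps (prob_weak_star X) (weak_star A K) \<Psi> \<Phi>"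
    unfolding homeomorphic_maps_def top1 top2 using cont1 cont2 PhiPsi PsiPhi by blast
  then have "homeomorphic_map (prob_weak_star X) (weak_star A K) \<Psi>"
    unfolding homeomorphic_map_maps by blast
  moreover have "\<Psi> (dirac X x) = \<psi> x" if x: "x \<in> X" for x
  proof -
    have "measure (dirac X x) {y} = (if y = x then 1 else 0)" if "y \<in> X" for y
      unfolding dirac_def using that sets_restrict_borel_finite[OF X]
      by (subst measure_return) (auto simp: indicator_def)
    then have "\<Psi> (dirac X x) = mix A (\<lambda>y. if y = x then 1 else 0)"
      unfolding \<Psi>_def mix_def by (intro restrict_ext sum.cong refl) simp
    then show ?thesis using point[OF x] by simp
  qed
  moreover have "affine_on_prob X A \<Psi>"
    unfolding affine_on_prob_def
  proof (intro ballI impI)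
    fix P Q R and t :: real and T
    assume R: "R \<in> prob_measures X" and T: "T \<in> A"
      and w: "\<forall>B\<in>sets R. measure R B = t * measure P B + (1 - t) * measure Q B"
    have "measure R {x} = t * measure P {x} + (1 - t) * measure Q {x}" if "x \<in> X" for x
      using w prob_measures_finite(2)[OF X R] that by simp
    then have "\<Psi> R T = (\<Sum>x\<in>X. of_real (t * measure P {x} + (1 - t) * measure Q {x}) * \<psi> x T)"
      unfolding \<Psi>_def mix_def using T by simp
    also have "\<dots> = of_real t * \<Psi> P T + of_real (1 - t) * \<Psi> Q T"
      unfolding \<Psi>_def mix_def using T
      by (simp add: sum_distrib_left sum.distrib[symmetric] algebra_simps)
    finally show "\<Psi> R T = of_real t * \<Psi> P T + of_real (1 - t) * \<Psi> Q T" .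
  qed
  ultimately show "extends_to_affine_homeo X A K \<psi>"
    unfolding extends_to_affine_homeo_def by blast
qed

section \<open>The simplex of KMS states\<close>

text \<open>A function on the residues with nonnegative Fourier coefficients is bounded in modulus
  by its value at 0, the sum of the coefficients.\<close>

lemma local_L_bound:
  assumes n: "1 \<le> n" and per: "\<And>k. L (k mod n) = (L k :: complex)"
    and pos: "\<And>j. j < n \<Longrightarrow> (1 / of_nat n) * (\<Sum>k<n. omega n ^ ((n - 1) * j * k) * local_L \<beta> L D k) \<in> \<real>\<^sub>\<ge>\<^sub>0"
  shows "cmod (local_L \<beta> L D k) \<le> Re (local_L \<beta> L D 0)"
proof -
  define f where "f j = (1 / of_nat n) * (\<Sum>k<n. omega n ^ ((n - 1) * j * k) * local_L \<beta> L D k)" for j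
  have "L ((l mod n) * d) = L (l * d)" for l d by (metis per mod_mult_left_eq)
  then have per': "local_L \<beta> L D (l mod n) = local_L \<beta> L D l" for l unfolding local_L_def by simp
  have inv: "local_L \<beta> L D l = (\<Sum>j<n. f j * omega n ^ (j * l))" for l
    unfolding f_def by (rule fourier_inversion'[where w = "local_L \<beta> L D" and l = l, OF n per', symmetric])
  have f: "cmod (f j) = Re (f j)" if "j < n" for j
  proof -
    have "f j \<in> \<real>\<^sub>\<ge>\<^sub>0" unfolding f_def by (rule pos[OF that])
    then obtain r where "f j = of_real r" "0 \<le> r" by (rule nonneg_Reals_cases)
    then show ?thesis by simp
  qed
  have "cmod (local_L \<beta> L D k) \<le> (\<Sum>j<n. cmod (f j * omega n ^ (j * k)))"
    unfolding inv by (rule norm_sum)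
  also have "\<dots> = (\<Sum>j<n. Re (f j))"
    by (rule sum.cong) (simp_all add: norm_mult f)
  also have "\<dots> = Re (local_L \<beta> L D 0)" unfolding inv by simp
  finally show ?thesis .
qed

text \<open>Supplies the coefficients for \<open>coef\<close> in \<open>simplex_of_states\<close>:
  by periodicity the infinite moebius sum collapses to n values of L.\<close>

lemma (in divisor_system) weight_linear:
  assumes n: "1 \<le> n"
  obtains B where "\<And>L j. (\<And>x. L (x mod n) = L x) \<Longrightarrow> weight n L j = (\<Sum>r<n. B j r * L r)"
proof -
  define g where "g k r = (\<Sum>\<^sub>\<infinity>d\<in>{d \<in> C. k * d mod n = r}. complex_of_real (moebius d * real d powr (- \<beta>)))" for k r
  have s: "(\<lambda>d. complex_of_real (moebius d * real d powr (- \<beta>))) summable_on C"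
    using dir_summable(2)[of "\<lambda>_. 1" 1 0] by simp
  have "weight n L j = (\<Sum>r<n. (of_real Z * ((1 / of_nat n) * (\<Sum>k<n. omega n ^ ((n - 1) * j * k) * g k r))) * L r)"
    if per: "\<And>x. L (x mod n) = L x" for L j
  proof -
    have d: "dir_inv L k = (\<Sum>r<n. g k r * L r)" for k
      unfolding dir_inv_def g_def by (rule infsum_mod_classes[where L = L and k = k, OF n per s])
    define S where "S r = (\<Sum>k<n. omega n ^ ((n - 1) * j * k) * g k r)" for r
    have "(\<Sum>k<n. omega n ^ ((n - 1) * j * k) * (\<Sum>r<n. g k r * L r)) = (\<Sum>r<n. S r * L r)"
      unfolding S_def sum_distrib_left sum_distrib_right by (subst sum.swap) (simp only: mult.assoc)
    then have "weight n L j = of_real Z * ((1 / of_nat n) * (\<Sum>r<n. S r * L r))" unfolding weight_def d by (simp only:)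
    also have "\<dots> = (\<Sum>r<n. (of_real Z * ((1 / of_nat n) * S r)) * L r)" by (simp only: sum_distrib_left mult.assoc)
    finally show ?thesis unfolding S_def .
  qed
  then show ?thesis by (rule that)
qed

context
  fixes n :: nat
  assumes n: "1 \<le> n"
begin

lemma kms_formula_off_diagonal:
  assumes "kms_formula n \<beta> \<phi>" "1 \<le> a" "1 \<le> b" "a \<noteq> b"
  shows "\<phi> (W n a k b) = 0"
proof -
  have "\<forall>b\<ge>1. \<forall>k. \<phi> (W n a k b) = (if a = b then of_real (real a powr (- \<beta>)) * \<phi> (W n 1 k 1) else 0)"
    by (rule iffD1[OF kms_formula_def[OF n] assms(1), THEN spec, THEN mp, OF assms(2)])
  then have "\<phi> (W n a k b) = (if a = b then of_real (real a powr (- \<beta>)) * \<phi> (W n 1 k 1) else 0)"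
    using assms(3) by blast
  then show ?thesis unfolding if_not_P[OF assms(4)] .
qed

lemma kms_formulaI:
  assumes "\<And>a k. 1 \<le> a \<Longrightarrow> \<phi> (W n a k a) = of_real (real a powr (- \<beta>)) * \<phi> (W n 1 k 1)"
    and "\<And>a b k. 1 \<le> a \<Longrightarrow> 1 \<le> b \<Longrightarrow> a \<noteq> b \<Longrightarrow> \<phi> (W n a k b) = 0"
  shows "kms_formula n \<beta> \<phi>"
proof (rule iffD2[OF kms_formula_def[OF n]], intro allI impI)
  fix a b k :: nat assume ab: "1 \<le> a" "1 \<le> b"
  show "\<phi> (W n a k b) = (if a = b then of_real (real a powr (- \<beta>)) * \<phi> (W n 1 k 1) else 0)"
  proof (cases "a = b")
    case True
    then show ?thesis unfolding if_P[OF True] using assms(1)[OF ab(1)] by blast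
  next
    case False
    show ?thesis unfolding if_not_P[OF False] by (rule assms(2)[OF ab False])
  qed
qed

lemma kms_state_eqI:
  assumes "nz_state n \<phi>" "kms_formula n \<beta> \<phi>" "nz_state n \<psi>" "kms_formula n \<beta> \<psi>"
    and eq: "\<And>k. \<phi> (W n 1 k 1) = \<psi> (W n 1 k 1)"
  shows "\<phi> = \<psi>"
proof (rule nz_state_eqI[OF n assms(1,3)])
  fix a k b :: nat assume ab: "1 \<le> a" "1 \<le> b"
  show "\<phi> (W n a k b) = \<psi> (W n a k b)"
  proof (cases "a = b")
    case True
    show ?thesis
      unfolding True[symmetric] kms_formulaD[OF n assms(2) ab(1)] kms_formulaD[OF n assms(4) ab(1)] eq ..
  next
    case False
    show ?thesis
      unfolding kms_formula_off_diagonal[OF assms(2) ab False] kms_formula_off_diagonal[OF assms(4) ab False] ..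
  qed
qed

lemma kms_mixture:
  assumes X: "finite X" and p: "\<And>x. x \<in> X \<Longrightarrow> 0 \<le> p x" "(\<Sum>x\<in>X. p x) = 1"
    and st: "\<And>x. x \<in> X \<Longrightarrow> nz_state n (\<psi> x)"
  defines "\<phi> \<equiv> \<lambda>T\<in>nz_toeplitz n. \<Sum>x\<in>X. of_real (p x) * \<psi> x T"
  shows "nz_state n \<phi>" "(\<And>x. x \<in> X \<Longrightarrow> kms_formula n \<beta> (\<psi> x)) \<Longrightarrow> kms_formula n \<beta> \<phi>"
proof -
  have h: "(p has_sum 1) X" using has_sum_finite[OF X, of p] p(2) by simp
  show "nz_state n \<phi>"
    using state_mixture[OF nz_toeplitz_cstar[OF n] nz_one[OF n] p(1) h st] unfolding \<phi>_def infsum_finite[OF X] .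
  assume kf: "\<And>x. x \<in> X \<Longrightarrow> kms_formula n \<beta> (\<psi> x)"
  have val: "\<phi> (W n a k b) = (\<Sum>x\<in>X. of_real (p x) * \<psi> x (W n a k b))" if "1 \<le> a" "1 \<le> b" for a k b
    unfolding \<phi>_def by (rule restrict_apply'[OF W_in_toeplitz[OF n that]])
  show "kms_formula n \<beta> \<phi>"
  proof (rule kms_formulaI)
    fix a k :: nat assume a: "1 \<le> a"
    have "\<phi> (W n a k a) = (\<Sum>x\<in>X. of_real (p x) * (of_real (real a powr (- \<beta>)) * \<psi> x (W n 1 k 1)))"
      unfolding val[OF a a] by (rule sum.cong[OF refl]) (simp only: kms_formulaD[OF n kf a])
    also have "\<dots> = of_real (real a powr (- \<beta>)) * \<phi> (W n 1 k 1)"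
      unfolding val[OF order_refl order_refl] sum_distrib_left by (simp only: mult.left_commute)
    finally show "\<phi> (W n a k a) = of_real (real a powr (- \<beta>)) * \<phi> (W n 1 k 1)" .
  next
    fix a b k :: nat assume ab: "1 \<le> a" "1 \<le> b" "a \<noteq> b"
    show "\<phi> (W n a k b) = 0"
      unfolding val[OF ab(1,2)]
      by (rule sum.neutral, rule ballI) (simp only: kms_formula_off_diagonal[OF kf ab] mult_zero_right)
  qed
qed

lemma kms_values:
  assumes st: "nz_state n \<phi>" and kf: "kms_formula n \<beta> \<phi>"
  shows "\<phi> (W n 1 (k mod n) 1) = \<phi> (W n 1 k 1)" "\<phi> (W n 1 0 1) = 1"
    "1 \<le> D \<Longrightarrow> cmod (local_L \<beta> (\<lambda>k. \<phi> (W n 1 k 1)) D k) \<le> Re (local_L \<beta> (\<lambda>k. \<phi> (W n 1 k 1)) D 0)"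
    "cmod (\<phi> (W n 1 k 1)) \<le> 1"
proof -
  show per: "\<phi> (W n 1 (k mod n) 1) = \<phi> (W n 1 k 1)" for k
    using W_cong[where n = n and k = "k mod n" and l = k and a = 1 and b = 1] by (simp only: cong_def mod_mod_trivial)
  show one: "\<phi> (W n 1 0 1) = 1" using stateD(6)[OF st] unfolding op_one_eq_W .
  show bd: "cmod (local_L \<beta> (\<lambda>k. \<phi> (W n 1 k 1)) D k) \<le> Re (local_L \<beta> (\<lambda>k. \<phi> (W n 1 k 1)) D 0)"
    if D: "1 \<le> D" for D k
    by (rule local_L_bound[where L = "\<lambda>k. \<phi> (W n 1 k 1)", OF n per], unfold local_L_def) (rule fibre_projection_nonneg[OF n st kf D])
  have "local_L \<beta> (\<lambda>k. \<phi> (W n 1 k 1)) 1 k = \<phi> (W n 1 k 1)" for k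
    by (simp add: local_L_def moebius_def)
  then show "cmod (\<phi> (W n 1 k 1)) \<le> 1" using bd[of 1 k] one by simp
qed

text \<open>The blocks \<open>J x\<close> partition the frequencies, and the vertices are the block
  averages of the G_j. The coordinates of a state are the total weights of the blocks; they
  determine the state because by \<open>const\<close> the weights do not vary within a block. The
  blocks are singletons for \<beta> > 1 and orbits of the units for \<beta> \<le> 1.\<close>

lemma kms_simplex:
  fixes X :: "'x::t1_space set"
  assumes "divisor_system C \<beta>" and beta: "0 < \<beta>" and X: "finite X"
    and J: "\<And>x. x \<in> X \<Longrightarrow> J x \<noteq> {}" "(\<Union>x\<in>X. J x) = {..<n}"
      "\<And>x y. x \<in> X \<Longrightarrow> y \<in> X \<Longrightarrow> x \<noteq> y \<Longrightarrow> J x \<inter> J y = {}"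
    and st: "\<And>x. x \<in> X \<Longrightarrow> nz_state n (\<psi> x)" and kf: "\<And>x. x \<in> X \<Longrightarrow> kms_formula n \<beta> (\<psi> x)"
    and val: "\<And>x k. x \<in> X \<Longrightarrow>
      \<psi> x (W n 1 k 1) = (\<Sum>j\<in>J x. divisor_system.G C \<beta> n (j * k)) / of_nat (card (J x))"
    and const: "\<And>\<phi> x i j. nz_state n \<phi> \<Longrightarrow> kms_formula n \<beta> \<phi> \<Longrightarrow> x \<in> X \<Longrightarrow> i \<in> J x \<Longrightarrow> j \<in> J x \<Longrightarrow>
      divisor_system.weight C \<beta> n (\<lambda>k. \<phi> (W n 1 k 1)) i = divisor_system.weight C \<beta> n (\<lambda>k. \<phi> (W n 1 k 1)) j"
  shows "x \<in> X \<Longrightarrow> \<psi> x \<in> extremal (nz_toeplitz n) (nz_kms n (nz_sigma n) \<beta>)"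
    "extends_to_affine_homeo X (nz_toeplitz n) (nz_kms n (nz_sigma n) \<beta>) \<psi>"
proof -
  interpret divisor_system C \<beta> by fact
  let ?K = "nz_kms n (nz_sigma n) \<beta>"
  let ?w = "\<lambda>\<phi>. weight n (\<lambda>k. \<phi> (W n 1 k 1))"
  let ?mix = "\<lambda>p. \<lambda>T\<in>nz_toeplitz n. \<Sum>x\<in>X. of_real (p x) * \<psi> x T"
  note K = kms_iff[OF n beta]
  have KI: "\<phi> \<in> ?K" if "nz_state n \<phi>" "kms_formula n \<beta> \<phi>" for \<phi> by (rule iffD2[OF K conjI[OF that]])
  have KD: "nz_state n \<phi>" "kms_formula n \<beta> \<phi>" if "\<phi> \<in> ?K" for \<phi>
    by (rule conjunct1[OF iffD1[OF K that]], rule conjunct2[OF iffD1[OF K that]])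
  define c where "c x \<phi> = (\<Sum>j\<in>J x. ?w \<phi> j)" for x \<phi>
  have Jfin: "finite (J x)" if "x \<in> X" for x using that J(2) by (metis UN_upper finite_lessThan finite_subset)
  have Jcard: "card (J x) \<noteq> 0" if "x \<in> X" for x using J(1)[OF that] Jfin[OF that] by simp
  have Jlt: "j < n" if "x \<in> X" "j \<in> J x" for x j using that J(2) by blast
  have part: "(\<Sum>j<n. f j) = (\<Sum>x\<in>X. \<Sum>j\<in>J x. f j)" for f :: "nat \<Rightarrow> complex"
    unfolding J(2)[symmetric] by (rule sum.UNION_disjoint[OF X]) (use Jfin J(3) in blast)+
  have mixed: "(\<Sum>x\<in>X. a x * \<psi> x (W n 1 k 1)) = (\<Sum>x\<in>X. \<Sum>j\<in>J x. (a x / of_nat (card (J x))) * G n (j * k))" for a k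
    by (rule sum.cong[OF refl]) (simp only: val sum_distrib_left sum_divide_distrib times_divide_eq_right times_divide_eq_left)
  have dec: "j < n \<Longrightarrow> ?w \<phi> j \<in> \<real>\<^sub>\<ge>\<^sub>0" "(\<Sum>j<n. ?w \<phi> j) = 1" "\<phi> (W n 1 k 1) = (\<Sum>j<n. ?w \<phi> j * G n (j * k))"
    if phi: "\<phi> \<in> ?K" for \<phi> j k
  proof -
    note v = kms_values[OF KD[OF phi]]
    note d = decomposition[of n "\<lambda>k. \<phi> (W n 1 k 1)", OF n v(1,2,4) fibre_projection_nonneg[OF n KD[OF phi]]]
    show "j < n \<Longrightarrow> ?w \<phi> j \<in> \<real>\<^sub>\<ge>\<^sub>0" "(\<Sum>j<n. ?w \<phi> j) = 1" by (rule d(1), assumption+) (rule d(2), assumption)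
    show "\<phi> (W n 1 k 1) = (\<Sum>j<n. ?w \<phi> j * G n (j * k))" by (rule d(3))
  qed
  have cw: "c x \<phi> = of_nat (card (J x)) * ?w \<phi> j" if phi: "\<phi> \<in> ?K" and x: "x \<in> X" "j \<in> J x" for \<phi> x j
  proof -
    have "c x \<phi> = (\<Sum>i\<in>J x. ?w \<phi> j)"
      unfolding c_def by (rule sum.cong[OF refl]) (rule const[OF KD[OF phi] x(1) _ x(2)])
    then show ?thesis by simp
  qed
  have mixK: "?mix p \<in> ?K" if p: "\<And>x. x \<in> X \<Longrightarrow> 0 \<le> p x" "(\<Sum>x\<in>X. p x) = 1" for p
    by (rule KI[OF kms_mixture(1)[OF X p st] kms_mixture(2)[OF X p st kf]]) assumption+
  have dec1: "c x \<phi> \<in> \<real>\<^sub>\<ge>\<^sub>0" if "\<phi> \<in> ?K" "x \<in> X" for \<phi> x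
  proof -
    have "?w \<phi> j \<in> \<real>\<^sub>\<ge>\<^sub>0" if "j \<in> J x" for j by (rule dec(1)[OF \<open>\<phi> \<in> ?K\<close> Jlt[OF \<open>x \<in> X\<close> that]])
    then show ?thesis unfolding c_def complex_nonneg_Reals_iff by (simp add: sum_nonneg)
  qed
  have dec2: "(\<Sum>x\<in>X. c x \<phi>) = 1" if "\<phi> \<in> ?K" for \<phi>
    unfolding c_def part[symmetric] by (rule dec(2)[OF that])
  have dec3: "\<phi> T = (\<Sum>x\<in>X. c x \<phi> * \<psi> x T)" if phi: "\<phi> \<in> ?K" and T: "T \<in> nz_toeplitz n" for \<phi> T
  proof -
    have re: "0 \<le> Re (c x \<phi>)" "of_real (Re (c x \<phi>)) = c x \<phi>" if "x \<in> X" for x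
      using dec1[OF phi that] by (auto simp: complex_nonneg_Reals_iff complex_eq_iff)
    have "(\<Sum>x\<in>X. Re (c x \<phi>)) = 1" using dec2[OF phi] by (simp add: Re_sum[symmetric])
    then have m: "?mix (\<lambda>x. Re (c x \<phi>)) \<in> ?K" by (intro mixK re(1))
    \<comment> \<open>Both sides are KMS states, so it suffices to compare them on the powers of
      R.\<close>
    have "\<phi> = ?mix (\<lambda>x. Re (c x \<phi>))"
    proof (rule kms_state_eqI[OF KD[OF phi] KD[OF m]])
      fix k
      have "?mix (\<lambda>x. Re (c x \<phi>)) (W n 1 k 1) = (\<Sum>x\<in>X. c x \<phi> * \<psi> x (W n 1 k 1))"
        unfolding restrict_apply'[OF W_in_toeplitz[OF n order_refl order_refl]]
        by (rule sum.cong[OF refl]) (simp only: re(2))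
      also have "\<dots> = (\<Sum>x\<in>X. \<Sum>j\<in>J x. ?w \<phi> j * G n (j * k))"
        unfolding mixed by (intro sum.cong refl arg_cong2[of _ _ _ _ "(*)"]) (simp add: cw[OF phi] Jcard)
      also have "\<dots> = \<phi> (W n 1 k 1)" by (rule dec(3)[OF phi, where k = k, unfolded part, symmetric])
      finally show "\<phi> (W n 1 k 1) = ?mix (\<lambda>x. Re (c x \<phi>)) (W n 1 k 1)" by (rule sym)
    qed
    then have "\<phi> T = ?mix (\<lambda>x. Re (c x \<phi>)) T" by (rule fun_cong)
    also have "\<dots> = (\<Sum>x\<in>X. c x \<phi> * \<psi> x T)"
      unfolding restrict_apply'[OF T] by (rule sum.cong[OF refl]) (simp only: re(2))
    finally show ?thesis .
  qed
  obtain B where B: "\<And>L j. (\<And>x. L (x mod n) = L x) \<Longrightarrow> weight n L j = (\<Sum>r<n. B j r * L r)"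
    using weight_linear[OF n] by blast
  have coef: "c x \<phi> = (\<Sum>r<n. (\<Sum>j\<in>J x. B j r) * \<phi> (W n 1 r 1))" if phi: "\<phi> \<in> ?K" and "x \<in> X" for \<phi> x
  proof -
    have "c x \<phi> = (\<Sum>j\<in>J x. \<Sum>r<n. B j r * \<phi> (W n 1 r 1))"
      unfolding c_def by (rule sum.cong[OF refl]) (rule B, rule kms_values(1)[OF KD[OF phi]])
    then show ?thesis unfolding sum_distrib_right by (subst sum.swap)
  qed
  have inj: "c x (?mix p) = of_real (p x)"
    if p: "\<And>x. x \<in> X \<Longrightarrow> 0 \<le> p x" "(\<Sum>x\<in>X. p x) = 1" and x: "x \<in> X" for p x
  proof -
    \<comment> \<open>\<open>idx j\<close> is the block of j. The mass p of each block is spread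
      evenly over its members, which writes the mixture as a single combination of the G_j, to which
      \<open>weight_sum_G\<close> applies.\<close>
    define idx where "idx j = (SOME y. y \<in> X \<and> j \<in> J y)" for j
    have idx: "idx j = y" if "y \<in> X" "j \<in> J y" for y j
      unfolding idx_def by (rule some_equality) (use that J(3) in blast)+
    define y where "y j = complex_of_real (p (idx j)) / of_nat (card (J (idx j)))" for j
    have "?mix p (W n 1 k 1) = (\<Sum>x\<in>X. \<Sum>j\<in>J x. (of_real (p x) / of_nat (card (J x))) * G n (j * k))" for k
      unfolding restrict_apply'[OF W_in_toeplitz[OF n order_refl order_refl]] by (rule mixed)
    also have "\<dots> k = (\<Sum>x\<in>X. \<Sum>j\<in>J x. y j * G n (j * k))" for k
      unfolding y_def by (intro sum.cong refl) (simp only: idx)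
    finally have "?mix p (W n 1 k 1) = (\<Sum>j<n. y j * G n (j * k))" for k unfolding part .
    then have "?w (?mix p) j = y j" if "j < n" for j using weight_sum_G[OF n that, of y] by simp
    then have "c x (?mix p) = (\<Sum>j\<in>J x. y j)" unfolding c_def using Jlt[OF x] by (intro sum.cong refl) blast
    also have "\<dots> = (\<Sum>j\<in>J x. of_real (p x) / of_nat (card (J x)))"
      unfolding y_def by (intro sum.cong refl) (simp only: idx[OF x])
    also have "\<dots> = of_real (p x)" using Jcard[OF x] by simp
    finally show ?thesis .
  qed
  have Kext: "\<phi> \<in> extensional (nz_toeplitz n)" if "\<phi> \<in> ?K" for \<phi> by (rule stateD(1)[OF KD(1)[OF that]])
  have psi: "\<psi> x \<in> ?K" if "x \<in> X" for x by (rule KI[OF st[OF that] kf[OF that]])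
  have W: "W n 1 r 1 \<in> nz_toeplitz n" for r by (rule W_in_toeplitz[OF n order_refl order_refl])
  note S = simplex_of_states[where A = "nz_toeplitz n" and K = ?K and \<psi> = \<psi> and c = c and X = X
      and I = "{..<n}" and B = "\<lambda>r. W n 1 r 1" and a = "\<lambda>x r. \<Sum>j\<in>J x. B j r", OF X]
  show "\<psi> x \<in> extremal (nz_toeplitz n) ?K" if "x \<in> X" for x
    by (rule S(1)) (assumption | rule that Kext psi mixK dec1 dec2 dec3 finite_lessThan W coef inj)+
  show "extends_to_affine_homeo X (nz_toeplitz n) ?K \<psi>"
    by (rule S(2)) (assumption | rule Kext psi mixK dec1 dec2 dec3 finite_lessThan W coef inj)+
qed

end

lemma roots_of_unity_bij:
  assumes "1 \<le> n" shows "bij_betw (\<lambda>j. omega n ^ j) {..<n} {z::complex. z ^ n = 1}"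
proof -
  have "omega n ^ j = cis (2 * pi * real j / real n)" for j
    unfolding omega_def Complex.DeMoivre by (simp add: mult.commute)
  then show ?thesis using Complex.bij_betw_roots_unity[of n] assms by simp
qed

lemma smooth_member:
  assumes "0 < a" "a dvd N" "0 < N" shows "a \<in> smooth (prime_factors N)"
  using assms dvd_prime_factors[of N a] by (simp add: smooth_def)

section \<open>The two temperature ranges\<close>

context
  fixes n :: nat
  assumes n: "1 \<le> n"
begin

lemma state_determined:
  assumes psi: "nz_state n \<psi>" "\<And>a k b. 1 \<le> a \<Longrightarrow> 1 \<le> b \<Longrightarrow> \<psi> (W n a k b) = v a k b"
  shows "\<forall>a\<ge>1. \<forall>b\<ge>1. \<forall>k. \<psi> (VRV n a k b) = v a k b"
    "\<forall>\<phi>. nz_state n \<phi> \<and> (\<forall>a\<ge>1. \<forall>b\<ge>1. \<forall>k. \<phi> (VRV n a k b) = v a k b) \<longrightarrow> \<phi> = \<psi>"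
proof -
  show "\<forall>a\<ge>1. \<forall>b\<ge>1. \<forall>k. \<psi> (VRV n a k b) = v a k b"
  proof (intro allI impI)
    fix a b k :: nat assume ab: "1 \<le> a" "1 \<le> b"
    show "\<psi> (VRV n a k b) = v a k b" unfolding VRV_eq_W[OF n ab] by (rule psi(2)[OF ab])
  qed
  show "\<forall>\<phi>. nz_state n \<phi> \<and> (\<forall>a\<ge>1. \<forall>b\<ge>1. \<forall>k. \<phi> (VRV n a k b) = v a k b) \<longrightarrow> \<phi> = \<psi>"
  proof (intro allI impI)
    fix \<phi> assume phi: "nz_state n \<phi> \<and> (\<forall>a\<ge>1. \<forall>b\<ge>1. \<forall>k. \<phi> (VRV n a k b) = v a k b)"
    show "\<phi> = \<psi>"
    proof (rule nz_state_eqI[OF n conjunct1[OF phi] psi(1)])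
      fix a k b :: nat assume ab: "1 \<le> a" "1 \<le> b"
      have "\<phi> (VRV n a k b) = v a k b" using conjunct2[OF phi] ab by blast
      then show "\<phi> (W n a k b) = \<psi> (W n a k b)" unfolding VRV_eq_W[OF n ab] psi(2)[OF ab] .
    qed
  qed
qed

text \<open>With C all positive integers the condition that a belongs to C is automatic in
  \<open>sys_state_W\<close>, so every \<open>sys_state\<close> is a KMS state. A root z enters
  through its exponent with respect to \<open>omega n\<close>.\<close>

lemma kms_simplex_above_1:
  assumes beta: "1 < \<beta>"
  shows "\<exists>\<psi>. (\<forall>z\<in>{z::complex. z ^ n = 1}.
      \<psi> z \<in> extremal (nz_toeplitz n) (nz_kms n (nz_sigma n) \<beta>) \<and>
      (\<forall>a\<ge>1. \<forall>b\<ge>1. \<forall>k. \<psi> z (VRV n a k b) = root_value \<beta> z a k b) \<and>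
      (\<forall>\<phi>. nz_state n \<phi> \<and>
         (\<forall>a\<ge>1. \<forall>b\<ge>1. \<forall>k. \<phi> (VRV n a k b) = root_value \<beta> z a k b) \<longrightarrow> \<phi> = \<psi> z)) \<and>
    extends_to_affine_homeo {z::complex. z ^ n = 1} (nz_toeplitz n) (nz_kms n (nz_sigma n) \<beta>) \<psi>"
proof -
  note sys = all_system[OF beta]
  interpret divisor_system "{1..}" \<beta> by (rule sys)
  define idx where "idx z = the_inv_into {..<n} (\<lambda>j. omega n ^ j) z" for z
  define \<psi> where "\<psi> z = sys_state n {1..} \<beta> (idx z)" for z
  let ?X = "{z::complex. z ^ n = 1}"
  note bij = roots_of_unity_bij[OF n]
  have idx: "idx z < n" "omega n ^ idx z = z" if "z \<in> ?X" for z
  proof -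
    have "idx z \<in> {..<n}"
      unfolding idx_def
      by (rule the_inv_into_into[OF bij_betw_imp_inj_on[OF bij] _ subset_refl]) (use that bij in \<open>simp add: bij_betw_def\<close>)
    then show "idx z < n" by simp
    show "omega n ^ idx z = z"
      unfolding idx_def
      by (rule f_the_inv_into_f[OF bij_betw_imp_inj_on[OF bij]]) (use that bij in \<open>simp add: bij_betw_def\<close>)
  qed
  have idx_omega: "omega n ^ j \<in> ?X" "idx (omega n ^ j) = j" if "j < n" for j
  proof -
    show "omega n ^ j \<in> ?X" using bij that by (auto simp: bij_betw_def)
    show "idx (omega n ^ j) = j"
      unfolding idx_def by (rule the_inv_into_f_f[OF bij_betw_imp_inj_on[OF bij]]) (use that in simp)
  qed
  have W: "\<psi> z (W n a k b) = (if a = b then of_real (real a powr (- \<beta>)) * G n (idx z * k) else 0)"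
    if "1 \<le> a" "1 \<le> b" for z a k b
    using sys_state_W[OF n sys that] that unfolding \<psi>_def by simp
  have W1: "\<psi> z (W n 1 k 1) = G n (idx z * k)" for z k
    using W[of 1 1 z k] by simp
  have st: "nz_state n (\<psi> z)" for z unfolding \<psi>_def by (rule sys_state_state[OF n sys])
  have kf: "kms_formula n \<beta> (\<psi> z)" for z
  proof (rule kms_formulaI[OF n])
    show "\<psi> z (W n a k a) = of_real (real a powr (- \<beta>)) * \<psi> z (W n 1 k 1)" if "1 \<le> a" for a k
      unfolding W[OF that that] W1 by (simp only: refl if_True)
    show "\<psi> z (W n a k b) = 0" if "1 \<le> a" "1 \<le> b" "a \<noteq> b" for a b k
      unfolding W[OF that(1,2)] if_not_P[OF that(3)] ..
  qed
  have v: "\<psi> z (W n a k b) = root_value \<beta> z a k b" if z: "z \<in> ?X" and ab: "1 \<le> a" "1 \<le> b" for z a k b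
  proof (cases "a = b")
    case True
    have "omega n ^ (idx z * k * c) = z ^ (c * k)" for c
      unfolding mult.assoc power_mult idx(2)[OF z] by (simp only: power_mult[symmetric] mult.commute)
    then have "G n (idx z * k) = of_real (1 / Z) * (\<Sum>\<^sub>\<infinity>c\<in>{1..}. of_real (real c powr (- \<beta>)) * z ^ (c * k))"
      unfolding G_def by simp
    moreover have "zeta \<beta> = Z" unfolding zeta_def Z_def ..
    ultimately show ?thesis
      unfolding W[OF ab] root_value_def if_P[OF True] by simp
  next
    case False
    show ?thesis unfolding W[OF ab] root_value_def if_not_P[OF False] ..
  qed
  have fin: "finite ?X" using bij_betw_finite[OF bij] by simp
  note S = kms_simplex[OF n sys _ fin, where J = "\<lambda>z. {idx z}" and \<psi> = \<psi>]
  have union: "(\<Union>z\<in>?X. {idx z}) = {..<n}"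
  proof (intro equalityI subsetI)
    fix j assume "j \<in> {..<n}"
    then have "j < n" by simp
    have "j \<in> {idx (omega n ^ j)}" using idx_omega(2)[OF \<open>j < n\<close>] by simp
    then show "j \<in> (\<Union>z\<in>?X. {idx z})" by (rule UN_I[OF idx_omega(1)[OF \<open>j < n\<close>]])
  qed (use idx(1) in auto)
  have disj: "{idx x} \<inter> {idx y} = {}" if "x \<in> ?X" "y \<in> ?X" "x \<noteq> y" for x y
    using idx(2)[OF that(1)] idx(2)[OF that(2)] that(3) by fastforce
  have val: "\<psi> z (W n 1 k 1) = (\<Sum>j\<in>{idx z}. G n (j * k)) / of_nat (card {idx z})" for z k
    unfolding W1 by simp
  have b0: "0 < \<beta>" using beta by simp
  have const: "weight n L i = weight n L j" if "i \<in> {idx z}" "j \<in> {idx z}" for L i j z using that by simp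
  have ext: "\<psi> z \<in> extremal (nz_toeplitz n) (nz_kms n (nz_sigma n) \<beta>)" if "z \<in> ?X" for z
    by (rule S(1)) (assumption | rule that b0 union disj st kf val const insert_not_empty)+
  have homeo: "extends_to_affine_homeo ?X (nz_toeplitz n) (nz_kms n (nz_sigma n) \<beta>) \<psi>"
    by (rule S(2)) (assumption | rule b0 union disj st kf val const insert_not_empty)+
  show ?thesis
  proof (intro exI[of _ \<psi>] conjI ballI homeo)
    fix z assume z: "z \<in> ?X"
    show "\<psi> z \<in> extremal (nz_toeplitz n) (nz_kms n (nz_sigma n) \<beta>)" by (rule ext[OF z])
  qed (rule state_determined[OF st v], assumption+)+
qed

text \<open>Orbit averages of \<open>sys_state\<close> over growing systems. Once i \<ge> a the
  system contains a, and \<open>orbit_average_G\<close> gives the final value exactly, so on every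
  monomial the sequence is eventually constant.\<close>

lemma divisor_state_exists:
  assumes beta: "0 < \<beta>" and m: "m dvd n"
  shows "\<exists>\<psi>. nz_state n \<psi> \<and> (\<forall>a\<ge>1. \<forall>b\<ge>1. \<forall>k. \<psi> (W n a k b) = divisor_value \<beta> m a k b)"
proof -
  \<comment> \<open>The factor n puts every divisor m of n into each system; the factorial
    eventually brings in every a.\<close>
  define N :: "nat \<Rightarrow> nat" where "N i = n * fact i" for i
  define C where "C i = smooth (prime_factors (N i))" for i
  have sys: "divisor_system (C i) \<beta>" for i unfolding C_def by (rule smooth_system[OF beta])
  have n0: "0 < n" using n by simp
  have N0: "0 < N i" for i using n0 by (simp add: N_def)
  have m0: "0 < m" using m n0 by (rule dvd_pos_nat[rotated])
  have mC: "m \<in> C i" for i unfolding C_def by (rule smooth_member[OF m0 _ N0]) (simp add: N_def m)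
  have aC: "a \<in> C i" if "1 \<le> a" "a \<le> i" for a i
    unfolding C_def by (rule smooth_member[OF _ _ N0]) (use that in \<open>simp_all add: N_def dvd_fact\<close>)
  let ?O = "orbit n m"
  have card: "card ?O = totient m" by (rule card_orbit[OF n0 m])
  have tot: "0 < totient m" using m0 by simp
  define \<rho> where "\<rho> i = (\<lambda>T\<in>nz_toeplitz n. \<Sum>j\<in>?O. of_real (1 / real (totient m)) * sys_state n (C i) \<beta> j T)" for i
  have st: "nz_state n (\<rho> i)" for i
    unfolding \<rho>_def
    by (rule kms_mixture(1)[OF n finite_orbit _ _ sys_state_state[OF n sys]]) (use card tot in simp_all)
  have val: "\<rho> i (W n a k b) = divisor_value \<beta> m a k b" if ab: "1 \<le> a" "1 \<le> b" "a \<le> i" for a b k i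
  proof -
    interpret divisor_system "C i" \<beta> by (rule sys)
    have "\<rho> i (W n a k b) = (\<Sum>j\<in>?O. of_real (1 / real (totient m)) *
        (if a = b \<and> a \<in> C i then of_real (real a powr (- \<beta>)) * G n (j * k) else 0))"
      unfolding \<rho>_def restrict_apply'[OF W_in_toeplitz[OF n ab(1,2)]] sys_state_W[OF n sys ab(1,2)] ..
    also have "\<dots> = divisor_value \<beta> m a k b"
    proof (cases "a = b")
      case True
      have "(\<Sum>j\<in>?O. of_real (1 / real (totient m)) * (of_real (real a powr (- \<beta>)) * G n (j * k)))
        = of_real (real a powr (- \<beta>)) * ((\<Sum>j\<in>?O. G n (j * k)) / of_nat (totient m))"
        by (simp add: sum_distrib_left sum_divide_distrib mult_ac)
      also have "\<dots> = divisor_value \<beta> m a k b"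
        unfolding orbit_average_G[OF n0 m mC] divisor_value_def if_P[OF True] by (simp only: of_real_mult mult.assoc)
      finally show ?thesis using True aC[OF ab(1,3)] by simp
    next
      case False
      then show ?thesis by (simp add: divisor_value_def)
    qed
    finally show ?thesis .
  qed
  have lim: "(\<lambda>i. \<rho> i (W n a k b)) \<longlonglongrightarrow> divisor_value \<beta> m a k b" if ab: "1 \<le> a" "1 \<le> b" for a b k
    by (rule tendsto_eventually, rule eventually_sequentiallyI[of a]) (rule val[OF ab])
  have conv: "convergent (\<lambda>i. \<rho> i X)" if "X \<in> nz_span n" for X
    using that
  proof (induction rule: nz_span.induct)
    case (gen a b c k)
    have "(\<lambda>i. \<rho> i (op_scale c (W n a k b))) = (\<lambda>i. c * \<rho> i (W n a k b))"
      by (rule ext) (rule stateD(3)[OF st W_in_toeplitz[OF n gen]])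
    then show ?case using convergentI[OF tendsto_mult_left[OF lim[OF gen]]] by (simp only:)
  next
    case (add X Y)
    have "X \<in> nz_toeplitz n" "Y \<in> nz_toeplitz n" using add.hyps nz_span_subset_toeplitz[OF n] by blast+
    then have "(\<lambda>i. \<rho> i (op_add X Y)) = (\<lambda>i. \<rho> i X + \<rho> i Y)"
      by (intro ext stateD(2)[OF st])
    then show ?case using convergent_add[OF add.IH] by (simp only:)
  qed
  obtain \<psi> where psi: "nz_state n \<psi>" "\<And>T. T \<in> nz_toeplitz n \<Longrightarrow> (\<lambda>i. \<rho> i T) \<longlonglongrightarrow> \<psi> T"
    by (rule state_limit_exists[OF nz_toeplitz_cstar[OF n] nz_one[OF n] nz_span_subset_toeplitz[OF n] nz_dense[OF n] st conv]) (assumption+, (rule that; blast))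
  show ?thesis
  proof (intro exI[of _ \<psi>] conjI allI impI psi(1))
    fix a b k :: nat assume ab: "1 \<le> a" "1 \<le> b"
    show "\<psi> (W n a k b) = divisor_value \<beta> m a k b"
      by (rule LIMSEQ_unique[OF psi(2)[OF W_in_toeplitz[OF n ab]] lim[OF ab]])
  qed
qed

text \<open>Two kinds of systems meet here. States are decomposed over the integers built from the
  primes of n, while the vertices were obtained from ever larger prime sets. Their values on powers
  of R agree because \<open>orbit_average_G\<close> holds for every system containing m. Constancy
  of the weights on orbits is \<open>unit_invariance\<close>.\<close>

lemma kms_simplex_upto_1:
  assumes beta: "0 < \<beta>" "\<beta> \<le> 1"
  shows "\<exists>\<psi>. (\<forall>m\<in>{m::nat. m dvd n}.
      \<psi> m \<in> extremal (nz_toeplitz n) (nz_kms n (nz_sigma n) \<beta>) \<and>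
      (\<forall>a\<ge>1. \<forall>b\<ge>1. \<forall>k. \<psi> m (VRV n a k b) = divisor_value \<beta> m a k b) \<and>
      (\<forall>\<phi>. nz_state n \<phi> \<and>
         (\<forall>a\<ge>1. \<forall>b\<ge>1. \<forall>k. \<phi> (VRV n a k b) = divisor_value \<beta> m a k b) \<longrightarrow> \<phi> = \<psi> m)) \<and>
    extends_to_affine_homeo {m::nat. m dvd n} (nz_toeplitz n) (nz_kms n (nz_sigma n) \<beta>) \<psi>"
proof -
  let ?X = "{m::nat. m dvd n}"
  define C where "C = smooth (prime_factors n)"
  have sys: "divisor_system C \<beta>" unfolding C_def by (rule smooth_system[OF beta(1)])
  interpret divisor_system C \<beta> by (rule sys)
  have n0: "0 < n" using n by simp
  have fin: "finite ?X" using n0 by simp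
  obtain \<psi> where psi: "\<forall>m\<in>?X. nz_state n (\<psi> m) \<and> (\<forall>a\<ge>1. \<forall>b\<ge>1. \<forall>k. \<psi> m (W n a k b) = divisor_value \<beta> m a k b)"
    using bchoice[of ?X "\<lambda>m \<psi>. nz_state n \<psi> \<and> (\<forall>a\<ge>1. \<forall>b\<ge>1. \<forall>k. \<psi> (W n a k b) = divisor_value \<beta> m a k b)"]
      divisor_state_exists[OF beta(1)] by blast
  have st: "nz_state n (\<psi> m)" if "m \<in> ?X" for m using psi that by blast
  have v: "\<psi> m (W n a k b) = divisor_value \<beta> m a k b" if "m \<in> ?X" "1 \<le> a" "1 \<le> b" for m a k b
    using psi that by blast
  have kf: "kms_formula n \<beta> (\<psi> m)" if m: "m \<in> ?X" for m
  proof (rule kms_formulaI[OF n])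
    show "\<psi> m (W n a k a) = of_real (real a powr (- \<beta>)) * \<psi> m (W n 1 k 1)" if "1 \<le> a" for a k
      unfolding v[OF m that that] v[OF m order_refl order_refl] by (simp add: divisor_value_def)
    show "\<psi> m (W n a k b) = 0" if "1 \<le> a" "1 \<le> b" "a \<noteq> b" for a b k
      unfolding v[OF m that(1,2)] divisor_value_def if_not_P[OF that(3)] ..
  qed
  have pos_div: "0 < m" if "m \<in> ?X" for m using that n0 by (auto intro: dvd_pos_nat)
  have val: "\<psi> m (W n 1 k 1) = (\<Sum>j\<in>orbit n m. G n (j * k)) / of_nat (card (orbit n m))" if m: "m \<in> ?X" for m k
  proof -
    have d: "m dvd n" using m by simp
    have "m \<in> C" unfolding C_def by (rule smooth_member[OF pos_div[OF m] d n0])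
    then show ?thesis
      unfolding v[OF m order_refl order_refl] card_orbit[OF n0 d] orbit_average_G[OF n0 d \<open>m \<in> C\<close>]
      by (simp add: divisor_value_def)
  qed
  have ne: "orbit n m \<noteq> {}" if "m \<in> ?X" for m
  proof -
    have "card (orbit n m) \<noteq> 0" using card_orbit[of n m] n0 that pos_div[OF that] by simp
    then show ?thesis by force
  qed
  have union: "(\<Union>m\<in>?X. orbit n m) = {..<n}"
  proof (intro equalityI subsetI)
    fix j assume "j \<in> {..<n}"
    \<comment> \<open>The index is the order of \<open>omega n ^ j\<close>.\<close>
    then have "j \<in> orbit n (n div gcd j n)"
      using n0 by (simp add: orbit_def div_div_eq_right)
    moreover have "n div gcd j n dvd n" by (metis dvd_div_mult_self dvd_triv_left gcd_dvd2)
    ultimately show "j \<in> (\<Union>m\<in>?X. orbit n m)" by blast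
  qed (auto simp: orbit_def)
  have disj: "orbit n m \<inter> orbit n m' = {}" if "m \<in> ?X" "m' \<in> ?X" "m \<noteq> m'" for m m'
  proof (rule ccontr)
    assume "orbit n m \<inter> orbit n m' \<noteq> {}"
    then have e: "n div m = n div m'" by (auto simp: orbit_def)
    have "m = n div (n div m)" "m' = n div (n div m')" using that n0 by (simp_all add: div_div_eq_right)
    then show False using that(3) e by metis
  qed
  have const: "weight n (\<lambda>k. \<phi> (W n 1 k 1)) i = weight n (\<lambda>k. \<phi> (W n 1 k 1)) j"
    if phi: "nz_state n \<phi>" "kms_formula n \<beta> \<phi>" and ij: "i \<in> orbit n m" "j \<in> orbit n m" for \<phi> m i j
  proof -
    note kv = kms_values[OF n phi]
    have inv: "\<phi> (W n 1 (u * k) 1) = \<phi> (W n 1 k 1)" if "coprime u n" for u k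
      by (rule unit_invariance[where L = "\<lambda>k. \<phi> (W n 1 k 1)", OF n kv(1,2) beta kv(3) that]) assumption
    have "gcd i n = gcd j n" using ij by (simp add: orbit_def)
    then show ?thesis
      using weight_orbit_const[where L = "\<lambda>k. \<phi> (W n 1 k 1)", OF n0 kv(1) inv] by blast
  qed
  note S = kms_simplex[OF n sys beta(1) fin, where J = "\<lambda>m. orbit n m" and \<psi> = \<psi>]
  have ext: "\<psi> m \<in> extremal (nz_toeplitz n) (nz_kms n (nz_sigma n) \<beta>)" if "m \<in> ?X" for m
    by (rule S(1)) (assumption | rule that ne union disj st kf val | erule (3) const)+
  have homeo: "extends_to_affine_homeo ?X (nz_toeplitz n) (nz_kms n (nz_sigma n) \<beta>) \<psi>"
    by (rule S(2)) (assumption | rule ne union disj st kf val | erule (3) const)+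
  show ?thesis
  proof (intro exI[of _ \<psi>] conjI ballI homeo)
    fix m assume m: "m \<in> ?X"
    show "\<psi> m \<in> extremal (nz_toeplitz n) (nz_kms n (nz_sigma n) \<beta>)" by (rule ext[OF m])
  qed (rule state_determined[OF st v], assumption+)+
qed

end

theorem theorem9p7:
  fixes n :: nat
  assumes "n \<ge> 1"
  shows "(\<exists>!\<sigma>. nz_dynamics n \<sigma>) \<and>
    (\<forall>\<sigma>. nz_dynamics n \<sigma> \<longrightarrow>
      (\<forall>\<beta>::real. 1 < \<beta> \<longrightarrow>
        (\<exists>\<psi>. (\<forall>z\<in>{z::complex. z ^ n = 1}.
                \<psi> z \<in> extremal (nz_toeplitz n) (nz_kms n \<sigma> \<beta>) \<and>
                (\<forall>a\<ge>1. \<forall>b\<ge>1. \<forall>k. \<psi> z (VRV n a k b) = root_value \<beta> z a k b) \<and>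
                (\<forall>\<phi>. nz_state n \<phi> \<and>
                   (\<forall>a\<ge>1. \<forall>b\<ge>1. \<forall>k. \<phi> (VRV n a k b) = root_value \<beta> z a k b) \<longrightarrow> \<phi> = \<psi> z)) \<and>
             extends_to_affine_homeo {z::complex. z ^ n = 1} (nz_toeplitz n) (nz_kms n \<sigma> \<beta>) \<psi>)) \<and>
      (\<forall>\<beta>::real. 0 < \<beta> \<and> \<beta> \<le> 1 \<longrightarrow>
        (\<exists>\<psi>. (\<forall>m\<in>{m::nat. m dvd n}.
                \<psi> m \<in> extremal (nz_toeplitz n) (nz_kms n \<sigma> \<beta>) \<and>
                (\<forall>a\<ge>1. \<forall>b\<ge>1. \<forall>k. \<psi> m (VRV n a k b) = divisor_value \<beta> m a k b) \<and>
                (\<forall>\<phi>. nz_state n \<phi> \<and>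
                   (\<forall>a\<ge>1. \<forall>b\<ge>1. \<forall>k. \<phi> (VRV n a k b) = divisor_value \<beta> m a k b) \<longrightarrow> \<phi> = \<psi> m)) \<and>
             extends_to_affine_homeo {m::nat. m dvd n} (nz_toeplitz n) (nz_kms n \<sigma> \<beta>) \<psi>)))"
proof (intro conjI allI impI, goal_cases)
  case 1
  show ?case
    by (rule ex1I[of _ "nz_sigma n"]) (rule nz_sigma_dynamics[OF assms], rule nz_dynamics_unique[OF assms])
next
  case (2 \<sigma> \<beta>)
  \<comment> \<open>By uniqueness the given dynamics is the one implemented by the phase unitaries,
    for which the simplex was computed.\<close>
  show ?case unfolding nz_dynamics_unique[OF assms 2(1)] by (rule kms_simplex_above_1[OF assms 2(2)])
next
  case (3 \<sigma> \<beta>)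
  show ?case
    unfolding nz_dynamics_unique[OF assms 3(1)]
    by (rule kms_simplex_upto_1[OF assms conjunct1[OF 3(2)] conjunct2[OF 3(2)]])
qed

end
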